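(* Let $A|B$ be an HS-separable extension of simple rings, let $Z$ be the center of $A$, $R=C_A(B)$ the centralizer and $S=\mathrm{End}({}_BA_B)$ with its Hopf algebroid structure over $R$. Then there is a one-to-one correspondence between (i) intermediate simple rings $B\subseteq D\subseteq A$ such that $A_D$ is finitely generated projective, and (ii) Hopf subalgebroids $H$ of $S$ which are minimal over simple $Z$-subalgebras $V\subseteq R$. The correspondence is given by $D\mapsto\mathrm{End}({}_DA_D)$, a Hopf algebroid over $C_A(D)$, with inverse $H\mapsto A^H$, the fixed points $\{a\in A:\alpha(a)=\alpha(1)a\text{ for all }\alpha\in H\}$ under the canonical (evaluation) action of $H\subseteq S$ on $A$.
   Context: Rings are associative and unital, subrings are unital. A simple ring is a ring with no proper nonzero two-sided ideals (not necessarily artinian). $C_A(X)$ is the centralizer of $X$ in $A$. $A|B$ is H-separable if $A\otimes_BA$ is isomorphic, as an $A$-$A$-bimodule, to a direct summand of a finite direct sum $A\oplus\cdots\oplus A$. It is (right) HS-separable if it is H-separable and the natural right module $A_B$ is a progenerator. Left bialgebroid $(L,R,\tilde s,\tilde t,\Delta,\varepsilon)$ over a ground ring $K$: $L,R$ are $K$-algebras; $\tilde s:R\to L$ is an algebra homomorphism, $\tilde t:R\to L$ an algebra anti-homomorphism, with $\tilde s(r)\tilde t(r')=\tilde t(r')\tilde s(r)$; $L$ is an $R$-bimodule by $r\cdot x\cdot r' = \tilde s(r)\tilde t(r')x$; $(L,\Delta,\varepsilon)$ is an $R$-coring (coassociative, counital, with $\Delta:L\to L\otimes_RL$ and $\varepsilon:L\to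 R$ bimodule maps); $a_{(1)}\tilde t(r)\otimes a_{(2)} = a_{(1)}\otimes a_{(2)}\tilde s(r)$; $\Delta(ab)=\Delta(a)\Delta(b)$, $\Delta(1)=1\otimes1$; $\varepsilon(ab) = \varepsilon(a\tilde s(\varepsilon(b))) = \varepsilon(a\tilde t(\varepsilon(b)))$, $\varepsilon(1_L)=1_R$. Hopf algebroid: a left bialgebroid with an algebra anti-automorphism $\tau:L\to L$ (antipode) such that (1) $\tau\tilde t=\tilde s$; (2) $\tau(a_{(1)})a_{(2)} = \tilde t(\varepsilon(\tau(a)))$ for all $a\in L$; (3) there is a $K$-linear section $\eta:L\otimes_RL\to L\otimes_KL$ of the natural projection with $\mu(\mathrm{id}\otimes\tau)\eta\Delta = \tilde s\varepsilon$, $\mu$ being multiplication. Here $K=Z$. Bialgebroid homomorphism from $(L_1,R_1,s_1,t_1,\Delta_1,\varepsilon_1)$ to $(L_2,R_2,s_2,t_2,\Delta_2,\varepsilon_2)$: algebra homomorphisms $F:L_1\to L_2$, $f:R_1\to R_2$ with $Fs_1=s_2f$, $Ft_1=t_2f$, $\Delta_2F=p(F\otimes F)\Delta_1$, $\varepsilon_2F=f\varepsilon_1$, where $p:L_2\otimes_{R_1}L_2\to L_2\otimes_{R_2}L_2$ is canonical. If $F,f$ are inclusions, $L_1$ is a sub-bialgebroid of $L_2$; if moreover both are Hopf algebroids with antipodes satisfying $F\tau_1=\tau_2F$, then $L_1$ is a Hopf subalgebroid of $L_2$. A bialgebroid over $V$ is minimal over its base ring $V$ if it has no proper sub-bialgebroid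 over the same base $V$. Hopf algebroid structure on $S$ (for $A|B$ H-separable): the ring $S=\mathrm{End}({}_BA_B)$ under composition, $\tilde s(r)=\lambda_r$ (left multiplication by $r$), $\tilde t(r)=\rho_r$ (right multiplication by $r$), so $(r\cdot\alpha\cdot r')(a) = r\alpha(a)r'$; under $S\otimes_RS\cong\mathrm{Hom}_{B\text{-}B}(A\otimes_BA,A)$, $\alpha\otimes\beta\mapsto(a\otimes a'\mapsto\alpha(a)\beta(a'))$, the coproduct is $\Delta(\alpha)(a\otimes a')=\alpha(aa')$; $\varepsilon(\alpha)=\alpha(1)$. For H-separable $A|B$ one has an isomorphism of bialgebroids $R\otimes_ZR^{\mathrm{op}}\cong S$, $r\otimes r'\mapsto\lambda_r\rho_{r'}$, and the antipode of $S$ is the one corresponding to the twist $r\otimes r'\mapsto r'\otimes r$. For an intermediate ring $D$ with $A|D$ H-separable, $\mathrm{End}({}_DA_D)$ has the same structure with $B,R$ replaced by $D,C_A(D)$. *)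

theory Defs
  imports "HOL-Algebra.Algebra"
begin

section \<open>Rings, centralizers, algebras\<close>

definition simple_ring :: "('a, 'm) ring_scheme \<Rightarrow> bool" where
  "simple_ring R \<longleftrightarrow> ring R \<and> \<one>\<^bsub>R\<^esub> \<noteq> \<zero>\<^bsub>R\<^esub>
     \<and> (\<forall>I. ideal I R \<longrightarrow> I = {\<zero>\<^bsub>R\<^esub>} \<or> I = carrier R)"

definition centralizer :: "('a, 'm) ring_scheme \<Rightarrow> 'a set \<Rightarrow> 'a set" where
  "centralizer A U = {a \<in> carrier A. \<forall>x\<in>U. a \<otimes>\<^bsub>A\<^esub> x = x \<otimes>\<^bsub>A\<^esub> a}"

abbreviation center :: "('a, 'm) ring_scheme \<Rightarrow> 'a set" where
  "center A \<equiv> centralizer A (carrier A)"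

definition opp_ring :: "('a, 'm) ring_scheme \<Rightarrow> ('a, 'm) ring_scheme" where
  "opp_ring R = R\<lparr>monoid.mult := \<lambda>x y. y \<otimes>\<^bsub>R\<^esub> x\<rparr>"

text \<open>Associative unital algebras; the library locale \<open>algebra\<close> is restricted to commutative ones.\<close>

locale assoc_algebra = module K L + ring L for K (structure) and L (structure) +
  assumes smult_mult_left:
      "\<lbrakk>k \<in> carrier K; x \<in> carrier L; y \<in> carrier L\<rbrakk>
        \<Longrightarrow> (k \<odot>\<^bsub>L\<^esub> x) \<otimes>\<^bsub>L\<^esub> y = k \<odot>\<^bsub>L\<^esub> (x \<otimes>\<^bsub>L\<^esub> y)"
    and smult_mult_right:
      "\<lbrakk>k \<in> carrier K; x \<in> carrier L; y \<in> carrier L\<rbrakk>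
        \<Longrightarrow> x \<otimes>\<^bsub>L\<^esub> (k \<odot>\<^bsub>L\<^esub> y) = k \<odot>\<^bsub>L\<^esub> (x \<otimes>\<^bsub>L\<^esub> y)"

definition algebra_hom ::
  "('k, 'c) ring_scheme \<Rightarrow> ('k, 'l, 'm) module_scheme \<Rightarrow> ('k, 'n, 'p) module_scheme \<Rightarrow> ('l \<Rightarrow> 'n) set"
  where
  "algebra_hom K L M = {h \<in> ring_hom L M.
     \<forall>k\<in>carrier K. \<forall>x\<in>carrier L. h (k \<odot>\<^bsub>L\<^esub> x) = k \<odot>\<^bsub>M\<^esub> h x}"


section \<open>Bimodules\<close>

text \<open>A \<open>P\<close>-\<open>Q\<close>-bimodule. As for the library's \<open>module\<close> record, only the additive part of the underlying
  \<open>ring\<close> record is meaningful.\<close>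

record ('p, 'm, 'q) bimod = "'m ring" +
  lact :: "'p \<Rightarrow> 'm \<Rightarrow> 'm"
  ract :: "'m \<Rightarrow> 'q \<Rightarrow> 'm"

definition bimod_of ::
  "('m, 'z) ring_scheme \<Rightarrow> ('p \<Rightarrow> 'm \<Rightarrow> 'm) \<Rightarrow> ('m \<Rightarrow> 'q \<Rightarrow> 'm) \<Rightarrow> ('p, 'm, 'q) bimod" where
  "bimod_of G l r =
     \<lparr>carrier = carrier G, monoid.mult = monoid.mult G, monoid.one = monoid.one G,
      ring.zero = ring.zero G, ring.add = ring.add G,
      lact = l, ract = r\<rparr>"

text \<open>A ring as a bimodule over itself. Restricting the set of acting scalars makes it a bimodule
  over any pair of subrings.\<close>

definition regular_bimod :: "('a, 'm) ring_scheme \<Rightarrow> ('a, 'a, 'a) bimod" where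
  "regular_bimod A = bimod_of A (\<lambda>a x. a \<otimes>\<^bsub>A\<^esub> x) (\<lambda>x a. x \<otimes>\<^bsub>A\<^esub> a)"

text \<open>Right modules over \<open>B\<close> are treated as \<open>\<Z>\<close>-\<open>B\<close>-bimodules.\<close>

definition right_regular :: "('a, 'm) ring_scheme \<Rightarrow> (int, 'a, 'a) bimod" where
  "right_regular A = bimod_of A (\<lambda>n x. [n] \<cdot>\<^bsub>A\<^esub> x) (\<lambda>x a. x \<otimes>\<^bsub>A\<^esub> a)"

definition bimod_hom ::
  "('p, 'c) ring_scheme \<Rightarrow> ('q, 'd) ring_scheme \<Rightarrow> ('p, 'm, 'q, 'x) bimod_scheme
     \<Rightarrow> ('p, 'n, 'q, 'y) bimod_scheme \<Rightarrow> ('m \<Rightarrow> 'n) set" where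
  "bimod_hom P Q M N = {f \<in> carrier M \<rightarrow> carrier N.
     (\<forall>x\<in>carrier M. \<forall>y\<in>carrier M. f (x \<oplus>\<^bsub>M\<^esub> y) = f x \<oplus>\<^bsub>N\<^esub> f y) \<and>
     (\<forall>p\<in>carrier P. \<forall>x\<in>carrier M. f (lact M p x) = lact N p (f x)) \<and>
     (\<forall>q\<in>carrier Q. \<forall>x\<in>carrier M. f (ract M x q) = ract N (f x) q)}"

definition sub_bimod ::
  "('p, 'c) ring_scheme \<Rightarrow> ('q, 'd) ring_scheme \<Rightarrow> 'm set \<Rightarrow> ('p, 'm, 'q, 'x) bimod_scheme \<Rightarrow> bool"
  where
  "sub_bimod P Q U M \<longleftrightarrow> additive_subgroup U M \<and>
     (\<forall>p\<in>carrier P. \<forall>x\<in>U. lact M p x \<in> U) \<and> (\<forall>q\<in>carrier Q. \<forall>x\<in>U. ract M x q \<in> U)"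

text \<open>\<open>N\<close> is isomorphic to a direct summand of \<open>M\<close>.\<close>

definition iso_direct_summand ::
  "('p, 'c) ring_scheme \<Rightarrow> ('q, 'd) ring_scheme \<Rightarrow> ('p, 'n, 'q, 'y) bimod_scheme
     \<Rightarrow> ('p, 'm, 'q, 'x) bimod_scheme \<Rightarrow> bool" where
  "iso_direct_summand P Q N M \<longleftrightarrow>
     (\<exists>U V. sub_bimod P Q U M \<and> sub_bimod P Q V M \<and> U \<inter> V = {\<zero>\<^bsub>M\<^esub>} \<and> U <+>\<^bsub>M\<^esub> V = carrier M \<and>
        (\<exists>f \<in> bimod_hom P Q N (M\<lparr>carrier := U\<rparr>). bij_betw f (carrier N) U))"

definition bimod_power :: "nat \<Rightarrow> ('p, 'm, 'q, 'x) bimod_scheme \<Rightarrow> ('p, nat \<Rightarrow> 'm, 'q) bimod" where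
  "bimod_power n M =
     \<lparr>carrier = {..<n} \<rightarrow>\<^sub>E carrier M, monoid.mult = undefined, monoid.one = undefined,
      ring.zero = (\<lambda>i\<in>{..<n}. \<zero>\<^bsub>M\<^esub>), ring.add = (\<lambda>u v. \<lambda>i\<in>{..<n}. u i \<oplus>\<^bsub>M\<^esub> v i),
      lact = (\<lambda>p u. \<lambda>i\<in>{..<n}. lact M p (u i)), ract = (\<lambda>u q. \<lambda>i\<in>{..<n}. ract M (u i) q)\<rparr>"

text \<open>For right \<open>B\<close>-modules \<open>M\<close>, encoded as above: \<open>M\<close> is finitely generated projective
  if it is isomorphic to a direct summand of some \<open>B\<^sup>n\<close>, and a generator if \<open>B\<^sub>B\<close> is isomorphic
  to a direct summand of some \<open>M\<^sup>n\<close>.\<close>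

definition fg_projective :: "('b, 'c) ring_scheme \<Rightarrow> (int, 'm, 'b, 'x) bimod_scheme \<Rightarrow> bool" where
  "fg_projective B M \<longleftrightarrow> (\<exists>n. iso_direct_summand \<Z> B M (bimod_power n (right_regular B)))"

definition generator :: "('b, 'c) ring_scheme \<Rightarrow> (int, 'm, 'b, 'x) bimod_scheme \<Rightarrow> bool" where
  "generator B M \<longleftrightarrow> (\<exists>n. iso_direct_summand \<Z> B (right_regular B) (bimod_power n M))"

definition progenerator :: "('b, 'c) ring_scheme \<Rightarrow> (int, 'm, 'b, 'x) bimod_scheme \<Rightarrow> bool" where
  "progenerator B M \<longleftrightarrow> fg_projective B M \<and> generator B M"


section \<open>Tensor products\<close>

text \<open>\<open>M \<otimes>\<^sub>R N\<close> is the free abelian group on pairs modulo the usual relations. Its elements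
  are cosets, that is, sets of formal sums of pairs.\<close>

definition tensor_rels ::
  "('r, 'c) ring_scheme \<Rightarrow> ('p, 'm, 'r, 'x) bimod_scheme \<Rightarrow> ('r, 'n, 'q, 'y) bimod_scheme
     \<Rightarrow> (('m \<times> 'n) \<Rightarrow>\<^sub>0 int) set" where
  "tensor_rels R M N =
     {frag_of (m \<oplus>\<^bsub>M\<^esub> m', n) - frag_of (m, n) - frag_of (m', n) | m m' n.
        m \<in> carrier M \<and> m' \<in> carrier M \<and> n \<in> carrier N} \<union>
     {frag_of (m, n \<oplus>\<^bsub>N\<^esub> n') - frag_of (m, n) - frag_of (m, n') | m n n'.
        m \<in> carrier M \<and> n \<in> carrier N \<and> n' \<in> carrier N} \<union>
     {frag_of (ract M m r, n) - frag_of (m, lact N r n) | m r n.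
        m \<in> carrier M \<and> r \<in> carrier R \<and> n \<in> carrier N}"

definition tensor_subgroup ::
  "('r, 'c) ring_scheme \<Rightarrow> ('p, 'm, 'r, 'x) bimod_scheme \<Rightarrow> ('r, 'n, 'q, 'y) bimod_scheme
     \<Rightarrow> (('m \<times> 'n) \<Rightarrow>\<^sub>0 int) set" where
  "tensor_subgroup R M N =
     generate (free_Abelian_group (carrier M \<times> carrier N)) (tensor_rels R M N)"

definition tensor_group ::
  "('r, 'c) ring_scheme \<Rightarrow> ('p, 'm, 'r, 'x) bimod_scheme \<Rightarrow> ('r, 'n, 'q, 'y) bimod_scheme
     \<Rightarrow> (('m \<times> 'n) \<Rightarrow>\<^sub>0 int) set ring" where
  "tensor_group R M N =
     (let T = free_Abelian_group (carrier M \<times> carrier N) Mod tensor_subgroup R M N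
      in \<lparr>carrier = carrier T, monoid.mult = undefined, monoid.one = undefined,
          ring.zero = monoid.one T, ring.add = monoid.mult T\<rparr>)"

definition pure_tensor ::
  "('r, 'c) ring_scheme \<Rightarrow> ('p, 'm, 'r, 'x) bimod_scheme \<Rightarrow> ('r, 'n, 'q, 'y) bimod_scheme
     \<Rightarrow> 'm \<Rightarrow> 'n \<Rightarrow> (('m \<times> 'n) \<Rightarrow>\<^sub>0 int) set" where
  "pure_tensor R M N m n =
     tensor_subgroup R M N #>\<^bsub>free_Abelian_group (carrier M \<times> carrier N)\<^esub> frag_of (m, n)"

text \<open>\<open>formal_eval P f\<close> extends \<open>f\<close> additively to formal sums. When \<open>f\<close> is
  balanced, \<open>tensor_lift P f\<close> is the homomorphism it induces on a tensor product.\<close>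

definition formal_eval :: "('p, 'z) ring_scheme \<Rightarrow> ('i \<Rightarrow> 'p) \<Rightarrow> ('i \<Rightarrow>\<^sub>0 int) \<Rightarrow> 'p" where
  "formal_eval P f x = (\<Oplus>\<^bsub>P\<^esub>i\<in>Poly_Mapping.keys x. [Poly_Mapping.lookup x i] \<cdot>\<^bsub>P\<^esub> f i)"

definition tensor_lift ::
  "('p, 'z) ring_scheme \<Rightarrow> ('m \<Rightarrow> 'n \<Rightarrow> 'p) \<Rightarrow> (('m \<times> 'n) \<Rightarrow>\<^sub>0 int) set \<Rightarrow> 'p" where
  "tensor_lift P f u = the_elem (formal_eval P (\<lambda>(m, n). f m n) ` u)"

definition tensor ::
  "('r, 'c) ring_scheme \<Rightarrow> ('p, 'm, 'r, 'x) bimod_scheme \<Rightarrow> ('r, 'n, 'q, 'y) bimod_scheme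
     \<Rightarrow> ('p, (('m \<times> 'n) \<Rightarrow>\<^sub>0 int) set, 'q) bimod" where
  "tensor R M N =
     (let T = tensor_group R M N
      in bimod_of T (\<lambda>p. tensor_lift T (\<lambda>m n. pure_tensor R M N (lact M p m) n))
                    (\<lambda>u q. tensor_lift T (\<lambda>m n. pure_tensor R M N m (ract N n q)) u))"


section \<open>H-separable and HS-separable extensions\<close>

definition H_separable :: "('a, 'm) ring_scheme \<Rightarrow> 'a set \<Rightarrow> bool" where
  "H_separable A B \<longleftrightarrow>
     (\<exists>n. iso_direct_summand A A
            (tensor (A\<lparr>carrier := B\<rparr>) (regular_bimod A) (regular_bimod A))
            (bimod_power n (regular_bimod A)))"

definition HS_separable :: "('a, 'm) ring_scheme \<Rightarrow> 'a set \<Rightarrow> bool" where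
  "HS_separable A B \<longleftrightarrow>
     H_separable A B \<and> progenerator (A\<lparr>carrier := B\<rparr>) (right_regular A)"


section \<open>Bialgebroids and Hopf algebroids\<close>

record ('k, 'l, 'r) bialgebroid =
  total :: "('k, 'l) module"
  base :: "('k, 'r) module"
  source :: "'r \<Rightarrow> 'l"
  target :: "'r \<Rightarrow> 'l"
  comult :: "'l \<Rightarrow> (('l \<times> 'l) \<Rightarrow>\<^sub>0 int) set"
  counit :: "'l \<Rightarrow> 'r"

record ('k, 'l, 'r) hopf_algebroid = "('k, 'l, 'r) bialgebroid" +
  antipode :: "'l \<Rightarrow> 'l"

definition total_bimod :: "('k, 'l, 'r, 'z) bialgebroid_scheme \<Rightarrow> ('r, 'l, 'r) bimod" where
  "total_bimod H = bimod_of (total H)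
     (\<lambda>r x. source H r \<otimes>\<^bsub>total H\<^esub> x) (\<lambda>x r. target H r \<otimes>\<^bsub>total H\<^esub> x)"

definition base_bimod :: "('k, 'l, 'r, 'z) bialgebroid_scheme \<Rightarrow> ('r, 'r, 'r) bimod" where
  "base_bimod H = regular_bimod (base H)"

abbreviation total_tensor ::
  "('k, 'l, 'r, 'z) bialgebroid_scheme \<Rightarrow> ('r, (('l \<times> 'l) \<Rightarrow>\<^sub>0 int) set, 'r) bimod" where
  "total_tensor H \<equiv> tensor (base H) (total_bimod H) (total_bimod H)"

abbreviation total_pure ::
  "('k, 'l, 'r, 'z) bialgebroid_scheme \<Rightarrow> 'l \<Rightarrow> 'l \<Rightarrow> (('l \<times> 'l) \<Rightarrow>\<^sub>0 int) set" where
  "total_pure H \<equiv> pure_tensor (base H) (total_bimod H) (total_bimod H)"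

definition module_bimod :: "('k, 'm, 'z) module_scheme \<Rightarrow> ('k, 'm, 'k) bimod" where
  "module_bimod M = bimod_of M (\<lambda>k x. k \<odot>\<^bsub>M\<^esub> x) (\<lambda>x k. k \<odot>\<^bsub>M\<^esub> x)"

text \<open>In the locale below, coassociativity is stated after the canonical identification
  \<open>(L \<otimes>\<^sub>R L) \<otimes>\<^sub>R L \<cong> L \<otimes>\<^sub>R (L \<otimes>\<^sub>R L)\<close>.\<close>

definition tensor_assoc ::
  "('k, 'l, 'r, 'z) bialgebroid_scheme
     \<Rightarrow> (((('l \<times> 'l) \<Rightarrow>\<^sub>0 int) set \<times> 'l) \<Rightarrow>\<^sub>0 int) set
     \<Rightarrow> (('l \<times> (('l \<times> 'l) \<Rightarrow>\<^sub>0 int) set) \<Rightarrow>\<^sub>0 int) set" where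
  "tensor_assoc H =
     (let M = total_bimod H; T = tensor (base H) M (total_tensor H)
      in tensor_lift T (\<lambda>u z. tensor_lift T
           (\<lambda>x y. pure_tensor (base H) M (total_tensor H) x (total_pure H y z)) u))"

definition comult_id ::
  "('k, 'l, 'r, 'z) bialgebroid_scheme \<Rightarrow> (('l \<times> 'l) \<Rightarrow>\<^sub>0 int) set
     \<Rightarrow> (((('l \<times> 'l) \<Rightarrow>\<^sub>0 int) set \<times> 'l) \<Rightarrow>\<^sub>0 int) set" where
  "comult_id H =
     tensor_lift (tensor (base H) (total_tensor H) (total_bimod H))
       (\<lambda>x y. pure_tensor (base H) (total_tensor H) (total_bimod H) (comult H x) y)"

definition id_comult ::
  "('k, 'l, 'r, 'z) bialgebroid_scheme \<Rightarrow> (('l \<times> 'l) \<Rightarrow>\<^sub>0 int) set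
     \<Rightarrow> (('l \<times> (('l \<times> 'l) \<Rightarrow>\<^sub>0 int) set) \<Rightarrow>\<^sub>0 int) set" where
  "id_comult H =
     tensor_lift (tensor (base H) (total_bimod H) (total_tensor H))
       (\<lambda>x y. pure_tensor (base H) (total_bimod H) (total_tensor H) x (comult H y))"

text \<open>Structure maps are extensional (\<open>undefined\<close> off their domain), so that bialgebroids with
  the same structure are equal as records. The product in \<open>comult_mult\<close> is the factorwise product
  of arbitrary representatives of the two cosets; by \<open>takeuchi\<close> its class does not depend on the
  choice.\<close>

locale left_bialgebroid =
  fixes K :: "('k, 'c) ring_scheme" and H :: "('k, 'l, 'r, 'z) bialgebroid_scheme"
  assumes total_algebra: "assoc_algebra K (total H)"
    and base_algebra: "assoc_algebra K (base H)"
    and source_ext: "source H \<in> carrier (base H) \<rightarrow>\<^sub>E carrier (total H)"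
    and target_ext: "target H \<in> carrier (base H) \<rightarrow>\<^sub>E carrier (total H)"
    and comult_ext: "comult H \<in> carrier (total H) \<rightarrow>\<^sub>E carrier (total_tensor H)"
    and counit_ext: "counit H \<in> carrier (total H) \<rightarrow>\<^sub>E carrier (base H)"
    and source_hom: "source H \<in> algebra_hom K (base H) (total H)"
    and target_hom: "target H \<in> algebra_hom K (base H) (opp_ring (total H))"
    and source_target_comm: "\<lbrakk>r \<in> carrier (base H); r' \<in> carrier (base H)\<rbrakk> \<Longrightarrow>
      source H r \<otimes>\<^bsub>total H\<^esub> target H r' = target H r' \<otimes>\<^bsub>total H\<^esub> source H r"
    and comult_hom:
      "comult H \<in> bimod_hom (base H) (base H) (total_bimod H) (total_tensor H)"
    and counit_hom:
      "counit H \<in> bimod_hom (base H) (base H) (total_bimod H) (base_bimod H)"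
    and coassoc: "a \<in> carrier (total H) \<Longrightarrow>
      tensor_assoc H (comult_id H (comult H a)) = id_comult H (comult H a)"
    and counit_left: "a \<in> carrier (total H) \<Longrightarrow>
      tensor_lift (total H) (\<lambda>x y. lact (total_bimod H) (counit H x) y) (comult H a) = a"
    and counit_right: "a \<in> carrier (total H) \<Longrightarrow>
      tensor_lift (total H) (\<lambda>x y. ract (total_bimod H) x (counit H y)) (comult H a) = a"
    and takeuchi: "\<lbrakk>a \<in> carrier (total H); r \<in> carrier (base H)\<rbrakk> \<Longrightarrow>
      tensor_lift (total_tensor H)
        (\<lambda>x y. total_pure H (x \<otimes>\<^bsub>total H\<^esub> target H r) y) (comult H a) =
      tensor_lift (total_tensor H)
        (\<lambda>x y. total_pure H x (y \<otimes>\<^bsub>total H\<^esub> source H r)) (comult H a)"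
    and comult_mult: "\<lbrakk>a \<in> carrier (total H); b \<in> carrier (total H);
        u \<in> comult H a; v \<in> comult H b\<rbrakk> \<Longrightarrow>
      comult H (a \<otimes>\<^bsub>total H\<^esub> b) =
        formal_eval (total_tensor H) (\<lambda>(x, y). formal_eval (total_tensor H)
          (\<lambda>(x', y'). total_pure H (x \<otimes>\<^bsub>total H\<^esub> x') (y \<otimes>\<^bsub>total H\<^esub> y')) v) u"
    and comult_one:
      "comult H \<one>\<^bsub>total H\<^esub> = total_pure H \<one>\<^bsub>total H\<^esub> \<one>\<^bsub>total H\<^esub>"
    and counit_mult_source: "\<lbrakk>a \<in> carrier (total H); b \<in> carrier (total H)\<rbrakk> \<Longrightarrow>
      counit H (a \<otimes>\<^bsub>total H\<^esub> b) = counit H (a \<otimes>\<^bsub>total H\<^esub> source H (counit H b))"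
    and counit_mult_target: "\<lbrakk>a \<in> carrier (total H); b \<in> carrier (total H)\<rbrakk> \<Longrightarrow>
      counit H (a \<otimes>\<^bsub>total H\<^esub> b) = counit H (a \<otimes>\<^bsub>total H\<^esub> target H (counit H b))"
    and counit_one: "counit H \<one>\<^bsub>total H\<^esub> = \<one>\<^bsub>base H\<^esub>"

definition ground_tensor ::
  "('k, 'c) ring_scheme \<Rightarrow> ('k, 'm, 'z) module_scheme
     \<Rightarrow> ('k, (('m \<times> 'm) \<Rightarrow>\<^sub>0 int) set, 'k) bimod" where
  "ground_tensor K M = tensor K (module_bimod M) (module_bimod M)"

text \<open>\<open>K\<close>-linear sections \<open>L \<otimes>\<^sub>R L \<rightarrow> L \<otimes>\<^sub>K L\<close> of the canonical projection; the scalar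
  \<open>k\<close> acts on \<open>L \<otimes>\<^sub>R L\<close> by \<open>x \<otimes> y \<mapsto> k x \<otimes> y\<close>.\<close>

definition ground_sections ::
  "('k, 'c) ring_scheme \<Rightarrow> ('k, 'l, 'r, 'z) bialgebroid_scheme
     \<Rightarrow> ((('l \<times> 'l) \<Rightarrow>\<^sub>0 int) set \<Rightarrow> (('l \<times> 'l) \<Rightarrow>\<^sub>0 int) set) set" where
  "ground_sections K H =
     {\<eta> \<in> carrier (total_tensor H) \<rightarrow> carrier (ground_tensor K (total H)).
       (\<forall>u\<in>carrier (total_tensor H). \<forall>v\<in>carrier (total_tensor H).
          \<eta> (u \<oplus>\<^bsub>total_tensor H\<^esub> v) = \<eta> u \<oplus>\<^bsub>ground_tensor K (total H)\<^esub> \<eta> v) \<and>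
       (\<forall>k\<in>carrier K. \<forall>u\<in>carrier (total_tensor H).
          \<eta> (tensor_lift (total_tensor H) (\<lambda>x y. total_pure H (k \<odot>\<^bsub>total H\<^esub> x) y) u) =
          lact (ground_tensor K (total H)) k (\<eta> u)) \<and>
       (\<forall>u\<in>carrier (total_tensor H). tensor_lift (total_tensor H) (total_pure H) (\<eta> u) = u)}"

locale is_hopf_algebroid = left_bialgebroid K H
  for K :: "('k, 'c) ring_scheme" and H :: "('k, 'l, 'r, 'z) hopf_algebroid_scheme" +
  assumes antipode_ext: "antipode H \<in> carrier (total H) \<rightarrow>\<^sub>E carrier (total H)"
    and antipode_hom: "antipode H \<in> algebra_hom K (total H) (opp_ring (total H))"
    and antipode_bij: "bij_betw (antipode H) (carrier (total H)) (carrier (total H))"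
    and antipode_target: "r \<in> carrier (base H) \<Longrightarrow> antipode H (target H r) = source H r"
    and antipode_left: "a \<in> carrier (total H) \<Longrightarrow>
      tensor_lift (total H) (\<lambda>x y. antipode H x \<otimes>\<^bsub>total H\<^esub> y) (comult H a) =
        target H (counit H (antipode H a))"
    and antipode_right: "\<exists>\<eta> \<in> ground_sections K H. \<forall>a \<in> carrier (total H).
      tensor_lift (total H) (\<lambda>x y. x \<otimes>\<^bsub>total H\<^esub> antipode H y) (\<eta> (comult H a)) =
        source H (counit H a)"


section \<open>Sub-bialgebroids and Hopf subalgebroids\<close>

text \<open>The map \<open>p (F \<otimes> F)\<close> from \<open>L\<^sub>1 \<otimes>\<^bsub>R\<^sub>1\<^esub> L\<^sub>1\<close> to \<open>L\<^sub>2 \<otimes>\<^bsub>R\<^sub>2\<^esub> L\<^sub>2\<close> is formed in one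
  step, as \<open>x \<otimes> y \<mapsto> F x \<otimes> F y\<close>.\<close>

definition bialgebroid_hom ::
  "('k, 'c) ring_scheme \<Rightarrow> ('k, 'l1, 'r1, 'y) bialgebroid_scheme
     \<Rightarrow> ('k, 'l2, 'r2, 'z) bialgebroid_scheme \<Rightarrow> ('l1 \<Rightarrow> 'l2) \<Rightarrow> ('r1 \<Rightarrow> 'r2) \<Rightarrow> bool" where
  "bialgebroid_hom K H1 H2 F f \<longleftrightarrow>
     F \<in> algebra_hom K (total H1) (total H2) \<and> f \<in> algebra_hom K (base H1) (base H2) \<and>
     (\<forall>r\<in>carrier (base H1). F (source H1 r) = source H2 (f r)) \<and>
     (\<forall>r\<in>carrier (base H1). F (target H1 r) = target H2 (f r)) \<and>
     (\<forall>a\<in>carrier (total H1). comult H2 (F a) =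
        tensor_lift (total_tensor H2) (\<lambda>x y. total_pure H2 (F x) (F y)) (comult H1 a)) \<and>
     (\<forall>a\<in>carrier (total H1). counit H2 (F a) = f (counit H1 a))"

text \<open>The operations of the smaller algebras are required to be literally those of the larger ones
  (also off the carriers), as is the library's convention for substructures.\<close>

definition sub_bialgebroid ::
  "('k, 'c) ring_scheme \<Rightarrow> ('k, 'l, 'r, 'y) bialgebroid_scheme
     \<Rightarrow> ('k, 'l, 'r, 'z) bialgebroid_scheme \<Rightarrow> bool" where
  "sub_bialgebroid K H1 H2 \<longleftrightarrow>
     left_bialgebroid K H1 \<and> left_bialgebroid K H2 \<and>
     carrier (total H1) \<subseteq> carrier (total H2) \<and> carrier (base H1) \<subseteq> carrier (base H2) \<and>
     total H1 = (total H2)\<lparr>carrier := carrier (total H1)\<rparr> \<and>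
     base H1 = (base H2)\<lparr>carrier := carrier (base H1)\<rparr> \<and>
     bialgebroid_hom K H1 H2 (\<lambda>x. x) (\<lambda>r. r)"

definition hopf_subalgebroid ::
  "('k, 'c) ring_scheme \<Rightarrow> ('k, 'l, 'r, 'y) hopf_algebroid_scheme
     \<Rightarrow> ('k, 'l, 'r, 'z) hopf_algebroid_scheme \<Rightarrow> bool" where
  "hopf_subalgebroid K H1 H2 \<longleftrightarrow>
     is_hopf_algebroid K H1 \<and> is_hopf_algebroid K H2 \<and> sub_bialgebroid K H1 H2 \<and>
     (\<forall>a\<in>carrier (total H1). antipode H1 a = antipode H2 a)"

definition minimal_over_base ::
  "('k, 'c) ring_scheme \<Rightarrow> ('k, 'l, 'r, 'z) bialgebroid_scheme \<Rightarrow> bool" where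
  "minimal_over_base K H \<longleftrightarrow>
     (\<forall>H' :: ('k, 'l, 'r) bialgebroid.
        sub_bialgebroid K H' H \<and> carrier (base H') = carrier (base H)
          \<longrightarrow> carrier (total H') = carrier (total H))"


section \<open>The Hopf algebroid of bimodule endomorphisms\<close>

abbreviation center_ring :: "('a, 'm) ring_scheme \<Rightarrow> ('a, 'm) ring_scheme" where
  "center_ring A \<equiv> A\<lparr>carrier := center A\<rparr>"

text \<open>The endomorphism ring of the \<open>B\<close>-\<open>B\<close>-bimodule \<open>A\<close> under composition, an algebra over
  the center of \<open>A\<close> via \<open>(z \<alpha>) a = z (\<alpha> a)\<close>.\<close>

definition endo_algebra :: "('a, 'm) ring_scheme \<Rightarrow> 'a set \<Rightarrow> ('a, 'a \<Rightarrow> 'a) module" where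
  "endo_algebra A B =
     \<lparr>carrier = bimod_hom (A\<lparr>carrier := B\<rparr>) (A\<lparr>carrier := B\<rparr>) (regular_bimod A) (regular_bimod A)
                 \<inter> extensional (carrier A),
      monoid.mult = compose (carrier A), monoid.one = (\<lambda>a\<in>carrier A. a),
      ring.zero = (\<lambda>a\<in>carrier A. \<zero>\<^bsub>A\<^esub>), ring.add = (\<lambda>\<alpha> \<beta>. \<lambda>a\<in>carrier A. \<alpha> a \<oplus>\<^bsub>A\<^esub> \<beta> a),
      module.smult = (\<lambda>z \<alpha>. \<lambda>a\<in>carrier A. z \<otimes>\<^bsub>A\<^esub> \<alpha> a)\<rparr>"

definition centralizer_algebra :: "('a, 'm) ring_scheme \<Rightarrow> 'a set \<Rightarrow> ('a, 'a) module" where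
  "centralizer_algebra A B =
     \<lparr>carrier = centralizer A B, monoid.mult = monoid.mult A, monoid.one = monoid.one A,
      ring.zero = ring.zero A, ring.add = ring.add A,
      module.smult = monoid.mult A\<rparr>"

definition left_mult :: "('a, 'm) ring_scheme \<Rightarrow> 'a \<Rightarrow> 'a \<Rightarrow> 'a" where
  "left_mult A r = (\<lambda>a\<in>carrier A. r \<otimes>\<^bsub>A\<^esub> a)"

definition right_mult :: "('a, 'm) ring_scheme \<Rightarrow> 'a \<Rightarrow> 'a \<Rightarrow> 'a" where
  "right_mult A r = (\<lambda>a\<in>carrier A. a \<otimes>\<^bsub>A\<^esub> r)"

definition endo_bimod :: "('a, 'm) ring_scheme \<Rightarrow> 'a set \<Rightarrow> ('a, 'a \<Rightarrow> 'a, 'a) bimod" where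
  "endo_bimod A B = bimod_of (endo_algebra A B)
     (\<lambda>r \<alpha>. \<lambda>a\<in>carrier A. r \<otimes>\<^bsub>A\<^esub> \<alpha> a) (\<lambda>\<alpha> r. \<lambda>a\<in>carrier A. \<alpha> a \<otimes>\<^bsub>A\<^esub> r)"

text \<open>The canonical map \<open>S \<otimes>\<^sub>R S \<rightarrow> Hom\<^bsub>B-B\<^esub>(A \<otimes>\<^sub>B A, A)\<close>,
  \<open>\<alpha> \<otimes> \<beta> \<mapsto> (a \<otimes> a' \<mapsto> \<alpha>(a) \<beta>(a'))\<close>.\<close>

definition endo_tensor_map ::
  "('a, 'm) ring_scheme \<Rightarrow> 'a set \<Rightarrow> ((('a \<Rightarrow> 'a) \<times> ('a \<Rightarrow> 'a)) \<Rightarrow>\<^sub>0 int) set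
     \<Rightarrow> (('a \<times> 'a) \<Rightarrow>\<^sub>0 int) set \<Rightarrow> 'a" where
  "endo_tensor_map A B u =
     (\<lambda>w\<in>carrier (tensor (A\<lparr>carrier := B\<rparr>) (regular_bimod A) (regular_bimod A)).
        tensor_lift A (\<lambda>a a'. tensor_lift A (\<lambda>\<alpha> \<beta>. \<alpha> a \<otimes>\<^bsub>A\<^esub> \<beta> a') u) w)"

definition endo_comult ::
  "('a, 'm) ring_scheme \<Rightarrow> 'a set \<Rightarrow> ('a \<Rightarrow> 'a) \<Rightarrow> ((('a \<Rightarrow> 'a) \<times> ('a \<Rightarrow> 'a)) \<Rightarrow>\<^sub>0 int) set" where
  "endo_comult A B = (\<lambda>\<alpha>\<in>carrier (endo_algebra A B).
     inv_into
       (carrier (tensor (A\<lparr>carrier := centralizer A B\<rparr>) (endo_bimod A B) (endo_bimod A B)))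
       (endo_tensor_map A B)
       (\<lambda>w\<in>carrier (tensor (A\<lparr>carrier := B\<rparr>) (regular_bimod A) (regular_bimod A)).
          tensor_lift A (\<lambda>a a'. \<alpha> (a \<otimes>\<^bsub>A\<^esub> a')) w))"

text \<open>The map \<open>R \<otimes>\<^sub>Z R\<^sup>o\<^sup>p \<rightarrow> S\<close>, \<open>r \<otimes> r' \<mapsto> \<lambda>\<^sub>r \<rho>\<^bsub>r'\<^esub>\<close>; additively \<open>R \<otimes>\<^sub>Z R\<^sup>o\<^sup>p\<close> is
  \<open>R \<otimes>\<^sub>Z R\<close>.\<close>

definition mult_map ::
  "('a, 'm) ring_scheme \<Rightarrow> 'a set \<Rightarrow> (('a \<times> 'a) \<Rightarrow>\<^sub>0 int) set \<Rightarrow> 'a \<Rightarrow> 'a" where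
  "mult_map A B = tensor_lift (endo_algebra A B)
     (\<lambda>r r'. compose (carrier A) (left_mult A r) (right_mult A r'))"

definition endo_antipode :: "('a, 'm) ring_scheme \<Rightarrow> 'a set \<Rightarrow> ('a \<Rightarrow> 'a) \<Rightarrow> 'a \<Rightarrow> 'a" where
  "endo_antipode A B = (\<lambda>\<alpha>\<in>carrier (endo_algebra A B).
     let M = module_bimod (centralizer_algebra A B);
         T = ground_tensor (center_ring A) (centralizer_algebra A B)
     in mult_map A B
          (tensor_lift T (\<lambda>r r'. pure_tensor (center_ring A) M M r' r)
             (inv_into (carrier T) (mult_map A B) \<alpha>)))"

text \<open>The two uses of \<open>inv_into\<close> above invert bijections (onto the elements concerned)
  when \<open>A\<close> is H-separable over \<open>B\<close>, which is the only intended case.\<close>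

definition endo_hopf_algebroid ::
  "('a, 'm) ring_scheme \<Rightarrow> 'a set \<Rightarrow> ('a, 'a \<Rightarrow> 'a, 'a) hopf_algebroid" where
  "endo_hopf_algebroid A B =
     \<lparr>total = endo_algebra A B, base = centralizer_algebra A B,
      source = (\<lambda>r\<in>centralizer A B. left_mult A r),
      target = (\<lambda>r\<in>centralizer A B. right_mult A r),
      comult = endo_comult A B,
      counit = (\<lambda>\<alpha>\<in>carrier (endo_algebra A B). \<alpha> \<one>\<^bsub>A\<^esub>),
      antipode = endo_antipode A B\<rparr>"

definition fixed_points ::
  "('a, 'm) ring_scheme \<Rightarrow> ('k, 'a \<Rightarrow> 'a, 'r, 'z) bialgebroid_scheme \<Rightarrow> 'a set" where
  "fixed_points A H =
     {a \<in> carrier A. \<forall>\<alpha>\<in>carrier (total H). \<alpha> a = \<alpha> \<one>\<^bsub>A\<^esub> \<otimes>\<^bsub>A\<^esub> a}"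

end

theory Submission
  imports Defs
begin

text \<open>For an intermediate ring \<open>D\<close> put \<open>V = C\<^sub>A(D)\<close>. H-separability makes every \<open>D\<close>-\<open>D\<close>-bimodule
  endomorphism of \<open>A\<close> a finite sum of maps \<open>a \<mapsto> v a w\<close> with \<open>v, w \<in> V\<close>, and simplicity of \<open>A\<close> makes
  such sums faithful to \<open>V \<otimes>\<^sub>Z V\<^sup>o\<^sup>p\<close>: a relation \<open>\<Sum> x\<^sub>i a y\<^sub>i = 0\<close> (for all \<open>a\<close>) with \<open>Z\<close>-independent
  \<open>x\<^sub>i\<close> forces \<open>y\<^sub>i = 0\<close>. Hence additive identities in the Hopf algebroid of \<open>D\<close> need only be checked
  on these generators, which are products of source and target values; this also shows that it is minimal
  over \<open>V\<close> and that its fixed ring is \<open>C\<^sub>A(V)\<close>.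

  If \<open>A\<^sub>D\<close> is finitely generated projective and \<open>D\<close> is simple, ideal arguments with a dual basis
  give \<open>C\<^sub>A(V) = D\<close> and simplicity of \<open>V\<close>. Conversely, a simple \<open>V\<close> with \<open>Z \<subseteq> V \<subseteq> R\<close> is finite over
  the field \<open>Z\<close>, so \<open>R\<close> has a dual basis over \<open>V\<close>. Composing its coordinate maps with the
  sandwich expressions of the dual basis of \<open>A\<^sub>B\<close> yields maps from \<open>A\<close> to \<open>C\<^sub>A(V)\<close>, from which projectivity
  and simplicity of \<open>C\<^sub>A(V)\<close> and \<open>C\<^sub>A(C\<^sub>A(V)) = V\<close> follow. Finally the Hopf algebroid of
  \<open>C\<^sub>A(V)\<close> embeds in every Hopf subalgebroid of \<open>S\<close> over \<open>V\<close>, since the comultiplication is a bimodule map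
  with \<open>\<Delta>(1) = 1 \<otimes> 1\<close>; minimality then forces equality.\<close>

section \<open>Finite sums in abelian groups\<close>

text \<open>\<open>A\<close>, \<open>B\<close> and \<open>D\<close> may be infinite over
  \<open>Z\<close> and need not be artinian, so neither dimension counts nor the classical double
  centralizer theorem apply to them directly. H-separability is the substitute:
  \<open>A \<otimes>_Z R^op\<close> acts on \<open>A\<close> as the ring of all right
  \<open>B\<close>-linear endomorphisms, and faithfully since \<open>A\<close> is simple. Elements
  of such tensor products are therefore handled as functions on \<open>A\<close>, with the predicate
  \<open>sandwich\<close> naming the allowed coefficients, and ideals of the tensor product become
  sets of functions. Finiteness enters at two points only: the dual basis of \<open>A\<close> over
  \<open>B\<close>, and the coordinates of \<open>1 \<otimes> 1\<close> in
  \<open>A \<otimes>_B A\<close>, which span \<open>R\<close> over \<open>Z\<close>.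

  The simplicity arguments share one pattern: the elements for which a construction succeeds form a
  two-sided ideal with a nonzero member, hence it succeeds for \<open>\<one>\<close>.

  The correspondence is an equality of records. Structure maps are compared on carriers, and their
  extensionality does the rest.\<close>

definition join_index :: "nat set \<Rightarrow> nat set \<Rightarrow> nat set" where
  "join_index I J = (\<lambda>i. 2 * i) ` I \<union> (\<lambda>i. Suc (2 * i)) ` J"

text \<open>Finite sums are indexed by sets of naturals, so that predicates asserting the existence
  of such a sum carry no index type. To add two of them the index sets are made disjoint inside
  \<open>nat\<close>: even numbers carry the first family, odd numbers the second.\<close>

definition join_fam :: "(nat \<Rightarrow> 'd) \<Rightarrow> (nat \<Rightarrow> 'd) \<Rightarrow> nat \<Rightarrow> 'd" where
  "join_fam f g k = (if even k then f (k div 2) else g (k div 2))"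

lemma join_fam_simps [simp]: "join_fam f g (2 * i) = f i" "join_fam f g (Suc (2 * i)) = g i"
  by (simp_all add: join_fam_def)

lemma finite_join_index [simp]: "finite I \<Longrightarrow> finite J \<Longrightarrow> finite (join_index I J)"
  by (simp add: join_index_def)

lemma join_fam_Pi: "f \<in> I \<rightarrow> U \<Longrightarrow> g \<in> J \<rightarrow> U \<Longrightarrow> join_fam f g \<in> join_index I J \<rightarrow> U"
  by (auto simp: join_index_def)

lemma (in abelian_monoid) finsum_join:
  assumes "finite I" "finite J" "h \<in> join_index I J \<rightarrow> carrier G"
  shows "(\<Oplus>k\<in>join_index I J. h k) = (\<Oplus>i\<in>I. h (2 * i)) \<oplus> (\<Oplus>j\<in>J. h (Suc (2 * j)))"
proof -
  have "(\<Oplus>k\<in>join_index I J. h k)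
      = (\<Oplus>k\<in>(\<lambda>i. 2 * i) ` I. h k) \<oplus> (\<Oplus>k\<in>(\<lambda>i. Suc (2 * i)) ` J. h k)"
    unfolding join_index_def
    by (rule finsum_Un_disjoint) (use assms in \<open>auto simp: join_index_def double_not_eq_Suc_double Pi_def\<close>)
  also have "(\<Oplus>k\<in>(\<lambda>i. 2 * i) ` I. h k) = (\<Oplus>i\<in>I. h (2 * i))"
    by (rule finsum_reindex) (use assms in \<open>auto simp: join_index_def inj_on_def\<close>)
  also have "(\<Oplus>k\<in>(\<lambda>i. Suc (2 * i)) ` J. h k) = (\<Oplus>j\<in>J. h (Suc (2 * j)))"
    by (rule finsum_reindex) (use assms in \<open>auto simp: join_index_def inj_on_def\<close>)
  finally show ?thesis .
qed

lemma (in abelian_monoid) finsum_swap: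
  assumes "finite I" "finite J" "\<And>i j. i \<in> I \<Longrightarrow> j \<in> J \<Longrightarrow> f i j \<in> carrier G"
  shows "(\<Oplus>i\<in>I. \<Oplus>j\<in>J. f i j) = (\<Oplus>j\<in>J. \<Oplus>i\<in>I. f i j)"
  using assms
proof (induction I rule: finite_induct)
  case empty then show ?case by simp
next
  case (insert i I)
  have "(\<Oplus>k\<in>insert i I. \<Oplus>j\<in>J. f k j) = (\<Oplus>j\<in>J. f i j) \<oplus> (\<Oplus>k\<in>I. \<Oplus>j\<in>J. f k j)"
    by (rule finsum_insert) (use insert in \<open>auto intro!: finsum_closed\<close>)
  also have "\<dots> = (\<Oplus>j\<in>J. f i j) \<oplus> (\<Oplus>j\<in>J. \<Oplus>k\<in>I. f k j)"
    using insert by simp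
  also have "\<dots> = (\<Oplus>j\<in>J. f i j \<oplus> (\<Oplus>k\<in>I. f k j))"
    by (rule finsum_addf [symmetric]) (use insert in \<open>auto intro!: finsum_closed\<close>)
  also have "\<dots> = (\<Oplus>j\<in>J. \<Oplus>k\<in>insert i I. f k j)"
    by (rule finsum_cong') (use insert in \<open>auto intro!: finsum_closed finsum_insert [symmetric]\<close>)
  finally show ?case .
qed

lemma (in abelian_group) additive_zero:
  assumes "additive_subgroup U G" "abelian_group P" "h \<in> U \<rightarrow> carrier P"
    and "\<And>x y. x \<in> U \<Longrightarrow> y \<in> U \<Longrightarrow> h (x \<oplus> y) = h x \<oplus>\<^bsub>P\<^esub> h y"
  shows "h \<zero> = \<zero>\<^bsub>P\<^esub>"
proof -
  interpret P: abelian_group P by fact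
  interpret U: additive_subgroup U G by fact
  have z: "\<zero> \<in> U" by simp
  have "h \<zero> \<oplus>\<^bsub>P\<^esub> h \<zero> = h \<zero>" using assms(4)[OF z z] by simp
  moreover have "h \<zero> \<in> carrier P" using z assms(3) by auto
  ultimately show ?thesis
    by (metis P.add.l_cancel_one)
qed

lemma (in abelian_group) additive_subgroup_finsum_closed:
  assumes "additive_subgroup U G" "f \<in> I \<rightarrow> U"
  shows "(\<Oplus>i\<in>I. f i) \<in> U"
proof -
  interpret U: additive_subgroup U G by fact
  have "finite I \<Longrightarrow> f \<in> I \<rightarrow> U \<Longrightarrow> (\<Oplus>i\<in>I. f i) \<in> U"
  proof (induction I rule: finite_induct)
    case (insert i I)
    then show ?case by (subst finsum_insert) (auto simp: Pi_def dest: U.a_Hcarr)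
  qed simp
  then show ?thesis using assms(2)
    by (cases "finite I") (simp_all add: finsum_infinite)
qed

text \<open>Additivity is asked on a subgroup only, because \<open>sum_reexpress\<close> applies
  this to maps that are specified only on a subspace \<open>U\<close> of \<open>A\<close>.\<close>

lemma (in abelian_group) additive_finsum:
  assumes "additive_subgroup U G" "abelian_group P" "h \<in> U \<rightarrow> carrier P"
    and "\<And>x y. x \<in> U \<Longrightarrow> y \<in> U \<Longrightarrow> h (x \<oplus> y) = h x \<oplus>\<^bsub>P\<^esub> h y"
    and "finite I" "f \<in> I \<rightarrow> U"
  shows "h (\<Oplus>i\<in>I. f i) = (\<Oplus>\<^bsub>P\<^esub>i\<in>I. h (f i))"
proof -
  interpret P: abelian_group P by fact
  interpret U: additive_subgroup U G by fact
  show ?thesis using assms(5,6)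
  proof (induction I rule: finite_induct)
    case empty
    then show ?case by (simp add: additive_zero [OF assms(1-4)])
  next
    case (insert i I)
    have c: "f i \<in> U" "f \<in> I \<rightarrow> U" using insert by auto
    have "(\<Oplus>j\<in>I. f j) \<in> U"
      by (rule additive_subgroup_finsum_closed) (use c assms(1) in auto)
    moreover have "(\<Oplus>j\<in>insert i I. f j) = f i \<oplus> (\<Oplus>j\<in>I. f j)"
      by (rule finsum_insert) (use insert c in \<open>auto dest: U.a_Hcarr\<close>)
    ultimately have "h (\<Oplus>j\<in>insert i I. f j) = h (f i) \<oplus>\<^bsub>P\<^esub> h (\<Oplus>j\<in>I. f j)"
      using c assms(4) by simp
    also have "\<dots> = h (f i) \<oplus>\<^bsub>P\<^esub> (\<Oplus>\<^bsub>P\<^esub>j\<in>I. h (f j))" using insert c by simp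
    also have "\<dots> = (\<Oplus>\<^bsub>P\<^esub>j\<in>insert i I. h (f j))"
      by (rule P.finsum_insert [symmetric]) (use insert c assms(3) in auto)
    finally show ?case .
  qed
qed

lemma (in abelian_group) carrier_additive_subgroup: "additive_subgroup (carrier G) G"
  by (simp add: additive_subgroupI add.subgroup_self)

lemma centralizerI:
  "a \<in> carrier A \<Longrightarrow> (\<And>x. x \<in> U \<Longrightarrow> a \<otimes>\<^bsub>A\<^esub> x = x \<otimes>\<^bsub>A\<^esub> a) \<Longrightarrow> a \<in> centralizer A U"
  unfolding centralizer_def by blast

lemma centralizer_comm: "a \<in> centralizer A U \<Longrightarrow> x \<in> U \<Longrightarrow> a \<otimes>\<^bsub>A\<^esub> x = x \<otimes>\<^bsub>A\<^esub> a"
  unfolding centralizer_def by blast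

lemma centralizer_carrier: "a \<in> centralizer A U \<Longrightarrow> a \<in> carrier A"
  unfolding centralizer_def by blast

section \<open>Simple rings and their centers\<close>

locale simple = ring A for A (structure) +
  assumes simple: "simple_ring A"
begin

abbreviation "Z \<equiv> center A"

lemma one_not_zero: "\<one> \<noteq> \<zero>"
  using simple by (auto simp: simple_ring_def)

lemma ideal_cases: "ideal I A \<Longrightarrow> x \<in> I \<Longrightarrow> x \<noteq> \<zero> \<Longrightarrow> I = carrier A"
  using simple by (auto simp: simple_ring_def)

lemma center_carrier [simp]: "z \<in> Z \<Longrightarrow> z \<in> carrier A"
  by (rule centralizer_carrier)

lemma center_comm: "z \<in> Z \<Longrightarrow> a \<in> carrier A \<Longrightarrow> z \<otimes> a = a \<otimes> z"
  by (rule centralizer_comm)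

lemma centralizer_subring:
  assumes U: "U \<subseteq> carrier A"
  shows "subring (centralizer A U) A"
proof (rule subringI)
  show "centralizer A U \<subseteq> carrier A" by (auto simp: centralizer_carrier)
  show "\<one> \<in> centralizer A U" by (rule centralizerI) (use U in auto)
  fix h assume h: "h \<in> centralizer A U"
  then have hc: "h \<in> carrier A" by (rule centralizer_carrier)
  show "\<ominus> h \<in> centralizer A U"
  proof (rule centralizerI)
    fix x assume x: "x \<in> U"
    then show "\<ominus> h \<otimes> x = x \<otimes> \<ominus> h"
      using centralizer_comm [OF h x] hc U by (simp add: l_minus r_minus subset_iff)
  qed (use hc in simp)
  fix h' assume h': "h' \<in> centralizer A U"
  then have hc': "h' \<in> carrier A" by (rule centralizer_carrier)
  show "h \<oplus> h' \<in> centralizer A U"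
  proof (rule centralizerI)
    fix x assume x: "x \<in> U"
    then show "(h \<oplus> h') \<otimes> x = x \<otimes> (h \<oplus> h')"
      using centralizer_comm [OF h x] centralizer_comm [OF h' x] hc hc' U
      by (simp add: l_distr r_distr subset_iff)
  qed (use hc hc' in simp)
  show "h \<otimes> h' \<in> centralizer A U"
  proof (rule centralizerI)
    fix x assume x: "x \<in> U"
    then have xc: "x \<in> carrier A" using U by blast
    have "h \<otimes> h' \<otimes> x = h \<otimes> (x \<otimes> h')"
      using hc hc' xc centralizer_comm [OF h' x] by (simp add: m_assoc)
    also have "\<dots> = x \<otimes> (h \<otimes> h')"
      using hc hc' xc centralizer_comm [OF h x] by (simp add: m_assoc [symmetric])
    finally show "h \<otimes> h' \<otimes> x = x \<otimes> (h \<otimes> h')" .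
  qed (use hc hc' in simp)
qed

lemma center_subring: "subring Z A"
  by (rule centralizer_subring) simp

text \<open>For central \<open>z\<close> the set \<open>z A\<close> is a two-sided ideal, so it is
  all of \<open>A\<close>. Together with centrality of the inverse this makes \<open>Z\<close> a
  field, which is what the linear algebra below rests on.\<close>

lemma center_inverse:
  assumes "z \<in> Z" "z \<noteq> \<zero>"
  obtains w where "w \<in> Z" "w \<otimes> z = \<one>" "z \<otimes> w = \<one>"
proof -
  define I where "I = (\<lambda>a. z \<otimes> a) ` carrier A"
  have zc: "z \<in> carrier A" using assms by simp
  have "ideal I A"
  proof (rule idealI [OF ring_axioms])
    show "subgroup I (add_monoid A)"
    proof (rule add.subgroupI)
      show "I \<noteq> {}" "I \<subseteq> carrier A" using zc by (auto simp: I_def)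
      fix a assume "a \<in> I"
      then obtain b where b: "b \<in> carrier A" "a = z \<otimes> b" by (auto simp: I_def)
      then have "\<ominus> a = z \<otimes> (\<ominus> b)" using zc by (simp add: r_minus)
      then show "\<ominus> a \<in> I" using b by (auto simp: I_def)
      fix a' assume "a' \<in> I"
      then obtain b' where b': "b' \<in> carrier A" "a' = z \<otimes> b'" by (auto simp: I_def)
      then have "a \<oplus> a' = z \<otimes> (b \<oplus> b')" using zc b by (simp add: r_distr)
      then show "a \<oplus> a' \<in> I" using b b' by (auto simp: I_def)
    qed
    fix a x assume "a \<in> I" and x: "x \<in> carrier A"
    then obtain b where b: "b \<in> carrier A" "a = z \<otimes> b" by (auto simp: I_def)
    have "x \<otimes> a = z \<otimes> (x \<otimes> b)"
      using b x zc center_comm [OF assms(1) x] by (simp add: m_assoc [symmetric])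
    then show "x \<otimes> a \<in> I" using b x by (auto simp: I_def)
    have "a \<otimes> x = z \<otimes> (b \<otimes> x)" using b x zc by (simp add: m_assoc)
    then show "a \<otimes> x \<in> I" using b x by (auto simp: I_def)
  qed
  moreover have "z \<in> I" unfolding I_def using zc by (intro image_eqI [of _ _ \<one>]) auto
  ultimately have "I = carrier A" using assms(2) by (rule ideal_cases)
  then have "\<one> \<in> I" by simp
  then obtain w where w: "w \<in> carrier A" "z \<otimes> w = \<one>" by (auto simp: I_def)
  have wz: "w \<otimes> z = \<one>" using w center_comm [OF assms(1) w(1)] by simp
  \<comment> \<open>Insert \<open>z \<otimes> w = \<one>\<close> on the right of
    \<open>w \<otimes> a\<close> and move the central \<open>z\<close> across \<open>a\<close>,
    where it cancels the left \<open>w\<close>.\<close>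
  have "w \<otimes> a = a \<otimes> w" if a: "a \<in> carrier A" for a
  proof -
    have "w \<otimes> a = w \<otimes> a \<otimes> (z \<otimes> w)" using w a by simp
    also have "\<dots> = w \<otimes> (a \<otimes> z) \<otimes> w" using w a zc by (simp add: m_assoc)
    also have "\<dots> = w \<otimes> (z \<otimes> a) \<otimes> w" using center_comm [OF assms(1) a] by simp
    also have "\<dots> = (w \<otimes> z) \<otimes> (a \<otimes> w)" using w a zc by (simp add: m_assoc)
    finally show ?thesis using wz w a by simp
  qed
  then have "w \<in> Z" using w by (intro centralizerI)
  then show ?thesis using that w wz by blast
qed

text \<open>The finite sums of terms \<open>x s y\<close> form a two-sided ideal containing
  \<open>s\<close>. This is the device for turning a nonzero coefficient of a sandwich expression
  into \<open>\<one>\<close>.\<close>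

lemma one_eq_sum:
  assumes s: "s \<in> carrier A" "s \<noteq> \<zero>"
  obtains I :: "nat set" and x y where "finite I" "x \<in> I \<rightarrow> carrier A" "y \<in> I \<rightarrow> carrier A"
    "\<one> = (\<Oplus>i\<in>I. x i \<otimes> s \<otimes> y i)"
proof -
  define K where "K = {k. \<exists>I :: nat set. \<exists>x y. finite I \<and> x \<in> I \<rightarrow> carrier A \<and> y \<in> I \<rightarrow> carrier A
    \<and> k = (\<Oplus>i\<in>I. x i \<otimes> s \<otimes> y i)}"
  have KI: "(\<Oplus>i\<in>I. x i \<otimes> s \<otimes> y i) \<in> K"
    if "finite I" "x \<in> I \<rightarrow> carrier A" "y \<in> I \<rightarrow> carrier A" for x y and I :: "nat set"
    unfolding K_def using that by blast
  have KE: "\<exists>I x y. finite (I :: nat set) \<and> x \<in> I \<rightarrow> carrier A \<and> y \<in> I \<rightarrow> carrier A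
    \<and> k = (\<Oplus>i\<in>I. x i \<otimes> s \<otimes> y i)" if "k \<in> K" for k
    using that by (simp add: K_def)
  have "ideal K A"
  proof (rule idealI [OF ring_axioms])
    show "subgroup K (add_monoid A)"
    proof (rule add.subgroupI)
      show "K \<subseteq> carrier A" using s by (auto simp: K_def Pi_def intro!: finsum_closed)
      have "(\<Oplus>i\<in>({} :: nat set). \<one> \<otimes> s \<otimes> \<one>) \<in> K" by (rule KI) auto
      then show "K \<noteq> {}" by blast
      fix a assume "a \<in> K"
      then obtain x y and I :: "nat set" where 1: "finite I" "x \<in> I \<rightarrow> carrier A" "y \<in> I \<rightarrow> carrier A"
          "a = (\<Oplus>i\<in>I. x i \<otimes> s \<otimes> y i)" using KE [OF \<open>a \<in> K\<close>] by blast
      have "\<ominus> a = (\<Oplus>i\<in>I. (\<ominus> \<one>) \<otimes> (x i \<otimes> s \<otimes> y i))"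
        using 1 s by (subst finsum_rdistr [symmetric]) (auto simp: Pi_def l_minus intro!: finsum_closed)
      also have "\<dots> = (\<Oplus>i\<in>I. (\<ominus> x i) \<otimes> s \<otimes> y i)"
        by (rule finsum_cong') (use 1 s in \<open>auto simp: l_minus Pi_def\<close>)
      finally show "\<ominus> a \<in> K" using KI [of I "\<lambda>i. \<ominus> x i" y] 1 by (simp add: Pi_def)
      fix b assume "b \<in> K"
      then obtain x' y' and J :: "nat set" where 2: "finite J" "x' \<in> J \<rightarrow> carrier A" "y' \<in> J \<rightarrow> carrier A"
          "b = (\<Oplus>i\<in>J. x' i \<otimes> s \<otimes> y' i)" using KE [OF \<open>b \<in> K\<close>] by blast
      have c: "join_fam x x' \<in> join_index I J \<rightarrow> carrier A" "join_fam y y' \<in> join_index I J \<rightarrow> carrier A"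
        using 1 2 by (simp_all only: join_fam_Pi)
      have "a \<oplus> b = (\<Oplus>k\<in>join_index I J. join_fam x x' k \<otimes> s \<otimes> join_fam y y' k)"
        using 1 2 c s by (subst finsum_join) (auto simp: Pi_def)
      then show "a \<oplus> b \<in> K" using KI [OF _ c] 1 2 by simp
    qed
    fix a c assume "a \<in> K" and c: "c \<in> carrier A"
    then obtain x y and I :: "nat set" where 1: "finite I" "x \<in> I \<rightarrow> carrier A" "y \<in> I \<rightarrow> carrier A"
        "a = (\<Oplus>i\<in>I. x i \<otimes> s \<otimes> y i)" using KE [OF \<open>a \<in> K\<close>] by blast
    have "c \<otimes> a = (\<Oplus>i\<in>I. c \<otimes> (x i \<otimes> s \<otimes> y i))"
      using 1 s c by (auto simp: Pi_def intro!: finsum_rdistr)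
    also have "\<dots> = (\<Oplus>i\<in>I. (c \<otimes> x i) \<otimes> s \<otimes> y i)"
      by (rule finsum_cong') (use 1 s c in \<open>auto simp: m_assoc Pi_def\<close>)
    finally show "c \<otimes> a \<in> K" using KI [of I "\<lambda>i. c \<otimes> x i" y] 1 c by (simp add: Pi_def)
    have "a \<otimes> c = (\<Oplus>i\<in>I. (x i \<otimes> s \<otimes> y i) \<otimes> c)"
      using 1 s c by (auto simp: Pi_def intro!: finsum_ldistr)
    also have "\<dots> = (\<Oplus>i\<in>I. x i \<otimes> s \<otimes> (y i \<otimes> c))"
      by (rule finsum_cong') (use 1 s c in \<open>auto simp: m_assoc Pi_def\<close>)
    finally show "a \<otimes> c \<in> K" using KI [of I x "\<lambda>i. y i \<otimes> c"] 1 c by (simp add: Pi_def)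
  qed
  moreover have "s \<in> K" using KI [of "{0}" "\<lambda>_. \<one>" "\<lambda>_. \<one>"] s by simp
  ultimately have "K = carrier A" using s ideal_cases by blast
  then have "\<one> \<in> K" by simp
  then show ?thesis using KE [OF \<open>\<one> \<in> K\<close>] that by blast
qed

definition indep :: "('i \<Rightarrow> 'a) \<Rightarrow> 'i set \<Rightarrow> bool" where
  "indep c I \<longleftrightarrow> finite I \<and> c \<in> I \<rightarrow> carrier A \<and>
     (\<forall>z\<in>I \<rightarrow> Z. (\<Oplus>i\<in>I. z i \<otimes> c i) = \<zero> \<longrightarrow> (\<forall>i\<in>I. z i = \<zero>))"

lemma indep_finite: "indep c I \<Longrightarrow> finite I" by (simp add: indep_def)
lemma indep_carrier: "indep c I \<Longrightarrow> c \<in> I \<rightarrow> carrier A" by (simp add: indep_def)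

lemma indepD: "indep c I \<Longrightarrow> z \<in> I \<rightarrow> Z \<Longrightarrow> (\<Oplus>i\<in>I. z i \<otimes> c i) = \<zero> \<Longrightarrow> i \<in> I \<Longrightarrow> z i = \<zero>"
  by (auto simp: indep_def)

lemma zero_center: "\<zero> \<in> Z" using subringE(2)[OF center_subring] .
lemma one_center: "\<one> \<in> Z" using subringE(3)[OF center_subring] .

lemma indep_remove:
  assumes "indep c I" shows "indep c (I - {k})"
proof (cases "k \<in> I")
  case True
  note f = indep_finite [OF assms] and c = indep_carrier [OF assms]
  show ?thesis unfolding indep_def
  proof (intro conjI ballI impI)
    fix z i assume z: "z \<in> I - {k} \<rightarrow> Z" "(\<Oplus>i\<in>I - {k}. z i \<otimes> c i) = \<zero>" and i: "i \<in> I - {k}"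
    define z' where "z' = z(k := \<zero>)"
    have z': "z' \<in> I \<rightarrow> Z" using z(1) zero_center by (auto simp: z'_def)
    have "(\<Oplus>i\<in>I - {k}. z' i \<otimes> c i) = (\<Oplus>i\<in>I - {k}. z i \<otimes> c i)"
      by (rule finsum_cong') (use z c in \<open>auto simp: z'_def Pi_def\<close>)
    moreover have "(\<Oplus>i\<in>insert k (I - {k}). z' i \<otimes> c i) = z' k \<otimes> c k \<oplus> (\<Oplus>i\<in>I - {k}. z' i \<otimes> c i)"
      by (rule finsum_insert) (use f c z' True in \<open>auto simp: Pi_def\<close>)
    ultimately have "(\<Oplus>i\<in>I. z' i \<otimes> c i) = \<zero>"
      using z True c by (simp add: insert_absorb z'_def Pi_def)
    from indepD [OF assms z' this, of i] show "z i = \<zero>" using i by (auto simp: z'_def)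
  qed (use f c in auto)
qed (use assms in simp)

text \<open>Shortening argument: normalise one coefficient to \<open>\<one>\<close> and pass to commutators,
  which kills that term; hence all coefficients become central.\<close>

lemma sandwich_zero:
  assumes "indep c I" "v \<in> I \<rightarrow> carrier A" "\<And>a. a \<in> carrier A \<Longrightarrow> (\<Oplus>i\<in>I. c i \<otimes> a \<otimes> v i) = \<zero>"
    and "i \<in> I"
  shows "v i = \<zero>"
proof -
  have "finite I" using assms(1) by (rule indep_finite)
  then show ?thesis using assms
  proof (induction I arbitrary: v i rule: finite_psubset_induct)
    case (psubset I)
    note f = \<open>finite I\<close>
    have c: "c \<in> I \<rightarrow> carrier A" by (rule indep_carrier) fact
    show ?case
    proof (rule ccontr)
      assume "v i \<noteq> \<zero>"
      moreover have "v i \<in> carrier A" using psubset by auto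
      ultimately obtain K :: "nat set" and x y where K: "finite K" "x \<in> K \<rightarrow> carrier A"
        "y \<in> K \<rightarrow> carrier A" "\<one> = (\<Oplus>k\<in>K. x k \<otimes> v i \<otimes> y k)"
        using one_eq_sum [of "v i"] by blast
      define t where "t j = (\<Oplus>k\<in>K. x k \<otimes> v j \<otimes> y k)" for j
      have t: "t j \<in> carrier A" if "j \<in> I" for j
        using that K psubset.prems(2) by (auto simp: t_def Pi_def intro!: finsum_closed)
      have ti: "t i = \<one>" using K by (simp add: t_def)
      have cc: "\<And>j. j \<in> I \<Longrightarrow> c j \<in> carrier A" "\<And>j. j \<in> I \<Longrightarrow> v j \<in> carrier A"
        "\<And>j. j \<in> K \<Longrightarrow> x j \<in> carrier A" "\<And>j. j \<in> K \<Longrightarrow> y j \<in> carrier A"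
        using c psubset.prems(2) K by auto
      \<comment> \<open>Substitute \<open>a \<otimes> x k\<close> into the relation for
        \<open>v\<close>, multiply by \<open>y k\<close> on the right and sum over
        \<open>k\<close>.\<close>
      have rel: "(\<Oplus>j\<in>I. c j \<otimes> a \<otimes> t j) = \<zero>" if a: "a \<in> carrier A" for a
      proof -
        have "(\<Oplus>j\<in>I. c j \<otimes> a \<otimes> t j) = (\<Oplus>j\<in>I. \<Oplus>k\<in>K. c j \<otimes> a \<otimes> (x k \<otimes> v j \<otimes> y k))"
          unfolding t_def
          by (rule finsum_cong') (use a cc K in \<open>auto intro!: finsum_rdistr finsum_closed\<close>)
        also have "\<dots> = (\<Oplus>k\<in>K. \<Oplus>j\<in>I. c j \<otimes> a \<otimes> (x k \<otimes> v j \<otimes> y k))"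
          by (rule finsum_swap) (use f K cc a in auto)
        also have "\<dots> = (\<Oplus>k\<in>K. (\<Oplus>j\<in>I. c j \<otimes> (a \<otimes> x k) \<otimes> v j) \<otimes> y k)"
        proof (rule finsum_cong')
          fix k assume k: "k \<in> K"
          have "(\<Oplus>j\<in>I. c j \<otimes> a \<otimes> (x k \<otimes> v j \<otimes> y k)) = (\<Oplus>j\<in>I. c j \<otimes> (a \<otimes> x k) \<otimes> v j \<otimes> y k)"
            by (rule finsum_cong') (use a cc k in \<open>auto simp: m_assoc\<close>)
          also have "\<dots> = (\<Oplus>j\<in>I. c j \<otimes> (a \<otimes> x k) \<otimes> v j) \<otimes> y k"
            by (rule finsum_ldistr [symmetric]) (use f a cc k in auto)
          finally show "(\<Oplus>j\<in>I. c j \<otimes> a \<otimes> (x k \<otimes> v j \<otimes> y k)) = (\<Oplus>j\<in>I. c j \<otimes> (a \<otimes> x k) \<otimes> v j) \<otimes> y k" .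
        qed (use a cc in \<open>auto intro!: finsum_closed\<close>)
        also have "\<dots> = (\<Oplus>k\<in>K. \<zero>)"
          by (rule finsum_cong') (use a cc psubset.prems(3) in auto)
        finally show ?thesis by simp
      qed
      have cent: "b \<otimes> t j = t j \<otimes> b" if b: "b \<in> carrier A" and j: "j \<in> I" for b j
      proof (cases "j = i")
        case True then show ?thesis using b ti by simp
      next
        case False
        define w where "w j = b \<otimes> t j \<ominus> t j \<otimes> b" for j
        have wc: "\<And>j. j \<in> I \<Longrightarrow> w j \<in> carrier A" using t b by (auto simp: w_def)
        have wi: "w i = \<zero>" using b ti by (simp add: w_def a_minus_def r_neg)
        have "w j = \<zero>"
        proof (rule psubset.IH)
          show "I - {i} \<subset> I" using psubset.prems(4) by auto
          show "indep c (I - {i})" by (rule indep_remove) fact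
          show "w \<in> I - {i} \<rightarrow> carrier A" using wc by auto
          show "j \<in> I - {i}" using j False by simp
          fix a assume a: "a \<in> carrier A"
          have "(\<Oplus>j\<in>insert i (I - {i}). c j \<otimes> a \<otimes> w j) = c i \<otimes> a \<otimes> w i \<oplus> (\<Oplus>j\<in>I - {i}. c j \<otimes> a \<otimes> w j)"
            by (rule finsum_insert) (use f cc a wc psubset.prems(4) in auto)
          then have "(\<Oplus>j\<in>I - {i}. c j \<otimes> a \<otimes> w j) = (\<Oplus>j\<in>I. c j \<otimes> a \<otimes> w j)"
            using wi cc a psubset.prems(4) wc by (simp add: insert_absorb finsum_closed)
          \<comment> \<open>The relation for the commutators is the relation for \<open>t\<close> at
            \<open>a \<otimes> b\<close> minus the relation at \<open>a\<close> multiplied by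
            \<open>b\<close> on the right.\<close>
          also have "\<dots> = (\<Oplus>j\<in>I. c j \<otimes> (a \<otimes> b) \<otimes> t j \<oplus> (c j \<otimes> a \<otimes> t j) \<otimes> (\<ominus> b))"
            by (rule finsum_cong')
              (use cc a b t in \<open>auto simp: w_def a_minus_def r_distr m_assoc r_minus l_minus\<close>)
          also have "\<dots> = (\<Oplus>j\<in>I. c j \<otimes> (a \<otimes> b) \<otimes> t j) \<oplus> (\<Oplus>j\<in>I. c j \<otimes> a \<otimes> t j \<otimes> (\<ominus> b))"
            by (rule finsum_addf) (use cc a b t in auto)
          also have "(\<Oplus>j\<in>I. c j \<otimes> a \<otimes> t j \<otimes> (\<ominus> b)) = (\<Oplus>j\<in>I. c j \<otimes> a \<otimes> t j) \<otimes> (\<ominus> b)"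
            by (rule finsum_ldistr [symmetric]) (use f cc a b t in auto)
          finally show "(\<Oplus>j\<in>I - {i}. c j \<otimes> a \<otimes> w j) = \<zero>" using rel a b by simp
        qed
        then show ?thesis unfolding w_def using t j b r_right_minus_eq by simp
      qed
      have tZ: "t \<in> I \<rightarrow> Z" using t cent by (auto intro!: centralizerI)
      \<comment> \<open>With central \<open>t j\<close> the relation at \<open>a = \<one>\<close> is
        a linear dependence among the \<open>c j\<close> in which \<open>c i\<close> has coefficient
        \<open>\<one>\<close>.\<close>
      have "(\<Oplus>j\<in>I. t j \<otimes> c j) = (\<Oplus>j\<in>I. c j \<otimes> \<one> \<otimes> t j)"
        by (rule finsum_cong') (use cc t cent in auto)
      then have "(\<Oplus>j\<in>I. t j \<otimes> c j) = \<zero>" using rel by simp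
      with indepD [OF psubset.prems(1) tZ] have "t i = \<zero>" using psubset.prems(4) by blast
      then show False using ti one_not_zero by simp
    qed
  qed
qed

end

section \<open>The opposite ring and linear algebra over the center\<close>

lemma finsum_opp [simp]: "finsum (opp_ring A) = finsum A"
  by (simp add: finsum_def opp_ring_def fun_eq_iff)

lemma opp_ring_simps [simp]:
  "carrier (opp_ring A) = carrier A" "\<one>\<^bsub>opp_ring A\<^esub> = \<one>\<^bsub>A\<^esub>" "\<zero>\<^bsub>opp_ring A\<^esub> = \<zero>\<^bsub>A\<^esub>"
  "ring.add (opp_ring A) = ring.add A" "x \<otimes>\<^bsub>opp_ring A\<^esub> y = y \<otimes>\<^bsub>A\<^esub> x"
  "add_monoid (opp_ring A) = add_monoid A" "\<ominus>\<^bsub>opp_ring A\<^esub> x = \<ominus>\<^bsub>A\<^esub> x"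
  by (simp_all add: opp_ring_def a_inv_def)

lemma (in ring) ring_opp: "ring (opp_ring A)" if "A = R" for A
proof -
  have "abelian_group (opp_ring R)"
    by (rule abelian_groupI) (auto simp: a_ac intro: bexI [of _ "\<ominus> _"] l_neg)
  moreover have "Group.monoid (opp_ring R)"
    by (rule monoidI) (auto simp: m_assoc)
  ultimately show ?thesis unfolding that
    by (rule ringI) (auto simp: l_distr r_distr)
qed

lemma (in abelian_group) finsum_minus:
  assumes "finite I" "f \<in> I \<rightarrow> carrier G"
  shows "\<ominus> (\<Oplus>i\<in>I. f i) = (\<Oplus>i\<in>I. \<ominus> (f i))"
  by (rule additive_finsum [OF carrier_additive_subgroup abelian_group_axioms])
    (use assms in \<open>auto simp: minus_add a_comm\<close>)

lemma (in abelian_group) abelian_group_restrict: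
  assumes "additive_subgroup S G" shows "abelian_group (G\<lparr>carrier := S\<rparr>)"
proof -
  interpret S: additive_subgroup S G by fact
  have neg: "\<ominus> x \<in> S" if "x \<in> S" for x
    using that S.a_subgroup subgroup.m_inv_closed by (fastforce simp: a_inv_def)
  show ?thesis
    by (rule abelian_groupI) (auto simp: a_ac S.a_Hcarr r_neg intro!: bexI [OF _ neg])
qed

context simple begin

lemma simple_opp: "simple (opp_ring A)"
proof (intro simple.intro simple_axioms.intro)
  show r: "ring (opp_ring A)" by (rule ring_opp) simp
  show "simple_ring (opp_ring A)" unfolding simple_ring_def
  proof (intro conjI allI impI)
    fix I assume "ideal I (opp_ring A)"
    then interpret I: ideal I "opp_ring A" .
    have "ideal I A"
      by (rule idealI [OF ring_axioms])
        (use I.a_subgroup I.I_l_closed I.I_r_closed in \<open>simp_all\<close>)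
    then show "I = {\<zero>\<^bsub>opp_ring A\<^esub>} \<or> I = carrier (opp_ring A)"
      using simple by (simp add: simple_ring_def)
  qed (use r one_not_zero in auto)
qed

lemma center_opp: "center (opp_ring A) = Z"
  unfolding centralizer_def opp_ring_simps
  by (intro Collect_cong conj_cong ball_cong refl) (rule eq_commute)

text \<open>Coefficients are central, so the order of the factors in a linear combination is
  irrelevant.\<close>

lemma indep_opp: "simple.indep (opp_ring A) c I = indep c I"
proof -
  interpret o: simple "opp_ring A" by (rule simple_opp)
  have "(\<Oplus>i\<in>I. c i \<otimes> z i) = (\<Oplus>i\<in>I. z i \<otimes> c i)"
    if "z \<in> I \<rightarrow> Z" "c \<in> I \<rightarrow> carrier A" for z
    by (rule finsum_cong') (use that in \<open>auto simp: Pi_def center_comm\<close>)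
  then show ?thesis unfolding indep_def o.indep_def center_opp by auto
qed

text \<open>This is \<open>sandwich_zero\<close> in the opposite ring, where the two outer factors
  change places.\<close>

lemma sandwich_zero_right:
  assumes "indep v I" "c \<in> I \<rightarrow> carrier A"
    "\<And>a. a \<in> carrier A \<Longrightarrow> (\<Oplus>i\<in>I. c i \<otimes> a \<otimes> v i) = \<zero>" and "i \<in> I"
  shows "c i = \<zero>"
proof -
  interpret o: simple "opp_ring A" by (rule simple_opp)
  have "(\<Oplus>\<^bsub>opp_ring A\<^esub>i\<in>I. v i \<otimes>\<^bsub>opp_ring A\<^esub> a \<otimes>\<^bsub>opp_ring A\<^esub> c i) = \<zero>\<^bsub>opp_ring A\<^esub>"
    if a: "a \<in> carrier (opp_ring A)" for a
  proof -
    have "(\<Oplus>i\<in>I. c i \<otimes> (a \<otimes> v i)) = (\<Oplus>i\<in>I. c i \<otimes> a \<otimes> v i)"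
      by (rule finsum_cong')
        (use assms(2) indep_carrier [OF assms(1)] a in \<open>auto simp: m_assoc Pi_def\<close>)
    then show ?thesis using assms(3) a by simp
  qed
  then have "c i = \<zero>\<^bsub>opp_ring A\<^esub>"
    by (intro o.sandwich_zero [where I = I and c = v and v = c]) (use assms in \<open>auto simp: indep_opp\<close>)
  then show ?thesis by simp
qed

lemma center_solve:
  assumes "z \<in> Z" "w \<in> Z" "w \<otimes> z = \<one>" "x \<in> carrier A" "s \<in> carrier A" "z \<otimes> x \<oplus> s = \<zero>"
  shows "x = w \<otimes> (\<ominus> s)"
proof -
  have c: "z \<in> carrier A" "w \<in> carrier A" using assms by auto
  have "\<ominus> s = z \<otimes> x" by (rule minus_equality) (use assms c in auto)
  then have "w \<otimes> (\<ominus> s) = (w \<otimes> z) \<otimes> x" using assms(4) c by (simp add: m_assoc)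
  then show ?thesis using assms by simp
qed

text \<open>This identity is what makes \<open>(u, e) \<mapsto> u a e\<close> balanced over
  \<open>Z\<close>, hence well defined on tensors over \<open>Z\<close>.\<close>

lemma center_move:
  assumes "z \<in> Z" "u \<in> carrier A" "a \<in> carrier A" "e \<in> carrier A"
  shows "z \<otimes> u \<otimes> a \<otimes> e = u \<otimes> a \<otimes> (z \<otimes> e)"
proof -
  have c: "z \<in> carrier A" using assms by auto
  have "z \<otimes> u \<otimes> a \<otimes> e = z \<otimes> (u \<otimes> a) \<otimes> e" using assms c by (simp add: m_assoc)
  also have "z \<otimes> (u \<otimes> a) = u \<otimes> a \<otimes> z" using assms by (intro center_comm) auto
  finally show ?thesis using assms c by (simp add: m_assoc)
qed

text \<open>Linear algebra over the field \<open>Z\<close>. The coordinates \<open>y\<close> are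
  returned with the basis because the later proofs regroup sums along them.\<close>

lemma basis_extraction:
  assumes "finite I" "x \<in> I \<rightarrow> carrier A"
  obtains J y where "J \<subseteq> I" "indep x J" "\<And>i j. i \<in> I \<Longrightarrow> j \<in> J \<Longrightarrow> y i j \<in> Z"
    "\<And>i. i \<in> I \<Longrightarrow> x i = (\<Oplus>j\<in>J. y i j \<otimes> x j)"
proof -
  have "\<exists>J y. J \<subseteq> I \<and> indep x J \<and> (\<forall>i\<in>I. \<forall>j\<in>J. y i j \<in> Z) \<and> (\<forall>i\<in>I. x i = (\<Oplus>j\<in>J. y i j \<otimes> x j))"
    using assms
  proof (induction I rule: finite_induct)
    case empty
    then show ?case by (intro exI [of _ "{}"]) (auto simp: indep_def)
  next
    case (insert k I)
    have "x \<in> I \<rightarrow> carrier A" using insert.prems by auto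
    from insert.IH [OF this] obtain J y where J0: "J \<subseteq> I \<and> indep x J \<and> (\<forall>i\<in>I. \<forall>j\<in>J. y i j \<in> Z)
        \<and> (\<forall>i\<in>I. x i = (\<Oplus>j\<in>J. y i j \<otimes> x j))" by (elim exE)
    have J: "J \<subseteq> I" "indep x J" "\<And>i j. i \<in> I \<Longrightarrow> j \<in> J \<Longrightarrow> y i j \<in> Z"
        "\<And>i. i \<in> I \<Longrightarrow> x i = (\<Oplus>j\<in>J. y i j \<otimes> x j)" using J0 by blast+
    have f: "finite J" using J(2) by (rule indep_finite)
    have xc: "\<And>j. j \<in> J \<Longrightarrow> x j \<in> carrier A" "x k \<in> carrier A" "\<And>j. j \<in> I \<Longrightarrow> x j \<in> carrier A"
      using insert.prems J(1) by (auto simp: Pi_def)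
    show ?case
    proof (cases "\<exists>t\<in>J \<rightarrow> Z. x k = (\<Oplus>j\<in>J. t j \<otimes> x j)")
      case True
      then obtain t where t: "t \<in> J \<rightarrow> Z" "x k = (\<Oplus>j\<in>J. t j \<otimes> x j)" by blast
      have "(\<forall>i\<in>insert k I. \<forall>j\<in>J. (y(k := t)) i j \<in> Z)" using t J(3) by auto
      moreover have "(\<forall>i\<in>insert k I. x i = (\<Oplus>j\<in>J. (y(k := t)) i j \<otimes> x j))"
        using t J(4) insert.hyps by auto
      ultimately show ?thesis using J(1,2) by (intro exI [of _ J] exI [of _ "y(k := t)"]) auto
    next
      case False
      have kJ: "k \<notin> J" using insert J by auto
      have ind: "indep x (insert k J)" unfolding indep_def
      proof (intro conjI ballI impI)
        fix z i assume z: "z \<in> insert k J \<rightarrow> Z" "(\<Oplus>i\<in>insert k J. z i \<otimes> x i) = \<zero>"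
          and i: "i \<in> insert k J"
        have zc: "\<And>j. j \<in> J \<Longrightarrow> z j \<in> Z" "z k \<in> Z" using z(1) by auto
        have e: "(\<Oplus>i\<in>insert k J. z i \<otimes> x i) = z k \<otimes> x k \<oplus> (\<Oplus>i\<in>J. z i \<otimes> x i)"
          by (rule finsum_insert) (use f kJ xc zc in auto)
        have sc: "(\<Oplus>i\<in>J. z i \<otimes> x i) \<in> carrier A" using xc zc by (auto intro!: finsum_closed)
        have zk: "z k = \<zero>"
        proof (rule ccontr)
          assume "z k \<noteq> \<zero>"
          then obtain w where w: "w \<in> Z" "w \<otimes> z k = \<one>" using center_inverse [OF zc(2)] by blast
          have "x k = w \<otimes> (\<ominus> (\<Oplus>i\<in>J. z i \<otimes> x i))"
            by (rule center_solve [OF zc(2) w xc(2) sc]) (use z(2) e in simp)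
          also have "\<dots> = (\<ominus> w) \<otimes> (\<Oplus>i\<in>J. z i \<otimes> x i)"
            using w sc by (simp add: l_minus r_minus)
          also have "\<dots> = (\<Oplus>i\<in>J. (\<ominus> w) \<otimes> (z i \<otimes> x i))"
            by (rule finsum_rdistr) (use f w xc zc in auto)
          also have "\<dots> = (\<Oplus>i\<in>J. ((\<ominus> w) \<otimes> z i) \<otimes> x i)"
            by (rule finsum_cong') (use w xc zc in \<open>auto simp: m_assoc\<close>)
          finally have "x k = (\<Oplus>i\<in>J. ((\<ominus> w) \<otimes> z i) \<otimes> x i)" .
          moreover have "(\<lambda>i. (\<ominus> w) \<otimes> z i) \<in> J \<rightarrow> Z"
            using w zc subringE(5,6) [OF center_subring] by auto
          ultimately show False
            by (rule notE [OF False bexI [where x = "\<lambda>i. (\<ominus> w) \<otimes> z i"]])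
        qed
        have "(\<Oplus>i\<in>J. z i \<otimes> x i) = \<zero>" using z(2) e sc xc zk by simp
        then have "\<And>j. j \<in> J \<Longrightarrow> z j = \<zero>" using indepD [OF J(2), of z] zc by blast
        then show "z i = \<zero>" using i zk by auto
      qed (use f xc in auto)
      define y' where "y' i j = (if j = k then (if i = k then \<one> else \<zero>) else (if i = k then \<zero> else y i j))" for i j
      have y'Z: "y' i j \<in> Z" if "i \<in> insert k I" "j \<in> insert k J" for i j
        using that J(3) zero_center one_center by (auto simp: y'_def)
      have "x i = (\<Oplus>j\<in>insert k J. y' i j \<otimes> x j)" if i: "i \<in> insert k I" for i
      proof -
        have "(\<Oplus>j\<in>insert k J. y' i j \<otimes> x j) = y' i k \<otimes> x k \<oplus> (\<Oplus>j\<in>J. y' i j \<otimes> x j)"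
          by (rule finsum_insert) (use f kJ xc y'Z i in auto)
        also have "(\<Oplus>j\<in>J. y' i j \<otimes> x j) = (if i = k then \<zero> else x i)"
        proof (cases "i = k")
          case True
          have "(\<Oplus>j\<in>J. y' i j \<otimes> x j) = (\<Oplus>j\<in>J. \<zero>)"
            by (rule finsum_cong') (use True kJ xc in \<open>auto simp: y'_def\<close>)
          then show ?thesis using True by simp
        next
          case False
          then have "i \<in> I" using i by simp
          have "(\<Oplus>j\<in>J. y' i j \<otimes> x j) = (\<Oplus>j\<in>J. y i j \<otimes> x j)"
            by (rule finsum_cong') (use False kJ xc J(3) i in \<open>auto simp: y'_def\<close>)
          then show ?thesis using False J(4) \<open>i \<in> I\<close> by simp
        qed
        finally show ?thesis using xc i by (auto simp: y'_def)
      qed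
      with y'Z ind show ?thesis
        using J(1) by (intro exI [of _ "insert k J"] exI [of _ y']) blast
    qed
  qed
  then obtain J y where "J \<subseteq> I" "indep x J" "\<forall>i\<in>I. \<forall>j\<in>J. y i j \<in> Z"
    "\<forall>i\<in>I. x i = (\<Oplus>j\<in>J. y i j \<otimes> x j)" by blast
  then show ?thesis by (intro that [of J y]; blast)
qed

section \<open>Subspaces of \<open>A\<close> and balanced maps over the center\<close>

definition central_subspace :: "'a set \<Rightarrow> bool" where
  "central_subspace U \<longleftrightarrow> additive_subgroup U A \<and> (\<forall>z\<in>Z. \<forall>u\<in>U. z \<otimes> u \<in> U)"

end

text \<open>A \<open>Z\<close>-balanced map on \<open>U \<times> N\<close>, kept apart from any
  particular tensor product. The same regrouping of sums is thus available for pure tensors in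
  \<open>L \<otimes>_V L\<close> and \<open>V \<otimes>_Z V\<close> and for the maps
  \<open>(u, n) \<mapsto> u a e(n)\<close> with values in \<open>A\<close>. The scalar action on
  \<open>N\<close> is the parameter \<open>sm\<close>, since \<open>N\<close> is sometimes a
  subspace of \<open>A\<close> and sometimes a ring of endomorphisms.\<close>

locale central_balanced = simple A + N: abelian_group N + P: abelian_group P
  for A (structure) and U N sm P g +
  assumes U: "central_subspace U"
    and sm_closed: "z \<in> Z \<Longrightarrow> n \<in> carrier N \<Longrightarrow> sm z n \<in> carrier N"
    and g_closed: "u \<in> U \<Longrightarrow> n \<in> carrier N \<Longrightarrow> g u n \<in> carrier P"
    and g_add_l: "u \<in> U \<Longrightarrow> u' \<in> U \<Longrightarrow> n \<in> carrier N \<Longrightarrow> g (u \<oplus> u') n = g u n \<oplus>\<^bsub>P\<^esub> g u' n"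
    and g_add_r: "u \<in> U \<Longrightarrow> n \<in> carrier N \<Longrightarrow> n' \<in> carrier N \<Longrightarrow> g u (n \<oplus>\<^bsub>N\<^esub> n') = g u n \<oplus>\<^bsub>P\<^esub> g u n'"
    and g_balanced: "z \<in> Z \<Longrightarrow> u \<in> U \<Longrightarrow> n \<in> carrier N \<Longrightarrow> g (z \<otimes> u) n = g u (sm z n)"
begin

lemma U_sub: "additive_subgroup U A" using U by (simp add: central_subspace_def)

lemma U_carrier: "u \<in> U \<Longrightarrow> u \<in> carrier A"
  using additive_subgroup.a_Hcarr [OF U_sub] .

lemma U_smult: "z \<in> Z \<Longrightarrow> u \<in> U \<Longrightarrow> z \<otimes> u \<in> U" using U by (simp add: central_subspace_def)

lemma g_zero_right: "u \<in> U \<Longrightarrow> g u \<zero>\<^bsub>N\<^esub> = \<zero>\<^bsub>P\<^esub>"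
  by (rule N.additive_zero [OF N.carrier_additive_subgroup P.abelian_group_axioms])
    (auto simp: g_closed g_add_r)

text \<open>Rewriting \<open>\<Sum> x\<^sub>i \<otimes> n\<^sub>i\<close> along a basis of the span
  of the \<open>x\<^sub>i\<close>: expand each left factor, pass its central coefficients to the
  right, and collect.\<close>

lemma sum_reexpress:
  assumes I: "finite I" and J: "J \<subseteq> I" and x: "x \<in> I \<rightarrow> U" and n: "n \<in> I \<rightarrow> carrier N"
    and y: "\<And>i j. i \<in> I \<Longrightarrow> j \<in> J \<Longrightarrow> y i j \<in> Z"
    and xy: "\<And>i. i \<in> I \<Longrightarrow> x i = (\<Oplus>j\<in>J. y i j \<otimes> x j)"
  shows "(\<Oplus>\<^bsub>P\<^esub>i\<in>I. g (x i) (n i)) = (\<Oplus>\<^bsub>P\<^esub>j\<in>J. g (x j) (\<Oplus>\<^bsub>N\<^esub>i\<in>I. sm (y i j) (n i)))"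
proof -
  have fJ: "finite J" using I J by (rule rev_finite_subset)
  have xc: "\<And>i. i \<in> I \<Longrightarrow> x i \<in> U" "\<And>i. i \<in> J \<Longrightarrow> x i \<in> U" "\<And>i. i \<in> I \<Longrightarrow> n i \<in> carrier N"
    using x n J by auto
  have "(\<Oplus>\<^bsub>P\<^esub>i\<in>I. g (x i) (n i)) = (\<Oplus>\<^bsub>P\<^esub>i\<in>I. \<Oplus>\<^bsub>P\<^esub>j\<in>J. g (x j) (sm (y i j) (n i)))"
  proof (rule P.finsum_cong')
    fix i assume i: "i \<in> I"
    have "g (x i) (n i) = g (\<Oplus>j\<in>J. y i j \<otimes> x j) (n i)" using xy [OF i] by simp
    also have "\<dots> = (\<Oplus>\<^bsub>P\<^esub>j\<in>J. g (y i j \<otimes> x j) (n i))"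
      by (rule additive_finsum [OF U_sub P.abelian_group_axioms, where h = "\<lambda>u. g u (n i)"])
        (use i xc y fJ in \<open>auto simp: g_closed g_add_l U_smult\<close>)
    also have "\<dots> = (\<Oplus>\<^bsub>P\<^esub>j\<in>J. g (x j) (sm (y i j) (n i)))"
      by (rule P.finsum_cong') (use i xc y in \<open>auto simp: g_balanced g_closed sm_closed\<close>)
    finally show "g (x i) (n i) = (\<Oplus>\<^bsub>P\<^esub>j\<in>J. g (x j) (sm (y i j) (n i)))" .
  qed (use xc y in \<open>auto simp: g_closed sm_closed intro!: P.finsum_closed\<close>)
  also have "\<dots> = (\<Oplus>\<^bsub>P\<^esub>j\<in>J. \<Oplus>\<^bsub>P\<^esub>i\<in>I. g (x j) (sm (y i j) (n i)))"
    by (rule P.finsum_swap) (use I fJ xc y in \<open>auto simp: g_closed sm_closed\<close>)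
  also have "\<dots> = (\<Oplus>\<^bsub>P\<^esub>j\<in>J. g (x j) (\<Oplus>\<^bsub>N\<^esub>i\<in>I. sm (y i j) (n i)))"
  proof (rule P.finsum_cong')
    fix j assume j: "j \<in> J"
    show "(\<Oplus>\<^bsub>P\<^esub>i\<in>I. g (x j) (sm (y i j) (n i))) = g (x j) (\<Oplus>\<^bsub>N\<^esub>i\<in>I. sm (y i j) (n i))"
      by (rule N.additive_finsum [OF N.carrier_additive_subgroup P.abelian_group_axioms, symmetric])
        (use I j xc y in \<open>auto simp: g_closed g_add_r sm_closed\<close>)
  qed (use xc y in \<open>auto simp: g_closed sm_closed intro!: N.finsum_closed\<close>)
  finally show ?thesis .
qed

text \<open>Injectivity of the map \<open>U \<otimes>\<^sub>Z N \<rightarrow> Map(A \<times> T, A)\<close>, \<open>u \<otimes> n \<mapsto> ((a, t) \<mapsto> u a e\<^sub>t(n))\<close>.\<close>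

lemma tensor_zero_of_map_zero:
  fixes e :: "'t \<Rightarrow> _"
  assumes I: "finite I" and x: "x \<in> I \<rightarrow> U" and n: "n \<in> I \<rightarrow> carrier N"
    and e_closed: "\<And>t n. t \<in> T \<Longrightarrow> n \<in> carrier N \<Longrightarrow> e t n \<in> carrier A"
    and e_add: "\<And>t n n'. t \<in> T \<Longrightarrow> n \<in> carrier N \<Longrightarrow> n' \<in> carrier N \<Longrightarrow> e t (n \<oplus>\<^bsub>N\<^esub> n') = e t n \<oplus> e t n'"
    and e_smult: "\<And>t z n. t \<in> T \<Longrightarrow> z \<in> Z \<Longrightarrow> n \<in> carrier N \<Longrightarrow> e t (sm z n) = z \<otimes> e t n"
    and e_inj: "\<And>n. n \<in> carrier N \<Longrightarrow> (\<And>t. t \<in> T \<Longrightarrow> e t n = \<zero>) \<Longrightarrow> n = \<zero>\<^bsub>N\<^esub>"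
    and rel: "\<And>a t. a \<in> carrier A \<Longrightarrow> t \<in> T \<Longrightarrow> (\<Oplus>i\<in>I. x i \<otimes> a \<otimes> e t (n i)) = \<zero>"
  shows "(\<Oplus>\<^bsub>P\<^esub>i\<in>I. g (x i) (n i)) = \<zero>\<^bsub>P\<^esub>"
proof -
  have xA: "x \<in> I \<rightarrow> carrier A" using x U_carrier by auto
  obtain J y where J: "J \<subseteq> I" "indep x J" and y: "\<And>i j. i \<in> I \<Longrightarrow> j \<in> J \<Longrightarrow> y i j \<in> Z"
    and xy: "\<And>i. i \<in> I \<Longrightarrow> x i = (\<Oplus>j\<in>J. y i j \<otimes> x j)"
    by (rule basis_extraction [OF I xA]) (rule that)
  define m where "m j = (\<Oplus>\<^bsub>N\<^esub>i\<in>I. sm (y i j) (n i))" for j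
  have mc: "m j \<in> carrier N" if "j \<in> J" for j
    unfolding m_def using that y n by (auto intro!: N.finsum_closed sm_closed)
  have xc: "\<And>j. j \<in> J \<Longrightarrow> x j \<in> U" using x J by auto
  have "m j = \<zero>\<^bsub>N\<^esub>" if j: "j \<in> J" for j
  proof (rule e_inj [OF mc [OF j]])
    fix t assume t: "t \<in> T"
    show "e t (m j) = \<zero>"
    proof (rule sandwich_zero [OF J(2) _ _ j])
      show "(\<lambda>j. e t (m j)) \<in> J \<rightarrow> carrier A" using e_closed t mc by auto
      fix a assume a: "a \<in> carrier A"
      \<comment> \<open>The same regrouping applied to the map \<open>u a e t n\<close> turns the
        given relation into one over the independent \<open>x j\<close>, to which
        \<open>sandwich_zero\<close> applies.\<close>
      interpret G: central_balanced A U N sm A "\<lambda>u n. u \<otimes> a \<otimes> e t n"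
      proof unfold_locales
        show "z \<otimes> u \<otimes> a \<otimes> e t n = u \<otimes> a \<otimes> e t (sm z n)"
          if "z \<in> Z" "u \<in> U" "n \<in> carrier N" for z u n
          unfolding e_smult [OF t that(1,3)]
          by (rule center_move) (use that a e_closed [OF t] U_carrier in auto)
      qed (use a t in \<open>simp_all add: U sm_closed U_carrier e_closed e_add l_distr r_distr\<close>)
      have "(\<Oplus>j\<in>J. x j \<otimes> a \<otimes> e t (m j)) = (\<Oplus>i\<in>I. x i \<otimes> a \<otimes> e t (n i))"
        unfolding m_def by (rule G.sum_reexpress [OF I J(1) x n y xy, symmetric])
      then show "(\<Oplus>j\<in>J. x j \<otimes> a \<otimes> e t (m j)) = \<zero>" using rel a t by simp
    qed
  qed
  then have "(\<Oplus>\<^bsub>P\<^esub>j\<in>J. g (x j) (m j)) = (\<Oplus>\<^bsub>P\<^esub>j\<in>J. \<zero>\<^bsub>P\<^esub>)"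
    by (intro P.finsum_cong') (auto simp: g_zero_right xc)
  then show ?thesis using sum_reexpress [OF I J(1) x n y xy] by (simp add: m_def)
qed

end

section \<open>Sandwich maps\<close>

text \<open>The action on \<open>A\<close> of an element of \<open>U \<otimes>_Z W^op\<close>. For
  simple \<open>A\<close> this action is faithful, so functions with this property stand for
  tensors. Only the values on the carrier matter, as \<open>sandwich_cong\<close> records.\<close>

definition (in ring) sandwich :: "'a set \<Rightarrow> 'a set \<Rightarrow> ('a \<Rightarrow> 'a) \<Rightarrow> bool" where
  "sandwich U W \<alpha> \<longleftrightarrow> (\<exists>I :: nat set. \<exists>x\<in>I \<rightarrow> U. \<exists>y\<in>I \<rightarrow> W. finite I \<and>
     (\<forall>a\<in>carrier R. \<alpha> a = (\<Oplus>i\<in>I. x i \<otimes> a \<otimes> y i)))"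

context ring begin

lemma sandwichI:
  fixes I :: "nat set"
  assumes "finite I" "x \<in> I \<rightarrow> U" "y \<in> I \<rightarrow> W"
    "\<And>a. a \<in> carrier R \<Longrightarrow> \<alpha> a = (\<Oplus>i\<in>I. x i \<otimes> a \<otimes> y i)"
  shows "sandwich U W \<alpha>"
  unfolding sandwich_def using assms by blast

lemma sandwichE:
  assumes "sandwich U W \<alpha>"
  obtains I :: "nat set" and x y where "finite I" "x \<in> I \<rightarrow> U" "y \<in> I \<rightarrow> W"
    "\<And>a. a \<in> carrier R \<Longrightarrow> \<alpha> a = (\<Oplus>i\<in>I. x i \<otimes> a \<otimes> y i)"
  using assms unfolding sandwich_def by blast

lemma sandwich_cong:
  assumes "\<And>a. a \<in> carrier R \<Longrightarrow> \<alpha> a = \<beta> a"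
  shows "sandwich U W \<alpha> = sandwich U W \<beta>"
  unfolding sandwich_def using assms by simp

lemma sandwich_mono:
  assumes "sandwich U W \<alpha>" "U \<subseteq> U'" "W \<subseteq> W'" shows "sandwich U' W' \<alpha>"
  using assms(1) by (rule sandwichE) (rule sandwichI, use assms in auto)

context
  fixes U W assumes UW: "U \<subseteq> carrier R" "W \<subseteq> carrier R"
begin

lemma sandwich_closed:
  assumes "sandwich U W \<alpha>" "a \<in> carrier R" shows "\<alpha> a \<in> carrier R"
  using assms(1)
proof (rule sandwichE)
  fix I :: "nat set" and x y
  assume "finite I" "x \<in> I \<rightarrow> U" "y \<in> I \<rightarrow> W"
    "\<And>a. a \<in> carrier R \<Longrightarrow> \<alpha> a = (\<Oplus>i\<in>I. x i \<otimes> a \<otimes> y i)"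
  moreover have "x \<in> I \<rightarrow> carrier R" "y \<in> I \<rightarrow> carrier R" using calculation UW by auto
  ultimately show ?thesis using assms(2) by (auto simp: Pi_def intro!: finsum_closed)
qed

lemma sandwich_additive:
  assumes "sandwich U W \<alpha>" "a \<in> carrier R" "b \<in> carrier R"
  shows "\<alpha> (a \<oplus> b) = \<alpha> a \<oplus> \<alpha> b"
  using assms(1)
proof (rule sandwichE)
  fix I :: "nat set" and x y
  assume *: "finite I" "x \<in> I \<rightarrow> U" "y \<in> I \<rightarrow> W"
    "\<And>a. a \<in> carrier R \<Longrightarrow> \<alpha> a = (\<Oplus>i\<in>I. x i \<otimes> a \<otimes> y i)"
  have c: "\<And>i. i \<in> I \<Longrightarrow> x i \<in> carrier R" "\<And>i. i \<in> I \<Longrightarrow> y i \<in> carrier R" using * UW by auto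
  have "\<alpha> (a \<oplus> b) = (\<Oplus>i\<in>I. x i \<otimes> a \<otimes> y i \<oplus> x i \<otimes> b \<otimes> y i)"
    unfolding *(4) [OF a_closed [OF assms(2,3)]]
    by (rule finsum_cong') (use c assms in \<open>auto simp: l_distr r_distr\<close>)
  also have "\<dots> = \<alpha> a \<oplus> \<alpha> b"
    using assms c *(4) by (simp add: finsum_addf)
  finally show ?thesis .
qed

lemma sandwich_right_linear:
  assumes "sandwich U W \<alpha>" "a \<in> carrier R" "s \<in> carrier R" "\<And>w. w \<in> W \<Longrightarrow> s \<otimes> w = w \<otimes> s"
  shows "\<alpha> (a \<otimes> s) = \<alpha> a \<otimes> s"
  using assms(1)
proof (rule sandwichE)
  fix I :: "nat set" and x y
  assume *: "finite I" "x \<in> I \<rightarrow> U" "y \<in> I \<rightarrow> W"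
    "\<And>a. a \<in> carrier R \<Longrightarrow> \<alpha> a = (\<Oplus>i\<in>I. x i \<otimes> a \<otimes> y i)"
  have c: "\<And>i. i \<in> I \<Longrightarrow> x i \<in> carrier R" "\<And>i. i \<in> I \<Longrightarrow> y i \<in> carrier R"
    "\<And>i. i \<in> I \<Longrightarrow> s \<otimes> y i = y i \<otimes> s" using * UW assms(4) by (auto simp: Pi_def)
  have "\<alpha> (a \<otimes> s) = (\<Oplus>i\<in>I. x i \<otimes> a \<otimes> y i \<otimes> s)"
    unfolding *(4) [OF m_closed [OF assms(2,3)]]
    by (rule finsum_cong') (use c assms in \<open>auto simp: m_assoc\<close>)
  also have "\<dots> = \<alpha> a \<otimes> s"
    unfolding *(4) [OF assms(2)] by (rule finsum_ldistr [symmetric]) (use * c assms in auto)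
  finally show ?thesis .
qed

lemma sandwich_left_linear:
  assumes "sandwich U W \<alpha>" "a \<in> carrier R" "s \<in> carrier R" "\<And>u. u \<in> U \<Longrightarrow> s \<otimes> u = u \<otimes> s"
  shows "\<alpha> (s \<otimes> a) = s \<otimes> \<alpha> a"
  using assms(1)
proof (rule sandwichE)
  fix I :: "nat set" and x y
  assume *: "finite I" "x \<in> I \<rightarrow> U" "y \<in> I \<rightarrow> W"
    "\<And>a. a \<in> carrier R \<Longrightarrow> \<alpha> a = (\<Oplus>i\<in>I. x i \<otimes> a \<otimes> y i)"
  have c: "\<And>i. i \<in> I \<Longrightarrow> x i \<in> carrier R" "\<And>i. i \<in> I \<Longrightarrow> y i \<in> carrier R"
    "\<And>i. i \<in> I \<Longrightarrow> s \<otimes> x i = x i \<otimes> s" using * UW assms(4) by (auto simp: Pi_def)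
  have "\<alpha> (s \<otimes> a) = (\<Oplus>i\<in>I. s \<otimes> (x i \<otimes> a \<otimes> y i))"
    unfolding *(4) [OF m_closed [OF assms(3,2)]]
    by (rule finsum_cong') (use c assms in \<open>auto simp: m_assoc [symmetric]\<close>)
  also have "\<dots> = s \<otimes> \<alpha> a"
    unfolding *(4) [OF assms(2)] by (rule finsum_rdistr [symmetric]) (use * c assms in auto)
  finally show ?thesis .
qed

lemma sandwich_zero_map: "sandwich U W (\<lambda>a. \<zero>)"
  by (rule sandwichI [of "{}"]) auto

lemma sandwich_single: "u \<in> U \<Longrightarrow> w \<in> W \<Longrightarrow> sandwich U W (\<lambda>a. u \<otimes> a \<otimes> w)"
  by (rule sandwichI [of "{0}" "\<lambda>_. u" _ "\<lambda>_. w"]) (use UW in \<open>auto simp: finsum_insert subset_iff\<close>)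

lemma sandwich_plus:
  assumes "sandwich U W \<alpha>" "sandwich U W \<beta>" shows "sandwich U W (\<lambda>a. \<alpha> a \<oplus> \<beta> a)"
  using assms(1)
proof (rule sandwichE)
  fix I :: "nat set" and x y
  assume 1: "finite I" "x \<in> I \<rightarrow> U" "y \<in> I \<rightarrow> W"
    "\<And>a. a \<in> carrier R \<Longrightarrow> \<alpha> a = (\<Oplus>i\<in>I. x i \<otimes> a \<otimes> y i)"
  from assms(2) show ?thesis
  proof (rule sandwichE)
    fix J :: "nat set" and x' y'
    assume 2: "finite J" "x' \<in> J \<rightarrow> U" "y' \<in> J \<rightarrow> W"
      "\<And>a. a \<in> carrier R \<Longrightarrow> \<beta> a = (\<Oplus>i\<in>J. x' i \<otimes> a \<otimes> y' i)"
    have c: "join_fam x x' \<in> join_index I J \<rightarrow> U" "join_fam y y' \<in> join_index I J \<rightarrow> W"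
      using 1 2 by (simp_all only: join_fam_Pi)
    then have c': "\<And>k. k \<in> join_index I J \<Longrightarrow> join_fam x x' k \<in> carrier R"
      "\<And>k. k \<in> join_index I J \<Longrightarrow> join_fam y y' k \<in> carrier R" using UW by auto
    show ?thesis
    proof (rule sandwichI [OF _ c])
      fix a assume "a \<in> carrier R"
      then show "\<alpha> a \<oplus> \<beta> a = (\<Oplus>i\<in>join_index I J. join_fam x x' i \<otimes> a \<otimes> join_fam y y' i)"
        using 1 2 c' by (subst finsum_join) auto
    qed (use 1 2 in simp)
  qed
qed

lemma sandwich_finsum:
  assumes "finite K" "\<And>k. k \<in> K \<Longrightarrow> sandwich U W (\<alpha> k)"
  shows "sandwich U W (\<lambda>a. \<Oplus>k\<in>K. \<alpha> k a)"
  using assms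
proof (induction K rule: finite_induct)
  case empty then show ?case using sandwich_zero_map by simp
next
  case (insert k K)
  have "sandwich U W (\<lambda>a. \<alpha> k a \<oplus> (\<Oplus>k\<in>K. \<alpha> k a))"
    using insert by (intro sandwich_plus) auto
  moreover have "(\<Oplus>k\<in>insert k K. \<alpha> k a) = \<alpha> k a \<oplus> (\<Oplus>k\<in>K. \<alpha> k a)" if "a \<in> carrier R" for a
    using insert that by (intro finsum_insert) (auto intro: sandwich_closed)
  ultimately show ?case by (subst sandwich_cong) auto
qed

end

lemma sandwich_outer:
  assumes "sandwich U W \<alpha>" and UW: "U \<subseteq> carrier R" "W \<subseteq> carrier R" and c: "c \<in> carrier R" "v \<in> carrier R"
    and "\<And>u. u \<in> U \<Longrightarrow> c \<otimes> u \<in> U'" "\<And>w. w \<in> W \<Longrightarrow> w \<otimes> v \<in> W'"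
  shows "sandwich U' W' (\<lambda>a. c \<otimes> \<alpha> a \<otimes> v)"
  using assms(1)
proof (rule sandwichE)
  fix I :: "nat set" and x y
  assume *: "finite I" "x \<in> I \<rightarrow> U" "y \<in> I \<rightarrow> W"
    "\<And>a. a \<in> carrier R \<Longrightarrow> \<alpha> a = (\<Oplus>i\<in>I. x i \<otimes> a \<otimes> y i)"
  have xy: "\<And>i. i \<in> I \<Longrightarrow> x i \<in> carrier R" "\<And>i. i \<in> I \<Longrightarrow> y i \<in> carrier R" using * UW by auto
  show ?thesis
  proof (rule sandwichI [OF *(1)])
    show "(\<lambda>i. c \<otimes> x i) \<in> I \<rightarrow> U'" "(\<lambda>i. y i \<otimes> v) \<in> I \<rightarrow> W'" using * assms by (auto simp: Pi_def)
    fix a assume a: "a \<in> carrier R"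
    have "c \<otimes> \<alpha> a = (\<Oplus>i\<in>I. c \<otimes> (x i \<otimes> a \<otimes> y i))"
      unfolding *(4) [OF a] by (rule finsum_rdistr) (use * xy a c in auto)
    then have "c \<otimes> \<alpha> a \<otimes> v = (\<Oplus>i\<in>I. c \<otimes> (x i \<otimes> a \<otimes> y i) \<otimes> v)"
      using finsum_ldistr [of I v "\<lambda>i. c \<otimes> (x i \<otimes> a \<otimes> y i)"] * xy a c by (simp add: Pi_def)
    also have "\<dots> = (\<Oplus>i\<in>I. (c \<otimes> x i) \<otimes> a \<otimes> (y i \<otimes> v))"
      by (rule finsum_cong') (use xy a c in \<open>auto simp: m_assoc\<close>)
    finally show "c \<otimes> \<alpha> a \<otimes> v = (\<Oplus>i\<in>I. (c \<otimes> x i) \<otimes> a \<otimes> (y i \<otimes> v))" .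
  qed
qed

lemma sandwich_inner:
  assumes "sandwich U W \<alpha>" and UW: "U \<subseteq> carrier R" "W \<subseteq> carrier R" and c: "c \<in> carrier R" "v \<in> carrier R"
    and "\<And>u. u \<in> U \<Longrightarrow> u \<otimes> c \<in> U'" "\<And>w. w \<in> W \<Longrightarrow> v \<otimes> w \<in> W'"
  shows "sandwich U' W' (\<lambda>a. \<alpha> (c \<otimes> a \<otimes> v))"
  using assms(1)
proof (rule sandwichE)
  fix I :: "nat set" and x y
  assume *: "finite I" "x \<in> I \<rightarrow> U" "y \<in> I \<rightarrow> W"
    "\<And>a. a \<in> carrier R \<Longrightarrow> \<alpha> a = (\<Oplus>i\<in>I. x i \<otimes> a \<otimes> y i)"
  have xy: "\<And>i. i \<in> I \<Longrightarrow> x i \<in> carrier R" "\<And>i. i \<in> I \<Longrightarrow> y i \<in> carrier R" using * UW by auto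
  show ?thesis
  proof (rule sandwichI [OF *(1)])
    show "(\<lambda>i. x i \<otimes> c) \<in> I \<rightarrow> U'" "(\<lambda>i. v \<otimes> y i) \<in> I \<rightarrow> W'" using * assms by (auto simp: Pi_def)
    fix a assume a: "a \<in> carrier R"
    show "\<alpha> (c \<otimes> a \<otimes> v) = (\<Oplus>i\<in>I. (x i \<otimes> c) \<otimes> a \<otimes> (v \<otimes> y i))"
      using *(4) [of "c \<otimes> a \<otimes> v"] a c xy
      by (simp add: m_assoc cong: finsum_cong)
  qed
qed

text \<open>Composition multiplies left coefficients in order and right coefficients in reverse, as
  the product of \<open>U \<otimes> W^op\<close> does; hence the factor
  \<open>w' \<otimes> w\<close>.\<close>

lemma sandwich_comp:
  assumes "sandwich U W \<alpha>" "sandwich U' W' \<beta>"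
    and UW: "U \<subseteq> carrier R" "W \<subseteq> carrier R" "U' \<subseteq> carrier R" "W' \<subseteq> carrier R"
      "U'' \<subseteq> carrier R" "W'' \<subseteq> carrier R"
    and UU: "\<And>u u'. u \<in> U \<Longrightarrow> u' \<in> U' \<Longrightarrow> u \<otimes> u' \<in> U''"
    and WW: "\<And>w w'. w \<in> W \<Longrightarrow> w' \<in> W' \<Longrightarrow> w' \<otimes> w \<in> W''"
  shows "sandwich U'' W'' (\<lambda>a. \<alpha> (\<beta> a))"
  using assms(1)
proof (rule sandwichE)
  fix I :: "nat set" and x y
  assume *: "finite I" "x \<in> I \<rightarrow> U" "y \<in> I \<rightarrow> W"
    "\<And>a. a \<in> carrier R \<Longrightarrow> \<alpha> a = (\<Oplus>i\<in>I. x i \<otimes> a \<otimes> y i)"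
  have "sandwich U'' W'' (\<lambda>a. \<Oplus>i\<in>I. x i \<otimes> \<beta> a \<otimes> y i)"
    by (rule sandwich_finsum [OF UW(5,6) *(1)], rule sandwich_outer [OF assms(2) UW(3,4)])
      (use * UU WW UW in \<open>auto simp: Pi_def\<close>)
  then show ?thesis
    using sandwich_closed [OF UW(3,4) assms(2)] *(4) by (subst sandwich_cong) auto
qed

end

section \<open>Independent coefficients of sandwich maps\<close>

context simple begin

lemma central_subspace_carrier: "central_subspace U \<Longrightarrow> U \<subseteq> carrier A"
  by (auto simp: central_subspace_def intro: additive_subgroup.a_Hcarr)

text \<open>The left coefficients are replaced by a basis of their span, and the right ones by
  \<open>Z\<close>-linear combinations of themselves. For this \<open>W\<close> has to be a
  \<open>Z\<close>-subspace.\<close>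

lemma sandwich_indep_left:
  assumes "sandwich U W \<alpha>" "U \<subseteq> carrier A" and W: "central_subspace W"
  obtains I :: "nat set" and x y where "indep x I" "x \<in> I \<rightarrow> U" "y \<in> I \<rightarrow> W"
    "\<And>a. a \<in> carrier A \<Longrightarrow> \<alpha> a = (\<Oplus>i\<in>I. x i \<otimes> a \<otimes> y i)"
  using assms(1)
proof (rule sandwichE)
  fix I :: "nat set" and x y
  assume *: "finite I" "x \<in> I \<rightarrow> U" "y \<in> I \<rightarrow> W"
    "\<And>a. a \<in> carrier A \<Longrightarrow> \<alpha> a = (\<Oplus>i\<in>I. x i \<otimes> a \<otimes> y i)"
  have x: "x \<in> I \<rightarrow> carrier A" using * assms(2) by auto
  obtain J t where J: "J \<subseteq> I" "indep x J" and t: "\<And>i j. i \<in> I \<Longrightarrow> j \<in> J \<Longrightarrow> t i j \<in> Z"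
    and xt: "\<And>i. i \<in> I \<Longrightarrow> x i = (\<Oplus>j\<in>J. t i j \<otimes> x j)"
    by (rule basis_extraction [OF *(1) x]) (rule that)
  have Wc: "W \<subseteq> carrier A" by (rule central_subspace_carrier) fact
  have y: "y \<in> I \<rightarrow> carrier A" using * Wc by auto
  define m where "m j = (\<Oplus>i\<in>I. t i j \<otimes> y i)" for j
  have "m \<in> J \<rightarrow> W"
    unfolding m_def using t *(3) W
    by (auto intro!: additive_subgroup_finsum_closed simp: central_subspace_def Pi_def)
  moreover have "\<alpha> a = (\<Oplus>j\<in>J. x j \<otimes> a \<otimes> m j)" if a: "a \<in> carrier A" for a
  proof -
    interpret G: central_balanced A "carrier A" A "\<lambda>z n. z \<otimes> n" A "\<lambda>u n. u \<otimes> a \<otimes> n"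
    proof unfold_locales
      show "z \<otimes> u \<otimes> a \<otimes> n = u \<otimes> a \<otimes> (z \<otimes> n)"
        if "z \<in> Z" "u \<in> carrier A" "n \<in> carrier A" for z u n
        by (rule center_move) (use that a in auto)
    qed (use a in \<open>simp_all add: central_subspace_def carrier_additive_subgroup l_distr r_distr\<close>)
    show ?thesis unfolding *(4) [OF a] m_def
      by (rule G.sum_reexpress [OF *(1) J(1) x y t xt])
  qed
  ultimately show ?thesis using J *(2) by (intro that [of x J m]) auto
qed

lemma central_subspace_opp: "simple.central_subspace (opp_ring A) U = central_subspace U"
proof -
  interpret o: simple "opp_ring A" by (rule simple_opp)
  have sub: "additive_subgroup U (opp_ring A) = additive_subgroup U A"
    by (simp add: additive_subgroup_def)
  have "z \<otimes> u = u \<otimes> z" if "z \<in> Z" "u \<in> U" "additive_subgroup U A" for z u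
    using that by (meson additive_subgroup.a_Hcarr center_comm)
  then have "additive_subgroup U A \<Longrightarrow>
      (\<forall>z\<in>Z. \<forall>u\<in>U. u \<otimes> z \<in> U) = (\<forall>z\<in>Z. \<forall>u\<in>U. z \<otimes> u \<in> U)"
    by (intro ball_cong refl) metis
  then show ?thesis
    unfolding central_subspace_def o.central_subspace_def center_opp sub
    by auto
qed

lemma sandwich_opp: "U \<subseteq> carrier A \<Longrightarrow> W \<subseteq> carrier A \<Longrightarrow> ring.sandwich (opp_ring A) W U \<alpha> = sandwich U W \<alpha>"
proof -
  interpret o: simple "opp_ring A" by (rule simple_opp)
  assume UW: "U \<subseteq> carrier A" "W \<subseteq> carrier A"
  have eq: "(\<Oplus>i\<in>I. x i \<otimes> (a \<otimes> y i)) = (\<Oplus>i\<in>I. x i \<otimes> a \<otimes> y i)"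
    if "x \<in> I \<rightarrow> U" "y \<in> I \<rightarrow> W" "a \<in> carrier A" for I :: "nat set" and x y a
    by (rule finsum_cong') (use that UW in \<open>auto simp: m_assoc Pi_def subset_iff\<close>)
  show ?thesis
  proof
    assume "o.sandwich W U \<alpha>"
    then show "sandwich U W \<alpha>"
      by (rule o.sandwichE) (rule sandwichI, use eq in auto)
  next
    assume "sandwich U W \<alpha>"
    then show "o.sandwich W U \<alpha>"
      by (rule sandwichE) (rule o.sandwichI, use eq in auto)
  qed
qed

lemma sandwich_indep_right:
  assumes "sandwich U W \<alpha>" "W \<subseteq> carrier A" and U: "central_subspace U"
  obtains I :: "nat set" and x y where "indep y I" "x \<in> I \<rightarrow> U" "y \<in> I \<rightarrow> W"
    "\<And>a. a \<in> carrier A \<Longrightarrow> \<alpha> a = (\<Oplus>i\<in>I. x i \<otimes> a \<otimes> y i)"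
proof -
  interpret o: simple "opp_ring A" by (rule simple_opp)
  have Uc: "U \<subseteq> carrier A" by (rule central_subspace_carrier) fact
  have "o.sandwich W U \<alpha>" using assms(1) sandwich_opp Uc assms(2) by simp
  then show ?thesis
  proof (rule o.sandwich_indep_left)
    show "o.central_subspace U" using U central_subspace_opp by simp
    fix I :: "nat set" and x y
    assume *: "o.indep x I" "x \<in> I \<rightarrow> W" "y \<in> I \<rightarrow> U"
      "\<And>a. a \<in> carrier (opp_ring A) \<Longrightarrow> \<alpha> a = (\<Oplus>\<^bsub>opp_ring A\<^esub>i\<in>I. x i \<otimes>\<^bsub>opp_ring A\<^esub> a \<otimes>\<^bsub>opp_ring A\<^esub> y i)"
    have "(\<Oplus>i\<in>I. y i \<otimes> (a \<otimes> x i)) = (\<Oplus>i\<in>I. y i \<otimes> a \<otimes> x i)" if "a \<in> carrier A" for a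
      by (rule finsum_cong') (use that * Uc assms(2) in \<open>auto simp: m_assoc Pi_def subset_iff\<close>)
    moreover have "indep x I" using *(1) by (simp add: indep_opp)
    ultimately show thesis using * by (intro that [of x I y]) auto
  qed (use assms(2) in simp)
qed

text \<open>Suppose \<open>a r = \<Sum> x\<^sub>i a y\<^sub>i\<close> with independent
  \<open>y\<^sub>i\<close> in \<open>W\<close>. If \<open>r\<close> were outside \<open>W\<close>,
  then \<open>r\<close> together with the \<open>y\<^sub>i\<close> would still be independent, and
  the relation \<open>\<one> a r - \<Sum> x\<^sub>i a y\<^sub>i = 0\<close> would force the
  coefficient \<open>\<one>\<close> to vanish. Later membership claims for ideals of centralizers
  and for double centralizers are reduced to this test.\<close>

lemma right_mult_sandwich:
  assumes r: "r \<in> carrier A" and W: "central_subspace W" and s: "sandwich (carrier A) W (\<lambda>a. a \<otimes> r)"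
  shows "r \<in> W"
proof (rule ccontr)
  assume nr: "r \<notin> W"
  have Wc: "W \<subseteq> carrier A" by (rule central_subspace_carrier) fact
  interpret Wg: additive_subgroup W A using W by (simp add: central_subspace_def)
  have cA: "central_subspace (carrier A)" by (simp add: central_subspace_def carrier_additive_subgroup)
  obtain I :: "nat set" and x y where *: "indep y I" "x \<in> I \<rightarrow> carrier A" "y \<in> I \<rightarrow> W"
    "\<And>a. a \<in> carrier A \<Longrightarrow> a \<otimes> r = (\<Oplus>i\<in>I. x i \<otimes> a \<otimes> y i)"
    by (rule sandwich_indep_right [OF s Wc cA]) (rule that)
  have f: "finite I" using *(1) by (rule indep_finite)
  \<comment> \<open>A fresh index under which \<open>r\<close> is adjoined to the family
    \<open>y\<close>, with left coefficient \<open>\<one>\<close>.\<close>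
  obtain k where k: "k \<notin> I" using f ex_new_if_finite infinite_UNIV_nat by blast
  define y' where "y' = y(k := r)"
  define x' where "x' = (\<lambda>i. \<ominus> x i)(k := \<one>)"
  have yc: "\<And>i. i \<in> I \<Longrightarrow> y i \<in> carrier A" "\<And>i. i \<in> I \<Longrightarrow> x i \<in> carrier A" using * Wc by auto
  have ind: "indep y' (insert k I)" unfolding indep_def
  proof (intro conjI ballI impI)
    fix z i assume z: "z \<in> insert k I \<rightarrow> Z" "(\<Oplus>i\<in>insert k I. z i \<otimes> y' i) = \<zero>"
      and i: "i \<in> insert k I"
    have zc: "\<And>j. j \<in> I \<Longrightarrow> z j \<in> Z" "z k \<in> Z" using z(1) by auto
    have e1: "(\<Oplus>i\<in>I. z i \<otimes> y' i) = (\<Oplus>i\<in>I. z i \<otimes> y i)"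
      by (rule finsum_cong') (use yc zc k in \<open>auto simp: y'_def\<close>)
    have e: "(\<Oplus>i\<in>insert k I. z i \<otimes> y' i) = z k \<otimes> r \<oplus> (\<Oplus>i\<in>I. z i \<otimes> y i)"
      by (subst finsum_insert) (use f k yc zc r e1 in \<open>auto simp: y'_def\<close>)
    have sW: "(\<Oplus>i\<in>I. z i \<otimes> y i) \<in> W"
      by (rule additive_subgroup_finsum_closed) (use W zc *(3) in \<open>auto simp: central_subspace_def\<close>)
    then have sc: "(\<Oplus>i\<in>I. z i \<otimes> y i) \<in> carrier A" using Wc by blast
    have zk: "z k = \<zero>"
    proof (rule ccontr)
      assume "z k \<noteq> \<zero>"
      then obtain w where w: "w \<in> Z" "w \<otimes> z k = \<one>" using center_inverse [OF zc(2)] by blast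
      have "r = w \<otimes> (\<ominus> (\<Oplus>i\<in>I. z i \<otimes> y i))"
        by (rule center_solve [OF zc(2) w r sc]) (use z(2) e in simp)
      moreover have "\<ominus> (\<Oplus>i\<in>I. z i \<otimes> y i) \<in> W" using sW by simp
      ultimately have "r \<in> W" using w W by (simp add: central_subspace_def)
      then show False using nr by simp
    qed
    have "(\<Oplus>i\<in>I. z i \<otimes> y i) = \<zero>" using z(2) e sc r zk by simp
    then have "\<And>j. j \<in> I \<Longrightarrow> z j = \<zero>" using indepD [OF *(1), of z] zc by blast
    then show "z i = \<zero>" using i zk by auto
  qed (use f yc r in \<open>auto simp: y'_def\<close>)
  have "x' k = \<zero>"
  proof (rule sandwich_zero_right [OF ind])
    show "x' \<in> insert k I \<rightarrow> carrier A" using yc by (auto simp: x'_def)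
    fix a assume a: "a \<in> carrier A"
    have "(\<Oplus>i\<in>insert k I. x' i \<otimes> a \<otimes> y' i) = x' k \<otimes> a \<otimes> y' k \<oplus> (\<Oplus>i\<in>I. x' i \<otimes> a \<otimes> y' i)"
      by (rule finsum_insert) (use f k a yc r in \<open>auto simp: x'_def y'_def\<close>)
    also have "(\<Oplus>i\<in>I. x' i \<otimes> a \<otimes> y' i) = (\<Oplus>i\<in>I. \<ominus> (x i \<otimes> a \<otimes> y i))"
      by (rule finsum_cong') (use k a yc in \<open>auto simp: x'_def y'_def l_minus\<close>)
    also have "\<dots> = \<ominus> (a \<otimes> r)"
      using finsum_minus [OF f, of "\<lambda>i. x i \<otimes> a \<otimes> y i"] *(4) a yc by (simp add: Pi_def)
    finally show "(\<Oplus>i\<in>insert k I. x' i \<otimes> a \<otimes> y' i) = \<zero>"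
      using a r by (simp add: x'_def y'_def r_neg)
  qed simp
  then show False using one_not_zero by (simp add: x'_def)
qed

text \<open>Well-definedness of \<open>id \<otimes> \<pi>\<close> on \<open>A \<otimes>_Z S\<close>:
  two sandwich expressions that agree as maps come from the same tensor, so they still agree after a
  \<open>Z\<close>-linear map has been applied to the right coefficients.\<close>

lemma sandwich_map:
  fixes I J :: "nat set"
  assumes S: "central_subspace S" and pc: "\<And>s. s \<in> S \<Longrightarrow> \<pi> s \<in> carrier A"
    and padd: "\<And>s s'. s \<in> S \<Longrightarrow> s' \<in> S \<Longrightarrow> \<pi> (s \<oplus> s') = \<pi> s \<oplus> \<pi> s'"
    and pz: "\<And>z s. z \<in> Z \<Longrightarrow> s \<in> S \<Longrightarrow> \<pi> (z \<otimes> s) = z \<otimes> \<pi> s"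
    and I: "finite I" "x \<in> I \<rightarrow> carrier A" "s \<in> I \<rightarrow> S"
    and J: "finite J" "y \<in> J \<rightarrow> carrier A" "t \<in> J \<rightarrow> S"
    and eq: "\<And>a. a \<in> carrier A \<Longrightarrow> (\<Oplus>i\<in>I. x i \<otimes> a \<otimes> s i) = (\<Oplus>i\<in>J. y i \<otimes> a \<otimes> t i)"
    and a: "a \<in> carrier A"
  shows "(\<Oplus>i\<in>I. x i \<otimes> a \<otimes> \<pi> (s i)) = (\<Oplus>i\<in>J. y i \<otimes> a \<otimes> \<pi> (t i))"
proof -
  have Sc: "S \<subseteq> carrier A" by (rule central_subspace_carrier) fact
  have Ssub: "additive_subgroup S A" using S by (simp add: central_subspace_def)
  interpret Sg: abelian_group "A\<lparr>carrier := S\<rparr>"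
    using abelian_group_restrict [OF Ssub] .
  interpret G: central_balanced A "carrier A" "A\<lparr>carrier := S\<rparr>" "\<lambda>z n. z \<otimes> n" A "\<lambda>u n. u \<otimes> a \<otimes> \<pi> n"
  proof unfold_locales
    fix z u n assume z: "z \<in> Z" and u: "u \<in> carrier A" and n: "n \<in> carrier (A\<lparr>carrier := S\<rparr>)"
    then have "\<pi> n \<in> carrier A" using pc by simp
    with z u a have "z \<otimes> u \<otimes> a \<otimes> \<pi> n = u \<otimes> a \<otimes> (z \<otimes> \<pi> n)" by (rule center_move)
    then show "z \<otimes> u \<otimes> a \<otimes> \<pi> n = u \<otimes> a \<otimes> \<pi> (z \<otimes> n)" using pz z n by simp
  qed (use a S in \<open>auto simp: central_subspace_def carrier_additive_subgroup l_distr r_distr pc padd\<close>)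
  \<comment> \<open>The two expressions are joined, one with negated left factors, so that equality
    becomes the vanishing of a single sum.\<close>
  define X' where "X' = join_fam x (\<lambda>j. \<ominus> (y j))"
  define S' where "S' = join_fam s t"
  let ?K = "join_index I J"
  have X': "X' \<in> ?K \<rightarrow> carrier A" unfolding X'_def by (rule join_fam_Pi) (use I J in auto)
  have S': "S' \<in> ?K \<rightarrow> carrier (A\<lparr>carrier := S\<rparr>)" unfolding S'_def using I J by (simp add: join_fam_Pi)
  have cc: "\<And>k. k \<in> ?K \<Longrightarrow> X' k \<in> carrier A" "\<And>k. k \<in> ?K \<Longrightarrow> S' k \<in> S" "\<And>k. k \<in> ?K \<Longrightarrow> S' k \<in> carrier A"
    using X' S' Sc by auto
  have ic: "\<And>k. k \<in> I \<Longrightarrow> x k \<in> carrier A" "\<And>k. k \<in> I \<Longrightarrow> s k \<in> S" "\<And>k. k \<in> I \<Longrightarrow> s k \<in> carrier A"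
    "\<And>k. k \<in> J \<Longrightarrow> y k \<in> carrier A" "\<And>k. k \<in> J \<Longrightarrow> t k \<in> S" "\<And>k. k \<in> J \<Longrightarrow> t k \<in> carrier A"
    using I J Sc by auto
  have split: "(\<Oplus>k\<in>?K. X' k \<otimes> b \<otimes> q (S' k)) = (\<Oplus>i\<in>I. x i \<otimes> b \<otimes> q (s i)) \<oplus> \<ominus> (\<Oplus>i\<in>J. y i \<otimes> b \<otimes> q (t i))"
    if b: "b \<in> carrier A" and q: "\<And>s. s \<in> S \<Longrightarrow> q s \<in> carrier A" for q b
  proof -
    have "(\<Oplus>k\<in>?K. X' k \<otimes> b \<otimes> q (S' k)) = (\<Oplus>i\<in>I. x i \<otimes> b \<otimes> q (s i)) \<oplus> (\<Oplus>i\<in>J. \<ominus> (y i) \<otimes> b \<otimes> q (t i))"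
      using I J b q cc by (subst finsum_join) (auto simp: X'_def S'_def)
    also have "(\<Oplus>i\<in>J. \<ominus> (y i) \<otimes> b \<otimes> q (t i)) = (\<Oplus>i\<in>J. \<ominus> (y i \<otimes> b \<otimes> q (t i)))"
      by (rule finsum_cong') (use ic b q in \<open>auto simp: l_minus\<close>)
    also have "\<dots> = \<ominus> (\<Oplus>i\<in>J. y i \<otimes> b \<otimes> q (t i))"
      by (rule finsum_minus [symmetric]) (use J ic b q in auto)
    finally show ?thesis .
  qed
  have cl: "(\<Oplus>i\<in>I. x i \<otimes> b \<otimes> q (s i)) \<in> carrier A" "(\<Oplus>i\<in>J. y i \<otimes> b \<otimes> q (t i)) \<in> carrier A"
    if "b \<in> carrier A" "\<And>s. s \<in> S \<Longrightarrow> q s \<in> carrier A" for q b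
    using that ic by (auto intro!: finsum_closed)
  have "(\<Oplus>k\<in>?K. X' k \<otimes> a \<otimes> \<pi> (S' k)) = \<zero>"
  proof (rule G.tensor_zero_of_map_zero [OF _ X' S', where T = "{()}" and e = "\<lambda>_ n. n"])
    fix b assume b: "b \<in> carrier A"
    show "(\<Oplus>k\<in>?K. X' k \<otimes> b \<otimes> S' k) = \<zero>"
      using split [OF b, of "\<lambda>x. x"] eq [OF b] cl [OF b, of "\<lambda>x. x"] Sc by (auto simp: r_neg)
  qed (use I J Sc in auto)
  then have "(\<Oplus>i\<in>I. x i \<otimes> a \<otimes> \<pi> (s i)) \<ominus> (\<Oplus>i\<in>J. y i \<otimes> a \<otimes> \<pi> (t i)) = \<zero>"
    using split [OF a, of \<pi>, OF pc] by (simp add: a_minus_def)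
  then show ?thesis using r_right_minus_eq cl [OF a, of \<pi>, OF pc] by blast
qed

end

section \<open>Functionals, dual bases and simple subrings\<close>

definition (in ring) right_linear :: "'a set \<Rightarrow> ('a \<Rightarrow> 'a) \<Rightarrow> bool" where
  "right_linear D f \<longleftrightarrow> f \<in> carrier R \<rightarrow> carrier R
     \<and> (\<forall>a\<in>carrier R. \<forall>b\<in>carrier R. f (a \<oplus> b) = f a \<oplus> f b)
     \<and> (\<forall>a\<in>carrier R. \<forall>d\<in>D. f (a \<otimes> d) = f a \<otimes> d)"

definition (in ring) functional :: "'a set \<Rightarrow> ('a \<Rightarrow> 'a) \<Rightarrow> bool" where
  "functional D f \<longleftrightarrow> right_linear D f \<and> f ` carrier R \<subseteq> D"

definition (in ring) dual_basis :: "'a set \<Rightarrow> nat set \<Rightarrow> (nat \<Rightarrow> 'a) \<Rightarrow> (nat \<Rightarrow> 'a \<Rightarrow> 'a) \<Rightarrow> bool" where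
  "dual_basis D I y f \<longleftrightarrow> finite I \<and> y \<in> I \<rightarrow> carrier R \<and> (\<forall>i\<in>I. functional D (f i))
     \<and> (\<forall>a\<in>carrier R. a = (\<Oplus>i\<in>I. y i \<otimes> f i a))"

text \<open>Simplicity in the form in which it is applied: a property that is stable under sums and
  two-sided multiplication and holds for some nonzero element holds for \<open>\<one>\<close>.
  Stability under negation is multiplication by \<open>\<ominus> \<one>\<close>, which lies in
  \<open>V\<close>.\<close>

lemma (in ring) simple_subring_one:
  assumes s: "simple_ring (R\<lparr>carrier := V\<rparr>)" and V: "subring V R"
    and Q: "Q \<subseteq> V" and add: "\<And>x y. x \<in> Q \<Longrightarrow> y \<in> Q \<Longrightarrow> x \<oplus> y \<in> Q"
    and l: "\<And>v x. v \<in> V \<Longrightarrow> x \<in> Q \<Longrightarrow> v \<otimes> x \<in> Q"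
    and r: "\<And>v x. v \<in> V \<Longrightarrow> x \<in> Q \<Longrightarrow> x \<otimes> v \<in> Q"
    and q: "q \<in> Q" "q \<noteq> \<zero>"
  shows "\<one> \<in> Q"
proof -
  interpret V: ring "R\<lparr>carrier := V\<rparr>" using V by (rule subring_is_ring)
  have Vc: "V \<subseteq> carrier R" using V by (rule subringE)
  have m1: "\<ominus> \<one> \<in> V" using subringE(3,5)[OF V] by blast
  have nV: "\<ominus>\<^bsub>R\<lparr>carrier := V\<rparr>\<^esub> x = \<ominus> x" if "x \<in> V" for x
    by (rule V.minus_equality) (use that Vc subringE(5)[OF V] in \<open>auto simp: l_neg subset_iff\<close>)
  have n: "\<ominus> x \<in> Q" if "x \<in> Q" for x
    using l [OF m1 that] that Q Vc by (simp add: l_minus subset_iff)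
  have "q \<oplus> (\<ominus> q) \<in> Q" using add [OF q(1) n [OF q(1)]] .
  then have z: "\<zero> \<in> Q" using q Q Vc by (auto simp: r_neg subset_iff)
  have "ideal Q (R\<lparr>carrier := V\<rparr>)"
  proof (rule idealI [OF V.ring_axioms])
    show "subgroup Q (add_monoid (R\<lparr>carrier := V\<rparr>))"
    proof (rule V.add.subgroupI)
      show "\<ominus>\<^bsub>R\<lparr>carrier := V\<rparr>\<^esub> a \<in> Q" if "a \<in> Q" for a
        using that nV n Q by auto
    qed (use Q q add in auto)
  qed (use l r in auto)
  then have "Q = {\<zero>} \<or> Q = V" using s by (simp add: simple_ring_def)
  then show ?thesis using q subringE(3)[OF V] by blast
qed

text \<open>The converse form, phrased with plain closure properties so that applications need not
  handle ideals of a ring with restricted carrier.\<close>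

lemma (in ring) simple_subringI:
  assumes V: "subring V R" and one: "\<one> \<noteq> \<zero>"
    and Q: "\<And>Q q. Q \<subseteq> V \<Longrightarrow> (\<And>x y. x \<in> Q \<Longrightarrow> y \<in> Q \<Longrightarrow> x \<oplus> y \<in> Q) \<Longrightarrow>
      (\<And>v x. v \<in> V \<Longrightarrow> x \<in> Q \<Longrightarrow> v \<otimes> x \<in> Q) \<Longrightarrow> (\<And>v x. v \<in> V \<Longrightarrow> x \<in> Q \<Longrightarrow> x \<otimes> v \<in> Q) \<Longrightarrow>
      q \<in> Q \<Longrightarrow> q \<noteq> \<zero> \<Longrightarrow> \<one> \<in> Q"
  shows "simple_ring (R\<lparr>carrier := V\<rparr>)"
  unfolding simple_ring_def
proof (intro conjI allI impI)
  show "ring (R\<lparr>carrier := V\<rparr>)" using V by (rule subring_is_ring)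
  show "\<one>\<^bsub>R\<lparr>carrier := V\<rparr>\<^esub> \<noteq> \<zero>\<^bsub>R\<lparr>carrier := V\<rparr>\<^esub>" using one by simp
  fix Q assume "ideal Q (R\<lparr>carrier := V\<rparr>)"
  then interpret I: ideal Q "R\<lparr>carrier := V\<rparr>" .
  have QV: "Q \<subseteq> V" using I.a_subset by simp
  have z: "\<zero> \<in> Q" using additive_subgroup.zero_closed [OF I.additive_subgroup_axioms] by simp
  show "Q = {\<zero>\<^bsub>R\<lparr>carrier := V\<rparr>\<^esub>} \<or> Q = carrier (R\<lparr>carrier := V\<rparr>)"
  proof (cases "Q = {\<zero>}")
    case False
    then obtain q where q: "q \<in> Q" "q \<noteq> \<zero>" using z by blast
    have "\<one> \<in> Q"
      by (rule Q [OF QV _ _ _ q]) (use additive_subgroup.a_closed [OF I.additive_subgroup_axioms] I.I_l_closed I.I_r_closed in auto)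
    then have "v \<in> Q" if "v \<in> V" for v
      using I.I_l_closed [of \<one> v] that subringE(1)[OF V] by auto
    then show ?thesis using QV by auto
  qed simp
qed

lemma (in ring) sandwich_eq:
  "sandwich U W \<alpha> \<Longrightarrow> (\<And>a. a \<in> carrier R \<Longrightarrow> \<alpha> a = \<beta> a) \<Longrightarrow> sandwich U W \<beta>"
  using sandwich_cong [of \<alpha> \<beta>] by simp

context simple begin

lemma subring_central_subspace:
  assumes "subring V A" "Z \<subseteq> V" shows "central_subspace V"
  unfolding central_subspace_def
  using subring.axioms(1)[OF assms(1)] subringE(6)[OF assms(1)] assms(2)
  by (auto intro: additive_subgroup.intro)

lemma central_subspaceI:
  assumes "subring V A" "Z \<subseteq> V" "Q \<subseteq> V" "\<And>x y. x \<in> Q \<Longrightarrow> y \<in> Q \<Longrightarrow> x \<oplus> y \<in> Q"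
    "\<And>v x. v \<in> Z \<Longrightarrow> x \<in> Q \<Longrightarrow> v \<otimes> x \<in> Q" "q \<in> Q"
  shows "central_subspace Q"
proof -
  have Qc: "Q \<subseteq> carrier A" using assms(3) subringE(1)[OF assms(1)] by blast
  have m1: "\<ominus> \<one> \<in> Z" using subringE(3,5)[OF center_subring] by blast
  have "subgroup Q (add_monoid A)"
  proof (rule add.subgroupI)
    show "\<ominus> a \<in> Q" if "a \<in> Q" for a
      using assms(5)[OF m1 that] that Qc by (simp add: l_minus subset_iff)
  qed (use Qc assms in auto)
  then show ?thesis unfolding central_subspace_def using assms(5) by (auto intro: additive_subgroup.intro)
qed

lemma center_le_centralizer: "D \<subseteq> carrier A \<Longrightarrow> Z \<subseteq> centralizer A D"
proof
  fix z assume D: "D \<subseteq> carrier A" and z: "z \<in> Z"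
  show "z \<in> centralizer A D"
    by (rule centralizerI) (use D z center_comm [OF z] in auto)
qed

lemma centralizer_subspace: "D \<subseteq> carrier A \<Longrightarrow> central_subspace (centralizer A D)"
  by (rule subring_central_subspace [OF centralizer_subring center_le_centralizer])

lemma centralizer_sub: "centralizer A D \<subseteq> carrier A"
  by (rule subsetI) (rule centralizer_carrier)

lemma sandwich_functional:
  assumes "sandwich (carrier A) (centralizer A D) f" "D \<subseteq> carrier A" "f ` carrier A \<subseteq> D"
  shows "functional D f"
  unfolding functional_def right_linear_def
  using assms sandwich_closed [OF _ _ assms(1)] sandwich_additive [OF _ _ assms(1)]
    sandwich_right_linear [OF _ _ assms(1)] centralizer_sub centralizer_comm
  by (smt (verit, best) Pi_I subset_iff subset_refl)

text \<open>The action of \<open>A \<otimes>\<^sub>Z V\<^sup>o\<^sup>p\<close> on \<open>A\<close> by sandwich maps is faithful; the lemma expresses that this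
  ring is simple when \<open>V\<close> is.\<close>

lemma sandwich_ideal:
  assumes V: "subring V A" "Z \<subseteq> V" "simple_ring (A\<lparr>carrier := V\<rparr>)"
    and sw: "\<And>e. J e \<Longrightarrow> sandwich (carrier A) V e"
    and cong: "\<And>e e'. J e \<Longrightarrow> (\<And>a. a \<in> carrier A \<Longrightarrow> e a = e' a) \<Longrightarrow> J e'"
    and add: "\<And>e e'. J e \<Longrightarrow> J e' \<Longrightarrow> J (\<lambda>a. e a \<oplus> e' a)"
    and lo: "\<And>e b. J e \<Longrightarrow> b \<in> carrier A \<Longrightarrow> J (\<lambda>a. b \<otimes> e a)"
    and li: "\<And>e b. J e \<Longrightarrow> b \<in> carrier A \<Longrightarrow> J (\<lambda>a. e (b \<otimes> a))"
    and ro: "\<And>e v. J e \<Longrightarrow> v \<in> V \<Longrightarrow> J (\<lambda>a. e a \<otimes> v)"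
    and ri: "\<And>e v. J e \<Longrightarrow> v \<in> V \<Longrightarrow> J (\<lambda>a. e (a \<otimes> v))"
    and nz: "J e0" "a0 \<in> carrier A" "e0 a0 \<noteq> \<zero>"
  shows "J (\<lambda>a. a)"
proof -
  have Vc: "V \<subseteq> carrier A" using V(1) by (rule subringE)
  have Vs: "central_subspace V" using V by (intro subring_central_subspace)
  have ec: "e a \<in> carrier A" if "J e" "a \<in> carrier A" for e a
    using sandwich_closed [OF _ Vc sw] that by blast
  have Jsum: "J (\<lambda>a. \<Oplus>k\<in>K. e k a)" if "finite K" "\<And>k. k \<in> K \<Longrightarrow> J (e k)" for e and K :: "nat set"
    using that
  proof (induction K rule: finite_induct)
    case empty
    show ?case by (rule cong [OF lo [OF nz(1), of \<zero>]]) (use ec [OF nz(1)] in auto)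
  next
    case (insert k K)
    have c: "\<And>j a. j \<in> insert k K \<Longrightarrow> a \<in> carrier A \<Longrightarrow> e j a \<in> carrier A" using insert.prems ec by blast
    have J1: "J (\<lambda>a. \<Oplus>k\<in>K. e k a)" using insert.IH insert.prems by blast
    have "J (\<lambda>a. e k a \<oplus> (\<Oplus>k\<in>K. e k a))" using add [OF insert.prems J1] by blast
    moreover have "e k a \<oplus> (\<Oplus>k\<in>K. e k a) = (\<Oplus>k\<in>insert k K. e k a)" if "a \<in> carrier A" for a
      using insert.hyps c that by (intro finsum_insert [symmetric]) auto
    ultimately show ?case by (rule cong)
  qed
  \<comment> \<open>From a nonzero member of \<open>J\<close> to a right multiplication in
    \<open>J\<close>, by induction on the number of terms. A coefficient is normalised to
    \<open>\<one>\<close>. If all coefficients have become central, the map is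
    \<open>a \<mapsto> a v\<close> with \<open>v = \<Sum> x'\<^sub>j y\<^sub>j\<close>, nonzero by
    independence of the \<open>y\<^sub>j\<close>; otherwise a commutator yields a nonzero member of
    \<open>J\<close> with fewer terms.\<close>
  have key: "\<exists>v\<in>V. v \<noteq> \<zero> \<and> J (\<lambda>a. a \<otimes> v)"
    if "finite I" "J e" "x \<in> I \<rightarrow> carrier A" "y \<in> I \<rightarrow> V" "indep y I" "i \<in> I" "x i \<noteq> \<zero>"
      "\<And>a. a \<in> carrier A \<Longrightarrow> e a = (\<Oplus>i\<in>I. x i \<otimes> a \<otimes> y i)" for I :: "nat set" and e x y i
    using that
  proof (induction I arbitrary: e x i rule: finite_psubset_induct)
    case (psubset I)
    have xc: "\<And>j. j \<in> I \<Longrightarrow> x j \<in> carrier A" "\<And>j. j \<in> I \<Longrightarrow> y j \<in> carrier A"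
      using psubset.prems Vc by auto
    obtain K :: "nat set" and p q where K: "finite K" "p \<in> K \<rightarrow> carrier A"
      "q \<in> K \<rightarrow> carrier A" "\<one> = (\<Oplus>k\<in>K. p k \<otimes> x i \<otimes> q k)"
      by (rule one_eq_sum [OF xc(1)[OF psubset.prems(5)] psubset.prems(6)]) (rule that)
    have pq: "\<And>j. j \<in> K \<Longrightarrow> p j \<in> carrier A" "\<And>j. j \<in> K \<Longrightarrow> q j \<in> carrier A"
      using K by auto
    define x' where "x' j = (\<Oplus>k\<in>K. p k \<otimes> x j \<otimes> q k)" for j
    have x'c: "x' j \<in> carrier A" if "j \<in> I" for j
      using that xc pq by (auto simp: x'_def intro!: finsum_closed)
    have x'i: "x' i = \<one>" using K by (simp add: x'_def)
    define e' where "e' a = (\<Oplus>k\<in>K. p k \<otimes> e (q k \<otimes> a))" for a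
    have Je': "J e'" unfolding e'_def
      by (rule Jsum [OF K(1)], rule lo, rule li) (use psubset.prems(1) pq in auto)
    have e'_eq: "e' a = (\<Oplus>i\<in>I. x' i \<otimes> a \<otimes> y i)" if a: "a \<in> carrier A" for a
    proof -
      have "e' a = (\<Oplus>k\<in>K. \<Oplus>i\<in>I. p k \<otimes> (x i \<otimes> (q k \<otimes> a) \<otimes> y i))"
        unfolding e'_def
      proof (rule finsum_cong')
        fix k assume k: "k \<in> K"
        have "e (q k \<otimes> a) = (\<Oplus>i\<in>I. x i \<otimes> (q k \<otimes> a) \<otimes> y i)"
          using psubset.prems(7) pq k a by blast
        then show "p k \<otimes> e (q k \<otimes> a) = (\<Oplus>i\<in>I. p k \<otimes> (x i \<otimes> (q k \<otimes> a) \<otimes> y i))"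
          using psubset.hyps(1) pq k a xc by (auto intro!: finsum_rdistr)
      qed (use xc pq a in \<open>auto intro!: finsum_closed\<close>)
      also have "\<dots> = (\<Oplus>i\<in>I. \<Oplus>k\<in>K. p k \<otimes> (x i \<otimes> (q k \<otimes> a) \<otimes> y i))"
        by (rule finsum_swap) (use K psubset.hyps(1) xc pq a in auto)
      also have "\<dots> = (\<Oplus>i\<in>I. x' i \<otimes> a \<otimes> y i)"
      proof (rule finsum_cong')
        fix i assume i: "i \<in> I"
        have "(\<Oplus>k\<in>K. p k \<otimes> (x i \<otimes> (q k \<otimes> a) \<otimes> y i)) = (\<Oplus>k\<in>K. (p k \<otimes> x i \<otimes> q k) \<otimes> (a \<otimes> y i))"
          by (rule finsum_cong') (use i xc pq a in \<open>auto simp: m_assoc\<close>)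
        also have "\<dots> = x' i \<otimes> (a \<otimes> y i)" unfolding x'_def
          by (rule finsum_ldistr [symmetric]) (use K i xc pq a in auto)
        finally show "(\<Oplus>k\<in>K. p k \<otimes> (x i \<otimes> (q k \<otimes> a) \<otimes> y i)) = x' i \<otimes> a \<otimes> y i"
          using i xc x'c a by (simp add: m_assoc)
      qed (use x'c xc a in auto)
      finally show ?thesis .
    qed
    show ?case
    proof (cases "\<forall>b\<in>carrier A. \<forall>j\<in>I. b \<otimes> x' j = x' j \<otimes> b")
      case True
      define v where "v = (\<Oplus>j\<in>I. x' j \<otimes> y j)"
      have x'Z: "x' \<in> I \<rightarrow> Z" using True x'c by (auto intro!: centralizerI)
      have "v \<in> V" unfolding v_def
        by (rule additive_subgroup_finsum_closed)
          (use Vs x'Z psubset.prems(3) in \<open>auto simp: central_subspace_def Pi_def\<close>)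
      moreover have "v \<noteq> \<zero>"
        using indepD [OF psubset.prems(4) x'Z _ psubset.prems(5)] x'i one_not_zero by (auto simp: v_def)
      moreover have "e' a = a \<otimes> v" if a: "a \<in> carrier A" for a
      proof -
        have "e' a = (\<Oplus>j\<in>I. a \<otimes> (x' j \<otimes> y j))" unfolding e'_eq [OF a]
          by (rule finsum_cong') (use True a xc x'c in \<open>auto simp: m_assoc [symmetric]\<close>)
        also have "\<dots> = a \<otimes> v" unfolding v_def
          by (rule finsum_rdistr [symmetric]) (use psubset.hyps(1) a xc x'c in auto)
        finally show ?thesis .
      qed
      ultimately show ?thesis using cong [OF Je', of "\<lambda>a. a \<otimes> v"] by blast
    next
      case False
      then obtain b j where b: "b \<in> carrier A" "j \<in> I" "b \<otimes> x' j \<noteq> x' j \<otimes> b" by blast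
      define w where "w j = b \<otimes> x' j \<ominus> x' j \<otimes> b" for j
      have wc: "\<And>j. j \<in> I \<Longrightarrow> w j \<in> carrier A" using x'c b by (auto simp: w_def)
      have wi: "w i = \<zero>" using b x'i by (simp add: w_def a_minus_def r_neg)
      have wj: "w j \<noteq> \<zero>" using b x'c by (simp add: w_def r_right_minus_eq)
      \<comment> \<open>The commutator with \<open>b\<close> in the left tensor factor: multiplying
        outside acts on the left coefficients from the left, multiplying the argument acts on them
        from the right.\<close>
      define e'' where "e'' a = b \<otimes> e' a \<oplus> (\<ominus> \<one>) \<otimes> e' (b \<otimes> a)" for a
      have Je'': "J e''" unfolding e''_def using b
        by (intro add lo li Je') auto
      show ?thesis
      proof (rule psubset.IH)
        show "I - {i} \<subset> I" using psubset.prems(5) by auto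
        show "J e''" by fact
        show "w \<in> I - {i} \<rightarrow> carrier A" using wc by auto
        show "y \<in> I - {i} \<rightarrow> V" using psubset.prems(3) by auto
        show "indep y (I - {i})" by (rule indep_remove) (rule psubset.prems(4))
        show "j \<in> I - {i}" using b wi wj by auto
        show "w j \<noteq> \<zero>" by fact
        fix a assume a: "a \<in> carrier A"
        have "e'' a = (\<Oplus>j\<in>I. b \<otimes> (x' j \<otimes> a \<otimes> y j)) \<oplus> (\<Oplus>j\<in>I. (\<ominus> \<one>) \<otimes> (x' j \<otimes> (b \<otimes> a) \<otimes> y j))"
          unfolding e''_def e'_eq [OF a] e'_eq [OF m_closed [OF b(1) a]]
          by (intro arg_cong2 [of _ _ _ _ "(\<oplus>)"] finsum_rdistr) (use psubset.hyps(1) a b xc x'c in auto)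
        also have "\<dots> = (\<Oplus>j\<in>I. b \<otimes> (x' j \<otimes> a \<otimes> y j) \<oplus> (\<ominus> \<one>) \<otimes> (x' j \<otimes> (b \<otimes> a) \<otimes> y j))"
          by (rule finsum_addf [symmetric]) (use a b xc x'c in auto)
        also have "\<dots> = (\<Oplus>j\<in>I. w j \<otimes> a \<otimes> y j)"
          by (rule finsum_cong')
            (use a b xc x'c in \<open>auto simp: w_def a_minus_def l_distr m_assoc l_minus\<close>)
        also have "\<dots> = (\<Oplus>j\<in>insert i (I - {i}). w j \<otimes> a \<otimes> y j)"
          using psubset.prems(5) by (simp add: insert_absorb)
        also have "\<dots> = w i \<otimes> a \<otimes> y i \<oplus> (\<Oplus>j\<in>I - {i}. w j \<otimes> a \<otimes> y j)"
          by (rule finsum_insert) (use psubset.hyps(1) psubset.prems(5) a xc wc in auto)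
        finally show "e'' a = (\<Oplus>j\<in>I - {i}. w j \<otimes> a \<otimes> y j)"
          using wi a xc psubset.prems(5) wc by (simp add: finsum_closed)
      qed
    qed
  qed
  obtain I :: "nat set" and x y where I: "indep y I" "x \<in> I \<rightarrow> carrier A" "y \<in> I \<rightarrow> V"
    "\<And>a. a \<in> carrier A \<Longrightarrow> e0 a = (\<Oplus>i\<in>I. x i \<otimes> a \<otimes> y i)"
    by (rule sandwich_indep_right [OF sw [OF nz(1)] Vc])
      (simp add: central_subspace_def carrier_additive_subgroup, rule that)
  have "\<exists>i\<in>I. x i \<noteq> \<zero>"
  proof (rule ccontr)
    assume "\<not> ?thesis"
    then have "(\<Oplus>i\<in>I. x i \<otimes> a0 \<otimes> y i) = (\<Oplus>i\<in>I. \<zero>)"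
      by (intro finsum_cong') (use nz(2) I(3) Vc in \<open>auto simp: Pi_def subset_iff\<close>)
    then show False using I(4)[OF nz(2)] nz(3) by simp
  qed
  then obtain v where v: "v \<in> V" "v \<noteq> \<zero>" "J (\<lambda>a. a \<otimes> v)"
    using key [OF indep_finite [OF I(1)] nz(1) I(2,3,1) _ _ I(4)] by blast
  \<comment> \<open>The elements of \<open>V\<close> whose right multiplication lies in
    \<open>J\<close> form a two-sided ideal of \<open>V\<close>; this is where simplicity of
    \<open>V\<close> enters.\<close>
  have "\<one> \<in> {v \<in> V. J (\<lambda>a. a \<otimes> v)}"
  proof (rule simple_subring_one [OF V(3,1)])
    fix x y assume x: "x \<in> {v \<in> V. J (\<lambda>a. a \<otimes> v)}"
    then have xV: "x \<in> V" "x \<in> carrier A" using Vc by auto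
    { assume y: "y \<in> {v \<in> V. J (\<lambda>a. a \<otimes> v)}"
      then have yV: "y \<in> V" "y \<in> carrier A" using Vc by auto
      have "J (\<lambda>a. a \<otimes> x \<oplus> a \<otimes> y)" using x y by (intro add) auto
      then have "J (\<lambda>a. a \<otimes> (x \<oplus> y))" by (rule cong) (use xV yV in \<open>auto simp: r_distr\<close>)
      then show "x \<oplus> y \<in> {v \<in> V. J (\<lambda>a. a \<otimes> v)}" using xV yV subringE(7)[OF V(1)] by auto }
    { assume y: "y \<in> V"
      then have yc: "y \<in> carrier A" using Vc by auto
      have "J (\<lambda>a. a \<otimes> y \<otimes> x)" by (rule ri [of "\<lambda>a. a \<otimes> x" y]) (use x y in auto)
      then have "J (\<lambda>a. a \<otimes> (y \<otimes> x))" by (rule cong) (use xV yc in \<open>auto simp: m_assoc\<close>)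
      then show "y \<otimes> x \<in> {v \<in> V. J (\<lambda>a. a \<otimes> v)}" using xV y subringE(6)[OF V(1)] by auto
      have "J (\<lambda>a. a \<otimes> x \<otimes> y)" by (rule ro) (use x y in auto)
      then have "J (\<lambda>a. a \<otimes> (x \<otimes> y))" by (rule cong) (use xV yc in \<open>auto simp: m_assoc\<close>)
      then show "x \<otimes> y \<in> {v \<in> V. J (\<lambda>a. a \<otimes> v)}" using xV y subringE(6)[OF V(1)] by auto }
  qed (use v in auto)
  then have "J (\<lambda>a. a \<otimes> \<one>)" by blast
  then show ?thesis by (rule cong) simp
qed

end

section \<open>Intermediate rings\<close>

text \<open>H-separability in the form used in this section: the endomorphisms of the right
  \<open>B\<close>-module \<open>A\<close> are the sandwich maps with right coefficients in the
  centralizer. \<open>HS_separable_imp\<close> derives it from the tensor definition.\<close>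

locale h_separable = simple +
  fixes B Rc
  assumes B: "subring B A" and Rc_def: "Rc = centralizer A B"
    and right_linear_sandwich: "right_linear B \<alpha> \<Longrightarrow> sandwich (carrier A) Rc \<alpha>"
begin

lemma B_carrier: "B \<subseteq> carrier A" using B by (rule subringE)

lemma Rc_sub: "Rc \<subseteq> carrier A" unfolding Rc_def by (rule centralizer_sub)

text \<open>Write the map with coefficients in \<open>Rc\<close> and independent left factors.
  Linearity over \<open>d\<close> gives
  \<open>\<Sum> x\<^sub>i a (d y\<^sub>i - y\<^sub>i d) = 0\<close>, so each
  \<open>y\<^sub>i\<close> commutes with \<open>d\<close>.\<close>

lemma right_linear_sandwich_intermediate:
  assumes D: "B \<subseteq> D" "D \<subseteq> carrier A" and \<alpha>: "right_linear D \<alpha>"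
  shows "sandwich (carrier A) (centralizer A D) \<alpha>"
proof -
  have "right_linear B \<alpha>" using \<alpha> D(1) unfolding right_linear_def by blast
  then have "sandwich (carrier A) Rc \<alpha>" by (rule right_linear_sandwich)
  then obtain I :: "nat set" and x y where I: "indep x I" "x \<in> I \<rightarrow> carrier A" "y \<in> I \<rightarrow> Rc"
    "\<And>a. a \<in> carrier A \<Longrightarrow> \<alpha> a = (\<Oplus>i\<in>I. x i \<otimes> a \<otimes> y i)"
    by (rule sandwich_indep_left) (auto simp: Rc_def B_carrier centralizer_subspace that)
  have c: "\<And>j. j \<in> I \<Longrightarrow> x j \<in> carrier A" "\<And>j. j \<in> I \<Longrightarrow> y j \<in> carrier A"
    using I Rc_sub by auto
  have f: "finite I" by (rule indep_finite) fact
  have "y i \<in> centralizer A D" if i: "i \<in> I" for i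
  proof (rule centralizerI)
    fix d assume d: "d \<in> D"
    then have dc: "d \<in> carrier A" using D by auto
    have "d \<otimes> y i \<ominus> y i \<otimes> d = \<zero>"
    proof (rule sandwich_zero [OF I(1) _ _ i])
      fix a assume a: "a \<in> carrier A"
      have "(\<Oplus>i\<in>I. x i \<otimes> a \<otimes> (d \<otimes> y i \<ominus> y i \<otimes> d)) =
          (\<Oplus>i\<in>I. x i \<otimes> (a \<otimes> d) \<otimes> y i \<oplus> x i \<otimes> a \<otimes> y i \<otimes> (\<ominus> d))"
        by (rule finsum_cong') (use a c dc in \<open>auto simp: a_minus_def r_distr m_assoc r_minus\<close>)
      also have "\<dots> = (\<Oplus>i\<in>I. x i \<otimes> (a \<otimes> d) \<otimes> y i) \<oplus> (\<Oplus>i\<in>I. x i \<otimes> a \<otimes> y i \<otimes> (\<ominus> d))"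
        by (rule finsum_addf) (use a c dc in auto)
      also have "(\<Oplus>i\<in>I. x i \<otimes> (a \<otimes> d) \<otimes> y i) = \<alpha> (a \<otimes> d)" using I(4) a dc by simp
      also have "(\<Oplus>i\<in>I. x i \<otimes> a \<otimes> y i \<otimes> (\<ominus> d)) = \<alpha> a \<otimes> (\<ominus> d)"
        unfolding I(4)[OF a] by (rule finsum_ldistr [symmetric]) (use f a c dc in auto)
      also have "\<alpha> (a \<otimes> d) = \<alpha> a \<otimes> d" using \<alpha> a d by (simp add: right_linear_def)
      finally show "(\<Oplus>i\<in>I. x i \<otimes> a \<otimes> (d \<otimes> y i \<ominus> y i \<otimes> d)) = \<zero>"
        using \<alpha> a dc by (simp add: right_linear_def r_minus r_neg Pi_def)
    qed (use c dc in auto)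
    then show "y i \<otimes> d = d \<otimes> y i" using c dc i r_right_minus_eq by simp
  qed (use c i in auto)
  then show ?thesis using f I by (intro sandwichI [of I x _ y]) auto
qed

text \<open>The argument on the other side: with right factors independent and already in the
  centralizer of \<open>D\<close>, left linearity gives
  \<open>\<Sum> (x\<^sub>i d - d x\<^sub>i) a y\<^sub>i = 0\<close>.\<close>

lemma bilinear_sandwich_intermediate:
  assumes D: "B \<subseteq> D" "D \<subseteq> carrier A" and \<alpha>: "right_linear D \<alpha>"
    and l: "\<And>a d. a \<in> carrier A \<Longrightarrow> d \<in> D \<Longrightarrow> \<alpha> (d \<otimes> a) = d \<otimes> \<alpha> a"
  shows "sandwich (centralizer A D) (centralizer A D) \<alpha>"
proof -
  have "sandwich (carrier A) (centralizer A D) \<alpha>"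
    using D \<alpha> by (rule right_linear_sandwich_intermediate)
  then obtain I :: "nat set" and x y where I: "indep y I" "x \<in> I \<rightarrow> carrier A" "y \<in> I \<rightarrow> centralizer A D"
    "\<And>a. a \<in> carrier A \<Longrightarrow> \<alpha> a = (\<Oplus>i\<in>I. x i \<otimes> a \<otimes> y i)"
    by (rule sandwich_indep_right)
      (auto simp: centralizer_carrier central_subspace_def carrier_additive_subgroup intro: that)
  have c: "\<And>j. j \<in> I \<Longrightarrow> x j \<in> carrier A" "\<And>j. j \<in> I \<Longrightarrow> y j \<in> carrier A"
    using I centralizer_sub [of D] by (auto simp: Pi_def)
  have f: "finite I" by (rule indep_finite) fact
  have "x i \<in> centralizer A D" if i: "i \<in> I" for i
  proof (rule centralizerI)
    fix d assume d: "d \<in> D"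
    then have dc: "d \<in> carrier A" using D by auto
    have "x i \<otimes> d \<ominus> d \<otimes> x i = \<zero>"
    proof (rule sandwich_zero_right [OF I(1) _ _ i, where c = "\<lambda>i. x i \<otimes> d \<ominus> d \<otimes> x i"])
      fix a assume a: "a \<in> carrier A"
      have "(\<Oplus>i\<in>I. (x i \<otimes> d \<ominus> d \<otimes> x i) \<otimes> a \<otimes> y i) =
          (\<Oplus>i\<in>I. x i \<otimes> (d \<otimes> a) \<otimes> y i \<oplus> (\<ominus> d) \<otimes> (x i \<otimes> a \<otimes> y i))"
        by (rule finsum_cong') (use a c dc in \<open>auto simp: a_minus_def l_distr m_assoc l_minus\<close>)
      also have "\<dots> = (\<Oplus>i\<in>I. x i \<otimes> (d \<otimes> a) \<otimes> y i) \<oplus> (\<Oplus>i\<in>I. (\<ominus> d) \<otimes> (x i \<otimes> a \<otimes> y i))"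
        by (rule finsum_addf) (use a c dc in auto)
      also have "(\<Oplus>i\<in>I. x i \<otimes> (d \<otimes> a) \<otimes> y i) = \<alpha> (d \<otimes> a)" using I(4) a dc by simp
      also have "(\<Oplus>i\<in>I. (\<ominus> d) \<otimes> (x i \<otimes> a \<otimes> y i)) = (\<ominus> d) \<otimes> \<alpha> a"
        unfolding I(4)[OF a] by (rule finsum_rdistr [symmetric]) (use f a c dc in auto)
      also have "\<alpha> (d \<otimes> a) = d \<otimes> \<alpha> a" using l a d by simp
      finally show "(\<Oplus>i\<in>I. (x i \<otimes> d \<ominus> d \<otimes> x i) \<otimes> a \<otimes> y i) = \<zero>"
        using \<alpha> a dc by (simp add: right_linear_def l_minus r_neg Pi_def)
    qed (use c dc in auto)
    then show "x i \<otimes> d = d \<otimes> x i" using c dc i r_right_minus_eq by simp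
  qed (use c i in auto)
  then show ?thesis using f I by (intro sandwichI [of I x _ y]) auto
qed

lemma functional_sandwich:
  "B \<subseteq> D \<Longrightarrow> D \<subseteq> carrier A \<Longrightarrow> functional D f \<Longrightarrow> sandwich (carrier A) (centralizer A D) f"
  by (simp add: functional_def right_linear_sandwich_intermediate)

lemma dual_basis_nonzero:
  assumes "dual_basis D I y f" "a \<in> carrier A" "a \<noteq> \<zero>"
  obtains i where "i \<in> I" "f i a \<noteq> \<zero>"
proof -
  have "\<exists>i\<in>I. f i a \<noteq> \<zero>"
  proof (rule ccontr)
    assume "\<not> ?thesis"
    then have "(\<Oplus>i\<in>I. y i \<otimes> f i a) = (\<Oplus>i\<in>I. \<zero>)"
      by (intro finsum_cong') (use assms(1) in \<open>auto simp: dual_basis_def Pi_def\<close>)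
    then show False using assms by (simp add: dual_basis_def)
  qed
  then show ?thesis using that by blast
qed

text \<open>Let \<open>c\<close> centralize the centralizer of \<open>D\<close>. A functional
  \<open>f i\<close> has right coefficients in that centralizer, hence
  \<open>f i d' \<otimes> c = f i (d' \<otimes> c)\<close> lies in \<open>D\<close>. Thus
  \<open>f i \<one>\<close> belongs to the ideal of those \<open>d\<close> with \<open>d D c\<close>
  inside \<open>D\<close>; as \<open>D\<close> is simple, \<open>\<one>\<close> belongs to it as
  well.\<close>

lemma double_centralizer:
  assumes D: "subring D A" "B \<subseteq> D" "simple_ring (A\<lparr>carrier := D\<rparr>)" and db: "dual_basis D I y f"
  shows "centralizer A (centralizer A D) = D"
proof
  have Dc: "D \<subseteq> carrier A" using D(1) by (rule subringE)
  show "D \<subseteq> centralizer A (centralizer A D)"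
    using Dc by (auto intro!: centralizerI simp: centralizer_comm)
  show "centralizer A (centralizer A D) \<subseteq> D"
  proof
    fix c assume c: "c \<in> centralizer A (centralizer A D)"
    then have cc: "c \<in> carrier A" by (rule centralizer_carrier)
    obtain i where i: "i \<in> I" "f i \<one> \<noteq> \<zero>"
      using dual_basis_nonzero [OF db one_closed one_not_zero] by blast
    have fi: "functional D (f i)" using db i by (simp add: dual_basis_def)
    then have sw: "sandwich (carrier A) (centralizer A D) (f i)"
      using D Dc by (intro functional_sandwich)
    have fD: "f i a \<in> D" if "a \<in> carrier A" for a using fi that by (auto simp: functional_def)
    \<comment> \<open>The middle factor \<open>d'\<close> makes this set stable under multiplication
      from the right too.\<close>
    have "\<one> \<in> {d \<in> D. \<forall>d'\<in>D. d \<otimes> d' \<otimes> c \<in> D}"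
    proof (rule simple_subring_one [OF D(3,1)])
      fix x v assume x: "x \<in> {d \<in> D. \<forall>d'\<in>D. d \<otimes> d' \<otimes> c \<in> D}" 
      then have xc: "x \<in> D" "x \<in> carrier A" using Dc by auto
      { assume v: "v \<in> D"
        then have vc: "v \<in> carrier A" using Dc by auto
        have "v \<otimes> x \<otimes> d' \<otimes> c \<in> D" if d': "d' \<in> D" for d'
        proof -
          have "v \<otimes> (x \<otimes> d' \<otimes> c) \<in> D" using x d' v subringE(6)[OF D(1)] by auto
          then show ?thesis using xc vc cc d' Dc by (simp add: m_assoc subset_iff)
        qed
        then show "v \<otimes> x \<in> {d \<in> D. \<forall>d'\<in>D. d \<otimes> d' \<otimes> c \<in> D}" using xc v subringE(6)[OF D(1)] by auto
        have "x \<otimes> v \<otimes> d' \<otimes> c \<in> D" if d': "d' \<in> D" for d'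
        proof -
          have "x \<otimes> (v \<otimes> d') \<otimes> c \<in> D" using x d' v subringE(6)[OF D(1)] by auto
          then show ?thesis using xc vc cc d' Dc by (simp add: m_assoc subset_iff)
        qed
        then show "x \<otimes> v \<in> {d \<in> D. \<forall>d'\<in>D. d \<otimes> d' \<otimes> c \<in> D}" using xc v subringE(6)[OF D(1)] by auto }
      { assume v: "v \<in> {d \<in> D. \<forall>d'\<in>D. d \<otimes> d' \<otimes> c \<in> D}"
        then have vc: "v \<in> D" "v \<in> carrier A" using Dc by auto
        have "(x \<oplus> v) \<otimes> d' \<otimes> c \<in> D" if d': "d' \<in> D" for d'
        proof -
          have "x \<otimes> d' \<otimes> c \<oplus> v \<otimes> d' \<otimes> c \<in> D" using x d' v subringE(7)[OF D(1)] by auto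
          then show ?thesis using xc vc cc d' Dc by (simp add: l_distr subset_iff)
        qed
        then show "x \<oplus> v \<in> {d \<in> D. \<forall>d'\<in>D. d \<otimes> d' \<otimes> c \<in> D}" using xc vc subringE(7)[OF D(1)] by auto }
    next
      have "f i \<one> \<otimes> d' \<otimes> c \<in> D" if d': "d' \<in> D" for d'
      proof -
        have d'c: "d' \<in> carrier A" using d' Dc by auto
        have "f i \<one> \<otimes> d' = f i d'"
          using fi d' d'c by (metis functional_def right_linear_def one_closed l_one)
        moreover have "f i (d' \<otimes> c) = f i d' \<otimes> c"
          by (rule sandwich_right_linear [OF _ _ sw d'c cc]) (use c centralizer_carrier centralizer_comm in auto)
        ultimately show ?thesis using fD [of "d' \<otimes> c"] d'c cc by simp
      qed
      then show "f i \<one> \<in> {d \<in> D. \<forall>d'\<in>D. d \<otimes> d' \<otimes> c \<in> D}" using fD by auto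
    qed (use i in auto)
    then have "\<one> \<otimes> \<one> \<otimes> c \<in> D" using subringE(3)[OF D(1)] by blast
    then show "c \<in> D" using cc by simp
  qed
qed

text \<open>An ideal \<open>Q\<close> of the centralizer \<open>V\<close> is transported to an ideal
  \<open>T\<close> of \<open>D\<close>, in the manner of a Morita context. If
  \<open>q \<in> Q\<close> and \<open>g\<close> is a functional, then
  \<open>f i q \<otimes> g a = f i (g a \<otimes> q)\<close>, and the right coefficients of this map
  lie in \<open>V Q V\<close>, hence in \<open>Q\<close>. So \<open>f i q \<in> T\<close>, and it is
  nonzero for a suitable \<open>i\<close>. With \<open>\<one> \<in> T\<close> the dual basis
  represents the identity of \<open>A\<close> with right coefficients in \<open>Q\<close>, and
  \<open>right_mult_sandwich\<close> gives \<open>\<one> \<in> Q\<close>.\<close>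

lemma centralizer_simple:
  assumes D: "subring D A" "B \<subseteq> D" "simple_ring (A\<lparr>carrier := D\<rparr>)" and db: "dual_basis D I y f"
  shows "simple_ring (A\<lparr>carrier := centralizer A D\<rparr>)"
proof (rule simple_subringI [OF _ one_not_zero])
  have Dc: "D \<subseteq> carrier A" using D(1) by (rule subringE)
  let ?V = "centralizer A D"
  show V: "subring ?V A" using Dc by (rule centralizer_subring)
  have ZV: "Z \<subseteq> ?V" using Dc by (rule center_le_centralizer)
  fix Q q assume Q: "Q \<subseteq> ?V" and add: "\<And>x y. x \<in> Q \<Longrightarrow> y \<in> Q \<Longrightarrow> x \<oplus> y \<in> Q"
    and l: "\<And>v x. v \<in> ?V \<Longrightarrow> x \<in> Q \<Longrightarrow> v \<otimes> x \<in> Q"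
    and r: "\<And>v x. v \<in> ?V \<Longrightarrow> x \<in> Q \<Longrightarrow> x \<otimes> v \<in> Q"
    and q: "q \<in> Q" "q \<noteq> \<zero>"
  have Qc: "Q \<subseteq> carrier A" using Q centralizer_sub by blast
  have Qs: "central_subspace Q"
    by (rule central_subspaceI [OF V ZV Q add _ q(1)]) (use l ZV in auto)
  have Vc: "?V \<subseteq> carrier A" by (rule centralizer_sub)
  \<comment> \<open>Quantifying over \<open>x\<close> and \<open>g\<close> makes \<open>T\<close>
    two-sided: \<open>x\<close> absorbs multiplication of \<open>d\<close> from the left, and
    \<open>d' g\<close> is again a functional.\<close>
  define T where "T = {d \<in> D. \<forall>x\<in>carrier A. \<forall>g. functional D g \<longrightarrow> sandwich (carrier A) Q (\<lambda>a. x \<otimes> d \<otimes> g a)}"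
  have TI: "d \<in> T" if "d \<in> D" "\<And>x g. x \<in> carrier A \<Longrightarrow> functional D g \<Longrightarrow> sandwich (carrier A) Q (\<lambda>a. x \<otimes> d \<otimes> g a)" for d
    using that by (auto simp: T_def)
  have TD: "sandwich (carrier A) Q (\<lambda>a. x \<otimes> d \<otimes> g a)" if "d \<in> T" "x \<in> carrier A" "functional D g" for x d g
    using that by (auto simp: T_def)
  have gD: "g a \<in> D" "g a \<in> carrier A" if "functional D g" "a \<in> carrier A" for g a
    using that Dc by (auto simp: functional_def)
  have qc: "q \<in> carrier A" "q \<in> ?V" using q Q Qc by auto
  obtain i where i: "i \<in> I" "f i q \<noteq> \<zero>"
    using dual_basis_nonzero [OF db qc(1) q(2)] by blast
  have fi: "functional D (f i)" using db i by (simp add: dual_basis_def)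
  have "\<one> \<in> T"
  proof (rule simple_subring_one [OF D(3,1)])
    show "T \<subseteq> D" by (auto simp: T_def)
    show "f i q \<noteq> \<zero>" by fact
    show "f i q \<in> T"
    proof (rule TI)
      show "f i q \<in> D" using gD fi qc by blast
      fix x g assume x: "x \<in> carrier A" and g: "functional D g"
      have "sandwich (carrier A) Q (\<lambda>a. \<one> \<otimes> g a \<otimes> q)"
        by (rule sandwich_outer [OF functional_sandwich [OF D(2) Dc g] subset_refl Vc])
          (use qc l q in auto)
      then have "sandwich (carrier A) Q (\<lambda>a. f i (\<one> \<otimes> g a \<otimes> q))"
        by (rule sandwich_comp [OF functional_sandwich [OF D(2) Dc fi]]) (use Vc Qc r in auto)
      then have "sandwich (carrier A) Q (\<lambda>a. x \<otimes> f i (\<one> \<otimes> g a \<otimes> q) \<otimes> \<one>)"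
        by (rule sandwich_outer) (use Qc x in auto)
      moreover have "x \<otimes> f i (\<one> \<otimes> g a \<otimes> q) \<otimes> \<one> = x \<otimes> f i q \<otimes> g a" if a: "a \<in> carrier A" for a
      proof -
        have ga: "g a \<in> D" "g a \<in> carrier A" using gD g a by auto
        have "\<one> \<otimes> g a \<otimes> q = q \<otimes> g a" using centralizer_comm [OF qc(2) ga(1)] ga by simp
        then have "f i (\<one> \<otimes> g a \<otimes> q) = f i q \<otimes> g a"
          using fi ga qc by (simp add: functional_def right_linear_def)
        then show ?thesis using x ga gD(2)[OF fi qc(1)] by (simp add: m_assoc)
      qed
      ultimately show "sandwich (carrier A) Q (\<lambda>a. x \<otimes> f i q \<otimes> g a)"
        by (rule sandwich_eq)
    qed
    fix d d' assume d: "d \<in> T"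
    then have dD: "d \<in> D" "d \<in> carrier A" using Dc by (auto simp: T_def)
    { assume d': "d' \<in> T"
      then have d'D: "d' \<in> D" "d' \<in> carrier A" using Dc by (auto simp: T_def)
      show "d \<oplus> d' \<in> T"
      proof (rule TI)
        fix x g assume x: "x \<in> carrier A" and g: "functional D g"
        have "sandwich (carrier A) Q (\<lambda>a. x \<otimes> d \<otimes> g a \<oplus> x \<otimes> d' \<otimes> g a)"
          using TD d d' x g Qc by (intro sandwich_plus) auto
        moreover have "x \<otimes> d \<otimes> g a \<oplus> x \<otimes> d' \<otimes> g a = x \<otimes> (d \<oplus> d') \<otimes> g a" if "a \<in> carrier A" for a
          using x dD d'D gD [OF g that] by (simp add: l_distr r_distr)
        ultimately show "sandwich (carrier A) Q (\<lambda>a. x \<otimes> (d \<oplus> d') \<otimes> g a)"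
          by (rule sandwich_eq)
      qed (use dD d'D subringE(7)[OF D(1)] in auto) }
    { assume d': "d' \<in> D"
      then have d'c: "d' \<in> carrier A" using Dc by auto
      show "d' \<otimes> d \<in> T"
      proof (rule TI)
        fix x g assume x: "x \<in> carrier A" and g: "functional D g"
        show "sandwich (carrier A) Q (\<lambda>a. x \<otimes> (d' \<otimes> d) \<otimes> g a)"
          using TD [OF d _ g, of "x \<otimes> d'"] x d'c dD by (simp add: m_assoc)
      qed (use dD d' subringE(6)[OF D(1)] in auto)
      show "d \<otimes> d' \<in> T"
      proof (rule TI)
        fix x g assume x: "x \<in> carrier A" and g: "functional D g"
        have "functional D (\<lambda>a. d' \<otimes> g a)"
          unfolding functional_def right_linear_def
        proof (intro conjI ballI Pi_I image_subsetI)
          fix a b assume ab: "a \<in> carrier A" "b \<in> carrier A"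
          show "d' \<otimes> g (a \<oplus> b) = d' \<otimes> g a \<oplus> d' \<otimes> g b"
            using g ab gD(2)[OF g] d'c by (simp add: functional_def right_linear_def r_distr)
        next
          fix a b assume a: "a \<in> carrier A" and b: "b \<in> D"
          then have "b \<in> carrier A" using Dc by auto
          then show "d' \<otimes> g (a \<otimes> b) = d' \<otimes> g a \<otimes> b"
            using g a b gD(2)[OF g a] d'c by (simp add: functional_def right_linear_def m_assoc)
        qed (use gD [OF g] d' d'c subringE(6)[OF D(1)] in auto)
        from TD [OF d x this] have "sandwich (carrier A) Q (\<lambda>a. x \<otimes> d \<otimes> (d' \<otimes> g a))" .
        moreover have "x \<otimes> d \<otimes> (d' \<otimes> g a) = x \<otimes> (d \<otimes> d') \<otimes> g a" if "a \<in> carrier A" for a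
          using x dD d'c gD [OF g that] by (simp add: m_assoc)
        ultimately show "sandwich (carrier A) Q (\<lambda>a. x \<otimes> (d \<otimes> d') \<otimes> g a)"
          by (rule sandwich_eq)
      qed (use dD d' subringE(6)[OF D(1)] in auto) }
  qed
  have fI: "finite I" and yI: "\<And>k. k \<in> I \<Longrightarrow> y k \<in> carrier A" and fk: "\<And>k. k \<in> I \<Longrightarrow> functional D (f k)"
    and rep: "\<And>a. a \<in> carrier A \<Longrightarrow> a = (\<Oplus>i\<in>I. y i \<otimes> f i a)"
    using db unfolding dual_basis_def by blast+
  \<comment> \<open>Each summand of the dual basis expansion is an instance of
    \<open>\<one> \<in> T\<close>, whence the inserted factor \<open>\<one>\<close>.\<close>
  have "sandwich (carrier A) Q (\<lambda>a. \<Oplus>k\<in>I. y k \<otimes> \<one> \<otimes> f k a)"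
    by (rule sandwich_finsum) (use TD [OF \<open>\<one> \<in> T\<close> yI fk] Qc fI in auto)
  moreover have "(\<Oplus>k\<in>I. y k \<otimes> \<one> \<otimes> f k a) = a \<otimes> \<one>" if a: "a \<in> carrier A" for a
  proof -
    have "(\<Oplus>k\<in>I. y k \<otimes> \<one> \<otimes> f k a) = (\<Oplus>k\<in>I. y k \<otimes> f k a)"
      by (rule finsum_cong') (use yI gD [OF fk a] in auto)
    then show ?thesis using rep [OF a, symmetric] a by simp
  qed
  ultimately have "sandwich (carrier A) Q (\<lambda>a. a \<otimes> \<one>)"
    by (rule sandwich_eq)
  then show "\<one> \<in> Q" by (rule right_mult_sandwich [OF one_closed Qs])
qed

end

lemma (in abelian_monoid) finsum_Times:
  assumes "finite I" "finite J" "\<And>i j. i \<in> I \<Longrightarrow> j \<in> J \<Longrightarrow> f i j \<in> carrier G"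
  shows "(\<Oplus>i\<in>I. \<Oplus>j\<in>J. f i j) = (\<Oplus>p\<in>I \<times> J. f (fst p) (snd p))"
  using assms
proof (induction I rule: finite_induct)
  case empty then show ?case by simp
next
  case (insert i I)
  have "(\<Oplus>k\<in>insert i I. \<Oplus>j\<in>J. f k j) = (\<Oplus>j\<in>J. f i j) \<oplus> (\<Oplus>k\<in>I. \<Oplus>j\<in>J. f k j)"
    by (rule finsum_insert) (use insert in \<open>auto intro!: finsum_closed\<close>)
  also have "(\<Oplus>j\<in>J. f i j) = (\<Oplus>p\<in>Pair i ` J. f (fst p) (snd p))"
    by (subst finsum_reindex) (use insert in \<open>auto simp: inj_on_def\<close>)
  also have "(\<Oplus>k\<in>I. \<Oplus>j\<in>J. f k j) = (\<Oplus>p\<in>I \<times> J. f (fst p) (snd p))"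
    using insert by simp
  also have "(\<Oplus>p\<in>Pair i ` J. f (fst p) (snd p)) \<oplus> (\<Oplus>p\<in>I \<times> J. f (fst p) (snd p))
      = (\<Oplus>p\<in>Pair i ` J \<union> I \<times> J. f (fst p) (snd p))"
    by (rule finsum_Un_disjoint [symmetric]) (use insert in auto)
  also have "Pair i ` J \<union> I \<times> J = insert i I \<times> J" by auto
  finally show ?case .
qed

section \<open>Pivots, minimal right ideals and finite modules over a simple algebra\<close>

context simple begin

text \<open>Pivot positions of \<open>W\<close> relative to a finite family \<open>r\<close>: those
  \<open>k\<close> for which \<open>W\<close> contains a combination of the members up to
  \<open>k\<close> with coefficient \<open>\<one>\<close> at \<open>k\<close>. The family may be
  dependent, so the number of pivots is not the dimension, but it is at most \<open>n\<close> and,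
  by the next lemma, it distinguishes nested subspaces of the span.\<close>

definition lead :: "nat \<Rightarrow> (nat \<Rightarrow> 'a) \<Rightarrow> 'a set \<Rightarrow> nat set" where
  "lead n r W = {k. k < n \<and> (\<exists>w\<in>W. \<exists>z\<in>{..<n} \<rightarrow> Z. w = (\<Oplus>i\<in>{..<Suc k}. z i \<otimes> r i) \<and> z k = \<one>)}"

text \<open>Gaussian elimination. If \<open>z k\<close> is nonzero, then after division
  \<open>k\<close> is a pivot of \<open>W2\<close>, hence of \<open>W1\<close>; subtracting
  \<open>z k\<close> times a pivot element of \<open>W1\<close> leaves an element of
  \<open>W2\<close> that uses only the first \<open>k\<close> positions.\<close>

lemma lead_subspace_eq:
  assumes W: "central_subspace W1" "central_subspace W2" "W1 \<subseteq> W2" "lead n r W1 = lead n r W2"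
    and r: "r \<in> {..<n} \<rightarrow> carrier A"
    and "w \<in> W2" "z \<in> {..<n} \<rightarrow> Z" "k \<le> n" "w = (\<Oplus>i\<in>{..<k}. z i \<otimes> r i)"
  shows "w \<in> W1"
  using assms(6-)
proof (induction k arbitrary: w z)
  case 0
  then show ?case using W(1) by (simp add: central_subspace_def additive_subgroup.zero_closed)
next
  case (Suc k)
  have kn: "k < n" using Suc.prems by simp
  have rc: "\<And>i. i < Suc k \<Longrightarrow> r i \<in> carrier A" "\<And>i. i < Suc k \<Longrightarrow> z i \<in> Z"
    "\<And>i. i < Suc k \<Longrightarrow> z i \<in> carrier A"
    using r Suc.prems kn by (auto simp: Pi_def)
  interpret W1: additive_subgroup W1 A using W by (simp add: central_subspace_def)
  interpret W2: additive_subgroup W2 A using W by (simp add: central_subspace_def)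
  have split: "(\<Oplus>i\<in>{..<Suc k}. y i \<otimes> r i) = y k \<otimes> r k \<oplus> (\<Oplus>i\<in>{..<k}. y i \<otimes> r i)"
    if "y \<in> {..<n} \<rightarrow> Z" for y
    unfolding lessThan_Suc by (rule finsum_insert) (use that rc kn in \<open>auto simp: Pi_def\<close>)
  show ?case
  proof (cases "z k = \<zero>")
    case True
    then have "w = (\<Oplus>i\<in>{..<k}. z i \<otimes> r i)"
      using split [OF Suc.prems(2)] Suc.prems(4) rc by (simp add: finsum_closed)
    then show ?thesis using Suc.IH Suc.prems kn by auto
  next
    case False
    obtain p where p: "p \<in> Z" "p \<otimes> z k = \<one>" using center_inverse [OF rc(2) False] by blast
    have ZZ: "\<And>x y. x \<in> Z \<Longrightarrow> y \<in> Z \<Longrightarrow> x \<otimes> y \<in> Z" "\<And>x y. x \<in> Z \<Longrightarrow> y \<in> Z \<Longrightarrow> x \<ominus> y \<in> Z"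
      using subringE(5-7)[OF center_subring] by (auto simp: a_minus_def)
    have "p \<otimes> w \<in> W2" using p W(2) Suc.prems(1) by (simp add: central_subspace_def)
    moreover have "p \<otimes> w = (\<Oplus>i\<in>{..<Suc k}. (p \<otimes> z i) \<otimes> r i)"
    proof -
      have "p \<otimes> w = (\<Oplus>i\<in>{..<Suc k}. p \<otimes> (z i \<otimes> r i))"
        unfolding Suc.prems(4) by (rule finsum_rdistr) (use rc p in auto)
      also have "\<dots> = (\<Oplus>i\<in>{..<Suc k}. (p \<otimes> z i) \<otimes> r i)"
        by (rule finsum_cong') (use rc p in \<open>auto simp: m_assoc\<close>)
      finally show ?thesis .
    qed
    moreover have "(\<lambda>i. p \<otimes> z i) \<in> {..<n} \<rightarrow> Z" using p Suc.prems(2) ZZ by (auto simp: Pi_def)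
    ultimately have "\<exists>w\<in>W2. \<exists>z\<in>{..<n} \<rightarrow> Z. w = (\<Oplus>i\<in>{..<Suc k}. z i \<otimes> r i) \<and> z k = \<one>"
      using p(2) by (intro bexI [of _ "p \<otimes> w"] bexI [of _ "\<lambda>i. p \<otimes> z i"]) auto
    then have "k \<in> lead n r W2" using kn by (simp add: lead_def)
    then have "k \<in> lead n r W1" using W by simp
    then obtain u z' where u: "u \<in> W1" "z' \<in> {..<n} \<rightarrow> Z" "u = (\<Oplus>i\<in>{..<Suc k}. z' i \<otimes> r i)" "z' k = \<one>"
      by (auto simp: lead_def)
    have z'c: "\<And>i. i < Suc k \<Longrightarrow> z' i \<in> Z" using u(2) kn by (auto simp: Pi_def)
    have zku: "z k \<otimes> u \<in> W1" using u(1) rc W(1) by (simp add: central_subspace_def)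
    have sc: "(\<Oplus>i\<in>{..<k}. z i \<otimes> r i) \<in> carrier A" "(\<Oplus>i\<in>{..<k}. z' i \<otimes> r i) \<in> carrier A"
      using rc z'c by (auto intro!: finsum_closed)
    have wc: "w \<in> carrier A" using Suc.prems(1) W2.a_Hcarr by blast
    have "w \<ominus> z k \<otimes> u \<in> W1"
    proof (rule Suc.IH)
      show "(\<lambda>i. z i \<ominus> z k \<otimes> z' i) \<in> {..<n} \<rightarrow> Z"
        using Suc.prems(2) u(2) kn ZZ by (auto simp: Pi_def)
      have "\<ominus> (z k \<otimes> u) \<in> W2" using zku W(3) by auto
      then show "w \<ominus> z k \<otimes> u \<in> W2" using Suc.prems(1) by (auto simp: a_minus_def)
      have "z k \<otimes> u = z k \<otimes> r k \<oplus> z k \<otimes> (\<Oplus>i\<in>{..<k}. z' i \<otimes> r i)"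
        unfolding u(3) split [OF u(2)] u(4) using rc sc by (simp add: r_distr)
      then have "w \<ominus> z k \<otimes> u = (\<Oplus>i\<in>{..<k}. z i \<otimes> r i) \<ominus> z k \<otimes> (\<Oplus>i\<in>{..<k}. z' i \<otimes> r i)"
        unfolding Suc.prems(4) split [OF Suc.prems(2)] using rc sc
        by (simp add: a_minus_def minus_add a_ac r_neg r_neg2)
      also have "z k \<otimes> (\<Oplus>i\<in>{..<k}. z' i \<otimes> r i) = (\<Oplus>i\<in>{..<k}. z k \<otimes> (z' i \<otimes> r i))"
        by (rule finsum_rdistr) (use rc z'c in auto)
      also have "(\<Oplus>i\<in>{..<k}. z i \<otimes> r i) \<ominus> (\<Oplus>i\<in>{..<k}. z k \<otimes> (z' i \<otimes> r i))
          = (\<Oplus>i\<in>{..<k}. z i \<otimes> r i \<oplus> \<ominus> (z k \<otimes> (z' i \<otimes> r i)))"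
        unfolding a_minus_def using rc z'c
        by (subst finsum_minus) (auto intro!: finsum_addf [symmetric])
      also have "\<dots> = (\<Oplus>i\<in>{..<k}. (z i \<ominus> z k \<otimes> z' i) \<otimes> r i)"
        by (rule finsum_cong') (use rc z'c in \<open>auto simp: a_minus_def l_distr l_minus m_assoc\<close>)
      finally show "w \<ominus> z k \<otimes> u = (\<Oplus>i\<in>{..<k}. (z i \<ominus> z k \<otimes> z' i) \<otimes> r i)" .
    qed (use kn in simp)
    then have "(w \<ominus> z k \<otimes> u) \<oplus> z k \<otimes> u \<in> W1" using zku by simp
    moreover have "(w \<ominus> z k \<otimes> u) \<oplus> z k \<otimes> u = w"
      using wc W1.a_Hcarr [OF zku] by (simp add: a_minus_def a_assoc l_neg)
    ultimately show ?thesis by simp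
  qed
qed

definition right_ideal :: "'a set \<Rightarrow> 'a set \<Rightarrow> bool" where
  "right_ideal V W \<longleftrightarrow> W \<subseteq> V \<and> (\<forall>x\<in>W. \<forall>y\<in>W. x \<oplus> y \<in> W) \<and> (\<forall>x\<in>W. \<forall>v\<in>V. x \<otimes> v \<in> W)
     \<and> (\<exists>x\<in>W. x \<noteq> \<zero>)"

lemma right_ideal_subspace:
  assumes V: "subring V A" "Z \<subseteq> V" and W: "right_ideal V W"
  shows "central_subspace W"
proof -
  obtain x where x: "x \<in> W" using W by (auto simp: right_ideal_def)
  have "v \<otimes> x \<in> W" if v: "v \<in> Z" and x: "x \<in> W" for v x
  proof -
    have "v \<otimes> x = x \<otimes> v"
      by (rule center_comm) (use v x W subringE(1)[OF V(1)] in \<open>auto simp: right_ideal_def\<close>)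
    moreover have "x \<otimes> v \<in> W" using v x W V(2) by (auto simp: right_ideal_def)
    ultimately show ?thesis by simp
  qed
  then show ?thesis
    by (intro central_subspaceI [OF V _ _ _ x]) (use W V(2) in \<open>auto simp: right_ideal_def subset_iff\<close>)
qed

text \<open>A nonzero right ideal with the fewest pivots is minimal, since an ideal inside it has
  the same pivots and therefore equals it.\<close>

lemma minimal_right_ideal:
  fixes r :: "nat \<Rightarrow> 'a" and n :: nat
  assumes V: "subring V A" "Z \<subseteq> V"
    and fg: "r \<in> {..<n} \<rightarrow> carrier A" "\<And>v. v \<in> V \<Longrightarrow> \<exists>z\<in>{..<n} \<rightarrow> Z. v = (\<Oplus>i\<in>{..<n}. z i \<otimes> r i)"
  obtains U where "right_ideal V U" "\<And>W. right_ideal V W \<Longrightarrow> W \<subseteq> U \<Longrightarrow> W = U"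
proof -
  have "right_ideal V V"
    using subringE[OF V(1)] one_not_zero by (auto simp: right_ideal_def)
  then obtain U where U: "right_ideal V U"
    "\<And>W. right_ideal V W \<Longrightarrow> card (lead n r U) \<le> card (lead n r W)"
    using ex_has_least_nat [of "right_ideal V" V "\<lambda>W. card (lead n r W)"] by blast
  have "W = U" if W: "right_ideal V W" "W \<subseteq> U" for W
  proof
    have "lead n r W \<subseteq> lead n r U" using W(2) by (auto simp: lead_def)
    moreover have "finite (lead n r U)" by (auto simp: lead_def)
    ultimately have eq: "lead n r W = lead n r U" using U(2)[OF W(1)] card_seteq by blast
    show "U \<subseteq> W"
    proof
      fix u assume u: "u \<in> U"
      then obtain z where "z \<in> {..<n} \<rightarrow> Z" "u = (\<Oplus>i\<in>{..<n}. z i \<otimes> r i)"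
        using fg(2) U(1) unfolding right_ideal_def by blast
      then show "u \<in> W"
        using lead_subspace_eq [OF right_ideal_subspace [OF V W(1)] right_ideal_subspace [OF V U(1)] W(2) eq fg(1) u]
        by blast
    qed
  qed (rule W(2))
  then show ?thesis using that U(1) by blast
qed

text \<open>A simple algebra \<open>V\<close> that is finite over \<open>Z\<close> is semisimple: every module \<open>M\<close> that is finite
  over \<open>Z\<close> is a direct sum of copies \<open>m\<^sub>l U\<close> of a minimal right ideal \<open>U\<close>, the summands being given
  by a spanning family of minimal size. Composing with \<open>U \<subseteq> V\<close> yields a dual basis of \<open>M\<close> over \<open>V\<close>.\<close>

lemma finite_module_dual_basis:
  fixes r :: "nat \<Rightarrow> 'a" and n :: nat
  assumes V: "subring V A" "Z \<subseteq> V" "simple_ring (A\<lparr>carrier := V\<rparr>)"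
    and M: "subring M A" "V \<subseteq> M"
    and fg: "r \<in> {..<n} \<rightarrow> M" "\<And>x. x \<in> M \<Longrightarrow> \<exists>z\<in>{..<n} \<rightarrow> Z. x = (\<Oplus>i\<in>{..<n}. z i \<otimes> r i)"
  obtains L :: "(nat \<times> nat) set" and m \<pi> where "finite L" "m \<in> L \<rightarrow> M"
    "\<And>l x. l \<in> L \<Longrightarrow> x \<in> M \<Longrightarrow> \<pi> l x \<in> V"
    "\<And>l x y. l \<in> L \<Longrightarrow> x \<in> M \<Longrightarrow> y \<in> M \<Longrightarrow> \<pi> l (x \<oplus> y) = \<pi> l x \<oplus> \<pi> l y"
    "\<And>l x v. l \<in> L \<Longrightarrow> x \<in> M \<Longrightarrow> v \<in> V \<Longrightarrow> \<pi> l (x \<otimes> v) = \<pi> l x \<otimes> v"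
    "\<And>x. x \<in> M \<Longrightarrow> x = (\<Oplus>l\<in>L. m l \<otimes> \<pi> l x)"
proof -
  have Mc: "M \<subseteq> carrier A" using M(1) by (rule subringE)
  have Vc: "V \<subseteq> carrier A" using V(1) by (rule subringE)
  have rc: "r \<in> {..<n} \<rightarrow> carrier A" using fg(1) Mc by auto
  obtain U where U: "right_ideal V U" and Umin: "\<And>W. right_ideal V W \<Longrightarrow> W \<subseteq> U \<Longrightarrow> W = U"
    by (rule minimal_right_ideal [OF V(1,2) rc]) (rule fg(2), erule subsetD [OF M(2)], rule that)
  have UV: "U \<subseteq> V" and Ur: "\<And>u v. u \<in> U \<Longrightarrow> v \<in> V \<Longrightarrow> u \<otimes> v \<in> U"
    using U by (auto simp: right_ideal_def)
  have Us: "central_subspace U" using V U by (intro right_ideal_subspace) auto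
  interpret Ug: additive_subgroup U A using Us by (simp add: central_subspace_def)
  have Uc: "U \<subseteq> carrier A" using UV Vc by blast
  \<comment> \<open>This is the two-sided ideal \<open>V U\<close> of \<open>V\<close>, its elements
    being written as values at \<open>\<one>\<close> of sandwich maps. It contains
    \<open>u0\<close>, so \<open>\<one> = \<Sum> p\<^sub>i q\<^sub>i\<close> with all
    \<open>q\<^sub>i\<close> in \<open>U\<close>.\<close>
  define T where "T = {\<alpha> \<one> | \<alpha>. sandwich V U \<alpha>}"
  obtain u0 where u0: "u0 \<in> U" "u0 \<noteq> \<zero>" using U by (auto simp: right_ideal_def)
  have "\<one> \<in> T"
  proof (rule simple_subring_one [OF V(3,1)])
    show "T \<subseteq> V"
    proof
      fix x assume "x \<in> T"
      then obtain \<alpha> where \<alpha>: "x = \<alpha> \<one>" "sandwich V U \<alpha>" by (auto simp: T_def)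
      from \<alpha>(2) obtain I :: "nat set" and p q where "finite I" "p \<in> I \<rightarrow> V" "q \<in> I \<rightarrow> U"
        "\<And>a. a \<in> carrier A \<Longrightarrow> \<alpha> a = (\<Oplus>i\<in>I. p i \<otimes> a \<otimes> q i)" by (rule sandwichE) (rule that)
      moreover from this have "p i \<otimes> \<one> \<otimes> q i \<in> V" if "i \<in> I" for i
        using that UV Vc subringE(6)[OF V(1)] by (simp add: Pi_def subset_iff)
      ultimately show "x \<in> V" unfolding \<alpha>(1)
        by (auto intro!: additive_subgroup_finsum_closed [OF additive_subgroup.intro [OF subring.axioms(1)[OF V(1)]]])
    qed
    show "u0 \<noteq> \<zero>" by fact
    have "sandwich V U (\<lambda>a. \<one> \<otimes> a \<otimes> u0)"
      using u0 Vc Uc subringE(3)[OF V(1)] by (intro sandwich_single) auto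
    then show "u0 \<in> T" unfolding T_def using u0 Uc by (auto intro!: exI [of _ "\<lambda>a. \<one> \<otimes> a \<otimes> u0"])
    fix x v assume "x \<in> T"
    then obtain \<alpha> where \<alpha>: "x = \<alpha> \<one>" "sandwich V U \<alpha>" by (auto simp: T_def)
    have \<alpha>c: "\<alpha> \<one> \<in> carrier A" using sandwich_closed [OF Vc Uc \<alpha>(2)] by simp
    { assume v: "v \<in> V"
      then have vc: "v \<in> carrier A" using Vc by auto
      have "sandwich V U (\<lambda>a. v \<otimes> \<alpha> a \<otimes> \<one>)"
        by (rule sandwich_outer [OF \<alpha>(2) Vc Uc]) (use v vc Vc Uc subringE(6)[OF V(1)] in auto)
      then show "v \<otimes> x \<in> T" unfolding T_def \<alpha>(1)
        using \<alpha>c vc by (auto intro!: exI [of _ "\<lambda>a. v \<otimes> \<alpha> a \<otimes> \<one>"])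
      have "sandwich V U (\<lambda>a. \<one> \<otimes> \<alpha> a \<otimes> v)"
        by (rule sandwich_outer [OF \<alpha>(2) Vc Uc]) (use v vc Vc Uc Ur in auto)
      then show "x \<otimes> v \<in> T" unfolding T_def \<alpha>(1)
        using \<alpha>c vc by (auto intro!: exI [of _ "\<lambda>a. \<one> \<otimes> \<alpha> a \<otimes> v"]) }
    { assume "v \<in> T"
      then obtain \<beta> where \<beta>: "v = \<beta> \<one>" "sandwich V U \<beta>" by (auto simp: T_def)
      have "sandwich V U (\<lambda>a. \<alpha> a \<oplus> \<beta> a)" using \<alpha> \<beta> Vc Uc by (intro sandwich_plus) auto
      then show "x \<oplus> v \<in> T" unfolding T_def \<alpha>(1) \<beta>(1)
        by (intro CollectI exI [of _ "\<lambda>a. \<alpha> a \<oplus> \<beta> a"]) simp }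
  qed
  then obtain \<alpha> where \<alpha>: "\<one> = \<alpha> \<one>" "sandwich V U \<alpha>" by (auto simp: T_def)
  from \<alpha>(2) obtain I :: "nat set" and p q where I: "finite I" "p \<in> I \<rightarrow> V" "q \<in> I \<rightarrow> U"
    "\<And>a. a \<in> carrier A \<Longrightarrow> \<alpha> a = (\<Oplus>i\<in>I. p i \<otimes> a \<otimes> q i)" by (rule sandwichE) (rule that)
  have one: "\<one> = (\<Oplus>i\<in>I. p i \<otimes> \<one> \<otimes> q i)" using \<alpha>(1) I(4) by simp
  have pqc: "\<And>i. i \<in> I \<Longrightarrow> p i \<in> carrier A" "\<And>i. i \<in> I \<Longrightarrow> q i \<in> carrier A"
     "\<And>i. i \<in> {..<n} \<Longrightarrow> r i \<in> carrier A"
    using I Vc Uc rc by (auto simp: Pi_def)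
  \<comment> \<open>From \<open>z r = z r \<Sum> p\<^sub>j q\<^sub>j = \<Sum> (r p\<^sub>j) (z
    q\<^sub>j)\<close> for central \<open>z\<close>, the elements \<open>r\<^sub>i p\<^sub>j\<close>
    generate \<open>M\<close> with coefficients in \<open>U\<close>.\<close>
  define m where "m l = r (fst l) \<otimes> p (snd l)" for l
  define spans where "spans L \<longleftrightarrow> L \<subseteq> {..<n} \<times> I \<and> (\<forall>x\<in>M. \<exists>u\<in>L \<rightarrow> U. x = (\<Oplus>l\<in>L. m l \<otimes> u l))" for L
  have "spans ({..<n} \<times> I)" unfolding spans_def
  proof (intro conjI ballI subset_refl)
    fix x assume "x \<in> M"
    then obtain z where z: "z \<in> {..<n} \<rightarrow> Z" "x = (\<Oplus>i\<in>{..<n}. z i \<otimes> r i)" using fg(2) by blast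
    have zc: "\<And>i. i < n \<Longrightarrow> z i \<in> Z" using z by auto
    define u where "u l = z (fst l) \<otimes> q (snd l)" for l
    have uU: "u \<in> {..<n} \<times> I \<rightarrow> U" using Us I(3) zc by (auto simp: u_def central_subspace_def Pi_def)
    have "x = (\<Oplus>i\<in>{..<n}. \<Oplus>j\<in>I. m (i, j) \<otimes> u (i, j))"
      unfolding z(2)
    proof (rule finsum_cong')
      fix i assume i: "i \<in> {..<n}"
      have zr: "z i \<otimes> r i \<in> carrier A" using i pqc zc by auto
      have "z i \<otimes> r i = z i \<otimes> r i \<otimes> (\<Oplus>j\<in>I. p j \<otimes> \<one> \<otimes> q j)"
        using one zr by simp
      also have "\<dots> = (\<Oplus>j\<in>I. z i \<otimes> r i \<otimes> (p j \<otimes> \<one> \<otimes> q j))"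
        by (rule finsum_rdistr) (use I zr pqc in auto)
      also have "\<dots> = (\<Oplus>j\<in>I. m (i, j) \<otimes> u (i, j))"
      proof (rule finsum_cong')
        fix j assume j: "j \<in> I"
        have "z i \<otimes> r i \<otimes> (p j \<otimes> \<one> \<otimes> q j) = z i \<otimes> (r i \<otimes> p j) \<otimes> q j"
          using i j pqc zc by (simp add: m_assoc)
        also have "z i \<otimes> (r i \<otimes> p j) = (r i \<otimes> p j) \<otimes> z i"
          by (rule center_comm) (use i j pqc zc in auto)
        finally show "z i \<otimes> r i \<otimes> (p j \<otimes> \<one> \<otimes> q j) = m (i, j) \<otimes> u (i, j)"
          using i j pqc zc by (simp add: m_assoc m_def u_def)
      qed (use i pqc zc in \<open>auto simp: m_def u_def\<close>)
      finally show "z i \<otimes> r i = (\<Oplus>j\<in>I. m (i, j) \<otimes> u (i, j))" .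
    qed (use pqc zc in \<open>auto simp: m_def u_def intro!: finsum_closed\<close>)
    also have "\<dots> = (\<Oplus>l\<in>{..<n} \<times> I. m l \<otimes> u l)"
      by (subst finsum_Times) (use I pqc zc in \<open>auto simp: m_def u_def\<close>)
    finally show "\<exists>u\<in>{..<n} \<times> I \<rightarrow> U. x = (\<Oplus>l\<in>{..<n} \<times> I. m l \<otimes> u l)" using uU by blast
  qed
  then obtain L where L: "spans L" "\<And>L'. spans L' \<Longrightarrow> card L \<le> card L'"
    using ex_has_least_nat [of spans "{..<n} \<times> I" card] by blast
  have LI: "L \<subseteq> {..<n} \<times> I" using L(1) by (simp add: spans_def)
  have fL: "finite L" by (rule finite_subset [OF LI]) (use I in auto)
  have mM: "m l \<in> M" if "l \<in> L" for l
    using that LI fg(1) I(2) M(2) subringE(6)[OF M(1)]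
    by (cases l) (auto simp: m_def Pi_def subset_iff)
  have mc: "\<And>l. l \<in> L \<Longrightarrow> m l \<in> carrier A" using mM Mc by auto
  \<comment> \<open>Minimality of \<open>L\<close> against minimality of \<open>U\<close>: if
    \<open>u k\<close> is nonzero, then \<open>u k V = U\<close>, so any coefficient at
    \<open>k\<close> is \<open>u k v\<close> for some \<open>v\<close>. Subtracting the relation
    multiplied by \<open>v\<close> removes the index \<open>k\<close> from every expansion.\<close>
  have unique: "u k = \<zero>" if u: "u \<in> L \<rightarrow> U" "(\<Oplus>l\<in>L. m l \<otimes> u l) = \<zero>" and k: "k \<in> L" for u k
  proof (rule ccontr)
    assume uk: "u k \<noteq> \<zero>"
    have uc: "\<And>l. l \<in> L \<Longrightarrow> u l \<in> U" "\<And>l. l \<in> L \<Longrightarrow> u l \<in> carrier A" using u(1) Uc by auto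
    have "right_ideal V ((\<lambda>v. u k \<otimes> v) ` V)"
      unfolding right_ideal_def
    proof (intro conjI ballI)
      show "(\<lambda>v. u k \<otimes> v) ` V \<subseteq> V" using uc(1)[OF k] uc(2)[OF k] UV subringE(6)[OF V(1)] by auto
      have "u k \<otimes> \<one> \<in> (\<lambda>v. u k \<otimes> v) ` V" using subringE(3)[OF V(1)] by (rule imageI)
      then show "\<exists>x\<in>(\<lambda>v. u k \<otimes> v) ` V. x \<noteq> \<zero>"
        by (rule bexI [rotated]) (use uk uc(2)[OF k] in simp)
      fix x y assume x: "x \<in> (\<lambda>v. u k \<otimes> v) ` V"
      then obtain v where v: "v \<in> V" "x = u k \<otimes> v" by blast
      { assume "y \<in> (\<lambda>v. u k \<otimes> v) ` V"
        then obtain v' where v': "v' \<in> V" "y = u k \<otimes> v'" by blast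
        have "x \<oplus> y = u k \<otimes> (v \<oplus> v')" using v v' uc(1)[OF k] uc(2)[OF k] Vc by (simp add: r_distr subset_iff)
        then show "x \<oplus> y \<in> (\<lambda>v. u k \<otimes> v) ` V" using v v' subringE(7)[OF V(1)] by blast }
      { assume y: "y \<in> V"
        have "x \<otimes> y = u k \<otimes> (v \<otimes> y)" using v y uc(1)[OF k] uc(2)[OF k] Vc by (simp add: m_assoc subset_iff)
        then show "x \<otimes> y \<in> (\<lambda>v. u k \<otimes> v) ` V" using v y subringE(6)[OF V(1)] by blast }
    qed
    moreover have "(\<lambda>v. u k \<otimes> v) ` V \<subseteq> U" using uc(1)[OF k] uc(2)[OF k] Ur by auto
    ultimately have ukV: "(\<lambda>v. u k \<otimes> v) ` V = U" by (rule Umin)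
    have "spans (L - {k})" unfolding spans_def
    proof (intro conjI ballI)
      fix x assume "x \<in> M"
      then obtain w where w: "w \<in> L \<rightarrow> U" "x = (\<Oplus>l\<in>L. m l \<otimes> w l)"
        using L(1) unfolding spans_def by blast
      have wc: "\<And>l. l \<in> L \<Longrightarrow> w l \<in> U" "\<And>l. l \<in> L \<Longrightarrow> w l \<in> carrier A" using w(1) Uc by auto
      have "w k \<in> (\<lambda>v. u k \<otimes> v) ` V" using wc(1)[OF k] ukV by simp
      then obtain v where v: "v \<in> V" "w k = u k \<otimes> v" by blast
      have vc: "v \<in> carrier A" using v Vc by auto
      have cc: "m l \<otimes> w l \<in> carrier A" "m l \<otimes> u l \<otimes> v \<in> carrier A" if "l \<in> L" for l
        using that mc wc uc vc by auto
      have "x = (\<Oplus>l\<in>L. m l \<otimes> w l) \<ominus> (\<Oplus>l\<in>L. m l \<otimes> u l) \<otimes> v"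
        using w(2) u(2) vc cc by (simp add: a_minus_def finsum_closed)
      also have "(\<Oplus>l\<in>L. m l \<otimes> u l) \<otimes> v = (\<Oplus>l\<in>L. m l \<otimes> u l \<otimes> v)"
        by (rule finsum_ldistr) (use fL vc mc uc in auto)
      also have "(\<Oplus>l\<in>L. m l \<otimes> w l) \<ominus> (\<Oplus>l\<in>L. m l \<otimes> u l \<otimes> v)
          = (\<Oplus>l\<in>L. m l \<otimes> w l \<oplus> \<ominus> (m l \<otimes> u l \<otimes> v))"
        unfolding a_minus_def using fL cc
        by (subst finsum_minus) (auto intro!: finsum_addf [symmetric])
      also have "\<dots> = (\<Oplus>l\<in>L. m l \<otimes> (w l \<ominus> u l \<otimes> v))"
        by (rule finsum_cong') (use mc wc uc vc in \<open>auto simp: a_minus_def r_distr r_minus m_assoc\<close>)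
      also have "\<dots> = (\<Oplus>l\<in>insert k (L - {k}). m l \<otimes> (w l \<ominus> u l \<otimes> v))"
        using k by (simp add: insert_absorb)
      also have "\<dots> = m k \<otimes> (w k \<ominus> u k \<otimes> v) \<oplus> (\<Oplus>l\<in>L - {k}. m l \<otimes> (w l \<ominus> u l \<otimes> v))"
        by (rule finsum_insert) (use fL k mc wc uc vc in auto)
      also have "w k \<ominus> u k \<otimes> v = \<zero>" using v(2) uc(2)[OF k] vc by (simp add: a_minus_def r_neg)
      finally have "x = (\<Oplus>l\<in>L - {k}. m l \<otimes> (w l \<ominus> u l \<otimes> v))"
        using k mc wc uc vc mc[OF k] by (simp add: finsum_closed)
      moreover have "w l \<ominus> u l \<otimes> v \<in> U" if "l \<in> L" for l
        using that wc(1) Ur [OF uc(1) v(1)] by (simp add: a_minus_def)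
      ultimately show "\<exists>u\<in>L - {k} \<rightarrow> U. x = (\<Oplus>l\<in>L - {k}. m l \<otimes> u l)"
        by (intro bexI [of _ "\<lambda>l. w l \<ominus> u l \<otimes> v"]) auto
    qed (use LI in auto)
    then have "card L \<le> card (L - {k})" by (rule L(2))
    then show False using k fL by (metis card_Diff1_less leD)
  qed
  have "\<forall>x. \<exists>u. x \<in> M \<longrightarrow> u \<in> L \<rightarrow> U \<and> x = (\<Oplus>l\<in>L. m l \<otimes> u l)"
    using L(1) unfolding spans_def by blast
  then obtain \<rho> where \<rho>: "\<And>x. x \<in> M \<Longrightarrow> \<rho> x \<in> L \<rightarrow> U" "\<And>x. x \<in> M \<Longrightarrow> x = (\<Oplus>l\<in>L. m l \<otimes> \<rho> x l)"
    by metis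
  have \<rho>c: "\<rho> x l \<in> U" "\<rho> x l \<in> carrier A" if "x \<in> M" "l \<in> L" for x l
    using \<rho>(1)[OF that(1)] that(2) Uc by auto
  \<comment> \<open>Coordinates are unique, so the chosen \<open>\<rho>\<close> is automatically
    additive and \<open>V\<close>-linear.\<close>
  have eqI: "\<rho> x l = u l" if x: "x \<in> M" and u: "u \<in> L \<rightarrow> U" "x = (\<Oplus>l\<in>L. m l \<otimes> u l)" and l: "l \<in> L" for x u l
  proof -
    have uc: "\<And>l. l \<in> L \<Longrightarrow> u l \<in> U" "\<And>l. l \<in> L \<Longrightarrow> u l \<in> carrier A" using u(1) Uc by auto
    have cc: "m l \<otimes> \<rho> x l \<in> carrier A" "m l \<otimes> u l \<in> carrier A" if "l \<in> L" for l
      using that mc uc \<rho>c x by auto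
    have xc: "x \<in> carrier A" using x Mc by auto
    have "(\<Oplus>l\<in>L. m l \<otimes> (\<rho> x l \<ominus> u l)) = (\<Oplus>l\<in>L. m l \<otimes> \<rho> x l \<oplus> \<ominus> (m l \<otimes> u l))"
      by (rule finsum_cong') (use mc uc \<rho>c x in \<open>auto simp: a_minus_def r_distr r_minus\<close>)
    also have "\<dots> = (\<Oplus>l\<in>L. m l \<otimes> \<rho> x l) \<oplus> (\<Oplus>l\<in>L. \<ominus> (m l \<otimes> u l))"
      by (rule finsum_addf) (use cc in auto)
    also have "(\<Oplus>l\<in>L. \<ominus> (m l \<otimes> u l)) = \<ominus> (\<Oplus>l\<in>L. m l \<otimes> u l)"
      by (rule finsum_minus [symmetric]) (use fL cc in auto)
    finally have "(\<Oplus>l\<in>L. m l \<otimes> (\<rho> x l \<ominus> u l)) = \<zero>"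
      using \<rho>(2)[OF x, symmetric] u(2)[symmetric] xc by (simp add: r_neg)
    moreover have "(\<lambda>l. \<rho> x l \<ominus> u l) \<in> L \<rightarrow> U" using \<rho>c x uc by (auto simp: a_minus_def)
    ultimately have "\<rho> x l \<ominus> u l = \<zero>" using unique [of "\<lambda>l. \<rho> x l \<ominus> u l"] l by blast
    then show ?thesis using r_right_minus_eq \<rho>c x uc l by blast
  qed
  show ?thesis
  proof (rule that [of L m "\<lambda>l x. \<rho> x l"])
    show "finite L" by fact
    show "m \<in> L \<rightarrow> M" using mM by auto
    show "\<rho> x l \<in> V" if "l \<in> L" "x \<in> M" for l x using \<rho>c that UV by blast
    show "x = (\<Oplus>l\<in>L. m l \<otimes> \<rho> x l)" if "x \<in> M" for x using \<rho>(2) that by blast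
    show "\<rho> (x \<oplus> y) l = \<rho> x l \<oplus> \<rho> y l" if l: "l \<in> L" and x: "x \<in> M" and y: "y \<in> M" for l x y
    proof (rule eqI [OF _ _ _ l])
      show "x \<oplus> y \<in> M" using x y subringE(7)[OF M(1)] by blast
      show "(\<lambda>l. \<rho> x l \<oplus> \<rho> y l) \<in> L \<rightarrow> U" using \<rho>c x y by auto
      have "(\<Oplus>l\<in>L. m l \<otimes> (\<rho> x l \<oplus> \<rho> y l)) = (\<Oplus>l\<in>L. m l \<otimes> \<rho> x l \<oplus> m l \<otimes> \<rho> y l)"
        by (rule finsum_cong') (use mc \<rho>c x y in \<open>auto simp: r_distr\<close>)
      also have "\<dots> = (\<Oplus>l\<in>L. m l \<otimes> \<rho> x l) \<oplus> (\<Oplus>l\<in>L. m l \<otimes> \<rho> y l)"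
        by (rule finsum_addf) (use mc \<rho>c x y in auto)
      finally show "x \<oplus> y = (\<Oplus>l\<in>L. m l \<otimes> (\<rho> x l \<oplus> \<rho> y l))"
        using \<rho>(2)[OF x, symmetric] \<rho>(2)[OF y, symmetric] by simp
    qed
    show "\<rho> (x \<otimes> v) l = \<rho> x l \<otimes> v" if l: "l \<in> L" and x: "x \<in> M" and v: "v \<in> V" for l x v
    proof (rule eqI [OF _ _ _ l])
      have vc: "v \<in> carrier A" using v Vc by blast
      show "x \<otimes> v \<in> M" using x v M(2) subringE(6)[OF M(1)] by blast
      show "(\<lambda>l. \<rho> x l \<otimes> v) \<in> L \<rightarrow> U" using \<rho>c x Ur v by auto
      have "(\<Oplus>l\<in>L. m l \<otimes> (\<rho> x l \<otimes> v)) = (\<Oplus>l\<in>L. m l \<otimes> \<rho> x l \<otimes> v)"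
        by (rule finsum_cong') (use mc \<rho>c x vc in \<open>auto simp: m_assoc\<close>)
      also have "\<dots> = (\<Oplus>l\<in>L. m l \<otimes> \<rho> x l) \<otimes> v"
        by (rule finsum_ldistr [symmetric]) (use fL mc \<rho>c x vc in auto)
      finally show "x \<otimes> v = (\<Oplus>l\<in>L. m l \<otimes> (\<rho> x l \<otimes> v))"
        using \<rho>(2)[OF x, symmetric] by simp
    qed
  qed
qed

end

section \<open>Simple subalgebras of the centralizer\<close>

text \<open>The dual basis comes from projectivity of \<open>A\<close> over \<open>B\<close>.
  Finiteness of \<open>Rc\<close> over \<open>Z\<close> comes from H-separability: the coordinates
  of \<open>\<one> \<otimes> \<one>\<close> in \<open>A \<otimes>_B A\<close> span \<open>Rc\<close>
  with central coefficients.\<close>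

locale hs_separable = h_separable +
  assumes B_simple: "simple_ring (A\<lparr>carrier := B\<rparr>)"
    and B_dual: "\<exists>I y f. dual_basis B I y f"
    and Rc_finite: "\<exists>n::nat. \<exists>r\<in>{..<n} \<rightarrow> Rc. \<forall>x\<in>Rc. \<exists>z\<in>{..<n} \<rightarrow> Z. x = (\<Oplus>i\<in>{..<n}. z i \<otimes> r i)"
begin

context
  fixes V assumes V: "subring V A" "Z \<subseteq> V" "V \<subseteq> Rc" "simple_ring (A\<lparr>carrier := V\<rparr>)"
begin

lemma V_carrier: "V \<subseteq> carrier A" using V(1) by (rule subringE)
lemma V_subspace: "central_subspace V" using V by (intro subring_central_subspace)
lemma Rc_subring: "subring Rc A" unfolding Rc_def using B_carrier by (rule centralizer_subring)
lemma Rc_subspace: "central_subspace Rc" unfolding Rc_def using B_carrier by (rule centralizer_subspace)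

lemma B_le: "B \<subseteq> centralizer A V"
proof
  fix b assume b: "b \<in> B"
  show "b \<in> centralizer A V"
  proof (rule centralizerI)
    show "b \<in> carrier A" using b B_carrier by blast
    fix v assume "v \<in> V"
    then have "v \<in> centralizer A B" using V Rc_def by blast
    then show "b \<otimes> v = v \<otimes> b" using b centralizer_comm by metis
  qed
qed

text \<open>A map \<open>f = \<Sum> c\<^sub>i \<cdot> r\<^sub>i\<close> from \<open>A\<close> to \<open>B\<close> satisfies \<open>\<Sum> r c\<^sub>i \<otimes> r\<^sub>i = \<Sum> c\<^sub>i \<otimes> r\<^sub>i r\<close>, so that
  applying a \<open>V\<close>-linear map \<open>Rc \<rightarrow> V\<close> to the \<open>r\<^sub>i\<close> gives a map from \<open>A\<close> to the centralizer of \<open>V\<close>.\<close>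

lemma functional_transfer:
  assumes f: "functional B f"
    and \<pi>: "\<And>x. x \<in> Rc \<Longrightarrow> \<pi> x \<in> V" "\<And>x y. x \<in> Rc \<Longrightarrow> y \<in> Rc \<Longrightarrow> \<pi> (x \<oplus> y) = \<pi> x \<oplus> \<pi> y"
      "\<And>x v. x \<in> Rc \<Longrightarrow> v \<in> V \<Longrightarrow> \<pi> (x \<otimes> v) = \<pi> x \<otimes> v"
    and I: "finite (I :: nat set)" "c \<in> I \<rightarrow> carrier A" "r \<in> I \<rightarrow> Rc"
      "\<And>a. a \<in> carrier A \<Longrightarrow> f a = (\<Oplus>i\<in>I. c i \<otimes> a \<otimes> r i)"
    and a: "a \<in> carrier A"
  shows "(\<Oplus>i\<in>I. c i \<otimes> a \<otimes> \<pi> (r i)) \<in> centralizer A V"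
proof (rule centralizerI)
  have \<pi>c: "\<pi> x \<in> carrier A" if "x \<in> Rc" for x using \<pi>(1)[OF that] V_carrier by blast
  have cc: "\<And>i. i \<in> I \<Longrightarrow> c i \<in> carrier A" "\<And>i. i \<in> I \<Longrightarrow> r i \<in> Rc" "\<And>i. i \<in> I \<Longrightarrow> r i \<in> carrier A"
    using I Rc_sub by auto
  show "(\<Oplus>i\<in>I. c i \<otimes> a \<otimes> \<pi> (r i)) \<in> carrier A"
    using cc \<pi>c a by (auto intro!: finsum_closed)
  fix v assume v: "v \<in> V"
  then have vc: "v \<in> carrier A" "v \<in> Rc" using V_carrier V by auto
  \<comment> \<open>Linearity over \<open>Z\<close>, as \<open>sandwich_map\<close> requires it,
    follows from right linearity over \<open>V\<close> because \<open>Z\<close> lies in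
    \<open>V\<close> and its elements can change sides.\<close>
  have z: "\<pi> (z \<otimes> x) = z \<otimes> \<pi> x" if "z \<in> Z" "x \<in> Rc" for z x
  proof -
    have zV: "z \<in> V" using that V by auto
    have "z \<otimes> x = x \<otimes> z" using that Rc_sub by (intro center_comm) auto
    then have "\<pi> (z \<otimes> x) = \<pi> x \<otimes> z" using \<pi>(3) that zV by simp
    also have "\<dots> = z \<otimes> \<pi> x" using that \<pi>c by (intro center_comm [symmetric]) auto
    finally show ?thesis .
  qed
  \<comment> \<open>Since \<open>f\<close> has values in \<open>B\<close>,
    \<open>v f(b) = f(b) v\<close> for every \<open>b\<close>. Both sides are sandwich expressions
    with right coefficients in \<open>Rc\<close>, and \<open>sandwich_map\<close> carries the
    equality through \<open>\<pi>\<close>.\<close>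
  have "(\<Oplus>i\<in>I. (v \<otimes> c i) \<otimes> a \<otimes> \<pi> (r i)) = (\<Oplus>i\<in>I. c i \<otimes> a \<otimes> \<pi> (r i \<otimes> v))"
  proof (rule sandwich_map [where x = "\<lambda>i. v \<otimes> c i" and t = "\<lambda>i. r i \<otimes> v" and s = r, OF Rc_subspace \<pi>c \<pi>(2) z I(1) _ _ I(1) _ _ _ a])
    show "(\<lambda>i. v \<otimes> c i) \<in> I \<rightarrow> carrier A" using vc cc by auto
    show "(\<lambda>i. r i \<otimes> v) \<in> I \<rightarrow> Rc" using vc cc subringE(6)[OF Rc_subring] by auto
    fix b assume b: "b \<in> carrier A"
    have "f b \<in> B" using f b by (auto simp: functional_def)
    moreover have "v \<in> centralizer A B" using vc Rc_def by simp
    ultimately have comm: "v \<otimes> f b = f b \<otimes> v" by (intro centralizer_comm)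
    have "(\<Oplus>i\<in>I. (v \<otimes> c i) \<otimes> b \<otimes> r i) = (\<Oplus>i\<in>I. v \<otimes> (c i \<otimes> b \<otimes> r i))"
      by (rule finsum_cong') (use cc vc b in \<open>auto simp: m_assoc\<close>)
    also have "\<dots> = v \<otimes> f b" unfolding I(4)[OF b]
      by (rule finsum_rdistr [symmetric]) (use I cc vc b in auto)
    also have "v \<otimes> f b = f b \<otimes> v" by (rule comm)
    also have "\<dots> = (\<Oplus>i\<in>I. c i \<otimes> b \<otimes> r i \<otimes> v)" unfolding I(4)[OF b]
      by (rule finsum_ldistr) (use I cc vc b in auto)
    also have "\<dots> = (\<Oplus>i\<in>I. c i \<otimes> b \<otimes> (r i \<otimes> v))"
      by (rule finsum_cong') (use cc vc b in \<open>auto simp: m_assoc\<close>)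
    finally show "(\<Oplus>i\<in>I. (v \<otimes> c i) \<otimes> b \<otimes> r i) = (\<Oplus>i\<in>I. c i \<otimes> b \<otimes> (r i \<otimes> v))" .
  qed (use I in auto)
  also have "(\<Oplus>i\<in>I. c i \<otimes> a \<otimes> \<pi> (r i \<otimes> v)) = (\<Oplus>i\<in>I. c i \<otimes> a \<otimes> \<pi> (r i) \<otimes> v)"
    by (rule finsum_cong') (use cc vc a v \<pi>(3) \<pi>c in \<open>auto simp: m_assoc\<close>)
  also have "\<dots> = (\<Oplus>i\<in>I. c i \<otimes> a \<otimes> \<pi> (r i)) \<otimes> v"
    by (rule finsum_ldistr [symmetric]) (use I cc vc a \<pi>c in auto)
  finally have "(\<Oplus>i\<in>I. (v \<otimes> c i) \<otimes> a \<otimes> \<pi> (r i)) = (\<Oplus>i\<in>I. c i \<otimes> a \<otimes> \<pi> (r i)) \<otimes> v" .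
  moreover have "(\<Oplus>i\<in>I. (v \<otimes> c i) \<otimes> a \<otimes> \<pi> (r i)) = (\<Oplus>i\<in>I. v \<otimes> (c i \<otimes> a \<otimes> \<pi> (r i)))"
    by (rule finsum_cong') (use cc vc a \<pi>c in \<open>auto simp: m_assoc\<close>)
  moreover have "\<dots> = v \<otimes> (\<Oplus>i\<in>I. c i \<otimes> a \<otimes> \<pi> (r i))"
    by (rule finsum_rdistr [symmetric]) (use I cc vc a \<pi>c in auto)
  ultimately show "(\<Oplus>i\<in>I. c i \<otimes> a \<otimes> \<pi> (r i)) \<otimes> v = v \<otimes> (\<Oplus>i\<in>I. c i \<otimes> a \<otimes> \<pi> (r i))" by simp
qed

text \<open>Write \<open>f\<close> with coefficients \<open>c\<^sub>i\<close>,
  \<open>s\<^sub>i\<close> and let \<open>h l\<close> be \<open>f\<close> with the coordinate map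
  \<open>\<pi> l\<close> applied to the \<open>s\<^sub>i\<close>. Then
  \<open>\<theta>(a) = \<Sum> h\<^sub>l(g m\<^sub>l a)\<close> has values in the centralizer of
  \<open>V\<close>, and at \<open>a = \<one>\<close> the dual basis identity
  \<open>s\<^sub>i = \<Sum> m\<^sub>l \<pi>\<^sub>l(s\<^sub>i)\<close> reassembles
  \<open>f(g)\<close>.\<close>

lemma projection_value:
  assumes f: "functional B f" and g: "g \<in> carrier A"
  shows "\<exists>\<theta>. sandwich (carrier A) V \<theta> \<and> \<theta> ` carrier A \<subseteq> centralizer A V \<and> \<theta> \<one> = f g"
proof -
  obtain n r where fg: "r \<in> {..<n::nat} \<rightarrow> Rc" "\<And>x. x \<in> Rc \<Longrightarrow> \<exists>z\<in>{..<n} \<rightarrow> Z. x = (\<Oplus>i\<in>{..<n}. z i \<otimes> r i)"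
    using Rc_finite by blast
  obtain L :: "(nat \<times> nat) set" and m \<pi> where L: "finite L" "m \<in> L \<rightarrow> Rc"
    "\<And>l x. l \<in> L \<Longrightarrow> x \<in> Rc \<Longrightarrow> \<pi> l x \<in> V"
    "\<And>l x y. l \<in> L \<Longrightarrow> x \<in> Rc \<Longrightarrow> y \<in> Rc \<Longrightarrow> \<pi> l (x \<oplus> y) = \<pi> l x \<oplus> \<pi> l y"
    "\<And>l x v. l \<in> L \<Longrightarrow> x \<in> Rc \<Longrightarrow> v \<in> V \<Longrightarrow> \<pi> l (x \<otimes> v) = \<pi> l x \<otimes> v"
    "\<And>x. x \<in> Rc \<Longrightarrow> x = (\<Oplus>l\<in>L. m l \<otimes> \<pi> l x)"
    by (rule finite_module_dual_basis [OF V(1,2,4) Rc_subring V(3) fg]) (assumption, rule that)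
  have "sandwich (carrier A) Rc f"
    using right_linear_sandwich f by (simp add: functional_def)
  then obtain I :: "nat set" and c s where I: "finite I" "c \<in> I \<rightarrow> carrier A" "s \<in> I \<rightarrow> Rc"
      "\<And>a. a \<in> carrier A \<Longrightarrow> f a = (\<Oplus>i\<in>I. c i \<otimes> a \<otimes> s i)" by (rule sandwichE) (rule that)
  have cc: "\<And>i. i \<in> I \<Longrightarrow> c i \<in> carrier A" "\<And>i. i \<in> I \<Longrightarrow> s i \<in> Rc" "\<And>i. i \<in> I \<Longrightarrow> s i \<in> carrier A"
    "\<And>l. l \<in> L \<Longrightarrow> m l \<in> carrier A"
    using I L(2) Rc_sub by auto
  have \<pi>c: "\<And>l i. l \<in> L \<Longrightarrow> i \<in> I \<Longrightarrow> \<pi> l (s i) \<in> carrier A" using L(3) cc V_carrier by blast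
  define h where "h l a = (\<Oplus>i\<in>I. c i \<otimes> a \<otimes> \<pi> l (s i))" for l a
  have hs: "sandwich (carrier A) V (h l)" if "l \<in> L" for l
    unfolding h_def using I(1,2) L(3)[OF that] cc by (intro sandwichI [of I c _ "\<lambda>i. \<pi> l (s i)"]) auto
  have hD: "h l a \<in> centralizer A V" if "l \<in> L" "a \<in> carrier A" for l a
    unfolding h_def by (rule functional_transfer [OF f L(3-5) I]) (use that in auto)
  define \<theta> where "\<theta> a = (\<Oplus>l\<in>L. h l ((g \<otimes> m l) \<otimes> a \<otimes> \<one>))" for a
  have "sandwich (carrier A) V \<theta>" unfolding \<theta>_def
    by (rule sandwich_finsum [OF _ V_carrier L(1)], simp, rule sandwich_inner [OF hs])
      (use V_carrier g cc in auto)
  moreover have "\<theta> a \<in> centralizer A V" if a: "a \<in> carrier A" for a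
    unfolding \<theta>_def
    by (rule additive_subgroup_finsum_closed)
      (use centralizer_subspace [OF V_carrier] hD a g cc in \<open>auto simp: central_subspace_def\<close>)
  moreover have "\<theta> \<one> = f g"
  proof -
    have "\<theta> \<one> = (\<Oplus>l\<in>L. \<Oplus>i\<in>I. c i \<otimes> (g \<otimes> m l) \<otimes> \<pi> l (s i))"
      unfolding \<theta>_def h_def
      by (rule finsum_cong') (use g cc \<pi>c in \<open>auto intro!: finsum_closed\<close>)
    also have "\<dots> = (\<Oplus>i\<in>I. \<Oplus>l\<in>L. c i \<otimes> (g \<otimes> m l) \<otimes> \<pi> l (s i))"
      by (rule finsum_swap) (use L(1) I(1) g cc \<pi>c in auto)
    also have "\<dots> = (\<Oplus>i\<in>I. c i \<otimes> g \<otimes> s i)"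
    proof (rule finsum_cong')
      fix i assume i: "i \<in> I"
      have "(\<Oplus>l\<in>L. c i \<otimes> (g \<otimes> m l) \<otimes> \<pi> l (s i)) = (\<Oplus>l\<in>L. c i \<otimes> g \<otimes> (m l \<otimes> \<pi> l (s i)))"
        by (rule finsum_cong') (use i g cc \<pi>c in \<open>auto simp: m_assoc\<close>)
      also have "\<dots> = c i \<otimes> g \<otimes> (\<Oplus>l\<in>L. m l \<otimes> \<pi> l (s i))"
        by (rule finsum_rdistr [symmetric]) (use L(1) i g cc \<pi>c in auto)
      also have "(\<Oplus>l\<in>L. m l \<otimes> \<pi> l (s i)) = s i" using L(6) cc i by simp
      finally show "(\<Oplus>l\<in>L. c i \<otimes> (g \<otimes> m l) \<otimes> \<pi> l (s i)) = c i \<otimes> g \<otimes> s i" .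
    qed (use g cc in auto)
    finally show ?thesis using I(4) g by simp
  qed
  ultimately show ?thesis by blast
qed

text \<open>A trace ideal argument: the elements of \<open>B\<close> that occur as
  \<open>\<theta> \<one>\<close> form a two-sided ideal of the simple ring \<open>B\<close>, nonzero
  because some \<open>f i \<one>\<close> is. Since \<open>\<theta>\<close> has right coefficients in
  \<open>V\<close>, it is right linear over the centralizer of \<open>V\<close>, so
  \<open>\<theta> \<one> = \<one>\<close> makes it a projection of \<open>A\<close> onto that
  centralizer.\<close>

lemma projection:
  obtains \<theta> where "sandwich (carrier A) V \<theta>" "\<theta> ` carrier A \<subseteq> centralizer A V" "\<theta> \<one> = \<one>"
proof -
  let ?D = "centralizer A V"
  have Dsub: "subring ?D A" using V_carrier by (rule centralizer_subring)
  obtain I y f where db: "dual_basis B I y f" using B_dual by blast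
  obtain i where i: "i \<in> I" "f i \<one> \<noteq> \<zero>"
    using dual_basis_nonzero [OF db one_closed one_not_zero] by blast
  have fi: "functional B (f i)" using db i by (simp add: dual_basis_def)
  define T where "T = {b \<in> B. \<exists>\<theta>. sandwich (carrier A) V \<theta> \<and> \<theta> ` carrier A \<subseteq> ?D \<and> \<theta> \<one> = b}"
  have "\<one> \<in> T"
  proof (rule simple_subring_one [OF B_simple B])
    show "T \<subseteq> B" by (auto simp: T_def)
    show "f i \<one> \<noteq> \<zero>" by fact
    show "f i \<one> \<in> T" using projection_value [OF fi one_closed] fi by (auto simp: T_def functional_def)
    fix b b' assume "b \<in> T"
    then obtain \<theta> where \<theta>: "b \<in> B" "sandwich (carrier A) V \<theta>" "\<theta> ` carrier A \<subseteq> ?D" "\<theta> \<one> = b"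
      by (auto simp: T_def)
    have bc: "b \<in> carrier A" using \<theta> B_carrier by auto
    have \<theta>c: "\<theta> a \<in> ?D" "\<theta> a \<in> carrier A" if "a \<in> carrier A" for a
      using \<theta>(3) that centralizer_sub [of V] by blast+
    { assume "b' \<in> T"
      then obtain \<theta>' where \<theta>': "b' \<in> B" "sandwich (carrier A) V \<theta>'" "\<theta>' ` carrier A \<subseteq> ?D" "\<theta>' \<one> = b'"
        by (auto simp: T_def)
      have "sandwich (carrier A) V (\<lambda>a. \<theta> a \<oplus> \<theta>' a)"
        using \<theta> \<theta>' V_carrier by (intro sandwich_plus) auto
      moreover have "(\<lambda>a. \<theta> a \<oplus> \<theta>' a) ` carrier A \<subseteq> ?D"
        using \<theta>(3) \<theta>'(3) subringE(7)[OF Dsub] by blast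
      moreover have "b \<oplus> b' \<in> B" using \<theta> \<theta>' subringE(7)[OF B] by blast
      ultimately show "b \<oplus> b' \<in> T" unfolding T_def using \<theta>(4) \<theta>'(4) by blast }
    { assume b': "b' \<in> B"
      then have b'c: "b' \<in> carrier A" "b' \<in> ?D" using B_carrier B_le by auto
      have "sandwich (carrier A) V (\<lambda>a. b' \<otimes> \<theta> a \<otimes> \<one>)"
        by (rule sandwich_outer [OF \<theta>(2)]) (use V_carrier b'c in auto)
      moreover have "(\<lambda>a. b' \<otimes> \<theta> a \<otimes> \<one>) ` carrier A \<subseteq> ?D"
        using \<theta>c b'c subringE(6)[OF Dsub] by auto
      moreover have "b' \<otimes> b \<in> B" "b' \<otimes> \<theta> \<one> \<otimes> \<one> = b' \<otimes> b"
        using \<theta> b' b'c bc subringE(6)[OF B] by auto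
      ultimately show "b' \<otimes> b \<in> T" unfolding T_def
        by (intro CollectI conjI exI [of _ "\<lambda>a. b' \<otimes> \<theta> a \<otimes> \<one>"])
      have "sandwich (carrier A) V (\<lambda>a. \<theta> (b' \<otimes> a \<otimes> \<one>))"
        by (rule sandwich_inner [OF \<theta>(2)]) (use V_carrier b'c in auto)
      moreover have "(\<lambda>a. \<theta> (b' \<otimes> a \<otimes> \<one>)) ` carrier A \<subseteq> ?D"
        using \<theta>c b'c by auto
      moreover have "b \<otimes> b' \<in> B" using \<theta> b' subringE(6)[OF B] by auto
      \<comment> \<open>By \<open>B_le\<close> the element \<open>b'\<close> commutes with
        \<open>V\<close>, so \<open>\<theta>\<close> is right linear for it and
        \<open>\<theta> b' = \<theta> \<one> \<otimes> b'\<close>.\<close>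
      moreover have "\<theta> (b' \<otimes> \<one> \<otimes> \<one>) = b \<otimes> b'"
        using sandwich_right_linear [OF _ V_carrier \<theta>(2) one_closed b'c(1)]
          centralizer_comm [OF b'c(2)] b'c \<theta>(4) by simp
      ultimately show "b \<otimes> b' \<in> T" unfolding T_def
        by (intro CollectI conjI exI [of _ "\<lambda>a. \<theta> (b' \<otimes> a \<otimes> \<one>)"]) }
  qed
  then show ?thesis using that by (auto simp: T_def)
qed

text \<open>The maps \<open>\<Sum> y\<^sub>i f\<^sub>i\<close> with \<open>f\<^sub>i\<close> from
  \<open>A\<close> into the centralizer of \<open>V\<close> form a two-sided ideal of
  \<open>A \<otimes>_Z V^op\<close>. It contains the projection, so by \<open>sandwich_ideal\<close>
  it contains the identity, and that is a dual basis. The right coefficients are recorded to lie in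
  \<open>V\<close> itself, not merely in its double centralizer:
  \<open>centralizer_centralizer\<close> depends on this.\<close>

lemma centralizer_dual_basis:
  "\<exists>I y f. dual_basis (centralizer A V) I y f \<and> (\<forall>i\<in>I. sandwich (carrier A) V (f i))"
proof -
  let ?D = "centralizer A V"
  have Dsub: "subring ?D A" using V_carrier by (rule centralizer_subring)
  have Dc: "?D \<subseteq> carrier A" by (rule centralizer_sub)
  have VD: "V \<subseteq> centralizer A ?D"
    using V_carrier by (auto intro!: centralizerI simp: centralizer_comm)
  define ok where "ok \<theta> \<longleftrightarrow> sandwich (carrier A) V \<theta> \<and> \<theta> ` carrier A \<subseteq> ?D" for \<theta>
  define J where "J e \<longleftrightarrow> (\<exists>I :: nat set. \<exists>y\<in>I \<rightarrow> carrier A. \<exists>f. finite I \<and> (\<forall>i\<in>I. ok (f i))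
    \<and> (\<forall>a\<in>carrier A. e a = (\<Oplus>i\<in>I. y i \<otimes> f i a)))" for e
  have JI: "J e" if "finite I" "y \<in> I \<rightarrow> carrier A" "\<And>i. i \<in> I \<Longrightarrow> ok (f i)"
    "\<And>a. a \<in> carrier A \<Longrightarrow> e a = (\<Oplus>i\<in>I. y i \<otimes> f i a)" for e y f and I :: "nat set"
    unfolding J_def using that by blast
  have JE: thesis if "J e" "\<And>(I :: nat set) y f. finite I \<Longrightarrow> y \<in> I \<rightarrow> carrier A \<Longrightarrow> (\<And>i. i \<in> I \<Longrightarrow> ok (f i)) \<Longrightarrow>
    (\<And>a. a \<in> carrier A \<Longrightarrow> e a = (\<Oplus>i\<in>I. y i \<otimes> f i a)) \<Longrightarrow> thesis" for e thesis
    using that(1) unfolding J_def by (elim exE bexE conjE) (rule that(2), auto)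
  have okc: "f a \<in> carrier A" "f a \<in> ?D" if "ok f" "a \<in> carrier A" for f a
    using that Dc by (auto simp: ok_def)
  obtain \<theta> where \<theta>: "sandwich (carrier A) V \<theta>" "\<theta> ` carrier A \<subseteq> ?D" "\<theta> \<one> = \<one>" by (rule projection)
  have "J (\<lambda>a. a)"
  proof (rule sandwich_ideal [OF V(1,2,4), where J = J])
    fix e assume Je: "J e"
    then obtain I :: "nat set" and y f where I: "finite I" "y \<in> I \<rightarrow> carrier A" "\<And>i. i \<in> I \<Longrightarrow> ok (f i)"
      "\<And>a. a \<in> carrier A \<Longrightarrow> e a = (\<Oplus>i\<in>I. y i \<otimes> f i a)" by (rule JE) (rule that)
    have yc: "\<And>i. i \<in> I \<Longrightarrow> y i \<in> carrier A" using I by auto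
    have "sandwich (carrier A) V (\<lambda>a. \<Oplus>i\<in>I. y i \<otimes> f i a \<otimes> \<one>)"
    proof (rule sandwich_finsum [OF _ V_carrier I(1)])
      fix i assume "i \<in> I"
      then show "sandwich (carrier A) V (\<lambda>a. y i \<otimes> f i a \<otimes> \<one>)"
        by (intro sandwich_outer [of "carrier A" V "f i"]) (use I V_carrier yc in \<open>auto simp: ok_def\<close>)
    qed simp
    then show "sandwich (carrier A) V e"
    proof (rule sandwich_eq)
      fix a assume a: "a \<in> carrier A"
      show "(\<Oplus>i\<in>I. y i \<otimes> f i a \<otimes> \<one>) = e a" unfolding I(4)[OF a]
        by (rule finsum_cong') (use okc [OF I(3) a] yc in auto)
    qed
    show "J e'" if "\<And>a. a \<in> carrier A \<Longrightarrow> e a = e' a" for e'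
      by (rule JI [OF I(1-3)]) (use that I(4) in auto)
    show "J (\<lambda>a. e a \<oplus> e' a)" if "J e'" for e'
    proof -
      from that obtain I' :: "nat set" and y' f' where I': "finite I'" "y' \<in> I' \<rightarrow> carrier A" "\<And>i. i \<in> I' \<Longrightarrow> ok (f' i)"
        "\<And>a. a \<in> carrier A \<Longrightarrow> e' a = (\<Oplus>i\<in>I'. y' i \<otimes> f' i a)" by (rule JE) (rule that)
      have y: "join_fam y y' \<in> join_index I I' \<rightarrow> carrier A" using I I' by (simp only: join_fam_Pi)
      have ok: "join_fam f f' \<in> join_index I I' \<rightarrow> Collect ok" by (rule join_fam_Pi) (use I I' in auto)
      show ?thesis
      proof (rule JI [OF _ y, of "join_fam f f'"])
        fix a assume a: "a \<in> carrier A"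
        have "(\<lambda>k. join_fam y y' k \<otimes> join_fam f f' k a) \<in> join_index I I' \<rightarrow> carrier A"
          using y ok okc a by (auto simp: Pi_def)
        then show "e a \<oplus> e' a = (\<Oplus>k\<in>join_index I I'. join_fam y y' k \<otimes> join_fam f f' k a)"
          using I I' a by (subst finsum_join) auto
      qed (use I I' ok in \<open>auto simp: Pi_def\<close>)
    qed
    show "J (\<lambda>a. b \<otimes> e a)" if b: "b \<in> carrier A" for b
    proof (rule JI [OF I(1) _ I(3), of "\<lambda>i. b \<otimes> y i"])
      fix a assume a: "a \<in> carrier A"
      have "b \<otimes> e a = (\<Oplus>i\<in>I. b \<otimes> (y i \<otimes> f i a))" unfolding I(4)[OF a]
        by (rule finsum_rdistr) (use I(1) b yc okc [OF I(3) a] in auto)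
      also have "\<dots> = (\<Oplus>i\<in>I. b \<otimes> y i \<otimes> f i a)"
        by (rule finsum_cong') (use b yc okc [OF I(3) a] in \<open>auto simp: m_assoc\<close>)
      finally show "b \<otimes> e a = (\<Oplus>i\<in>I. b \<otimes> y i \<otimes> f i a)" .
    qed (use b yc in auto)
    show "J (\<lambda>a. e (b \<otimes> a))" if b: "b \<in> carrier A" for b
    proof (rule JI [OF I(1,2), of "\<lambda>i a. f i (b \<otimes> a)"])
      fix i assume i: "i \<in> I"
      have "sandwich (carrier A) V (\<lambda>a. f i (b \<otimes> a \<otimes> \<one>))"
        by (rule sandwich_inner [of "carrier A" V "f i"]) (use I(3)[OF i] V_carrier b in \<open>auto simp: ok_def\<close>)
      then have "sandwich (carrier A) V (\<lambda>a. f i (b \<otimes> a))" by (rule sandwich_eq) (use b in auto)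
      then show "ok (\<lambda>a. f i (b \<otimes> a))" using I(3)[OF i] b by (auto simp: ok_def)
    qed (use I(4) b in auto)
    \<comment> \<open>The value \<open>f i a\<close> commutes with \<open>v\<close>, so
      \<open>v\<close> is absorbed by \<open>y i\<close>.\<close>
    show "J (\<lambda>a. e a \<otimes> v)" if v: "v \<in> V" for v
    proof (rule JI [OF I(1) _ I(3), of "\<lambda>i. y i \<otimes> v"])
      have vc: "v \<in> carrier A" using v V_carrier by auto
      show "(\<lambda>i. y i \<otimes> v) \<in> I \<rightarrow> carrier A" using vc yc by auto
      fix a assume a: "a \<in> carrier A"
      have "e a \<otimes> v = (\<Oplus>i\<in>I. y i \<otimes> f i a \<otimes> v)" unfolding I(4)[OF a]
        by (rule finsum_ldistr) (use I(1) vc yc okc [OF I(3) a] in auto)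
      also have "\<dots> = (\<Oplus>i\<in>I. y i \<otimes> v \<otimes> f i a)"
      proof (rule finsum_cong')
        fix i assume i: "i \<in> I"
        show "y i \<otimes> f i a \<otimes> v = y i \<otimes> v \<otimes> f i a"
          using centralizer_comm [OF okc(2)[OF I(3)[OF i] a] v] okc [OF I(3)[OF i] a] yc [OF i] vc
          by (simp add: m_assoc)
      qed (use vc yc okc [OF I(3) a] in auto)
      finally show "e a \<otimes> v = (\<Oplus>i\<in>I. y i \<otimes> v \<otimes> f i a)" .
    qed
    show "J (\<lambda>a. e (a \<otimes> v))" if v: "v \<in> V" for v
    proof (rule JI [OF I(1,2), of "\<lambda>i a. f i (a \<otimes> v)"])
      have vc: "v \<in> carrier A" using v V_carrier by auto
      show "e (a \<otimes> v) = (\<Oplus>i\<in>I. y i \<otimes> f i (a \<otimes> v))" if "a \<in> carrier A" for a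
        using that vc I(4) by simp
      fix i assume i: "i \<in> I"
      have "sandwich (carrier A) V (\<lambda>a. f i (\<one> \<otimes> a \<otimes> v))"
        by (rule sandwich_inner [of "carrier A" V "f i"])
          (use I(3)[OF i] V_carrier v vc subringE(6)[OF V(1)] in \<open>auto simp: ok_def\<close>)
      then have "sandwich (carrier A) V (\<lambda>a. f i (a \<otimes> v))" by (rule sandwich_eq) (use vc in auto)
      then show "ok (\<lambda>a. f i (a \<otimes> v))" using I(3)[OF i] vc by (auto simp: ok_def)
    qed
  next
    have ok: "ok \<theta>" using \<theta> by (simp add: ok_def)
    show "J \<theta>"
      by (rule JI [of "{0}" "\<lambda>_. \<one>" "\<lambda>_. \<theta>"])
        (use ok okc [OF ok] in \<open>auto simp: finsum_insert\<close>)
    show "\<theta> \<one> \<noteq> \<zero>" using \<theta> one_not_zero by simp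
  qed simp
  then obtain I :: "nat set" and y f where I: "finite I" "y \<in> I \<rightarrow> carrier A" "\<And>i. i \<in> I \<Longrightarrow> ok (f i)"
    "\<And>a. a \<in> carrier A \<Longrightarrow> a = (\<Oplus>i\<in>I. y i \<otimes> f i a)" by (rule JE) (rule that)
  have "functional ?D (f i)" if "i \<in> I" for i
    by (rule sandwich_functional [OF sandwich_mono [OF _ subset_refl VD] Dc])
      (use I(3)[OF that] in \<open>auto simp: ok_def\<close>)
  then have "dual_basis ?D I y f" using I unfolding dual_basis_def by blast
  moreover have "\<forall>i\<in>I. sandwich (carrier A) V (f i)" using I(3) by (simp add: ok_def)
  ultimately show ?thesis by blast
qed

text \<open>Let \<open>AQ\<close> be the left ideal of \<open>A\<close> generated by an ideal
  \<open>Q\<close> of the centralizer. The sandwich maps with values in \<open>AQ\<close> form an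
  ideal of \<open>A \<otimes>_Z V^op\<close> that contains the nonzero map
  \<open>q \<theta>\<close>, so the identity takes values in \<open>AQ\<close> and
  \<open>\<one> = \<Sum> x\<^sub>i y\<^sub>i\<close> with \<open>y\<^sub>i \<in> Q\<close>. Applying
  the projection gives \<open>\<one> = \<Sum> \<theta>(x\<^sub>i) y\<^sub>i\<close>, an element of
  \<open>Q\<close>.\<close>

lemma centralizer_simple_ring: "simple_ring (A\<lparr>carrier := centralizer A V\<rparr>)"
proof (rule simple_subringI [OF centralizer_subring [OF V_carrier] one_not_zero])
  let ?D = "centralizer A V"
  have Dsub: "subring ?D A" using V_carrier by (rule centralizer_subring)
  have Dc: "?D \<subseteq> carrier A" by (rule centralizer_sub)
  fix Q q assume Q: "Q \<subseteq> ?D" and add: "\<And>x y. x \<in> Q \<Longrightarrow> y \<in> Q \<Longrightarrow> x \<oplus> y \<in> Q"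
    and l: "\<And>v x. v \<in> ?D \<Longrightarrow> x \<in> Q \<Longrightarrow> v \<otimes> x \<in> Q"
    and r: "\<And>v x. v \<in> ?D \<Longrightarrow> x \<in> Q \<Longrightarrow> x \<otimes> v \<in> Q"
    and q: "q \<in> Q" "q \<noteq> \<zero>"
  have Qc: "Q \<subseteq> carrier A" using Q Dc by blast
  have ZD: "Z \<subseteq> ?D" using V_carrier by (rule center_le_centralizer)
  have Qs: "central_subspace Q"
    by (rule central_subspaceI [OF Dsub ZD Q add _ q(1)]) (use l ZD in auto)
  obtain \<theta> where \<theta>: "sandwich (carrier A) V \<theta>" "\<theta> ` carrier A \<subseteq> ?D" "\<theta> \<one> = \<one>" by (rule projection)
  have \<theta>c: "\<theta> a \<in> ?D" "\<theta> a \<in> carrier A" if "a \<in> carrier A" for a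
    using \<theta>(2) that Dc by blast+
  define AQ where "AQ = {\<beta> \<one> | \<beta>. sandwich (carrier A) Q \<beta>}"
  define J where "J e \<longleftrightarrow> sandwich (carrier A) V e \<and> e ` carrier A \<subseteq> AQ" for e
  have QAQ: "x \<in> AQ" if x: "x \<in> Q" for x
    unfolding AQ_def using sandwich_single [OF subset_refl Qc one_closed x] x Qc
    by (auto intro!: exI [of _ "\<lambda>a. \<one> \<otimes> a \<otimes> x"])
  have "J (\<lambda>a. a)"
  proof (rule sandwich_ideal [OF V(1,2,4), where J = J])
    fix e assume Je: "J e"
    then have se: "sandwich (carrier A) V e" and eAQ: "\<And>a. a \<in> carrier A \<Longrightarrow> e a \<in> AQ"
      by (auto simp: J_def)
    have ec: "e a \<in> carrier A" if "a \<in> carrier A" for a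
      using sandwich_closed [OF _ V_carrier se] that by blast
    show "sandwich (carrier A) V e" by fact
    show "J e'" if "\<And>a. a \<in> carrier A \<Longrightarrow> e a = e' a" for e'
      unfolding J_def using sandwich_eq [OF se that] eAQ that by auto
    show "J (\<lambda>a. e a \<oplus> e' a)" if "J e'" for e'
      unfolding J_def
    proof (intro conjI image_subsetI)
      have se': "sandwich (carrier A) V e'" and e'AQ: "\<And>a. a \<in> carrier A \<Longrightarrow> e' a \<in> AQ"
        using that by (auto simp: J_def)
      show "sandwich (carrier A) V (\<lambda>a. e a \<oplus> e' a)"
        using se se' V_carrier by (intro sandwich_plus) auto
      fix a assume a: "a \<in> carrier A"
      obtain \<beta> \<beta>' where \<beta>: "e a = \<beta> \<one>" "sandwich (carrier A) Q \<beta>" "e' a = \<beta>' \<one>" "sandwich (carrier A) Q \<beta>'"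
        using eAQ [OF a] e'AQ [OF a] unfolding AQ_def by blast
      have "sandwich (carrier A) Q (\<lambda>a. \<beta> a \<oplus> \<beta>' a)" using \<beta> Qc by (intro sandwich_plus) auto
      then show "e a \<oplus> e' a \<in> AQ" unfolding AQ_def \<beta>(1,3)
        by (intro CollectI exI [of _ "\<lambda>a. \<beta> a \<oplus> \<beta>' a"]) simp
    qed
    show "J (\<lambda>a. b \<otimes> e a)" if b: "b \<in> carrier A" for b
      unfolding J_def
    proof (intro conjI image_subsetI)
      have "sandwich (carrier A) V (\<lambda>a. b \<otimes> e a \<otimes> \<one>)"
        by (rule sandwich_outer [OF se]) (use V_carrier b in auto)
      then show "sandwich (carrier A) V (\<lambda>a. b \<otimes> e a)" by (rule sandwich_eq) (use b ec in auto)
      fix a assume a: "a \<in> carrier A"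
      obtain \<beta> where \<beta>: "e a = \<beta> \<one>" "sandwich (carrier A) Q \<beta>" using eAQ [OF a] unfolding AQ_def by blast
      have "sandwich (carrier A) Q (\<lambda>a. b \<otimes> \<beta> a \<otimes> \<one>)"
        by (rule sandwich_outer [OF \<beta>(2)]) (use Qc b in auto)
      moreover have "b \<otimes> e a = b \<otimes> \<beta> \<one> \<otimes> \<one>" using b ec [OF a] \<beta>(1) by simp
      ultimately show "b \<otimes> e a \<in> AQ" unfolding AQ_def
        by (intro CollectI exI [of _ "\<lambda>a. b \<otimes> \<beta> a \<otimes> \<one>"]) simp
    qed
    show "J (\<lambda>a. e (b \<otimes> a))" if b: "b \<in> carrier A" for b
      unfolding J_def
    proof (intro conjI image_subsetI)
      have "sandwich (carrier A) V (\<lambda>a. e (b \<otimes> a \<otimes> \<one>))"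
        by (rule sandwich_inner [OF se]) (use V_carrier b in auto)
      then show "sandwich (carrier A) V (\<lambda>a. e (b \<otimes> a))" by (rule sandwich_eq) (use b in auto)
    qed (use eAQ b in auto)
    show "J (\<lambda>a. e (a \<otimes> v))" if v: "v \<in> V" for v
      unfolding J_def
    proof (intro conjI image_subsetI)
      have vc: "v \<in> carrier A" using v V_carrier by blast
      have "sandwich (carrier A) V (\<lambda>a. e (\<one> \<otimes> a \<otimes> v))"
        by (rule sandwich_inner [OF se]) (use V_carrier v vc subringE(6)[OF V(1)] in auto)
      then show "sandwich (carrier A) V (\<lambda>a. e (a \<otimes> v))" by (rule sandwich_eq) (use vc in auto)
      show "e (a \<otimes> v) \<in> AQ" if "a \<in> carrier A" for a using eAQ that vc by auto
    qed
    show "J (\<lambda>a. e a \<otimes> v)" if v: "v \<in> V" for v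
      unfolding J_def
    proof (intro conjI image_subsetI)
      have vc: "v \<in> carrier A" using v V_carrier by blast
      have "sandwich (carrier A) V (\<lambda>a. \<one> \<otimes> e a \<otimes> v)"
        by (rule sandwich_outer [OF se]) (use V_carrier v vc subringE(6)[OF V(1)] in auto)
      then show "sandwich (carrier A) V (\<lambda>a. e a \<otimes> v)" by (rule sandwich_eq) (use vc ec in auto)
      fix a assume a: "a \<in> carrier A"
      obtain \<beta> where \<beta>: "e a = \<beta> \<one>" "sandwich (carrier A) Q \<beta>" using eAQ [OF a] unfolding AQ_def by blast
      have "sandwich (carrier A) Q (\<lambda>a. \<beta> (v \<otimes> a \<otimes> \<one>))"
        by (rule sandwich_inner [OF \<beta>(2)]) (use Qc vc in auto)
      \<comment> \<open>\<open>Q\<close> commutes with \<open>V\<close>, so right multiplication by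
        \<open>v\<close> can be moved into the argument of \<open>\<beta>\<close>; hence
        \<open>AQ\<close> is stable under it.\<close>
      moreover have "v \<otimes> w = w \<otimes> v" if "w \<in> Q" for w
        using centralizer_comm [of w A V v] that Q v by auto
      then have "\<beta> (v \<otimes> \<one> \<otimes> \<one>) = e a \<otimes> v"
        using sandwich_right_linear [OF _ Qc \<beta>(2) one_closed vc] vc \<beta>(1) by simp
      ultimately show "e a \<otimes> v \<in> AQ" unfolding AQ_def
        by (intro CollectI exI [of _ "\<lambda>a. \<beta> (v \<otimes> a \<otimes> \<one>)"]) simp
    qed
  next
    have qc: "q \<in> carrier A" using q Qc by blast
    have "sandwich (carrier A) V (\<lambda>a. q \<otimes> \<theta> a \<otimes> \<one>)"
      by (rule sandwich_outer [OF \<theta>(1)]) (use V_carrier qc in auto)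
    moreover have "q \<otimes> \<theta> a \<otimes> \<one> \<in> AQ" if "a \<in> carrier A" for a
      using QAQ [OF r [OF \<theta>c(1)[OF that] q(1)]] \<theta>c [OF that] qc by simp
    ultimately show "J (\<lambda>a. q \<otimes> \<theta> a \<otimes> \<one>)" by (auto simp: J_def)
    show "q \<otimes> \<theta> \<one> \<otimes> \<one> \<noteq> \<zero>" using q qc \<theta>(3) by simp
  qed simp
  then have "\<one> \<in> AQ" by (auto simp: J_def)
  then obtain \<beta> where \<beta>: "\<one> = \<beta> \<one>" "sandwich (carrier A) Q \<beta>" unfolding AQ_def by blast
  from \<beta>(2) obtain I :: "nat set" and x y where I: "finite I" "x \<in> I \<rightarrow> carrier A" "y \<in> I \<rightarrow> Q"
    "\<And>a. a \<in> carrier A \<Longrightarrow> \<beta> a = (\<Oplus>i\<in>I. x i \<otimes> a \<otimes> y i)" by (rule sandwichE) (rule that)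
  have xy: "\<And>i. i \<in> I \<Longrightarrow> x i \<in> carrier A" "\<And>i. i \<in> I \<Longrightarrow> y i \<in> Q" "\<And>i. i \<in> I \<Longrightarrow> y i \<in> carrier A"
    using I Qc by auto
  have "\<one> = (\<Oplus>i\<in>I. x i \<otimes> \<one> \<otimes> y i)" using \<beta>(1) I(4)[OF one_closed] by simp
  then have "\<theta> \<one> = \<theta> (\<Oplus>i\<in>I. x i \<otimes> \<one> \<otimes> y i)" by simp
  also have "\<dots> = (\<Oplus>i\<in>I. \<theta> (x i \<otimes> \<one> \<otimes> y i))"
    by (rule additive_finsum [OF carrier_additive_subgroup abelian_group_axioms])
      (use \<theta>c xy I(1) sandwich_additive [OF _ V_carrier \<theta>(1)] in auto)
  also have "\<dots> \<in> Q"
  proof (rule additive_subgroup_finsum_closed)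
    show "(\<lambda>i. \<theta> (x i \<otimes> \<one> \<otimes> y i)) \<in> I \<rightarrow> Q"
    proof
      fix i assume i: "i \<in> I"
      have "\<theta> (x i \<otimes> y i) = \<theta> (x i) \<otimes> y i"
        by (rule sandwich_right_linear [OF _ V_carrier \<theta>(1)])
          (use xy i centralizer_comm [OF subsetD [OF Q xy(2)[OF i]]] in auto)
      then show "\<theta> (x i \<otimes> \<one> \<otimes> y i) \<in> Q" using l [OF \<theta>c(1) xy(2)] xy i by simp
    qed
  qed (use Qs in \<open>simp add: central_subspace_def\<close>)
  finally show "\<one> \<in> Q" using \<theta>(3) by simp
qed

text \<open>If \<open>c\<close> commutes with the centralizer of \<open>V\<close>, then \<open>a c =
  \<Sum> y\<^sub>i f\<^sub>i(a) c = \<Sum> (y\<^sub>i c) f\<^sub>i(a)\<close>. This displays right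
  multiplication by \<open>c\<close> with right coefficients in \<open>V\<close>, whence
  \<open>c \<in> V\<close>.\<close>

lemma centralizer_centralizer: "centralizer A (centralizer A V) = V"
proof
  let ?D = "centralizer A V"
  have Dc: "?D \<subseteq> carrier A" by (rule centralizer_sub)
  show "V \<subseteq> centralizer A ?D"
    using V_carrier by (auto intro!: centralizerI simp: centralizer_comm)
  show "centralizer A ?D \<subseteq> V"
  proof
    fix c assume c: "c \<in> centralizer A ?D"
    then have cc: "c \<in> carrier A" by (rule centralizer_carrier)
    obtain I y f where db: "dual_basis ?D I y f" and fV: "\<And>i. i \<in> I \<Longrightarrow> sandwich (carrier A) V (f i)"
      using centralizer_dual_basis by blast
    have I: "finite I" "\<And>i. i \<in> I \<Longrightarrow> y i \<in> carrier A" "\<And>a. a \<in> carrier A \<Longrightarrow> a = (\<Oplus>i\<in>I. y i \<otimes> f i a)"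
      using db unfolding dual_basis_def by blast+
    have fD: "f i a \<in> ?D" "f i a \<in> carrier A" if "i \<in> I" "a \<in> carrier A" for i a
      using db that Dc unfolding dual_basis_def functional_def by blast+
    have "sandwich (carrier A) V (\<lambda>a. \<Oplus>i\<in>I. (y i \<otimes> c) \<otimes> f i a \<otimes> \<one>)"
    proof (rule sandwich_finsum [OF _ V_carrier I(1)])
      fix i assume "i \<in> I"
      then show "sandwich (carrier A) V (\<lambda>a. (y i \<otimes> c) \<otimes> f i a \<otimes> \<one>)"
        by (intro sandwich_outer [OF fV]) (use I cc V_carrier in auto)
    qed simp
    then have "sandwich (carrier A) V (\<lambda>a. a \<otimes> c)"
    proof (rule sandwich_eq)
      fix a assume a: "a \<in> carrier A"
      have "(\<Oplus>i\<in>I. (y i \<otimes> c) \<otimes> f i a \<otimes> \<one>) = (\<Oplus>i\<in>I. y i \<otimes> f i a \<otimes> c)"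
      proof (rule finsum_cong')
        fix i assume i: "i \<in> I"
        show "(y i \<otimes> c) \<otimes> f i a \<otimes> \<one> = y i \<otimes> f i a \<otimes> c"
          using centralizer_comm [OF c fD(1)[OF i a]] fD [OF i a] I(2)[OF i] cc by (simp add: m_assoc)
      qed (use fD [OF _ a] I cc in auto)
      also have "\<dots> = (\<Oplus>i\<in>I. y i \<otimes> f i a) \<otimes> c"
        by (rule finsum_ldistr [symmetric]) (use fD [OF _ a] I cc in auto)
      finally show "(\<Oplus>i\<in>I. (y i \<otimes> c) \<otimes> f i a \<otimes> \<one>) = a \<otimes> c" using I(3)[OF a, symmetric] by simp
    qed
    then show "c \<in> V" by (rule right_mult_sandwich [OF cc V_subspace])
  qed
qed

end

end

section \<open>Bimodules and tensor products\<close>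

text \<open>The axioms are chosen so as to make the two induced actions on a tensor product well
  defined: additivity in the module argument and commutation of the left action with the right one.
  Actions by a ring, by a subring and by the integers are all covered.\<close>

locale bimodule = abelian_group M
  for P :: "('p, 'c) ring_scheme" and Q :: "('q, 'd) ring_scheme" and M :: "('p, 'm, 'q, 'x) bimod_scheme" +
  assumes lact_closed: "p \<in> carrier P \<Longrightarrow> x \<in> carrier M \<Longrightarrow> lact M p x \<in> carrier M"
    and ract_closed: "q \<in> carrier Q \<Longrightarrow> x \<in> carrier M \<Longrightarrow> ract M x q \<in> carrier M"
    and lact_add: "p \<in> carrier P \<Longrightarrow> x \<in> carrier M \<Longrightarrow> y \<in> carrier M \<Longrightarrow>
      lact M p (x \<oplus>\<^bsub>M\<^esub> y) = lact M p x \<oplus>\<^bsub>M\<^esub> lact M p y"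
    and ract_add: "q \<in> carrier Q \<Longrightarrow> x \<in> carrier M \<Longrightarrow> y \<in> carrier M \<Longrightarrow>
      ract M (x \<oplus>\<^bsub>M\<^esub> y) q = ract M x q \<oplus>\<^bsub>M\<^esub> ract M y q"
    and lact_ract: "p \<in> carrier P \<Longrightarrow> q \<in> carrier Q \<Longrightarrow> x \<in> carrier M \<Longrightarrow>
      lact M p (ract M x q) = ract M (lact M p x) q"

section \<open>Evaluation of formal sums\<close>

context abelian_group begin

lemma formal_eval_superset:
  assumes "finite T" "Poly_Mapping.keys x \<subseteq> T" "f \<in> T \<rightarrow> carrier G"
  shows "formal_eval G f x = (\<Oplus>i\<in>T. [Poly_Mapping.lookup x i] \<cdot> f i)"
  unfolding formal_eval_def
proof (rule add.finprod_mono_neutral_cong_left)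
  show "finite T" by fact
  show "Poly_Mapping.keys x \<subseteq> T" by fact
  show "[Poly_Mapping.lookup x i] \<cdot> f i = \<zero>" if "i \<in> T - Poly_Mapping.keys x" for i
  proof -
    have "Poly_Mapping.lookup x i = 0" using that by (simp add: in_keys_iff)
    then show ?thesis by (simp add: add_pow_def)
  qed
qed (use assms in auto)

lemma formal_eval_closed:
  assumes "Poly_Mapping.keys x \<subseteq> S" "f \<in> S \<rightarrow> carrier G"
  shows "formal_eval G f x \<in> carrier G"
  unfolding formal_eval_def by (rule finsum_closed) (use assms in auto)

lemma formal_eval_add:
  assumes "Poly_Mapping.keys x \<subseteq> S" "Poly_Mapping.keys y \<subseteq> S" "f \<in> S \<rightarrow> carrier G"
  shows "formal_eval G f (x + y) = formal_eval G f x \<oplus> formal_eval G f y"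
proof -
  let ?T = "Poly_Mapping.keys x \<union> Poly_Mapping.keys y"
  have T: "finite ?T" "f \<in> ?T \<rightarrow> carrier G" using assms by auto
  have "formal_eval G f (x + y) = (\<Oplus>i\<in>?T. [Poly_Mapping.lookup (x + y) i] \<cdot> f i)"
    by (rule formal_eval_superset) (use T Poly_Mapping.keys_add [of x y] in auto)
  also have "\<dots> = (\<Oplus>i\<in>?T. [Poly_Mapping.lookup x i] \<cdot> f i \<oplus> [Poly_Mapping.lookup y i] \<cdot> f i)"
    by (rule finsum_cong') (use T in \<open>auto simp: lookup_add add.int_pow_mult Pi_def\<close>)
  also have "\<dots> = (\<Oplus>i\<in>?T. [Poly_Mapping.lookup x i] \<cdot> f i) \<oplus> (\<Oplus>i\<in>?T. [Poly_Mapping.lookup y i] \<cdot> f i)"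
    by (rule finsum_addf) (use T in auto)
  also have "\<dots> = formal_eval G f x \<oplus> formal_eval G f y"
    using T by (simp add: formal_eval_superset [of ?T])
  finally show ?thesis .
qed

lemma formal_eval_zero: "formal_eval G f 0 = \<zero>"
  by (simp add: formal_eval_def)

lemma formal_eval_frag_of:
  assumes "f i \<in> carrier G" shows "formal_eval G f (frag_of i) = f i"
proof -
  have "formal_eval G f (frag_of i) = (\<Oplus>j\<in>{i}. f j)"
    unfolding formal_eval_def
    by (rule finsum_cong') (use assms add.int_pow_1 in auto)
  then show ?thesis using assms by (simp add: finsum_insert)
qed

lemma formal_eval_diff:
  assumes "Poly_Mapping.keys x \<subseteq> S" "Poly_Mapping.keys y \<subseteq> S" "f \<in> S \<rightarrow> carrier G"
  shows "formal_eval G f (x - y) = formal_eval G f x \<ominus> formal_eval G f y"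
proof -
  have k: "Poly_Mapping.keys (x - y) \<subseteq> S" using assms keys_diff [of x y] by blast
  have "formal_eval G f x = formal_eval G f (x - y) \<oplus> formal_eval G f y"
    using formal_eval_add [OF k assms(2,3)] by simp
  then show ?thesis
    using formal_eval_closed [OF k assms(3)] formal_eval_closed [OF assms(2,3)]
    by (simp add: a_minus_def a_assoc r_neg)
qed

lemma formal_eval_hom:
  assumes "abelian_group P" "h \<in> carrier G \<rightarrow> carrier P"
    "\<And>x y. x \<in> carrier G \<Longrightarrow> y \<in> carrier G \<Longrightarrow> h (x \<oplus> y) = h x \<oplus>\<^bsub>P\<^esub> h y"
    and k: "Poly_Mapping.keys x \<subseteq> S" and f: "f \<in> S \<rightarrow> carrier G"
  shows "h (formal_eval G f x) = formal_eval P (\<lambda>i. h (f i)) x"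
proof -
  interpret P: abelian_group P by fact
  have hf: "(\<lambda>i. h (f i)) \<in> S \<rightarrow> carrier P" using f assms(2) by auto
  have "Poly_Mapping.keys x \<subseteq> S \<Longrightarrow> ?thesis"
  proof (induction x rule: free_Abelian_group_induct [where S = S])
    case 2
    then show ?case
      using additive_zero [OF carrier_additive_subgroup assms(1-3)]
      by (simp add: formal_eval_zero P.formal_eval_zero)
  next
    case (3 x y)
    have c: "formal_eval G f x \<in> carrier G" "formal_eval G f y \<in> carrier G"
      "formal_eval G f (x - y) \<in> carrier G"
      using 3 f keys_diff [of x y] by (auto intro!: formal_eval_closed [of _ S])
    have "formal_eval G f x = formal_eval G f (x - y) \<oplus> formal_eval G f y"
      using formal_eval_diff [OF 3(1,2) f] c by (simp add: a_minus_def a_assoc l_neg)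
    then have "h (formal_eval G f x) = h (formal_eval G f (x - y)) \<oplus>\<^bsub>P\<^esub> h (formal_eval G f y)"
      using assms(3) c by simp
    moreover have "h (formal_eval G f (x - y)) \<in> carrier P" "h (formal_eval G f y) \<in> carrier P"
      using c assms(2) by auto
    ultimately have "h (formal_eval G f (x - y)) = h (formal_eval G f x) \<ominus>\<^bsub>P\<^esub> h (formal_eval G f y)"
      by (simp add: a_minus_def P.a_assoc P.r_neg)
    then show ?case using 3 P.formal_eval_diff [OF 3(1,2) hf] by simp
  next
    case (4 a)
    then show ?case using f hf by (auto simp: formal_eval_frag_of P.formal_eval_frag_of Pi_def)
  qed (use k in auto)
  then show ?thesis using k .
qed

lemma formal_eval_cong:
  assumes "Poly_Mapping.keys x \<subseteq> S" "g \<in> S \<rightarrow> carrier G" "\<And>i. i \<in> S \<Longrightarrow> f i = g i"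
  shows "formal_eval G f x = formal_eval G g x"
  unfolding formal_eval_def by (rule finsum_cong') (use assms in \<open>auto simp: subset_iff\<close>)

end

definition balanced ::
  "('r, 'c) ring_scheme \<Rightarrow> ('p, 'm, 'r, 'x) bimod_scheme \<Rightarrow> ('r, 'n, 'q, 'y) bimod_scheme
     \<Rightarrow> ('t, 'z) ring_scheme \<Rightarrow> ('m \<Rightarrow> 'n \<Rightarrow> 't) \<Rightarrow> bool" where
  "balanced R M N P f \<longleftrightarrow>
     (\<forall>m\<in>carrier M. \<forall>n\<in>carrier N. f m n \<in> carrier P) \<and>
     (\<forall>m\<in>carrier M. \<forall>m'\<in>carrier M. \<forall>n\<in>carrier N. f (m \<oplus>\<^bsub>M\<^esub> m') n = f m n \<oplus>\<^bsub>P\<^esub> f m' n) \<and>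
     (\<forall>m\<in>carrier M. \<forall>n\<in>carrier N. \<forall>n'\<in>carrier N. f m (n \<oplus>\<^bsub>N\<^esub> n') = f m n \<oplus>\<^bsub>P\<^esub> f m n') \<and>
     (\<forall>m\<in>carrier M. \<forall>n\<in>carrier N. \<forall>r\<in>carrier R. f (ract M m r) n = f m (lact N r n))"

lemma balancedI:
  assumes "\<And>m n. m \<in> carrier M \<Longrightarrow> n \<in> carrier N \<Longrightarrow> f m n \<in> carrier P"
    "\<And>m m' n. m \<in> carrier M \<Longrightarrow> m' \<in> carrier M \<Longrightarrow> n \<in> carrier N \<Longrightarrow> f (m \<oplus>\<^bsub>M\<^esub> m') n = f m n \<oplus>\<^bsub>P\<^esub> f m' n"
    "\<And>m n n'. m \<in> carrier M \<Longrightarrow> n \<in> carrier N \<Longrightarrow> n' \<in> carrier N \<Longrightarrow> f m (n \<oplus>\<^bsub>N\<^esub> n') = f m n \<oplus>\<^bsub>P\<^esub> f m n'"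
    "\<And>m n r. m \<in> carrier M \<Longrightarrow> n \<in> carrier N \<Longrightarrow> r \<in> carrier R \<Longrightarrow> f (ract M m r) n = f m (lact N r n)"
  shows "balanced R M N P f"
  using assms unfolding balanced_def by blast

lemma balancedD:
  assumes "balanced R M N P f"
  shows "m \<in> carrier M \<Longrightarrow> n \<in> carrier N \<Longrightarrow> f m n \<in> carrier P"
    "m \<in> carrier M \<Longrightarrow> m' \<in> carrier M \<Longrightarrow> n \<in> carrier N \<Longrightarrow> f (m \<oplus>\<^bsub>M\<^esub> m') n = f m n \<oplus>\<^bsub>P\<^esub> f m' n"
    "m \<in> carrier M \<Longrightarrow> n \<in> carrier N \<Longrightarrow> n' \<in> carrier N \<Longrightarrow> f m (n \<oplus>\<^bsub>N\<^esub> n') = f m n \<oplus>\<^bsub>P\<^esub> f m n'"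
    "m \<in> carrier M \<Longrightarrow> n \<in> carrier N \<Longrightarrow> r \<in> carrier R \<Longrightarrow> f (ract M m r) n = f m (lact N r n)"
  using assms unfolding balanced_def by blast+

lemma bimod_of_simps [simp]:
  "carrier (bimod_of G l r) = carrier G" "ring.add (bimod_of G l r) = ring.add G"
  "ring.zero (bimod_of G l r) = ring.zero G" "lact (bimod_of G l r) = l" "ract (bimod_of G l r) = r"
  by (simp_all add: bimod_of_def)

lemma abelian_group_cong:
  assumes "abelian_group G" "carrier H = carrier G" "ring.add H = ring.add G" "ring.zero H = ring.zero G"
  shows "abelian_group H"
proof -
  interpret G: abelian_group G by fact
  show ?thesis
    by (rule abelian_groupI) (auto simp: assms G.a_ac G.r_neg intro!: bexI [OF _ G.a_inv_closed])
qed

lemma abelian_group_bimod_of [simp]: "abelian_group G \<Longrightarrow> abelian_group (bimod_of G l r)"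
  by (rule abelian_group_cong) auto

locale tensor_product = M: bimodule P R M + N: bimodule R Q N
  for P :: "('p, 'c) ring_scheme" and R :: "('r, 'e) ring_scheme" and Q :: "('q, 'd) ring_scheme"
    and M :: "('p, 'm, 'r, 'x) bimod_scheme" and N :: "('r, 'n, 'q, 'y) bimod_scheme"
begin

abbreviation "S \<equiv> carrier M \<times> carrier N"
abbreviation "F \<equiv> free_Abelian_group S"
abbreviation "K \<equiv> tensor_subgroup R M N"
abbreviation "T \<equiv> tensor R M N"
abbreviation "pure \<equiv> pure_tensor R M N"

interpretation F: comm_group F by (rule abelian_free_Abelian_group)

lemma keys_diff2: "a \<in> S \<Longrightarrow> b \<in> S \<Longrightarrow> Poly_Mapping.keys (frag_of a - frag_of b) \<subseteq> S"
  by (rule order_trans [OF keys_diff]) simp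

lemma keys_diff3:
  "a \<in> S \<Longrightarrow> b \<in> S \<Longrightarrow> c \<in> S \<Longrightarrow> Poly_Mapping.keys (frag_of a - frag_of b - frag_of c) \<subseteq> S"
  by (rule order_trans [OF keys_diff Un_least [OF keys_diff2]]) simp_all

lemma tensor_rels_carrier: "tensor_rels R M N \<subseteq> carrier F"
proof
  fix x assume "x \<in> tensor_rels R M N"
  then have "Poly_Mapping.keys x \<subseteq> S"
    unfolding tensor_rels_def
    by (elim UnE CollectE exE conjE)
      (simp_all only:, (rule keys_diff3 keys_diff2; simp add: M.ract_closed N.lact_closed)+)
  then show "x \<in> carrier F" by simp
qed

lemma K_subgroup: "subgroup K F"
  unfolding tensor_subgroup_def using tensor_rels_carrier by (rule F.generate_is_subgroup)

lemma K_normal: "K \<lhd> F"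
  using K_subgroup by (rule F.subgroup_imp_normal)

lemma rel_in_K: "x \<in> tensor_rels R M N \<Longrightarrow> x \<in> K"
  unfolding tensor_subgroup_def by (rule generate.incl)

lemma tensor_group_simps:
  "carrier (tensor_group R M N) = carrier (F Mod K)" "ring.add (tensor_group R M N) = monoid.mult (F Mod K)"
  "ring.zero (tensor_group R M N) = K"
  by (simp_all add: tensor_group_def Let_def FactGroup_def)

lemma tensor_group_abelian: "abelian_group (tensor_group R M N)"
proof -
  have "comm_group (F Mod K)" using K_subgroup by (rule F.abelian_FactGroup)
  moreover have "add_monoid (tensor_group R M N) = F Mod K"
    by (simp add: tensor_group_simps FactGroup_def)
  ultimately show ?thesis by (metis comm_group_abelian_groupI)
qed

lemma tensor_simps:
  "carrier T = carrier (tensor_group R M N)" "ring.add T = ring.add (tensor_group R M N)"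
  "ring.zero T = ring.zero (tensor_group R M N)"
  by (simp_all add: tensor_def Let_def)

lemma T_abelian: "abelian_group T"
  by (rule abelian_group_cong [OF tensor_group_abelian]) (simp_all add: tensor_simps)

sublocale T: abelian_group T by (rule T_abelian)

lemma T_carrierE:
  assumes "u \<in> carrier T" obtains x where "Poly_Mapping.keys x \<subseteq> S" "u = K #>\<^bsub>F\<^esub> x"
  using assms by (auto simp: tensor_simps tensor_group_simps carrier_FactGroup)

lemma coset_closed: "Poly_Mapping.keys x \<subseteq> S \<Longrightarrow> K #>\<^bsub>F\<^esub> x \<in> carrier T"
  by (auto simp: tensor_simps tensor_group_simps carrier_FactGroup)

lemma coset_add:
  assumes "Poly_Mapping.keys x \<subseteq> S" "Poly_Mapping.keys y \<subseteq> S"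
  shows "(K #>\<^bsub>F\<^esub> x) \<oplus>\<^bsub>T\<^esub> (K #>\<^bsub>F\<^esub> y) = K #>\<^bsub>F\<^esub> (x + y)"
  using normal.rcos_sum [OF K_normal, of x y] assms by (simp add: tensor_simps tensor_group_simps)

lemma coset_eq:
  assumes "Poly_Mapping.keys x \<subseteq> S" "Poly_Mapping.keys y \<subseteq> S" "x - y \<in> K"
  shows "K #>\<^bsub>F\<^esub> x = K #>\<^bsub>F\<^esub> y"
proof -
  have "x = (x - y) \<otimes>\<^bsub>F\<^esub> y" by simp
  then have "x \<in> K #>\<^bsub>F\<^esub> y" unfolding r_coset_def using assms(3) by blast
  then show ?thesis using F.repr_independence [OF _ _ K_subgroup] assms by simp
qed

lemma pure_closed: "m \<in> carrier M \<Longrightarrow> n \<in> carrier N \<Longrightarrow> pure m n \<in> carrier T"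
  unfolding pure_tensor_def by (rule coset_closed) simp

lemma pure_add_left:
  assumes "m \<in> carrier M" "m' \<in> carrier M" "n \<in> carrier N"
  shows "pure (m \<oplus>\<^bsub>M\<^esub> m') n = pure m n \<oplus>\<^bsub>T\<^esub> pure m' n"
proof -
  have "frag_of (m \<oplus>\<^bsub>M\<^esub> m', n) - frag_of (m, n) - frag_of (m', n) \<in> K"
    by (rule rel_in_K) (use assms in \<open>auto simp: tensor_rels_def\<close>)
  then have "K #>\<^bsub>F\<^esub> frag_of (m \<oplus>\<^bsub>M\<^esub> m', n) = K #>\<^bsub>F\<^esub> (frag_of (m, n) + frag_of (m', n))"
    by (intro coset_eq) (use assms keys_add [of "frag_of (m, n)" "frag_of (m', n)"] in \<open>auto simp: diff_diff_eq\<close>)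
  then show ?thesis unfolding pure_tensor_def using assms by (subst coset_add) auto
qed

lemma pure_add_right:
  assumes "m \<in> carrier M" "n \<in> carrier N" "n' \<in> carrier N"
  shows "pure m (n \<oplus>\<^bsub>N\<^esub> n') = pure m n \<oplus>\<^bsub>T\<^esub> pure m n'"
proof -
  have "frag_of (m, n \<oplus>\<^bsub>N\<^esub> n') - frag_of (m, n) - frag_of (m, n') \<in> K"
    by (rule rel_in_K) (use assms in \<open>auto simp: tensor_rels_def\<close>)
  then have "K #>\<^bsub>F\<^esub> frag_of (m, n \<oplus>\<^bsub>N\<^esub> n') = K #>\<^bsub>F\<^esub> (frag_of (m, n) + frag_of (m, n'))"
    by (intro coset_eq) (use assms keys_add [of "frag_of (m, n)" "frag_of (m, n')"] in \<open>auto simp: diff_diff_eq\<close>)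
  then show ?thesis unfolding pure_tensor_def using assms by (subst coset_add) auto
qed

lemma pure_balanced:
  assumes "m \<in> carrier M" "n \<in> carrier N" "r \<in> carrier R"
  shows "pure (ract M m r) n = pure m (lact N r n)"
proof -
  have "frag_of (ract M m r, n) - frag_of (m, lact N r n) \<in> K"
    by (rule rel_in_K) (use assms in \<open>auto simp: tensor_rels_def\<close>)
  then show ?thesis unfolding pure_tensor_def
    by (intro coset_eq) (use assms M.ract_closed N.lact_closed in auto)
qed

lemma balanced_pure: "balanced R M N T pure"
  by (intro balancedI pure_closed pure_add_left pure_add_right pure_balanced)

lemma pure_minus:
  assumes "m \<in> carrier M" "n \<in> carrier N"
  shows "\<ominus>\<^bsub>T\<^esub> pure m n = pure (\<ominus>\<^bsub>M\<^esub> m) n"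
proof (rule T.minus_equality)
  have z: "pure \<zero>\<^bsub>M\<^esub> n = \<zero>\<^bsub>T\<^esub>"
    by (rule M.additive_zero [OF M.carrier_additive_subgroup T_abelian, of "\<lambda>m. pure m n"])
      (use assms pure_closed pure_add_left in auto)
  show "pure (\<ominus>\<^bsub>M\<^esub> m) n \<oplus>\<^bsub>T\<^esub> pure m n = \<zero>\<^bsub>T\<^esub>"
    using assms pure_add_left [of "\<ominus>\<^bsub>M\<^esub> m" m n] z by (simp add: M.l_neg)
qed (use assms pure_closed in auto)

text \<open>Negatives of pure tensors are pure tensors, so sums of pure tensors exhaust the group
  and no case for negation arises.\<close>

lemma tensor_induct [consumes 1, case_names zero pure add]:
  assumes u: "u \<in> carrier T" and z: "Pr \<zero>\<^bsub>T\<^esub>"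
    and p: "\<And>m n. m \<in> carrier M \<Longrightarrow> n \<in> carrier N \<Longrightarrow> Pr (pure m n)"
    and a: "\<And>u v. u \<in> carrier T \<Longrightarrow> v \<in> carrier T \<Longrightarrow> Pr u \<Longrightarrow> Pr v \<Longrightarrow> Pr (u \<oplus>\<^bsub>T\<^esub> v)"
  shows "Pr u"
proof -
  obtain x where x: "Poly_Mapping.keys x \<subseteq> S" "u = K #>\<^bsub>F\<^esub> x" using u by (rule T_carrierE)
  have K0: "K #>\<^bsub>F\<^esub> 0 = \<zero>\<^bsub>T\<^esub>"
    using F.coset_mult_one [OF subgroup.subset [OF K_subgroup]]
    by (simp add: tensor_simps tensor_group_simps)
  \<comment> \<open>Induction on the free abelian group produces differences, so the property is
    carried along for a coset and its negative together.\<close>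
  have "Pr (K #>\<^bsub>F\<^esub> x) \<and> Pr (\<ominus>\<^bsub>T\<^esub> (K #>\<^bsub>F\<^esub> x))"
    using x(1)
  proof (induction x rule: free_Abelian_group_induct [where S = S])
    case 2
    have "\<ominus>\<^bsub>T\<^esub> \<zero>\<^bsub>T\<^esub> = \<zero>\<^bsub>T\<^esub>" by (rule T.minus_equality) auto
    then have "Pr (\<ominus>\<^bsub>T\<^esub> \<zero>\<^bsub>T\<^esub>)" using z by (simp only:)
    then show ?case using z unfolding K0 by blast
  next
    case (3 x y)
    have k: "Poly_Mapping.keys (x - y) \<subseteq> S" using 3 keys_diff [of x y] by blast
    note c = coset_closed [OF 3(1)] coset_closed [OF 3(2)] coset_closed [OF k]
    have "K #>\<^bsub>F\<^esub> x = (K #>\<^bsub>F\<^esub> (x - y)) \<oplus>\<^bsub>T\<^esub> (K #>\<^bsub>F\<^esub> y)"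
      using coset_add [OF k 3(2)] by simp
    then have e: "K #>\<^bsub>F\<^esub> (x - y) = (K #>\<^bsub>F\<^esub> x) \<oplus>\<^bsub>T\<^esub> (\<ominus>\<^bsub>T\<^esub> (K #>\<^bsub>F\<^esub> y))"
      using c by (simp add: T.a_assoc T.r_neg)
    have "\<ominus>\<^bsub>T\<^esub> (K #>\<^bsub>F\<^esub> (x - y)) = (\<ominus>\<^bsub>T\<^esub> (K #>\<^bsub>F\<^esub> x)) \<oplus>\<^bsub>T\<^esub> (K #>\<^bsub>F\<^esub> y)"
      unfolding e using c by (simp add: T.minus_add)
    then show ?case using e 3 c a by auto
  next
    case (4 s)
    then obtain m n where s: "s = (m, n)" "m \<in> carrier M" "n \<in> carrier N" by auto
    have "K #>\<^bsub>F\<^esub> frag_of s = pure m n" by (simp add: pure_tensor_def s)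
    then show ?case using p s pure_minus by auto
  qed (use x in auto)
  then show ?thesis using x by simp
qed

lemma additive_eq:
  assumes G: "abelian_group G" and u: "u \<in> carrier T"
    and h: "\<And>u. u \<in> carrier T \<Longrightarrow> h u \<in> carrier G" "\<And>u v. u \<in> carrier T \<Longrightarrow> v \<in> carrier T \<Longrightarrow> h (u \<oplus>\<^bsub>T\<^esub> v) = h u \<oplus>\<^bsub>G\<^esub> h v"
    and h': "\<And>u. u \<in> carrier T \<Longrightarrow> h' u \<in> carrier G" "\<And>u v. u \<in> carrier T \<Longrightarrow> v \<in> carrier T \<Longrightarrow> h' (u \<oplus>\<^bsub>T\<^esub> v) = h' u \<oplus>\<^bsub>G\<^esub> h' v"
    and eq: "\<And>m n. m \<in> carrier M \<Longrightarrow> n \<in> carrier N \<Longrightarrow> h (pure m n) = h' (pure m n)"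
  shows "h u = h' u"
  using u
proof (induction u rule: tensor_induct)
  case zero
  have "h \<zero>\<^bsub>T\<^esub> = \<zero>\<^bsub>G\<^esub>" "h' \<zero>\<^bsub>T\<^esub> = \<zero>\<^bsub>G\<^esub>"
    using T.additive_zero [OF T.carrier_additive_subgroup G] h h' by auto
  then show ?case by simp
qed (use eq h h' in auto)

context
  fixes G f assumes G: "abelian_group G" and f: "balanced R M N G f"
begin

interpretation G: abelian_group G by (rule G)

abbreviation "ev \<equiv> formal_eval G (\<lambda>(m, n). f m n)"

lemma fS: "(\<lambda>(m, n). f m n) \<in> S \<rightarrow> carrier G"
  using balancedD(1)[OF f] by auto

text \<open>The kernel of the evaluation is a subgroup containing the defining relations. Hence
  evaluation is constant on cosets, and \<open>the_elem\<close> in \<open>tensor_lift\<close> is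
  applied to a singleton.\<close>

lemma ev_K: "x \<in> K \<Longrightarrow> ev x = \<zero>\<^bsub>G\<^esub>"
proof -
  have fo: "ev (frag_of (m, n)) = f m n" if "m \<in> carrier M" "n \<in> carrier N" for m n
    using G.formal_eval_frag_of [of "\<lambda>(m, n). f m n" "(m, n)"] balancedD(1)[OF f] that by simp
  have d3: "ev (frag_of a - frag_of b - frag_of c) = ev (frag_of a) \<ominus>\<^bsub>G\<^esub> ev (frag_of b) \<ominus>\<^bsub>G\<^esub> ev (frag_of c)"
    if "a \<in> S" "b \<in> S" "c \<in> S" for a b c
    using G.formal_eval_diff [OF keys_diff2 [OF that(1,2)] _ fS, of "frag_of c"]
      G.formal_eval_diff [OF _ _ fS, of "frag_of a" "frag_of b"] that by simp
  have d2: "ev (frag_of a - frag_of b) = ev (frag_of a) \<ominus>\<^bsub>G\<^esub> ev (frag_of b)"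
    if "a \<in> S" "b \<in> S" for a b
    using G.formal_eval_diff [OF _ _ fS, of "frag_of a" "frag_of b"] that by simp
  define L where "L = {x \<in> carrier F. ev x = \<zero>\<^bsub>G\<^esub>}"
  have cancel: "(a \<oplus>\<^bsub>G\<^esub> b) \<ominus>\<^bsub>G\<^esub> a \<ominus>\<^bsub>G\<^esub> b = \<zero>\<^bsub>G\<^esub>" if "a \<in> carrier G" "b \<in> carrier G" for a b
  proof -
    have "(a \<oplus>\<^bsub>G\<^esub> b) \<ominus>\<^bsub>G\<^esub> a \<ominus>\<^bsub>G\<^esub> b = (a \<oplus>\<^bsub>G\<^esub> b) \<oplus>\<^bsub>G\<^esub> \<ominus>\<^bsub>G\<^esub> (a \<oplus>\<^bsub>G\<^esub> b)"
      using that by (simp add: a_minus_def G.minus_add G.a_assoc)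
    then show ?thesis using that by (simp add: G.r_neg)
  qed
  have "tensor_rels R M N \<subseteq> L"
  proof
    fix x assume x: "x \<in> tensor_rels R M N"
    then have xF: "x \<in> carrier F" using tensor_rels_carrier by blast
    from x have "ev x = \<zero>\<^bsub>G\<^esub>"
      unfolding tensor_rels_def
    proof (elim UnE CollectE exE conjE)
      fix m m' n assume "x = frag_of (m \<oplus>\<^bsub>M\<^esub> m', n) - frag_of (m, n) - frag_of (m', n)"
        "m \<in> carrier M" "m' \<in> carrier M" "n \<in> carrier N"
      then show ?thesis using balancedD(1,2)[OF f] by (simp add: d3 fo cancel)
    next
      fix m n n' assume "x = frag_of (m, n \<oplus>\<^bsub>N\<^esub> n') - frag_of (m, n) - frag_of (m, n')"
        "m \<in> carrier M" "n \<in> carrier N" "n' \<in> carrier N"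
      then show ?thesis using balancedD(1,3)[OF f] by (simp add: d3 fo cancel)
    next
      fix m r n assume "x = frag_of (ract M m r, n) - frag_of (m, lact N r n)"
        "m \<in> carrier M" "r \<in> carrier R" "n \<in> carrier N"
      then show ?thesis using balancedD(1,4)[OF f]
        by (simp add: d2 fo M.ract_closed N.lact_closed a_minus_def G.r_neg)
    qed
    then show "x \<in> L" using xF by (simp add: L_def)
  qed
  moreover have "subgroup L F"
  proof (rule F.subgroupI)
    have "0 \<in> L" by (simp add: L_def G.formal_eval_zero)
    then show "L \<noteq> {}" by blast
    fix a assume a: "a \<in> L"
    have "ev (0 - a) = \<zero>\<^bsub>G\<^esub>"
      using G.formal_eval_diff [OF _ _ fS, of 0 a] a by (simp add: L_def G.formal_eval_zero a_minus_def)
    then show "inv\<^bsub>F\<^esub> a \<in> L" using a by (simp add: L_def)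
    fix b assume b: "b \<in> L"
    show "a \<otimes>\<^bsub>F\<^esub> b \<in> L"
      using a b G.formal_eval_add [OF _ _ fS, of a b] keys_add [of a b] by (auto simp: L_def)
  qed (auto simp: L_def)
  ultimately have "K \<subseteq> L" unfolding tensor_subgroup_def by (rule F.generate_subgroup_incl)
  then show "x \<in> K \<Longrightarrow> ev x = \<zero>\<^bsub>G\<^esub>" by (auto simp: L_def)
qed

lemma K_keys: "x \<in> K \<Longrightarrow> Poly_Mapping.keys x \<subseteq> S"
  using subsetD [OF subgroup.subset [OF K_subgroup]] by (simp only: carrier_free_Abelian_group_iff)

lemma ev_coset:
  assumes x: "Poly_Mapping.keys x \<subseteq> S" and y: "y \<in> K #>\<^bsub>F\<^esub> x"
  shows "ev y = ev x"
proof -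
  obtain k where k: "k \<in> K" "y = k + x" using y by (auto simp: r_coset_def)
  then show ?thesis
    using G.formal_eval_add [OF K_keys [OF k(1)] x fS] ev_K [OF k(1)] G.formal_eval_closed [OF x fS]
    by simp
qed

lemma lift_coset:
  assumes "Poly_Mapping.keys x \<subseteq> S" shows "tensor_lift G f (K #>\<^bsub>F\<^esub> x) = ev x"
proof -
  have "x \<in> K #>\<^bsub>F\<^esub> x" using F.rcos_self [OF _ K_subgroup] assms by simp
  then have "ev ` (K #>\<^bsub>F\<^esub> x) = {ev x}" using ev_coset [OF assms] by blast
  then show ?thesis by (simp add: tensor_lift_def)
qed

text \<open>For evaluation through an arbitrary representative of a coset, as multiplicativity of
  the coproduct is stated.\<close>

lemma lift_rep:
  assumes "u \<in> carrier T" "x \<in> u"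
  shows "ev x = tensor_lift G f u" "Poly_Mapping.keys x \<subseteq> S"
proof -
  obtain y where y: "Poly_Mapping.keys y \<subseteq> S" "u = K #>\<^bsub>F\<^esub> y" using assms(1) by (rule T_carrierE)
  then show "ev x = tensor_lift G f u" using ev_coset assms(2) lift_coset by simp
  have "K #>\<^bsub>F\<^esub> y \<subseteq> carrier F"
    using y by (intro F.r_coset_subset_G subgroup.subset [OF K_subgroup]) auto
  then have "x \<in> carrier F" using assms(2) y(2) by blast
  then show "Poly_Mapping.keys x \<subseteq> S" by (simp only: carrier_free_Abelian_group_iff)
qed

lemma lift_pure: "m \<in> carrier M \<Longrightarrow> n \<in> carrier N \<Longrightarrow> tensor_lift G f (pure m n) = f m n"
  unfolding pure_tensor_def
  using lift_coset [of "frag_of (m, n)"] G.formal_eval_frag_of [of "\<lambda>(m, n). f m n" "(m, n)"]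
    balancedD(1)[OF f] by simp

lemma lift_closed: "u \<in> carrier T \<Longrightarrow> tensor_lift G f u \<in> carrier G"
  by (erule T_carrierE) (simp add: lift_coset G.formal_eval_closed [OF _ fS])

lemma lift_add:
  assumes "u \<in> carrier T" "v \<in> carrier T"
  shows "tensor_lift G f (u \<oplus>\<^bsub>T\<^esub> v) = tensor_lift G f u \<oplus>\<^bsub>G\<^esub> tensor_lift G f v"
proof -
  obtain x where x: "Poly_Mapping.keys x \<subseteq> S" "u = K #>\<^bsub>F\<^esub> x" using assms(1) by (rule T_carrierE)
  obtain y where y: "Poly_Mapping.keys y \<subseteq> S" "v = K #>\<^bsub>F\<^esub> y" using assms(2) by (rule T_carrierE)
  have "Poly_Mapping.keys (x + y) \<subseteq> S" using x y keys_add [of x y] by blast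
  then show ?thesis using x y by (simp add: coset_add lift_coset G.formal_eval_add [OF _ _ fS])
qed

end

text \<open>The target is \<open>tensor_group\<close>, not \<open>tensor\<close>, since the actions
  of \<open>tensor\<close> are themselves defined by lifting into
  \<open>tensor_group\<close>.\<close>

lemma balanced_lact: "p \<in> carrier P \<Longrightarrow> balanced R M N (tensor_group R M N) (\<lambda>m n. pure (lact M p m) n)"
  using pure_closed pure_add_left pure_add_right pure_balanced
  by (intro balancedI) (auto simp: tensor_simps [symmetric] M.lact_closed M.lact_add M.lact_ract)

lemma balanced_ract: "q \<in> carrier Q \<Longrightarrow> balanced R M N (tensor_group R M N) (\<lambda>m n. pure m (ract N n q))"
  using pure_closed pure_add_left pure_add_right pure_balanced
  by (intro balancedI)
    (auto simp: tensor_simps [symmetric] N.ract_closed N.lact_closed N.ract_add N.lact_ract [symmetric])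

lemma lact_T: "lact T p = tensor_lift (tensor_group R M N) (\<lambda>m n. pure (lact M p m) n)"
  by (simp add: tensor_def Let_def)

lemma ract_T: "ract T u q = tensor_lift (tensor_group R M N) (\<lambda>m n. pure m (ract N n q)) u"
  by (simp add: tensor_def Let_def)

lemma lact_pure:
  "p \<in> carrier P \<Longrightarrow> m \<in> carrier M \<Longrightarrow> n \<in> carrier N \<Longrightarrow> lact T p (pure m n) = pure (lact M p m) n"
  unfolding lact_T by (rule lift_pure [OF tensor_group_abelian balanced_lact])

lemma ract_pure:
  "q \<in> carrier Q \<Longrightarrow> m \<in> carrier M \<Longrightarrow> n \<in> carrier N \<Longrightarrow> ract T (pure m n) q = pure m (ract N n q)"
  unfolding ract_T by (rule lift_pure [OF tensor_group_abelian balanced_ract])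

lemma tensor_bimodule: "bimodule P Q T"
proof unfold_locales
  fix p u v assume p: "p \<in> carrier P" and u: "u \<in> carrier T"
  show cl: "lact T p u \<in> carrier T"
    using lift_closed [OF tensor_group_abelian balanced_lact [OF p] u] by (simp add: lact_T tensor_simps)
  show "lact T p (u \<oplus>\<^bsub>T\<^esub> v) = lact T p u \<oplus>\<^bsub>T\<^esub> lact T p v" if v: "v \<in> carrier T"
    using lift_add [OF tensor_group_abelian balanced_lact [OF p] u v] by (simp add: lact_T tensor_simps)
next
  fix q u v assume q: "q \<in> carrier Q" and u: "u \<in> carrier T"
  show "ract T u q \<in> carrier T"
    using lift_closed [OF tensor_group_abelian balanced_ract [OF q] u] by (simp add: ract_T tensor_simps)
  show "ract T (u \<oplus>\<^bsub>T\<^esub> v) q = ract T u q \<oplus>\<^bsub>T\<^esub> ract T v q" if v: "v \<in> carrier T"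
    using lift_add [OF tensor_group_abelian balanced_ract [OF q] u v] by (simp add: ract_T tensor_simps)
next
  fix p q u assume p: "p \<in> carrier P" and q: "q \<in> carrier Q" and u: "u \<in> carrier T"
  have L: "lact T p u \<in> carrier T" if "u \<in> carrier T" for u
    using lift_closed [OF tensor_group_abelian balanced_lact [OF p] that] by (simp add: lact_T tensor_simps)
  have LA: "lact T p (u \<oplus>\<^bsub>T\<^esub> v) = lact T p u \<oplus>\<^bsub>T\<^esub> lact T p v" if "u \<in> carrier T" "v \<in> carrier T" for u v
    using lift_add [OF tensor_group_abelian balanced_lact [OF p] that] by (simp add: lact_T tensor_simps)
  have Q: "ract T u q \<in> carrier T" if "u \<in> carrier T" for u
    using lift_closed [OF tensor_group_abelian balanced_ract [OF q] that] by (simp add: ract_T tensor_simps)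
  have QA: "ract T (u \<oplus>\<^bsub>T\<^esub> v) q = ract T u q \<oplus>\<^bsub>T\<^esub> ract T v q" if "u \<in> carrier T" "v \<in> carrier T" for u v
    using lift_add [OF tensor_group_abelian balanced_ract [OF q] that] by (simp add: ract_T tensor_simps)
  show "lact T p (ract T u q) = ract T (lact T p u) q"
    by (rule additive_eq [OF T_abelian u])
      (use p q L LA Q QA in \<open>auto simp: lact_pure ract_pure M.lact_closed N.ract_closed\<close>)
qed

end

section \<open>Projective modules and H-separability\<close>

lemma bimod_homI:
  assumes "\<And>x. x \<in> carrier M \<Longrightarrow> f x \<in> carrier N"
    "\<And>x y. x \<in> carrier M \<Longrightarrow> y \<in> carrier M \<Longrightarrow> f (x \<oplus>\<^bsub>M\<^esub> y) = f x \<oplus>\<^bsub>N\<^esub> f y"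
    "\<And>p x. p \<in> carrier P \<Longrightarrow> x \<in> carrier M \<Longrightarrow> f (lact M p x) = lact N p (f x)"
    "\<And>q x. q \<in> carrier Q \<Longrightarrow> x \<in> carrier M \<Longrightarrow> f (ract M x q) = ract N (f x) q"
  shows "f \<in> bimod_hom P Q M N"
  using assms unfolding bimod_hom_def by blast

lemma bimod_homD:
  assumes "f \<in> bimod_hom P Q M N"
  shows "x \<in> carrier M \<Longrightarrow> f x \<in> carrier N"
    "x \<in> carrier M \<Longrightarrow> y \<in> carrier M \<Longrightarrow> f (x \<oplus>\<^bsub>M\<^esub> y) = f x \<oplus>\<^bsub>N\<^esub> f y"
    "p \<in> carrier P \<Longrightarrow> x \<in> carrier M \<Longrightarrow> f (lact M p x) = lact N p (f x)"
    "q \<in> carrier Q \<Longrightarrow> x \<in> carrier M \<Longrightarrow> f (ract M x q) = ract N (f x) q"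
  using assms unfolding bimod_hom_def by blast+

text \<open>The retraction sends \<open>m\<close> to the element of \<open>N\<close> that
  corresponds to its component in \<open>U\<close>. Uniqueness of this component makes
  \<open>g\<close> a homomorphism: in each case a decomposition of the result is exhibited.\<close>

lemma direct_summand_retract:
  assumes N: "bimodule P Q N" and M: "bimodule P Q M" and s: "iso_direct_summand P Q N M"
  obtains f g where "f \<in> bimod_hom P Q N M" "g \<in> bimod_hom P Q M N" "\<And>x. x \<in> carrier N \<Longrightarrow> g (f x) = x"
proof -
  interpret N: bimodule P Q N by fact
  interpret M: bimodule P Q M by fact
  from s obtain U V f where U: "sub_bimod P Q U M" and V: "sub_bimod P Q V M" and UV: "U \<inter> V = {\<zero>\<^bsub>M\<^esub>}"
    and sum: "U <+>\<^bsub>M\<^esub> V = carrier M" and f: "f \<in> bimod_hom P Q N (M\<lparr>carrier := U\<rparr>)"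
    and bij: "bij_betw f (carrier N) U" unfolding iso_direct_summand_def by blast
  interpret U: additive_subgroup U M using U by (simp add: sub_bimod_def)
  interpret V: additive_subgroup V M using V by (simp add: sub_bimod_def)
  have fU: "f x \<in> U" if "x \<in> carrier N" for x using bimod_homD(1)[OF f that] by simp
  have fhom: "f \<in> bimod_hom P Q N M"
    by (rule bimod_homI) (use bimod_homD [OF f] fU U.a_Hcarr in auto)
  define dec where "dec m x \<longleftrightarrow> x \<in> carrier N \<and> (\<exists>v\<in>V. m = f x \<oplus>\<^bsub>M\<^esub> v)" for m x
  have ex: "\<exists>x. dec m x" if m: "m \<in> carrier M" for m
  proof -
    obtain u v where uv: "u \<in> U" "v \<in> V" "m = u \<oplus>\<^bsub>M\<^esub> v"
      using m sum unfolding set_add_def' by blast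
    then obtain x where "x \<in> carrier N" "u = f x" using bij by (auto simp: bij_betw_def)
    then show ?thesis using uv by (auto simp: dec_def)
  qed
  have uniq: "x = y" if dx: "dec m x" and dy: "dec m y" for m x y
  proof -
    obtain v w where v: "x \<in> carrier N" "v \<in> V" "m = f x \<oplus>\<^bsub>M\<^esub> v"
      and w: "y \<in> carrier N" "w \<in> V" "m = f y \<oplus>\<^bsub>M\<^esub> w" using dx dy by (auto simp: dec_def)
    have c: "f x \<in> carrier M" "f y \<in> carrier M" "v \<in> carrier M" "w \<in> carrier M"
      using fU v w U.a_Hcarr V.a_Hcarr by auto
    have "f x = (f y \<oplus>\<^bsub>M\<^esub> w) \<oplus>\<^bsub>M\<^esub> \<ominus>\<^bsub>M\<^esub> v"
      using v(3) w(3) c by (metis M.add.inv_solve_right M.a_closed)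
    then have "\<ominus>\<^bsub>M\<^esub> f y \<oplus>\<^bsub>M\<^esub> f x = w \<oplus>\<^bsub>M\<^esub> \<ominus>\<^bsub>M\<^esub> v"
      using c by (simp add: M.a_assoc M.r_neg1)
    moreover have "\<ominus>\<^bsub>M\<^esub> f y \<oplus>\<^bsub>M\<^esub> f x \<in> U" using fU v w by simp
    moreover have "w \<oplus>\<^bsub>M\<^esub> \<ominus>\<^bsub>M\<^esub> v \<in> V" using v w by simp
    ultimately have "\<ominus>\<^bsub>M\<^esub> f y \<oplus>\<^bsub>M\<^esub> f x = \<zero>\<^bsub>M\<^esub>" using UV by auto
    then have "\<ominus>\<^bsub>M\<^esub> f x = \<ominus>\<^bsub>M\<^esub> f y"
      using c by (intro M.minus_equality) auto
    then have "f x = f y" using c M.minus_minus by metis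
    then show ?thesis using bij v w by (auto simp: bij_betw_def inj_on_def)
  qed
  define g where "g m = (THE x. dec m x)" for m
  have g_eq: "g m = x" if "dec m x" for m x
    unfolding g_def using that uniq by blast
  have g_dec: "dec m (g m)" if "m \<in> carrier M" for m using ex [OF that] g_eq by metis
  have gN: "g m \<in> carrier N" if "m \<in> carrier M" for m using g_dec [OF that] by (simp add: dec_def)
  have "g \<in> bimod_hom P Q M N"
  proof (rule bimod_homI)
    fix m assume m: "m \<in> carrier M"
    show "g m \<in> carrier N" using gN m .
    obtain v where v: "v \<in> V" "m = f (g m) \<oplus>\<^bsub>M\<^esub> v" using g_dec [OF m] by (auto simp: dec_def)
    have vc: "v \<in> carrier M" "f (g m) \<in> carrier M" "f (g m) \<in> U" using v gN [OF m] fU U.a_Hcarr V.a_Hcarr by auto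
    { fix m' assume m': "m' \<in> carrier M"
      obtain v' where v': "v' \<in> V" "m' = f (g m') \<oplus>\<^bsub>M\<^esub> v'" using g_dec [OF m'] by (auto simp: dec_def)
      have vc': "v' \<in> carrier M" "f (g m') \<in> carrier M" using v' gN [OF m'] fU U.a_Hcarr V.a_Hcarr by auto
      have "m \<oplus>\<^bsub>M\<^esub> m' = (f (g m) \<oplus>\<^bsub>M\<^esub> v) \<oplus>\<^bsub>M\<^esub> (f (g m') \<oplus>\<^bsub>M\<^esub> v')" using v v' by simp
      also have "\<dots> = f (g m \<oplus>\<^bsub>N\<^esub> g m') \<oplus>\<^bsub>M\<^esub> (v \<oplus>\<^bsub>M\<^esub> v')"
        using vc vc' bimod_homD(2)[OF fhom gN [OF m] gN [OF m']] by (simp add: M.a_ac)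
      finally have "dec (m \<oplus>\<^bsub>M\<^esub> m') (g m \<oplus>\<^bsub>N\<^esub> g m')"
        using v v' gN m m' by (auto simp: dec_def)
      then show "g (m \<oplus>\<^bsub>M\<^esub> m') = g m \<oplus>\<^bsub>N\<^esub> g m'" by (rule g_eq) }
    { fix p assume p: "p \<in> carrier P"
      have "lact M p m = lact M p (f (g m) \<oplus>\<^bsub>M\<^esub> v)" using v by simp
      also have "\<dots> = f (lact N p (g m)) \<oplus>\<^bsub>M\<^esub> lact M p v"
        using vc p bimod_homD(3)[OF fhom p gN [OF m]] by (simp add: M.lact_add)
      finally have "dec (lact M p m) (lact N p (g m))"
        using v V p gN [OF m] by (auto simp: dec_def sub_bimod_def N.lact_closed)
      then show "g (lact M p m) = lact N p (g m)" by (rule g_eq) }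
    { fix q assume q: "q \<in> carrier Q"
      have "ract M m q = ract M (f (g m) \<oplus>\<^bsub>M\<^esub> v) q" using v by simp
      also have "\<dots> = f (ract N (g m) q) \<oplus>\<^bsub>M\<^esub> ract M v q"
        using vc q bimod_homD(4)[OF fhom q gN [OF m]] by (simp add: M.ract_add)
      finally have "dec (ract M m q) (ract N (g m) q)"
        using v V q gN [OF m] by (auto simp: dec_def sub_bimod_def N.ract_closed)
      then show "g (ract M m q) = ract N (g m) q" by (rule g_eq) }
  qed
  moreover have "g (f x) = x" if "x \<in> carrier N" for x
  proof (rule g_eq)
    have "f x \<in> carrier M" using fU that U.a_Hcarr by blast
    then show "dec (f x) x" using that unfolding dec_def by (auto intro!: bexI [of _ "\<zero>\<^bsub>M\<^esub>"])
  qed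
  ultimately show ?thesis using that fhom by blast
qed

text \<open>\<open>M\<close> splits into the image of \<open>f\<close> and the kernel of
  \<open>g\<close>.\<close>

lemma retract_direct_summand:
  assumes N: "bimodule P Q N" and M: "bimodule P Q M"
    and f: "f \<in> bimod_hom P Q N M" and g: "g \<in> bimod_hom P Q M N"
    and gf: "\<And>x. x \<in> carrier N \<Longrightarrow> g (f x) = x"
  shows "iso_direct_summand P Q N M"
proof -
  interpret N: bimodule P Q N by fact
  interpret M: bimodule P Q M by fact
  note fD = bimod_homD [OF f] and gD = bimod_homD [OF g]
  define U where "U = f ` carrier N"
  define V where "V = {m \<in> carrier M. g m = \<zero>\<^bsub>N\<^esub>}"
  have f0: "f \<zero>\<^bsub>N\<^esub> = \<zero>\<^bsub>M\<^esub>"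
    by (rule N.additive_zero [OF N.carrier_additive_subgroup M.abelian_group_axioms]) (use fD in auto)
  have g0: "g \<zero>\<^bsub>M\<^esub> = \<zero>\<^bsub>N\<^esub>"
    by (rule M.additive_zero [OF M.carrier_additive_subgroup N.abelian_group_axioms]) (use gD in auto)
  have fneg: "f (\<ominus>\<^bsub>N\<^esub> x) = \<ominus>\<^bsub>M\<^esub> f x" if "x \<in> carrier N" for x
    using that fD(1) fD(2)[of "\<ominus>\<^bsub>N\<^esub> x" x] f0 by (intro M.minus_equality [symmetric]) (auto simp: N.l_neg)
  have gneg: "g (\<ominus>\<^bsub>M\<^esub> x) = \<ominus>\<^bsub>N\<^esub> g x" if "x \<in> carrier M" for x
    using that gD(1) gD(2)[of "\<ominus>\<^bsub>M\<^esub> x" x] g0 by (intro N.minus_equality [symmetric]) (auto simp: M.l_neg)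
  have l0: "lact N p \<zero>\<^bsub>N\<^esub> = \<zero>\<^bsub>N\<^esub>" if "p \<in> carrier P" for p
    by (rule N.additive_zero [OF N.carrier_additive_subgroup N.abelian_group_axioms])
      (use that N.lact_closed N.lact_add in auto)
  have r0: "ract N \<zero>\<^bsub>N\<^esub> q = \<zero>\<^bsub>N\<^esub>" if "q \<in> carrier Q" for q
    by (rule N.additive_zero [OF N.carrier_additive_subgroup N.abelian_group_axioms, of "\<lambda>x. ract N x q"])
      (use that N.ract_closed N.ract_add in auto)
  have Usub: "subgroup U (add_monoid M)"
  proof (rule M.add.subgroupI)
    show "U \<subseteq> carrier M" "U \<noteq> {}" using fD(1) by (auto simp: U_def)
    fix a assume "a \<in> U"
    then obtain x where x: "x \<in> carrier N" "a = f x" by (auto simp: U_def)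
    then show "\<ominus>\<^bsub>M\<^esub> a \<in> U" using fneg [of x] by (auto simp: U_def intro!: image_eqI [of _ _ "\<ominus>\<^bsub>N\<^esub> x"])
    fix b assume "b \<in> U"
    then obtain y where y: "y \<in> carrier N" "b = f y" by (auto simp: U_def)
    then show "a \<oplus>\<^bsub>M\<^esub> b \<in> U" using x fD(2)[of x y] by (auto simp: U_def intro!: image_eqI [of _ _ "x \<oplus>\<^bsub>N\<^esub> y"])
  qed
  have Vsub: "subgroup V (add_monoid M)"
    by (rule M.add.subgroupI) (use g0 gneg gD in \<open>auto simp: V_def N.add.inv_one\<close>)
  have U: "sub_bimod P Q U M" unfolding sub_bimod_def
    using Usub fD(3,4) N.lact_closed N.ract_closed
    by (auto simp: U_def intro: additive_subgroup.intro)
      (metis image_eqI)+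
  have V: "sub_bimod P Q V M" unfolding sub_bimod_def
    using Vsub gD(3,4) M.lact_closed M.ract_closed l0 r0
    by (auto simp: V_def intro: additive_subgroup.intro)
  have "U \<inter> V = {\<zero>\<^bsub>M\<^esub>}"
    using gf f0 g0 by (auto simp: U_def V_def intro!: image_eqI [of _ _ "\<zero>\<^bsub>N\<^esub>"])
  moreover have "U <+>\<^bsub>M\<^esub> V = carrier M"
  proof
    show "U <+>\<^bsub>M\<^esub> V \<subseteq> carrier M" using fD(1) by (auto simp: set_add_def' U_def V_def)
    show "carrier M \<subseteq> U <+>\<^bsub>M\<^esub> V"
    proof
      fix m assume m: "m \<in> carrier M"
      have c: "f (g m) \<in> carrier M" "g m \<in> carrier N" using m fD gD by auto
      have "g (\<ominus>\<^bsub>M\<^esub> f (g m) \<oplus>\<^bsub>M\<^esub> m) = \<zero>\<^bsub>N\<^esub>"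
        using m c gf gneg gD(2) by (simp add: N.l_neg)
      then have "\<ominus>\<^bsub>M\<^esub> f (g m) \<oplus>\<^bsub>M\<^esub> m \<in> V" using m c by (simp add: V_def)
      moreover have "f (g m) \<in> U" using c by (simp add: U_def)
      moreover have "m = f (g m) \<oplus>\<^bsub>M\<^esub> (\<ominus>\<^bsub>M\<^esub> f (g m) \<oplus>\<^bsub>M\<^esub> m)" using m c by (simp add: M.r_neg2)
      ultimately show "m \<in> U <+>\<^bsub>M\<^esub> V" unfolding set_add_def' by blast
    qed
  qed
  moreover have "f \<in> bimod_hom P Q N (M\<lparr>carrier := U\<rparr>)"
    by (rule bimod_homI) (use fD in \<open>auto simp: U_def\<close>)
  moreover have "bij_betw f (carrier N) U"
    unfolding bij_betw_def U_def using gf by (metis inj_on_def)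
  ultimately show ?thesis unfolding iso_direct_summand_def using U V by blast
qed

lemma bimod_power_simps [simp]:
  "carrier (bimod_power n M) = ({..<n} \<rightarrow>\<^sub>E carrier M)"
  "ring.zero (bimod_power n M) = (\<lambda>i\<in>{..<n}. \<zero>\<^bsub>M\<^esub>)"
  "ring.add (bimod_power n M) = (\<lambda>u v. \<lambda>i\<in>{..<n}. u i \<oplus>\<^bsub>M\<^esub> v i)"
  "lact (bimod_power n M) = (\<lambda>p u. \<lambda>i\<in>{..<n}. lact M p (u i))"
  "ract (bimod_power n M) = (\<lambda>u q. \<lambda>i\<in>{..<n}. ract M (u i) q)"
  by (simp_all add: bimod_power_def)

lemma (in bimodule) bimodule_power: "bimodule P Q (bimod_power n M)"
proof -
  interpret G: abelian_group "bimod_power n M"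
  proof (rule abelian_groupI)
    fix x assume x: "x \<in> carrier (bimod_power n M)"
    show "\<exists>y\<in>carrier (bimod_power n M). y \<oplus>\<^bsub>bimod_power n M\<^esub> x = \<zero>\<^bsub>bimod_power n M\<^esub>"
      by (rule bexI [of _ "\<lambda>i\<in>{..<n}. \<ominus>\<^bsub>M\<^esub> x i"])
        (use x in \<open>auto simp: fun_eq_iff restrict_def l_neg PiE_def Pi_def extensional_def\<close>)
    show "\<zero>\<^bsub>bimod_power n M\<^esub> \<oplus>\<^bsub>bimod_power n M\<^esub> x = x"
      using x by (auto simp: fun_eq_iff restrict_def PiE_def Pi_def extensional_def)
  qed (auto simp: fun_eq_iff restrict_def PiE_def Pi_def extensional_def a_ac)
  show ?thesis
    by unfold_locales
      (auto simp: fun_eq_iff restrict_def PiE_def Pi_def extensional_def lact_closed ract_closed lact_add ract_add lact_ract)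
qed

definition power_single :: "nat \<Rightarrow> ('p, 'm, 'q, 'x) bimod_scheme \<Rightarrow> nat \<Rightarrow> 'm \<Rightarrow> nat \<Rightarrow> 'm" where
  "power_single n M k x = (\<lambda>i\<in>{..<n}. if i = k then x else \<zero>\<^bsub>M\<^esub>)"

lemma (in bimodule) power_decompose:
  assumes u: "u \<in> carrier (bimod_power n M)"
  shows "u = (\<Oplus>\<^bsub>bimod_power n M\<^esub>k\<in>{..<n}. power_single n M k (u k))"
proof -
  interpret G: bimodule P Q "bimod_power n M" by (rule bimodule_power)
  have uc: "\<And>i. i < n \<Longrightarrow> u i \<in> carrier M" using u by auto
  have pc: "power_single n M k (u k) \<in> carrier (bimod_power n M)" if "k < n" for k
    using uc that by (auto simp: power_single_def)
  have "m \<le> n \<Longrightarrow> (\<Oplus>\<^bsub>bimod_power n M\<^esub>k\<in>{..<m}. power_single n M k (u k))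
      = (\<lambda>i\<in>{..<n}. if i < m then u i else \<zero>\<^bsub>M\<^esub>)" for m
  proof (induction m)
    case (Suc m)
    have "(\<Oplus>\<^bsub>bimod_power n M\<^esub>k\<in>{..<Suc m}. power_single n M k (u k))
       = power_single n M m (u m) \<oplus>\<^bsub>bimod_power n M\<^esub> (\<Oplus>\<^bsub>bimod_power n M\<^esub>k\<in>{..<m}. power_single n M k (u k))"
      unfolding lessThan_Suc by (rule G.finsum_insert) (use Suc.prems pc in auto)
    also have "(\<Oplus>\<^bsub>bimod_power n M\<^esub>k\<in>{..<m}. power_single n M k (u k)) = (\<lambda>i\<in>{..<n}. if i < m then u i else \<zero>\<^bsub>M\<^esub>)"
      by (rule Suc.IH) (use Suc.prems in simp)
    also have "power_single n M m (u m) \<oplus>\<^bsub>bimod_power n M\<^esub> (\<lambda>i\<in>{..<n}. if i < m then u i else \<zero>\<^bsub>M\<^esub>)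
      = (\<lambda>i\<in>{..<n}. if i < Suc m then u i else \<zero>\<^bsub>M\<^esub>)"
      using Suc.prems uc by (auto simp: power_single_def fun_eq_iff restrict_def less_Suc_eq)
    finally show ?case .
  qed (simp add: fun_eq_iff)
  from this [of n] show ?thesis using u by (auto simp: fun_eq_iff restrict_def PiE_def extensional_def)
qed

lemma regular_bimodule:
  assumes "ring A" "carrier P \<subseteq> carrier A" "carrier Q \<subseteq> carrier A"
  shows "bimodule P Q (regular_bimod A)"
proof -
  interpret ring A by fact
  interpret M: abelian_group "regular_bimod A"
    unfolding regular_bimod_def by (rule abelian_group_bimod_of) (rule abelian_group_axioms)
  show ?thesis
    by unfold_locales
      (use assms in \<open>auto simp: regular_bimod_def l_distr r_distr m_assoc subset_iff\<close>)
qed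

lemma right_regular_bimodule:
  assumes "ring A" "carrier Q \<subseteq> carrier A"
  shows "bimodule \<Z> Q (right_regular A)"
proof -
  interpret ring A by fact
  interpret M: abelian_group "right_regular A"
    unfolding right_regular_def by (rule abelian_group_bimod_of) (rule abelian_group_axioms)
  show ?thesis
    by unfold_locales
      (use assms in \<open>auto simp: right_regular_def l_distr m_assoc subset_iff add.int_pow_distrib add_pow_ldistr_int\<close>)
qed

text \<open>Right modules are encoded with a left action of the integers, so additive maps have to
  be shown to be linear for it.\<close>

lemma additive_add_pow:
  assumes "abelian_group G" "abelian_group H" "\<And>x. x \<in> carrier G \<Longrightarrow> h x \<in> carrier H"
    "\<And>x y. x \<in> carrier G \<Longrightarrow> y \<in> carrier G \<Longrightarrow> h (x \<oplus>\<^bsub>G\<^esub> y) = h x \<oplus>\<^bsub>H\<^esub> h y" "x \<in> carrier G"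
  shows "h (add_pow G (n :: int) x) = add_pow H n (h x)"
proof -
  interpret G: abelian_group G by fact
  interpret H: abelian_group H by fact
  have "h \<in> hom (add_monoid G) (add_monoid H)" using assms(3,4) by (auto simp: hom_def)
  then show ?thesis
    unfolding add_pow_def using assms(5)
    by (intro hom_int_pow G.a_group H.a_group) auto
qed

text \<open>The maps \<open>a \<mapsto> (f\<^sub>i a)\<close> and
  \<open>u \<mapsto> \<Sum> y\<^sub>i u\<^sub>i\<close> exhibit the module as a retract of a free
  one.\<close>

lemma (in ring) dual_basis_imp_fg_projective:
  assumes D: "subring D R" and db: "dual_basis D I y f"
  shows "fg_projective (R\<lparr>carrier := D\<rparr>) (right_regular R)"
proof -
  have Dc: "D \<subseteq> carrier R" using D by (rule subringE)
  interpret D: ring "R\<lparr>carrier := D\<rparr>" using D by (rule subring_is_ring)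
  have I: "finite I" "\<And>i. i \<in> I \<Longrightarrow> y i \<in> carrier R" "\<And>a. a \<in> carrier R \<Longrightarrow> a = (\<Oplus>i\<in>I. y i \<otimes> f i a)"
    and f: "\<And>i. i \<in> I \<Longrightarrow> functional D (f i)"
    using db unfolding dual_basis_def by blast+
  have fD: "f i a \<in> D" "f i a \<in> carrier R" if "i \<in> I" "a \<in> carrier R" for i a
    using f [OF that(1)] that Dc unfolding functional_def by blast+
  have fadd: "f i (a \<oplus> b) = f i a \<oplus> f i b" if "i \<in> I" "a \<in> carrier R" "b \<in> carrier R" for i a b
    using f that unfolding functional_def right_linear_def by blast
  have flin: "f i (a \<otimes> d) = f i a \<otimes> d" if "i \<in> I" "a \<in> carrier R" "d \<in> D" for i a d
    using f that unfolding functional_def right_linear_def by blast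
  \<comment> \<open>An upper bound for \<open>I\<close>, with \<open>0\<close> inserted so that
    \<open>Max\<close> is meaningful for empty \<open>I\<close>. Positions outside \<open>I\<close>
    receive \<open>\<zero>\<close> in \<open>F\<close> and do not contribute to
    \<open>G\<close>.\<close>
  define n where "n = Suc (Max (insert 0 I))"
  have In: "i < n" if "i \<in> I" for i using that I(1) by (simp add: n_def less_Suc_eq_le)
  let ?D = "R\<lparr>carrier := D\<rparr>"
  let ?M = "bimod_power n (right_regular ?D)"
  have N: "bimodule \<Z> ?D (right_regular R)"
    by (rule right_regular_bimodule) (use ring_axioms Dc in auto)
  have M0: "bimodule \<Z> ?D (right_regular ?D)"
    by (rule right_regular_bimodule) (use D.ring_axioms in auto)
  then have M: "bimodule \<Z> ?D ?M" by (rule bimodule.bimodule_power)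
  define F where "F a = (\<lambda>i\<in>{..<n}. if i \<in> I then f i a else \<zero>)" for a
  define G where "G u = (\<Oplus>i\<in>I. y i \<otimes> u i)" for u
  have zD: "\<zero> \<in> D" using subringE(2)[OF D] .
  have Fhom: "F a \<in> carrier ?M" if "a \<in> carrier R" for a
    using that fD zD by (auto simp: F_def right_regular_def)
  have Fadd: "F (a \<oplus> b) = F a \<oplus>\<^bsub>?M\<^esub> F b" if "a \<in> carrier R" "b \<in> carrier R" for a b
    using that by (auto simp: F_def right_regular_def fun_eq_iff restrict_def fadd)
  have uD: "u i \<in> D" "u i \<in> carrier R" if "u \<in> carrier ?M" "i \<in> I" for u i
    using that In Dc by (auto simp: right_regular_def PiE_def Pi_def)
  have Gc: "G u \<in> carrier R" if "u \<in> carrier ?M" for u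
    unfolding G_def using uD [OF that] I by (auto intro!: finsum_closed)
  have Gadd: "G (u \<oplus>\<^bsub>?M\<^esub> v) = G u \<oplus> G v" if u: "u \<in> carrier ?M" and v: "v \<in> carrier ?M" for u v
  proof -
    have "G (u \<oplus>\<^bsub>?M\<^esub> v) = (\<Oplus>i\<in>I. y i \<otimes> u i \<oplus> y i \<otimes> v i)"
      unfolding G_def
      by (rule finsum_cong') (use I uD [OF u] uD [OF v] In in \<open>auto simp: right_regular_def r_distr\<close>)
    also have "\<dots> = G u \<oplus> G v" unfolding G_def
      by (rule finsum_addf) (use I uD [OF u] uD [OF v] in auto)
    finally show ?thesis .
  qed
  interpret N: bimodule \<Z> ?D "right_regular R" by (rule N)
  interpret M: bimodule \<Z> ?D ?M by (rule M)
  have pw: "lact (right_regular B) = add_pow B" for B :: "('a, 'z) ring_scheme"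
    by (simp add: right_regular_def)
  have Nadd: "ring.add (right_regular R) = ring.add R" "carrier (right_regular R) = carrier R"
    by (simp_all add: right_regular_def)
  \<comment> \<open>By definition the integers act on the power componentwise, through multiples in
    \<open>D\<close>. This action is identified with taking multiples in the power itself, so that
    \<open>additive_add_pow\<close> can be used.\<close>
  have MP: "lact ?M p u = add_pow ?M p u" if "u \<in> carrier ?M" for p u
  proof -
    have "add_pow ?M p u i = add_pow (R\<lparr>carrier := D\<rparr>) p (u i)" if i: "i < n" for i
      by (rule additive_add_pow [where h = "\<lambda>u. u i", OF M.abelian_group_axioms D.abelian_group_axioms])
        (use i \<open>u \<in> carrier ?M\<close> in \<open>auto simp: right_regular_def\<close>)
    moreover have "add_pow ?M p u \<in> extensional {..<n}"
      using M.add.int_pow_closed [OF that, of p] by (auto simp: PiE_def)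
    ultimately show ?thesis
      by (auto simp: fun_eq_iff restrict_def extensional_def right_regular_def)
  qed
  show ?thesis unfolding fg_projective_def
  proof (rule exI [of _ n], rule retract_direct_summand [OF N M])
    show "F \<in> bimod_hom \<Z> ?D (right_regular R) ?M"
    proof (rule bimod_homI)
      fix p :: int and a assume "a \<in> carrier (right_regular R)"
      then have a: "a \<in> carrier R" by (simp add: Nadd)
      have "F (add_pow R (p :: int) a) = add_pow ?M p (F a)"
        by (rule additive_add_pow [OF abelian_group_axioms M.abelian_group_axioms Fhom Fadd a])
      then show "F (lact (right_regular R) p a) = lact ?M p (F a)"
        using MP [OF Fhom [OF a]] by (simp add: right_regular_def)
    next
      fix q a assume q: "q \<in> carrier ?D" and "a \<in> carrier (right_regular R)"
      then have a: "a \<in> carrier R" "q \<in> D" "q \<in> carrier R" using Dc by (auto simp: Nadd)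
      show "F (ract (right_regular R) a q) = ract ?M (F a) q"
        using a by (auto simp: F_def right_regular_def fun_eq_iff restrict_def flin)
    qed (use Fhom Fadd in \<open>simp_all add: Nadd\<close>)
    show "G \<in> bimod_hom \<Z> ?D ?M (right_regular R)"
    proof (rule bimod_homI)
      fix p :: int and u assume u: "u \<in> carrier ?M"
      have "G (add_pow ?M (p :: int) u) = add_pow R p (G u)"
        by (rule additive_add_pow [OF M.abelian_group_axioms abelian_group_axioms Gc Gadd u])
      then show "G (lact ?M p u) = lact (right_regular R) p (G u)"
        using MP [OF u] by (simp add: right_regular_def)
    next
      fix q u assume q: "q \<in> carrier ?D" and u: "u \<in> carrier ?M"
      then have qc: "q \<in> D" "q \<in> carrier R" using Dc by auto
      have "G (ract ?M u q) = (\<Oplus>i\<in>I. y i \<otimes> u i \<otimes> q)"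
        unfolding G_def
        by (rule finsum_cong') (use I uD [OF u] In qc in \<open>auto simp: right_regular_def m_assoc\<close>)
      also have "\<dots> = G u \<otimes> q" unfolding G_def
        by (rule finsum_ldistr [symmetric]) (use I uD [OF u] qc in auto)
      finally show "G (ract ?M u q) = ract (right_regular R) (G u) q" by (simp add: right_regular_def)
    qed (use Gc Gadd in \<open>simp_all only: Nadd\<close>)
    fix a assume "a \<in> carrier (right_regular R)"
    then have a: "a \<in> carrier R" by (simp add: Nadd)
    have "G (F a) = (\<Oplus>i\<in>I. y i \<otimes> f i a)"
      unfolding G_def by (rule finsum_cong') (use I fD a In in \<open>auto simp: F_def\<close>)
    then show "G (F a) = a" using I(3)[OF a] by simp
  qed
qed

text \<open>With \<open>F\<close> and \<open>G\<close> exhibiting the retract, the basis elements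
  are the images under \<open>G\<close> of the unit vectors, and the functionals are the coordinates
  of \<open>F\<close>.\<close>

lemma (in ring) fg_projective_imp_dual_basis:
  assumes D: "subring D R" and fg: "fg_projective (R\<lparr>carrier := D\<rparr>) (right_regular R)"
  obtains I y f where "dual_basis D I y f"
proof -
  have Dc: "D \<subseteq> carrier R" using D by (rule subringE)
  interpret D: ring "R\<lparr>carrier := D\<rparr>" using D by (rule subring_is_ring)
  let ?D = "R\<lparr>carrier := D\<rparr>"
  from fg obtain n where n: "iso_direct_summand \<Z> ?D (right_regular R) (bimod_power n (right_regular ?D))"
    by (auto simp: fg_projective_def)
  let ?M = "bimod_power n (right_regular ?D)"
  have N: "bimodule \<Z> ?D (right_regular R)"
    by (rule right_regular_bimodule) (use ring_axioms Dc in auto)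
  have M0: "bimodule \<Z> ?D (right_regular ?D)"
    by (rule right_regular_bimodule) (use D.ring_axioms in auto)
  then have M: "bimodule \<Z> ?D ?M" by (rule bimodule.bimodule_power)
  interpret M0: bimodule \<Z> ?D "right_regular ?D" by (rule M0)
  interpret M: bimodule \<Z> ?D ?M by (rule M)
  obtain F G where F: "F \<in> bimod_hom \<Z> ?D (right_regular R) ?M"
    and G: "G \<in> bimod_hom \<Z> ?D ?M (right_regular R)" and GF: "\<And>x. x \<in> carrier (right_regular R) \<Longrightarrow> G (F x) = x"
    using direct_summand_retract [OF N M n] by metis
  have rs: "carrier (right_regular B) = carrier B" "ring.add (right_regular B) = ring.add B"
    "ract (right_regular B) = (\<lambda>x a. x \<otimes>\<^bsub>B\<^esub> a)" "ring.zero (right_regular B) = ring.zero B"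
    for B :: "('a, 'z) ring_scheme"
    by (simp_all add: right_regular_def)
  define y where "y k = G (power_single n (right_regular ?D) k \<one>)" for k
  have s1: "power_single n (right_regular ?D) k d \<in> carrier ?M" if "d \<in> D" for k d
    using that subringE(2)[OF D] by (auto simp: power_single_def rs)
  have oneD: "\<one> \<in> D" using subringE(3)[OF D] .
  have yc: "y k \<in> carrier R" for k
    unfolding y_def using bimod_homD(1)[OF G s1 [OF oneD]] by (simp add: rs)
  have FD: "F a k \<in> D" "F a k \<in> carrier R" if "a \<in> carrier R" "k < n" for a k
    using bimod_homD(1)[OF F, of a] that Dc by (auto simp: rs)
  have "functional D (\<lambda>a. F a k)" if k: "k < n" for k
    unfolding functional_def right_linear_def
  proof (intro conjI ballI Pi_I image_subsetI)
    fix a b assume "a \<in> carrier R" "b \<in> carrier R"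
    then show "F (a \<oplus> b) k = F a k \<oplus> F b k"
      using bimod_homD(2)[OF F, of a b] k by (simp add: rs)
  next
    fix a d assume "a \<in> carrier R" "d \<in> D"
    then show "F (a \<otimes> d) k = F a k \<otimes> d"
      using bimod_homD(4)[OF F, of d a] k by (simp add: rs)
  qed (use FD k in auto)
  moreover have "a = (\<Oplus>k\<in>{..<n}. y k \<otimes> F a k)" if a: "a \<in> carrier R" for a
  proof -
    have Fa: "F a \<in> carrier ?M" using bimod_homD(1)[OF F] a by (simp add: rs)
    have "a = G (F a)" using GF a by (simp add: rs)
    also have "\<dots> = G (\<Oplus>\<^bsub>?M\<^esub>k\<in>{..<n}. power_single n (right_regular ?D) k (F a k))"
      using M0.power_decompose [OF Fa] by simp
    also have "\<dots> = (\<Oplus>k\<in>{..<n}. G (power_single n (right_regular ?D) k (F a k)))"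
      by (rule M.additive_finsum [OF M.carrier_additive_subgroup abelian_group_axioms])
        (use bimod_homD(1,2)[OF G] s1 FD a in \<open>auto simp: rs simp del: bimod_power_simps\<close>)
    also have "\<dots> = (\<Oplus>k\<in>{..<n}. y k \<otimes> F a k)"
    proof (rule finsum_cong')
      fix k assume k: "k \<in> {..<n}"
      have "power_single n (right_regular ?D) k (F a k) = ract ?M (power_single n (right_regular ?D) k \<one>) (F a k)"
        using FD a k by (auto simp: power_single_def rs fun_eq_iff restrict_def)
      then show "G (power_single n (right_regular ?D) k (F a k)) = y k \<otimes> F a k"
        using bimod_homD(4)[OF G, of "F a k" "power_single n (right_regular ?D) k \<one>"] s1 [OF oneD] FD a k
        by (simp add: rs y_def)
    qed (use yc FD a in auto)
    finally show ?thesis .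
  qed
  ultimately have "dual_basis D {..<n} y (\<lambda>k a. F a k)"
    unfolding dual_basis_def using yc by blast
  then show ?thesis by (rule that)
qed

section \<open>From HS-separability to sandwich maps\<close>

context simple begin

text \<open>An H-separability system: \<open>1 \<otimes> 1 = \<Sum> r\<^sub>i e\<^sub>i\<close> with \<open>r\<^sub>i\<close> in the centralizer of \<open>B\<close> and
  \<open>e\<^sub>i \<in> A \<otimes>\<^sub>B A\<close> commuting with \<open>A\<close>.\<close>

lemma H_separable_system:
  fixes B defines "B' \<equiv> A\<lparr>carrier := B\<rparr>" and "E \<equiv> regular_bimod A"
  assumes B: "subring B A" and h: "H_separable A B"
  obtains n :: nat and r e where "r \<in> {..<n} \<rightarrow> centralizer A B" "e \<in> {..<n} \<rightarrow> carrier (tensor B' E E)"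
    "\<And>i a. i < n \<Longrightarrow> a \<in> carrier A \<Longrightarrow> lact (tensor B' E E) a (e i) = ract (tensor B' E E) (e i) a"
    "pure_tensor B' E E \<one> \<one> = (\<Oplus>\<^bsub>tensor B' E E\<^esub>i\<in>{..<n}. lact (tensor B' E E) (r i) (e i))"
proof -
  have Bc: "B \<subseteq> carrier A" using B by (rule subringE)
  interpret T: tensor_product A B' A E E
    unfolding tensor_product_def E_def B'_def
    by (intro conjI regular_bimodule) (use ring_axioms Bc in auto)
  have TB: "bimodule A A (tensor B' E E)" by (rule T.tensor_bimodule)
  from h obtain n where n: "iso_direct_summand A A (tensor B' E E) (bimod_power n E)"
    by (auto simp: H_separable_def B'_def E_def)
  have E: "bimodule A A E" unfolding E_def by (rule regular_bimodule) (use ring_axioms in auto)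
  interpret E: bimodule A A E by (rule E)
  have M: "bimodule A A (bimod_power n E)" by (rule E.bimodule_power)
  interpret M: bimodule A A "bimod_power n E" by (rule M)
  obtain F G where F: "F \<in> bimod_hom A A (tensor B' E E) (bimod_power n E)"
    and G: "G \<in> bimod_hom A A (bimod_power n E) (tensor B' E E)" and GF: "\<And>x. x \<in> carrier (tensor B' E E) \<Longrightarrow> G (F x) = x"
    using direct_summand_retract [OF TB M n] by metis
  have Es: "carrier E = carrier A" "lact E = (\<lambda>a x. a \<otimes> x)" "ract E = (\<lambda>x a. x \<otimes> a)" "ring.zero E = \<zero>"
    by (simp_all add: E_def regular_bimod_def)
  let ?one = "pure_tensor B' E E \<one> \<one>"
  have one: "?one \<in> carrier (tensor B' E E)" by (rule T.pure_closed) (auto simp: Es)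
  \<comment> \<open>Unit vectors of the power commute with \<open>A\<close>, and so do their images
    under \<open>G\<close>. The partners \<open>r\<^sub>i\<close> are the coordinates of
    \<open>F\<close> at \<open>\<one> \<otimes> \<one>\<close>, which centralize \<open>B\<close>
    because \<open>b \<otimes> \<one> = \<one> \<otimes> b\<close> over \<open>B\<close>.\<close>
  define e where "e i = G (power_single n E i \<one>)" for i
  have s1: "power_single n E k d \<in> carrier (bimod_power n E)" if "d \<in> carrier A" for k d
    using that by (auto simp: power_single_def Es)
  have F1: "F ?one \<in> carrier (bimod_power n E)" using bimod_homD(1)[OF F one] .
  then have F1c: "F ?one i \<in> carrier A" if "i < n" for i using that by (auto simp: Es)
  show ?thesis
  proof (rule that [of "F ?one" n e])
    show "F ?one \<in> {..<n} \<rightarrow> centralizer A B"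
    proof (intro Pi_I centralizerI)
      fix i b assume i: "i \<in> {..<n}" and b: "b \<in> B"
      then have bc: "b \<in> carrier A" using Bc by auto
      have "lact (tensor B' E E) b ?one = pure_tensor B' E E b \<one>"
        using T.lact_pure [of b \<one> \<one>] bc by (simp add: Es)
      also have "\<dots> = pure_tensor B' E E \<one> b"
        using T.pure_balanced [of \<one> \<one> b] b bc by (simp add: Es B'_def)
      also have "\<dots> = ract (tensor B' E E) ?one b"
        using T.ract_pure [of b \<one> \<one>] bc by (simp add: Es)
      finally have "lact (bimod_power n E) b (F ?one) = ract (bimod_power n E) (F ?one) b"
        using bimod_homD(3,4)[OF F _ one] bc by metis
      from fun_cong [OF this, of i] show "F ?one i \<otimes> b = b \<otimes> F ?one i"
        using i by (simp add: Es)
    qed (use F1c in auto)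
    show "e \<in> {..<n} \<rightarrow> carrier (tensor B' E E)"
      using bimod_homD(1)[OF G s1] by (auto simp: e_def)
    show "lact (tensor B' E E) a (e i) = ract (tensor B' E E) (e i) a" if "i < n" "a \<in> carrier A" for i a
    proof -
      have "lact (bimod_power n E) a (power_single n E i \<one>) = ract (bimod_power n E) (power_single n E i \<one>) a"
        using that by (auto simp: power_single_def Es fun_eq_iff restrict_def)
      then show ?thesis unfolding e_def using bimod_homD(3,4)[OF G _ s1 [OF one_closed]] that by metis
    qed
    have "?one = G (F ?one)" using GF one by simp
    also have "\<dots> = G (\<Oplus>\<^bsub>bimod_power n E\<^esub>k\<in>{..<n}. power_single n E k (F ?one k))"
      using E.power_decompose [OF F1] by simp
    also have "\<dots> = (\<Oplus>\<^bsub>tensor B' E E\<^esub>k\<in>{..<n}. G (power_single n E k (F ?one k)))"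
      by (rule M.additive_finsum [OF M.carrier_additive_subgroup T.T_abelian])
        (use bimod_homD(1,2)[OF G] s1 F1c in \<open>auto simp del: bimod_power_simps\<close>)
    also have "\<dots> = (\<Oplus>\<^bsub>tensor B' E E\<^esub>i\<in>{..<n}. lact (tensor B' E E) (F ?one i) (e i))"
    proof (rule T.T.finsum_cong')
      fix k assume k: "k \<in> {..<n}"
      have "power_single n E k (F ?one k) = lact (bimod_power n E) (F ?one k) (power_single n E k \<one>)"
        using F1c k by (auto simp: power_single_def Es fun_eq_iff restrict_def)
      then show "G (power_single n E k (F ?one k)) = lact (tensor B' E E) (F ?one k) (e k)"
        using bimod_homD(3)[OF G _ s1 [OF one_closed], of "F ?one k" k] F1c k by (simp add: e_def)
    next
      have "e i \<in> carrier (tensor B' E E)" for i using bimod_homD(1)[OF G s1] by (auto simp: e_def)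
      then show "(\<lambda>i. lact (tensor B' E E) (F ?one i) (e i)) \<in> {..<n} \<rightarrow> carrier (tensor B' E E)"
        using bimodule.lact_closed [OF TB] F1c by auto
    qed simp
    finally show "?one = (\<Oplus>\<^bsub>tensor B' E E\<^esub>i\<in>{..<n}. lact (tensor B' E E) (F ?one i) (e i))" .
  qed
qed

lemma HS_separable_imp:
  assumes B: "subring B A" and Bs: "simple_ring (A\<lparr>carrier := B\<rparr>)" and hs: "HS_separable A B"
  shows "hs_separable A B (centralizer A B)"
proof -
  let ?B = "A\<lparr>carrier := B\<rparr>" and ?E = "regular_bimod A" and ?R = "centralizer A B"
  have Bc: "B \<subseteq> carrier A" using B by (rule subringE)
  interpret T: tensor_product A ?B A ?E ?E
    unfolding tensor_product_def by (intro conjI regular_bimodule) (use ring_axioms Bc in auto)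
  interpret TB: bimodule A A T.T by (rule T.tensor_bimodule)
  have Es: "carrier ?E = carrier A" "lact ?E = (\<lambda>a x. a \<otimes> x)" "ract ?E = (\<lambda>x a. x \<otimes> a)"
    "ring.add ?E = ring.add A" by (simp_all add: regular_bimod_def)
  have hB: "H_separable A B" using hs by (simp add: HS_separable_def)
  obtain n :: nat and r e where r: "r \<in> {..<n} \<rightarrow> ?R" and e: "e \<in> {..<n} \<rightarrow> carrier T.T"
    and cas: "\<And>i a. i < n \<Longrightarrow> a \<in> carrier A \<Longrightarrow> lact T.T a (e i) = ract T.T (e i) a"
    and one: "T.pure \<one> \<one> = (\<Oplus>\<^bsub>T.T\<^esub>i\<in>{..<n}. lact T.T (r i) (e i))"
    by (rule H_separable_system [OF B hB]) (rule that)
  have rc: "\<And>i. i < n \<Longrightarrow> r i \<in> carrier A" using r by (auto simp: Pi_def intro: centralizer_carrier)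
  have ec: "\<And>i. i < n \<Longrightarrow> e i \<in> carrier T.T" using e by auto
  \<comment> \<open>As \<open>e\<^sub>i\<close> commutes with \<open>A\<close>, \<open>a \<otimes>
    \<one> = \<Sum> a r\<^sub>i e\<^sub>i = \<Sum> e\<^sub>i a r\<^sub>i\<close>. Applying
    \<open>x \<otimes> y \<mapsto> \<alpha>(x) y\<close>, which is right \<open>A\<close>-linear,
    gives the formula.\<close>
  have key: "\<alpha> a = (\<Oplus>i\<in>{..<n}. tensor_lift A (\<lambda>x y. \<alpha> x \<otimes> y) (e i) \<otimes> a \<otimes> r i)"
    if \<alpha>: "right_linear B \<alpha>" and a: "a \<in> carrier A" for \<alpha> a
  proof -
    have \<alpha>c: "\<alpha> x \<in> carrier A" if "x \<in> carrier A" for x using \<alpha> that by (auto simp: right_linear_def)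
    have bal: "balanced ?B ?E ?E A (\<lambda>x y. \<alpha> x \<otimes> y)"
      by (rule balancedI) (use \<alpha> \<alpha>c Bc in \<open>auto simp: Es right_linear_def l_distr r_distr m_assoc subset_iff\<close>)
    let ?m = "tensor_lift A (\<lambda>x y. \<alpha> x \<otimes> y)"
    note mc = T.lift_closed [OF abelian_group_axioms bal]
      and ma = T.lift_add [OF abelian_group_axioms bal] and mp = T.lift_pure [OF abelian_group_axioms bal]
    have mr: "?m (ract T.T u b) = ?m u \<otimes> b" if "u \<in> carrier T.T" "b \<in> carrier A" for u b
      by (rule T.additive_eq [OF abelian_group_axioms that(1)])
        (use that mc ma mp TB.ract_closed TB.ract_add \<alpha>c T.ract_pure in \<open>auto simp: Es l_distr m_assoc\<close>)
    have "T.pure a \<one> = lact T.T a (T.pure \<one> \<one>)" using T.lact_pure [of a \<one> \<one>] a by (simp add: Es)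
    also have "\<dots> = (\<Oplus>\<^bsub>T.T\<^esub>i\<in>{..<n}. lact T.T a (lact T.T (r i) (e i)))" unfolding one
      by (rule T.T.additive_finsum [OF T.T.carrier_additive_subgroup T.T_abelian])
        (use a TB.lact_closed TB.lact_add rc ec in auto)
    also have "\<dots> = (\<Oplus>\<^bsub>T.T\<^esub>i\<in>{..<n}. ract T.T (ract T.T (e i) a) (r i))"
      by (rule T.T.finsum_cong')
        (use a TB.lact_closed TB.ract_closed rc ec in \<open>auto simp: cas TB.lact_ract\<close>)
    finally have "?m (T.pure a \<one>) = ?m (\<Oplus>\<^bsub>T.T\<^esub>i\<in>{..<n}. ract T.T (ract T.T (e i) a) (r i))" by simp
    also have "\<dots> = (\<Oplus>i\<in>{..<n}. ?m (ract T.T (ract T.T (e i) a) (r i)))"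
      by (rule T.T.additive_finsum [OF T.T.carrier_additive_subgroup abelian_group_axioms])
        (use a mc ma TB.ract_closed rc ec in auto)
    also have "\<dots> = (\<Oplus>i\<in>{..<n}. ?m (e i) \<otimes> a \<otimes> r i)"
      by (rule finsum_cong') (use a mc mr TB.ract_closed rc ec in auto)
    finally show ?thesis using mp [of a \<one>] a \<alpha>c by (simp add: Es)
  qed
  have sw: "sandwich (carrier A) ?R \<alpha>" if \<alpha>: "right_linear B \<alpha>" for \<alpha>
  proof (rule sandwichI [of "{..<n}" _ _ r, OF _ _ r key [OF \<alpha>]])
    have "\<alpha> x \<in> carrier A" if "x \<in> carrier A" for x using \<alpha> that by (auto simp: right_linear_def)
    then have bal: "balanced ?B ?E ?E A (\<lambda>x y. \<alpha> x \<otimes> y)"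
      by (intro balancedI) (use \<alpha> Bc in \<open>auto simp: Es right_linear_def l_distr r_distr m_assoc subset_iff\<close>)
    show "(\<lambda>i. tensor_lift A (\<lambda>x y. \<alpha> x \<otimes> y) (e i)) \<in> {..<n} \<rightarrow> carrier A"
      using T.lift_closed [OF abelian_group_axioms bal] ec by auto
  qed auto
  \<comment> \<open>Apply the map \<open>x \<otimes> y \<mapsto> x s y\<close> to
    \<open>\<one> \<otimes> \<one> = \<Sum> r\<^sub>i e\<^sub>i\<close>. It is balanced since
    \<open>s\<close> centralizes \<open>B\<close>, and it is linear for \<open>A\<close> on both
    sides, so the images of the \<open>e\<^sub>i\<close> commute with \<open>A\<close>.\<close>
  have fin: "\<exists>z\<in>{..<n} \<rightarrow> Z. s = (\<Oplus>i\<in>{..<n}. z i \<otimes> r i)" if s: "s \<in> ?R" for s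
  proof -
    have sc: "s \<in> carrier A" using s by (rule centralizer_carrier)
    have "x \<otimes> b \<otimes> s = x \<otimes> s \<otimes> b" if "b \<in> B" "x \<in> carrier A" for x b
      using that sc centralizer_comm [OF s that(1)] Bc by (simp add: m_assoc subset_iff)
    then have bal: "balanced ?B ?E ?E A (\<lambda>x y. x \<otimes> s \<otimes> y)"
      by (intro balancedI) (use sc Bc in \<open>auto simp: Es l_distr r_distr m_assoc subset_iff\<close>)
    let ?m = "tensor_lift A (\<lambda>x y. x \<otimes> s \<otimes> y)"
    note mc = T.lift_closed [OF abelian_group_axioms bal]
      and ma = T.lift_add [OF abelian_group_axioms bal] and mp = T.lift_pure [OF abelian_group_axioms bal]
    have mr: "?m (ract T.T u b) = ?m u \<otimes> b" if "u \<in> carrier T.T" "b \<in> carrier A" for u b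
      by (rule T.additive_eq [OF abelian_group_axioms that(1)])
        (use that mc ma mp TB.ract_closed TB.ract_add sc T.ract_pure in \<open>auto simp: Es l_distr m_assoc\<close>)
    have ml: "?m (lact T.T b u) = b \<otimes> ?m u" if "u \<in> carrier T.T" "b \<in> carrier A" for u b
      by (rule T.additive_eq [OF abelian_group_axioms that(1)])
        (use that mc ma mp TB.lact_closed TB.lact_add sc T.lact_pure in \<open>auto simp: Es r_distr m_assoc\<close>)
    have zZ: "?m (e i) \<in> Z" if i: "i < n" for i
    proof (rule centralizerI)
      fix a assume a: "a \<in> carrier A"
      show "?m (e i) \<otimes> a = a \<otimes> ?m (e i)" using mr [OF ec [OF i] a] ml [OF ec [OF i] a] cas [OF i a] by simp
    qed (use mc ec i in auto)
    have "s = ?m (T.pure \<one> \<one>)" using mp [of \<one> \<one>] sc by (simp add: Es)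
    also have "\<dots> = (\<Oplus>i\<in>{..<n}. ?m (lact T.T (r i) (e i)))" unfolding one
      by (rule T.T.additive_finsum [OF T.T.carrier_additive_subgroup abelian_group_axioms])
        (use mc ma TB.lact_closed rc ec in auto)
    also have "\<dots> = (\<Oplus>i\<in>{..<n}. ?m (e i) \<otimes> r i)"
    proof (rule finsum_cong')
      fix i assume i: "i \<in> {..<n}"
      then show "?m (lact T.T (r i) (e i)) = ?m (e i) \<otimes> r i"
        using ml [OF ec rc] center_comm [OF zZ rc] by simp
    qed (use mc rc ec in auto)
    finally show ?thesis using zZ by (intro bexI [of _ "\<lambda>i. ?m (e i)"]) auto
  qed
  have "fg_projective ?B (right_regular A)" using hs by (simp add: HS_separable_def progenerator_def)
  then have "\<exists>I y f. dual_basis B I y f" using fg_projective_imp_dual_basis [OF B] by metis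
  moreover have "\<exists>n::nat. \<exists>r\<in>{..<n} \<rightarrow> ?R. \<forall>x\<in>?R. \<exists>z\<in>{..<n} \<rightarrow> Z. x = (\<Oplus>i\<in>{..<n}. z i \<otimes> r i)"
    using r fin by blast
  ultimately show ?thesis
    by (intro hs_separable.intro hs_separable_axioms.intro h_separable.intro h_separable_axioms.intro
        simple_axioms B Bs sw refl)
qed

end

section \<open>The ring of bimodule endomorphisms\<close>

lemma endo_algebra_simps:
  "monoid.mult (endo_algebra A D) = compose (carrier A)"
  "\<one>\<^bsub>endo_algebra A D\<^esub> = (\<lambda>a\<in>carrier A. a)"
  "\<zero>\<^bsub>endo_algebra A D\<^esub> = (\<lambda>a\<in>carrier A. \<zero>\<^bsub>A\<^esub>)"
  "ring.add (endo_algebra A D) = (\<lambda>\<alpha> \<beta>. \<lambda>a\<in>carrier A. \<alpha> a \<oplus>\<^bsub>A\<^esub> \<beta> a)"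
  "module.smult (endo_algebra A D) = (\<lambda>z \<alpha>. \<lambda>a\<in>carrier A. z \<otimes>\<^bsub>A\<^esub> \<alpha> a)"
  by (simp_all add: endo_algebra_def)

lemma centralizer_algebra_simps [simp]:
  "carrier (centralizer_algebra A D) = centralizer A D"
  "monoid.mult (centralizer_algebra A D) = monoid.mult A"
  "\<one>\<^bsub>centralizer_algebra A D\<^esub> = \<one>\<^bsub>A\<^esub>"
  "\<zero>\<^bsub>centralizer_algebra A D\<^esub> = \<zero>\<^bsub>A\<^esub>"
  "ring.add (centralizer_algebra A D) = ring.add A"
  "module.smult (centralizer_algebra A D) = monoid.mult A"
  by (simp_all add: centralizer_algebra_def)

lemma endo_hopf_simps [simp]:
  "total (endo_hopf_algebroid A D) = endo_algebra A D"
  "base (endo_hopf_algebroid A D) = centralizer_algebra A D"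
  "source (endo_hopf_algebroid A D) = (\<lambda>r\<in>centralizer A D. left_mult A r)"
  "target (endo_hopf_algebroid A D) = (\<lambda>r\<in>centralizer A D. right_mult A r)"
  "comult (endo_hopf_algebroid A D) = endo_comult A D"
  "counit (endo_hopf_algebroid A D) = (\<lambda>\<alpha>\<in>carrier (endo_algebra A D). \<alpha> \<one>\<^bsub>A\<^esub>)"
  "antipode (endo_hopf_algebroid A D) = endo_antipode A D"
  by (simp_all add: endo_hopf_algebroid_def)

text \<open>The map \<open>\<lambda>\<^sub>v \<rho>\<^sub>w\<close>, image of
  \<open>v \<otimes> w\<close>. Source and target are the cases \<open>lr v \<one>\<close> and
  \<open>lr \<one> v\<close>, so products of their values have a normal form.\<close>

definition lr_mult :: "('a, 'm) ring_scheme \<Rightarrow> 'a \<Rightarrow> 'a \<Rightarrow> 'a \<Rightarrow> 'a" where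
  "lr_mult A v w = (\<lambda>a\<in>carrier A. v \<otimes>\<^bsub>A\<^esub> a \<otimes>\<^bsub>A\<^esub> w)"

lemma module_bimodule:
  assumes "module K M" shows "bimodule K K (module_bimod M)"
proof -
  interpret module K M by fact
  interpret N: abelian_group "module_bimod M"
    unfolding module_bimod_def by (rule abelian_group_bimod_of) (rule M.abelian_group_axioms)
  show ?thesis
  proof unfold_locales
    show "lact (module_bimod M) p (ract (module_bimod M) x q) = ract (module_bimod M) (lact (module_bimod M) p x) q"
      if "p \<in> carrier K" "q \<in> carrier K" "x \<in> carrier (module_bimod M)" for p q x
      using that smult_assoc1 [of p q x] smult_assoc1 [of q p x] R.m_comm [of p q]
      by (simp add: module_bimod_def)
  qed (auto simp: module_bimod_def smult_r_distr)
qed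

context simple begin

lemma center_cring: "cring (center_ring A)"
proof (rule cringI)
  interpret K: ring "center_ring A" using center_subring by (rule subring_is_ring)
  show "abelian_group (center_ring A)" by (rule K.abelian_group_axioms)
  show "comm_monoid (center_ring A)"
    by (rule K.monoid_comm_monoidI) (simp add: center_comm)
  show "(x \<oplus>\<^bsub>center_ring A\<^esub> y) \<otimes>\<^bsub>center_ring A\<^esub> z = x \<otimes>\<^bsub>center_ring A\<^esub> z \<oplus>\<^bsub>center_ring A\<^esub> y \<otimes>\<^bsub>center_ring A\<^esub> z"
    if "x \<in> carrier (center_ring A)" "y \<in> carrier (center_ring A)" "z \<in> carrier (center_ring A)" for x y z
    using that by (simp add: l_distr)
qed

lemma centralizer_algebra_assoc:
  assumes "D \<subseteq> carrier A"
  shows "assoc_algebra (center_ring A) (centralizer_algebra A D)"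
proof -
  have sub: "subring (centralizer A D) A" using assms by (rule centralizer_subring)
  interpret V: ring "A\<lparr>carrier := centralizer A D\<rparr>" using sub by (rule subring_is_ring)
  have Vc: "\<And>x. x \<in> centralizer A D \<Longrightarrow> x \<in> carrier A" by (rule centralizer_carrier)
  have ZV: "\<And>x. x \<in> Z \<Longrightarrow> x \<in> centralizer A D" using center_le_centralizer [OF assms] by blast
  have ab: "abelian_group (centralizer_algebra A D)"
    by (rule abelian_group_cong [OF V.abelian_group_axioms]) auto
  have "ring (centralizer_algebra A D)"
  proof (rule ringI [OF ab])
    show "Group.monoid (centralizer_algebra A D)"
      by (rule monoidI) (use subringE(3,6)[OF sub] Vc in \<open>auto simp: m_assoc\<close>)
  qed (use Vc in \<open>auto simp: l_distr r_distr\<close>)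
  moreover have "module (center_ring A) (centralizer_algebra A D)"
    by (rule moduleI [OF center_cring ab])
      (use Vc ZV subringE(6)[OF sub] in \<open>auto simp: l_distr r_distr m_assoc\<close>)
  moreover have "k \<otimes> x \<otimes> y = k \<otimes> (x \<otimes> y)" "x \<otimes> (k \<otimes> y) = k \<otimes> (x \<otimes> y)"
    if "k \<in> Z" "x \<in> centralizer A D" "y \<in> centralizer A D" for k x y
  proof -
    have c: "k \<in> carrier A" "x \<in> carrier A" "y \<in> carrier A" using that Vc by auto
    then show "k \<otimes> x \<otimes> y = k \<otimes> (x \<otimes> y)" by (simp add: m_assoc)
    show "x \<otimes> (k \<otimes> y) = k \<otimes> (x \<otimes> y)"
      using c center_comm [OF that(1) c(2)] by (simp add: m_assoc [symmetric])
  qed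
  ultimately show ?thesis
    by (intro assoc_algebra.intro assoc_algebra_axioms.intro) auto
qed

end

text \<open>The assumption is surjectivity of \<open>V \<otimes>_Z V^op \<rightarrow> End(A)\<close>
  onto the \<open>D\<close>-bimodule endomorphisms; injectivity follows from simplicity of
  \<open>A\<close>. It holds for every subring \<open>D\<close> of \<open>A\<close> that contains
  \<open>B\<close>, so the locale serves for the large Hopf algebroid as well as for the small
  ones.\<close>

locale endo_hopf = simple +
  fixes D
  assumes D: "subring D A"
    and endo_sandwich: "\<alpha> \<in> carrier (endo_algebra A D) \<Longrightarrow> sandwich (centralizer A D) (centralizer A D) \<alpha>"
begin

abbreviation "V \<equiv> centralizer A D"
abbreviation "VA \<equiv> centralizer_algebra A D"
abbreviation "L \<equiv> endo_algebra A D"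
abbreviation "K \<equiv> center_ring A"
abbreviation "H \<equiv> endo_hopf_algebroid A D"
abbreviation "M \<equiv> total_bimod H"
abbreviation "lr \<equiv> lr_mult A"

lemma D_carrier: "D \<subseteq> carrier A" using D by (rule subringE)
lemma V_carrier: "v \<in> V \<Longrightarrow> v \<in> carrier A" by (rule centralizer_carrier)
lemma V_subset: "V \<subseteq> carrier A" by (rule centralizer_sub)
lemma V_subring: "subring V A" using D_carrier by (rule centralizer_subring)
lemma V_one: "\<one> \<in> V" using subringE(3)[OF V_subring] .
lemma V_mult: "v \<in> V \<Longrightarrow> w \<in> V \<Longrightarrow> v \<otimes> w \<in> V" using subringE(6)[OF V_subring] .
lemma V_add: "v \<in> V \<Longrightarrow> w \<in> V \<Longrightarrow> v \<oplus> w \<in> V" using subringE(7)[OF V_subring] .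
lemma Z_V: "z \<in> Z \<Longrightarrow> z \<in> V" using center_le_centralizer [OF D_carrier] by blast
lemma V_comm: "v \<in> V \<Longrightarrow> d \<in> D \<Longrightarrow> v \<otimes> d = d \<otimes> v" by (rule centralizer_comm)

lemma L_carrier_iff: "\<alpha> \<in> carrier L \<longleftrightarrow> \<alpha> \<in> extensional (carrier A) \<and> \<alpha> \<in> carrier A \<rightarrow> carrier A \<and>
   (\<forall>a\<in>carrier A. \<forall>b\<in>carrier A. \<alpha> (a \<oplus> b) = \<alpha> a \<oplus> \<alpha> b) \<and>
   (\<forall>d\<in>D. \<forall>a\<in>carrier A. \<alpha> (d \<otimes> a) = d \<otimes> \<alpha> a) \<and> (\<forall>d\<in>D. \<forall>a\<in>carrier A. \<alpha> (a \<otimes> d) = \<alpha> a \<otimes> d)"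
  by (auto simp: endo_algebra_def bimod_hom_def regular_bimod_def)

lemma L_carrierI:
  assumes "\<And>a. a \<in> carrier A \<Longrightarrow> f a \<in> carrier A"
    "\<And>a b. a \<in> carrier A \<Longrightarrow> b \<in> carrier A \<Longrightarrow> f (a \<oplus> b) = f a \<oplus> f b"
    "\<And>d a. d \<in> D \<Longrightarrow> d \<in> carrier A \<Longrightarrow> a \<in> carrier A \<Longrightarrow> f (d \<otimes> a) = d \<otimes> f a"
    "\<And>d a. d \<in> D \<Longrightarrow> d \<in> carrier A \<Longrightarrow> a \<in> carrier A \<Longrightarrow> f (a \<otimes> d) = f a \<otimes> d"
  shows "(\<lambda>a\<in>carrier A. f a) \<in> carrier L"
  unfolding L_carrier_iff
proof (intro conjI ballI)
  fix d a assume "d \<in> D" and a: "a \<in> carrier A"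
  moreover then have "d \<in> carrier A" using D_carrier by blast
  ultimately show "(\<lambda>a\<in>carrier A. f a) (d \<otimes> a) = d \<otimes> (\<lambda>a\<in>carrier A. f a) a"
    "(\<lambda>a\<in>carrier A. f a) (a \<otimes> d) = (\<lambda>a\<in>carrier A. f a) a \<otimes> d"
    using assms(3,4) by simp_all
qed (use assms(1,2) in simp_all)

lemma L_app [simp]: "\<alpha> \<in> carrier L \<Longrightarrow> a \<in> carrier A \<Longrightarrow> \<alpha> a \<in> carrier A"
  by (auto simp: L_carrier_iff)

lemma L_additive: "\<alpha> \<in> carrier L \<Longrightarrow> a \<in> carrier A \<Longrightarrow> b \<in> carrier A \<Longrightarrow> \<alpha> (a \<oplus> b) = \<alpha> a \<oplus> \<alpha> b"
  by (auto simp: L_carrier_iff)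

lemma L_left: "\<alpha> \<in> carrier L \<Longrightarrow> d \<in> D \<Longrightarrow> a \<in> carrier A \<Longrightarrow> \<alpha> (d \<otimes> a) = d \<otimes> \<alpha> a"
  by (auto simp: L_carrier_iff)

lemma L_right: "\<alpha> \<in> carrier L \<Longrightarrow> d \<in> D \<Longrightarrow> a \<in> carrier A \<Longrightarrow> \<alpha> (a \<otimes> d) = \<alpha> a \<otimes> d"
  by (auto simp: L_carrier_iff)

lemma L_eqI: "\<alpha> \<in> carrier L \<Longrightarrow> \<beta> \<in> carrier L \<Longrightarrow> (\<And>a. a \<in> carrier A \<Longrightarrow> \<alpha> a = \<beta> a) \<Longrightarrow> \<alpha> = \<beta>"
  by (rule extensionalityI [of _ "carrier A"]) (auto simp: L_carrier_iff)

lemma L_zero_closed: "\<zero>\<^bsub>L\<^esub> \<in> carrier L"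
  unfolding endo_algebra_simps by (rule L_carrierI) simp_all

lemma L_one_closed: "\<one>\<^bsub>L\<^esub> \<in> carrier L"
  unfolding endo_algebra_simps by (rule L_carrierI) simp_all

lemma L_add_closed: "\<alpha> \<in> carrier L \<Longrightarrow> \<beta> \<in> carrier L \<Longrightarrow> \<alpha> \<oplus>\<^bsub>L\<^esub> \<beta> \<in> carrier L"
  unfolding endo_algebra_simps
  by (rule L_carrierI) (simp_all add: L_additive L_left L_right l_distr r_distr a_ac)

lemma L_mult_closed: "\<alpha> \<in> carrier L \<Longrightarrow> \<beta> \<in> carrier L \<Longrightarrow> \<alpha> \<otimes>\<^bsub>L\<^esub> \<beta> \<in> carrier L"
  unfolding endo_algebra_simps compose_def
  by (rule L_carrierI) (simp_all add: L_additive L_left L_right)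

lemma L_smult_closed:
  assumes v: "v \<in> V" and \<alpha>: "\<alpha> \<in> carrier L" shows "(\<lambda>a\<in>carrier A. v \<otimes> \<alpha> a) \<in> carrier L"
proof (rule L_carrierI)
  note vc = V_carrier [OF v]
  fix d a assume d: "d \<in> D" "d \<in> carrier A" and a: "a \<in> carrier A"
  have "v \<otimes> (d \<otimes> \<alpha> a) = (v \<otimes> d) \<otimes> \<alpha> a" using vc d a \<alpha> by (simp add: m_assoc)
  also have "v \<otimes> d = d \<otimes> v" using v d(1) by (rule V_comm)
  finally show "v \<otimes> \<alpha> (d \<otimes> a) = d \<otimes> (v \<otimes> \<alpha> a)" using vc d a \<alpha> by (simp add: L_left m_assoc)
qed (use V_carrier [OF v] \<alpha> in \<open>simp_all add: L_additive L_right r_distr m_assoc\<close>)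

lemma L_rmult_closed:
  assumes v: "v \<in> V" and \<alpha>: "\<alpha> \<in> carrier L" shows "(\<lambda>a\<in>carrier A. \<alpha> a \<otimes> v) \<in> carrier L"
proof (rule L_carrierI)
  note vc = V_carrier [OF v]
  fix d a assume d: "d \<in> D" "d \<in> carrier A" and a: "a \<in> carrier A"
  have "\<alpha> a \<otimes> d \<otimes> v = \<alpha> a \<otimes> (d \<otimes> v)" using vc d a \<alpha> by (simp add: m_assoc)
  also have "d \<otimes> v = v \<otimes> d" using V_comm [OF v d(1)] by simp
  finally show "\<alpha> (a \<otimes> d) \<otimes> v = \<alpha> a \<otimes> v \<otimes> d" using vc d a \<alpha> by (simp add: L_right m_assoc)
qed (use V_carrier [OF v] \<alpha> in \<open>simp_all add: L_additive L_left l_distr m_assoc\<close>)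

lemma zero_app [simp]: "a \<in> carrier A \<Longrightarrow> \<zero>\<^bsub>L\<^esub> a = \<zero>" by (simp add: endo_algebra_simps)
lemma one_app [simp]: "a \<in> carrier A \<Longrightarrow> \<one>\<^bsub>L\<^esub> a = a" by (simp add: endo_algebra_simps)
lemma add_app [simp]: "a \<in> carrier A \<Longrightarrow> (\<alpha> \<oplus>\<^bsub>L\<^esub> \<beta>) a = \<alpha> a \<oplus> \<beta> a" by (simp add: endo_algebra_simps)
lemma mult_app [simp]: "a \<in> carrier A \<Longrightarrow> (\<alpha> \<otimes>\<^bsub>L\<^esub> \<beta>) a = \<alpha> (\<beta> a)" by (simp add: endo_algebra_simps compose_def)
lemma smult_app [simp]: "a \<in> carrier A \<Longrightarrow> (z \<odot>\<^bsub>L\<^esub> \<alpha>) a = z \<otimes> \<alpha> a" by (simp add: endo_algebra_simps)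

lemma L_abelian: "abelian_group L"
proof (rule abelian_groupI)
  fix x assume x: "x \<in> carrier L"
  show "\<exists>y\<in>carrier L. y \<oplus>\<^bsub>L\<^esub> x = \<zero>\<^bsub>L\<^esub>"
  proof
    have m1: "\<ominus> \<one> \<in> V" using subringE(3,5)[OF V_subring] by blast
    show y: "(\<lambda>a\<in>carrier A. \<ominus> \<one> \<otimes> x a) \<in> carrier L" using m1 x by (rule L_smult_closed)
    show "(\<lambda>a\<in>carrier A. \<ominus> \<one> \<otimes> x a) \<oplus>\<^bsub>L\<^esub> x = \<zero>\<^bsub>L\<^esub>"
      by (rule L_eqI [OF L_add_closed [OF y x] L_zero_closed]) (use x in \<open>simp add: l_minus l_neg\<close>)
  qed
  show "\<zero>\<^bsub>L\<^esub> \<oplus>\<^bsub>L\<^esub> x = x"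
    by (rule L_eqI [OF L_add_closed [OF L_zero_closed x] x]) (use x in simp)
next
  fix x y z assume x: "x \<in> carrier L" and y: "y \<in> carrier L" and z: "z \<in> carrier L"
  show "x \<oplus>\<^bsub>L\<^esub> y \<oplus>\<^bsub>L\<^esub> z = x \<oplus>\<^bsub>L\<^esub> (y \<oplus>\<^bsub>L\<^esub> z)"
    by (rule L_eqI) (use x y z L_add_closed in \<open>simp_all add: a_assoc\<close>)
next
  fix x y assume x: "x \<in> carrier L" and y: "y \<in> carrier L"
  show "x \<oplus>\<^bsub>L\<^esub> y \<in> carrier L" using x y by (rule L_add_closed)
  show "x \<oplus>\<^bsub>L\<^esub> y = y \<oplus>\<^bsub>L\<^esub> x"
    by (rule L_eqI [OF L_add_closed [OF x y] L_add_closed [OF y x]]) (use x y in \<open>simp add: a_comm\<close>)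
qed (rule L_zero_closed)

lemma L_ring: "ring L"
proof (rule ringI [OF L_abelian])
  show "Group.monoid L"
  proof (rule monoidI)
    fix x y z assume x: "x \<in> carrier L" and y: "y \<in> carrier L" and z: "z \<in> carrier L"
    show "x \<otimes>\<^bsub>L\<^esub> y \<otimes>\<^bsub>L\<^esub> z = x \<otimes>\<^bsub>L\<^esub> (y \<otimes>\<^bsub>L\<^esub> z)"
      by (rule L_eqI) (use x y z L_mult_closed in simp_all)
  next
    fix x assume x: "x \<in> carrier L"
    show "\<one>\<^bsub>L\<^esub> \<otimes>\<^bsub>L\<^esub> x = x"
      by (rule L_eqI [OF L_mult_closed [OF L_one_closed x] x]) (use x in simp)
    show "x \<otimes>\<^bsub>L\<^esub> \<one>\<^bsub>L\<^esub> = x"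
      by (rule L_eqI [OF L_mult_closed [OF x L_one_closed] x]) (use x in simp)
  qed (simp_all add: L_mult_closed L_one_closed)
next
  fix x y z assume x: "x \<in> carrier L" and y: "y \<in> carrier L" and z: "z \<in> carrier L"
  show "(x \<oplus>\<^bsub>L\<^esub> y) \<otimes>\<^bsub>L\<^esub> z = x \<otimes>\<^bsub>L\<^esub> z \<oplus>\<^bsub>L\<^esub> y \<otimes>\<^bsub>L\<^esub> z"
    by (rule L_eqI) (use x y z L_mult_closed L_add_closed in simp_all)
  show "z \<otimes>\<^bsub>L\<^esub> (x \<oplus>\<^bsub>L\<^esub> y) = z \<otimes>\<^bsub>L\<^esub> x \<oplus>\<^bsub>L\<^esub> z \<otimes>\<^bsub>L\<^esub> y"
    by (rule L_eqI) (use x y z L_mult_closed L_add_closed in \<open>simp_all add: L_additive\<close>)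
qed

sublocale L: ring L by (rule L_ring)

lemma smult_closed: "z \<in> V \<Longrightarrow> x \<in> carrier L \<Longrightarrow> z \<odot>\<^bsub>L\<^esub> x \<in> carrier L"
  using L_smult_closed by (simp add: endo_algebra_simps)

lemma L_module: "module K L"
proof (rule moduleI [OF center_cring L_abelian])
  show "z \<odot>\<^bsub>L\<^esub> x \<in> carrier L" if "z \<in> carrier K" "x \<in> carrier L" for z x
    using that smult_closed Z_V by simp
  show "\<one>\<^bsub>K\<^esub> \<odot>\<^bsub>L\<^esub> x = x" if "x \<in> carrier L" for x
    by (rule L_eqI) (use that V_one smult_closed in simp_all)
next
  fix z x y assume z: "z \<in> carrier K" and x: "x \<in> carrier L" and y: "y \<in> carrier L"
  then have zV: "z \<in> Z" "z \<in> V" "z \<in> carrier A" using Z_V by auto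
  show "z \<odot>\<^bsub>L\<^esub> (x \<oplus>\<^bsub>L\<^esub> y) = z \<odot>\<^bsub>L\<^esub> x \<oplus>\<^bsub>L\<^esub> z \<odot>\<^bsub>L\<^esub> y"
    by (rule L_eqI) (use zV x y smult_closed L_add_closed in \<open>simp_all add: r_distr\<close>)
next
  fix z w x assume z: "z \<in> carrier K" and w: "w \<in> carrier K" and x: "x \<in> carrier L"
  then have zV: "z \<in> V" "z \<in> carrier A" "w \<in> V" "w \<in> carrier A" using Z_V by auto
  show "(z \<oplus>\<^bsub>K\<^esub> w) \<odot>\<^bsub>L\<^esub> x = z \<odot>\<^bsub>L\<^esub> x \<oplus>\<^bsub>L\<^esub> w \<odot>\<^bsub>L\<^esub> x"
    by (rule L_eqI) (use zV x V_add smult_closed L_add_closed in \<open>simp_all add: l_distr\<close>)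
  show "(z \<otimes>\<^bsub>K\<^esub> w) \<odot>\<^bsub>L\<^esub> x = z \<odot>\<^bsub>L\<^esub> (w \<odot>\<^bsub>L\<^esub> x)"
    by (rule L_eqI) (use zV x V_mult smult_closed in \<open>simp_all add: m_assoc\<close>)
qed

lemma lr_app [simp]: "a \<in> carrier A \<Longrightarrow> lr v w a = v \<otimes> a \<otimes> w" by (simp add: lr_mult_def)

lemma lr_closed: "v \<in> V \<Longrightarrow> w \<in> V \<Longrightarrow> lr v w \<in> carrier L"
proof -
  assume v: "v \<in> V" and w: "w \<in> V"
  have "(\<lambda>a\<in>carrier A. v \<otimes> (\<one>\<^bsub>L\<^esub>) a) \<in> carrier L" using v L_one_closed by (rule L_smult_closed)
  with w have "(\<lambda>a\<in>carrier A. (\<lambda>a\<in>carrier A. v \<otimes> (\<one>\<^bsub>L\<^esub>) a) a \<otimes> w) \<in> carrier L" by (rule L_rmult_closed)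
  moreover have "(\<lambda>a\<in>carrier A. (\<lambda>a\<in>carrier A. v \<otimes> (\<one>\<^bsub>L\<^esub>) a) a \<otimes> w) = lr v w"
    by (auto simp: lr_mult_def fun_eq_iff)
  ultimately show ?thesis by simp
qed

lemma source_eq: "v \<in> V \<Longrightarrow> left_mult A v = lr v \<one>"
  using V_carrier by (auto simp: left_mult_def lr_mult_def)

lemma target_eq: "v \<in> V \<Longrightarrow> right_mult A v = lr \<one> v"
  using V_carrier by (auto simp: right_mult_def lr_mult_def)

lemma one_eq_lr: "\<one>\<^bsub>L\<^esub> = lr \<one> \<one>"
  by (rule L_eqI) (simp_all add: L_one_closed lr_closed V_one)

lemma lr_compose: "v \<in> V \<Longrightarrow> w \<in> V \<Longrightarrow> compose (carrier A) (left_mult A v) (right_mult A w) = lr v w"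
  using V_carrier by (auto simp: lr_mult_def compose_def left_mult_def right_mult_def m_assoc)

lemma lr_mult_lr:
  "v \<in> V \<Longrightarrow> w \<in> V \<Longrightarrow> v' \<in> V \<Longrightarrow> w' \<in> V \<Longrightarrow> lr v w \<otimes>\<^bsub>L\<^esub> lr v' w' = lr (v \<otimes> v') (w' \<otimes> w)"
  by (rule L_eqI) (simp_all add: L_mult_closed lr_closed V_mult V_carrier m_assoc)

lemma L_assoc_algebra: "assoc_algebra K L"
proof (intro assoc_algebra.intro assoc_algebra_axioms.intro L_module L_ring)
  fix k x y assume k: "k \<in> carrier K" and x: "x \<in> carrier L" and y: "y \<in> carrier L"
  have kZ: "k \<in> Z" "k \<in> V" "k \<in> carrier A" using k Z_V by auto
  show "k \<odot>\<^bsub>L\<^esub> x \<otimes>\<^bsub>L\<^esub> y = k \<odot>\<^bsub>L\<^esub> (x \<otimes>\<^bsub>L\<^esub> y)"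
    by (rule L_eqI) (use kZ x y in \<open>simp_all add: L_mult_closed smult_closed\<close>)
  \<comment> \<open>Central elements need not lie in \<open>D\<close>, so linearity over
    \<open>Z\<close> is read off from the sandwich form.\<close>
  have "x (k \<otimes> a) = k \<otimes> x a" if "a \<in> carrier A" for a
    by (rule sandwich_left_linear [OF V_subset V_subset endo_sandwich [OF x] that kZ(3)])
      (use center_comm [OF kZ(1)] V_carrier in auto)
  then show "x \<otimes>\<^bsub>L\<^esub> (k \<odot>\<^bsub>L\<^esub> y) = k \<odot>\<^bsub>L\<^esub> (x \<otimes>\<^bsub>L\<^esub> y)"
    by (intro L_eqI) (use kZ x y in \<open>simp_all add: L_mult_closed smult_closed\<close>)
qed

lemma finsum_app:
  assumes "finite I" "f \<in> I \<rightarrow> carrier L" "a \<in> carrier A"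
  shows "(\<Oplus>\<^bsub>L\<^esub>i\<in>I. f i) a = (\<Oplus>i\<in>I. f i a)"
  by (rule L.additive_finsum [OF L.carrier_additive_subgroup abelian_group_axioms, where h = "\<lambda>\<alpha>. \<alpha> a"])
    (use assms in auto)

lemma L_span:
  assumes "\<alpha> \<in> carrier L"
  obtains I :: "nat set" and x y where "finite I" "x \<in> I \<rightarrow> V" "y \<in> I \<rightarrow> V"
    "\<alpha> = (\<Oplus>\<^bsub>L\<^esub>i\<in>I. lr (x i) (y i))"
proof -
  obtain I :: "nat set" and p q where I: "finite I" "p \<in> I \<rightarrow> V" "q \<in> I \<rightarrow> V"
    "\<And>a. a \<in> carrier A \<Longrightarrow> \<alpha> a = (\<Oplus>i\<in>I. p i \<otimes> a \<otimes> q i)"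
    by (rule sandwichE [OF endo_sandwich [OF assms]]) (rule that)
  have c: "\<And>i. i \<in> I \<Longrightarrow> lr (p i) (q i) \<in> carrier L" using I lr_closed by (simp add: Pi_def)
  have pq: "\<And>i. i \<in> I \<Longrightarrow> p i \<in> carrier A" "\<And>i. i \<in> I \<Longrightarrow> q i \<in> carrier A" using I V_subset by auto
  have "\<alpha> = (\<Oplus>\<^bsub>L\<^esub>i\<in>I. lr (p i) (q i))"
  proof (rule L_eqI [OF assms])
    show "(\<Oplus>\<^bsub>L\<^esub>i\<in>I. lr (p i) (q i)) \<in> carrier L" using c by (intro L.finsum_closed) auto
    fix a assume a: "a \<in> carrier A"
    have "(\<Oplus>\<^bsub>L\<^esub>i\<in>I. lr (p i) (q i)) a = (\<Oplus>i\<in>I. lr (p i) (q i) a)"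
      by (rule finsum_app) (use I c a in auto)
    also have "\<dots> = \<alpha> a" unfolding I(4)[OF a] by (rule finsum_cong') (use a pq in auto)
    finally show "\<alpha> a = (\<Oplus>\<^bsub>L\<^esub>i\<in>I. lr (p i) (q i)) a" by simp
  qed
  then show ?thesis using I that by blast
qed

lemma L_induct [consumes 1, case_names zero lr add]:
  assumes "\<alpha> \<in> carrier L" and z: "Pr \<zero>\<^bsub>L\<^esub>" and lr: "\<And>v w. v \<in> V \<Longrightarrow> w \<in> V \<Longrightarrow> Pr (lr v w)"
    and add: "\<And>\<alpha> \<beta>. \<alpha> \<in> carrier L \<Longrightarrow> \<beta> \<in> carrier L \<Longrightarrow> Pr \<alpha> \<Longrightarrow> Pr \<beta> \<Longrightarrow> Pr (\<alpha> \<oplus>\<^bsub>L\<^esub> \<beta>)"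
  shows "Pr \<alpha>"
proof -
  obtain I :: "nat set" and x y where I: "finite I" "x \<in> I \<rightarrow> V" "y \<in> I \<rightarrow> V"
    "\<alpha> = (\<Oplus>\<^bsub>L\<^esub>i\<in>I. lr (x i) (y i))"
    using assms(1) by (rule L_span)
  have "Pr (\<Oplus>\<^bsub>L\<^esub>i\<in>I. lr (x i) (y i))" using I(1-3)
  proof (induction I rule: finite_induct)
    case empty
    then show ?case using z by simp
  next
    case (insert i I)
    have c: "(\<lambda>i. lr (x i) (y i)) \<in> I \<rightarrow> carrier L" "x i \<in> V" "y i \<in> V" using insert lr_closed by auto
    have "(\<Oplus>\<^bsub>L\<^esub>i\<in>insert i I. lr (x i) (y i)) = lr (x i) (y i) \<oplus>\<^bsub>L\<^esub> (\<Oplus>\<^bsub>L\<^esub>i\<in>I. lr (x i) (y i))"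
      by (rule L.finsum_insert) (use insert c lr_closed in auto)
    moreover have "Pr (\<Oplus>\<^bsub>L\<^esub>i\<in>I. lr (x i) (y i))" using insert by auto
    ultimately show ?case
      using add [OF lr_closed [OF c(2,3)] L.finsum_closed [OF c(1)] lr [OF c(2,3)]] by (simp only:)
  qed
  then show ?thesis using I by simp
qed

lemma L_additive_eq:
  assumes G: "abelian_group G" and \<alpha>: "\<alpha> \<in> carrier L"
    and h: "\<And>u. u \<in> carrier L \<Longrightarrow> h u \<in> carrier G" "\<And>u v. u \<in> carrier L \<Longrightarrow> v \<in> carrier L \<Longrightarrow> h (u \<oplus>\<^bsub>L\<^esub> v) = h u \<oplus>\<^bsub>G\<^esub> h v"
    and h': "\<And>u. u \<in> carrier L \<Longrightarrow> h' u \<in> carrier G" "\<And>u v. u \<in> carrier L \<Longrightarrow> v \<in> carrier L \<Longrightarrow> h' (u \<oplus>\<^bsub>L\<^esub> v) = h' u \<oplus>\<^bsub>G\<^esub> h' v"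
    and eq: "\<And>v w. v \<in> V \<Longrightarrow> w \<in> V \<Longrightarrow> h (lr v w) = h' (lr v w)"
  shows "h \<alpha> = h' \<alpha>"
  using \<alpha>
proof (induction \<alpha> rule: L_induct)
  case zero
  have "h \<zero>\<^bsub>L\<^esub> = \<zero>\<^bsub>G\<^esub>"
    by (rule L.additive_zero [OF L.carrier_additive_subgroup G]) (use h in auto)
  moreover have "h' \<zero>\<^bsub>L\<^esub> = \<zero>\<^bsub>G\<^esub>"
    by (rule L.additive_zero [OF L.carrier_additive_subgroup G]) (use h' in auto)
  ultimately show ?case by simp
next
  case (add \<alpha> \<beta>)
  then show ?case using h(2) h'(2) by presburger
qed (use eq in auto)

section \<open>Tensor products of the endomorphism ring\<close>

lemma M_simps [simp]:
  "carrier M = carrier L" "ring.add M = ring.add L" "ring.zero M = ring.zero L"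
  by (simp_all add: total_bimod_def)

lemma lact_M: "r \<in> V \<Longrightarrow> \<alpha> \<in> carrier L \<Longrightarrow> lact M r \<alpha> = (\<lambda>a\<in>carrier A. r \<otimes> \<alpha> a)"
  by (auto simp: total_bimod_def compose_def left_mult_def endo_algebra_simps fun_eq_iff)

lemma ract_M: "r \<in> V \<Longrightarrow> \<alpha> \<in> carrier L \<Longrightarrow> ract M \<alpha> r = (\<lambda>a\<in>carrier A. \<alpha> a \<otimes> r)"
  by (auto simp: total_bimod_def compose_def right_mult_def endo_algebra_simps fun_eq_iff)

lemma lact_M_mult: "r \<in> V \<Longrightarrow> lact M r \<alpha> = lr r \<one> \<otimes>\<^bsub>L\<^esub> \<alpha>"
  by (simp add: total_bimod_def source_eq)

lemma ract_M_mult: "r \<in> V \<Longrightarrow> ract M \<alpha> r = lr \<one> r \<otimes>\<^bsub>L\<^esub> \<alpha>"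
  by (simp add: total_bimod_def target_eq)

lemma lact_app [simp]: "r \<in> V \<Longrightarrow> \<alpha> \<in> carrier L \<Longrightarrow> a \<in> carrier A \<Longrightarrow> lact M r \<alpha> a = r \<otimes> \<alpha> a"
  by (simp add: lact_M)

lemma ract_app [simp]: "r \<in> V \<Longrightarrow> \<alpha> \<in> carrier L \<Longrightarrow> a \<in> carrier A \<Longrightarrow> ract M \<alpha> r a = \<alpha> a \<otimes> r"
  by (simp add: ract_M)

lemma lact_closed: "r \<in> V \<Longrightarrow> \<alpha> \<in> carrier L \<Longrightarrow> lact M r \<alpha> \<in> carrier L"
  by (simp add: lact_M L_smult_closed)

lemma ract_closed: "r \<in> V \<Longrightarrow> \<alpha> \<in> carrier L \<Longrightarrow> ract M \<alpha> r \<in> carrier L"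
  by (simp add: ract_M L_rmult_closed)

lemma M_bimodule: "bimodule VA VA M"
proof -
  interpret M: abelian_group M unfolding total_bimod_def
    by (rule abelian_group_bimod_of) (simp only: endo_hopf_simps L_abelian)
  show ?thesis
  proof unfold_locales
    fix p x y assume p: "p \<in> carrier VA" and x: "x \<in> carrier M"
    then have c: "p \<in> V" "p \<in> carrier A" "x \<in> carrier L" using V_carrier by auto
    show "lact M p x \<in> carrier M" "ract M x p \<in> carrier M" using c by (auto simp: lact_closed ract_closed)
    assume "y \<in> carrier M"
    then have y: "y \<in> carrier L" by simp
    show "lact M p (x \<oplus>\<^bsub>M\<^esub> y) = lact M p x \<oplus>\<^bsub>M\<^esub> lact M p y" unfolding M_simps
      by (rule L_eqI) (use c y L_add_closed lact_closed in \<open>simp_all add: r_distr\<close>)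
    show "ract M (x \<oplus>\<^bsub>M\<^esub> y) p = ract M x p \<oplus>\<^bsub>M\<^esub> ract M y p" unfolding M_simps
      by (rule L_eqI) (use c y L_add_closed ract_closed in \<open>simp_all add: l_distr\<close>)
  next
    fix p q x assume "p \<in> carrier VA" "q \<in> carrier VA" "x \<in> carrier M"
    then have c: "p \<in> V" "p \<in> carrier A" "q \<in> V" "q \<in> carrier A" "x \<in> carrier L" using V_carrier by auto
    show "lact M p (ract M x q) = ract M (lact M p x) q"
      by (rule L_eqI) (use c lact_closed ract_closed in \<open>simp_all add: m_assoc\<close>)
  qed
qed

text \<open>Four tensor products occur: \<open>TT\<close> is \<open>L \<otimes>_V L\<close>,
  \<open>GT\<close> is \<open>L \<otimes>_Z L\<close>, \<open>TV\<close> is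
  \<open>V \<otimes>_Z V\<close>, and \<open>AA\<close> is \<open>A \<otimes>_D A\<close>.\<close>

sublocale TT: tensor_product VA VA VA M M
  by (intro tensor_product.intro M_bimodule)

sublocale GT: tensor_product K K K "module_bimod L" "module_bimod L"
  by (intro tensor_product.intro module_bimodule L_module)

lemma VA_module: "module K VA"
  using centralizer_algebra_assoc [OF D_carrier] by (simp add: assoc_algebra_def)

sublocale TV: tensor_product K K K "module_bimod VA" "module_bimod VA"
  by (intro tensor_product.intro module_bimodule VA_module)

sublocale AA: tensor_product A "A\<lparr>carrier := D\<rparr>" A "regular_bimod A" "regular_bimod A"
  by (intro tensor_product.intro regular_bimodule) (use ring_axioms D_carrier in auto)

end

definition (in abelian_monoid) fin_sums :: "'a set \<Rightarrow> 'a set" where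
  "fin_sums U = {u. \<exists>I :: nat set. \<exists>h\<in>I \<rightarrow> U. finite I \<and> u = (\<Oplus>i\<in>I. h i)}"

context abelian_monoid begin

lemma fin_sumsI: "finite (I :: nat set) \<Longrightarrow> h \<in> I \<rightarrow> U \<Longrightarrow> (\<Oplus>i\<in>I. h i) \<in> fin_sums U"
  unfolding fin_sums_def by blast

lemma fin_sums_zero: "\<zero> \<in> fin_sums U"
  using fin_sumsI [of "{}" "\<lambda>_. \<zero>" U] by simp

lemma fin_sums_single: "u \<in> U \<Longrightarrow> U \<subseteq> carrier G \<Longrightarrow> u \<in> fin_sums U"
  using fin_sumsI [of "{0}" "\<lambda>_. u" U] by (auto simp: finsum_insert)

lemma fin_sums_add:
  assumes "U \<subseteq> carrier G" "u \<in> fin_sums U" "v \<in> fin_sums U" shows "u \<oplus> v \<in> fin_sums U"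
proof -
  obtain I :: "nat set" and h where 1: "h \<in> I \<rightarrow> U" "finite I" "u = (\<Oplus>i\<in>I. h i)"
    using assms(2) unfolding fin_sums_def by blast
  obtain J :: "nat set" and k where 2: "k \<in> J \<rightarrow> U" "finite J" "v = (\<Oplus>i\<in>J. k i)"
    using assms(3) unfolding fin_sums_def by blast
  have hk: "join_fam h k \<in> join_index I J \<rightarrow> U" using 1 2 by (simp only: join_fam_Pi)
  moreover have "u \<oplus> v = (\<Oplus>i\<in>join_index I J. join_fam h k i)"
    using 1 2 hk assms(1) by (subst finsum_join) auto
  ultimately show ?thesis using fin_sumsI [OF _ hk] 1 2 by simp
qed

lemma fin_sums_finsum:
  assumes "U \<subseteq> carrier G" "finite K" "f \<in> K \<rightarrow> U" shows "(\<Oplus>i\<in>K. f i) \<in> fin_sums U"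
  using assms(2,3)
proof (induction K rule: finite_induct)
  case empty then show ?case by (simp add: fin_sums_zero)
next
  case (insert k K)
  have "(\<Oplus>i\<in>insert k K. f i) = f k \<oplus> (\<Oplus>i\<in>K. f i)"
    by (rule finsum_insert) (use insert assms(1) in auto)
  then show ?case using insert assms(1) by (simp add: fin_sums_add fin_sums_single)
qed

end

lemma (in abelian_group) formal_eval_swap:
  assumes "Poly_Mapping.keys x \<subseteq> S" "Poly_Mapping.keys y \<subseteq> T"
    "\<And>i j. i \<in> S \<Longrightarrow> j \<in> T \<Longrightarrow> f i j \<in> carrier G"
  shows "formal_eval G (\<lambda>i. formal_eval G (\<lambda>j. f i j) y) x = formal_eval G (\<lambda>j. formal_eval G (\<lambda>i. f i j) x) y"
proof -
  let ?X = "Poly_Mapping.keys x" and ?Y = "Poly_Mapping.keys y"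
  let ?l = "\<lambda>i. Poly_Mapping.lookup x i" and ?m = "\<lambda>j. Poly_Mapping.lookup y j"
  have c: "f i j \<in> carrier G" if "i \<in> ?X" "j \<in> ?Y" for i j using assms that by auto
  have pa: "add_pow G (n :: int) (\<Oplus>k\<in>K. h k) = (\<Oplus>k\<in>K. add_pow G n (h k))"
    if "finite K" "h \<in> K \<rightarrow> carrier G" for n h and K :: "'z set"
    by (rule additive_finsum [OF carrier_additive_subgroup abelian_group_axioms])
      (use that add.int_pow_distrib in auto)
  have pp: "add_pow G n (add_pow G m a) = add_pow G m (add_pow G n a)"
    if "a \<in> carrier G" for n m :: int and a
    using add.int_pow_pow [OF that] by (simp add: mult.commute)
  have "formal_eval G (\<lambda>i. formal_eval G (\<lambda>j. f i j) y) x =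
      (\<Oplus>i\<in>?X. \<Oplus>j\<in>?Y. add_pow G (?l i) (add_pow G (?m j) (f i j)))"
    unfolding formal_eval_def
    by (rule finsum_cong') (use c in \<open>auto intro!: additive_finsum [OF carrier_additive_subgroup abelian_group_axioms] finsum_closed add.int_pow_distrib\<close>)
  also have "\<dots> = (\<Oplus>j\<in>?Y. \<Oplus>i\<in>?X. add_pow G (?l i) (add_pow G (?m j) (f i j)))"
    by (rule finsum_swap) (use c in auto)
  also have "\<dots> = formal_eval G (\<lambda>j. formal_eval G (\<lambda>i. f i j) x) y"
    unfolding formal_eval_def
  proof (rule finsum_cong')
    fix j assume j: "j \<in> ?Y"
    have "add_pow G (?m j) (\<Oplus>i\<in>?X. add_pow G (?l i) (f i j)) =
        (\<Oplus>i\<in>?X. add_pow G (?m j) (add_pow G (?l i) (f i j)))"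
      by (rule additive_finsum [OF carrier_additive_subgroup abelian_group_axioms])
        (use c j add.int_pow_distrib in auto)
    also have "\<dots> = (\<Oplus>i\<in>?X. add_pow G (?l i) (add_pow G (?m j) (f i j)))"
      by (rule finsum_cong') (use c j pp in auto)
    finally show "(\<Oplus>i\<in>?X. add_pow G (?l i) (add_pow G (?m j) (f i j))) =
        add_pow G (?m j) (\<Oplus>i\<in>?X. add_pow G (?l i) (f i j))" by simp
  qed (use c in \<open>auto intro!: finsum_closed\<close>)
  finally show ?thesis .
qed

text \<open>The coproduct of the endomorphism ring is defined through \<open>endo_bimod\<close>,
  while the bialgebroid axioms use \<open>total_bimod\<close>. Carriers and actions agree where it
  matters, so the two tensor products consist of the same cosets.\<close>

lemma tensor_rels_cong:
  assumes "carrier R' = carrier R" "carrier M' = carrier M" "carrier N' = carrier N"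
    "ring.add M' = ring.add M" "ring.add N' = ring.add N"
    "\<And>m r. m \<in> carrier M \<Longrightarrow> r \<in> carrier R \<Longrightarrow> ract M' m r = ract M m r"
    "\<And>n r. n \<in> carrier N \<Longrightarrow> r \<in> carrier R \<Longrightarrow> lact N' r n = lact N r n"
  shows "tensor_rels R' M' N' = tensor_rels R M N"
proof -
  have "{frag_of (ract M' m r, n) - frag_of (m, lact N' r n) | m r n.
        m \<in> carrier M \<and> r \<in> carrier R \<and> n \<in> carrier N} =
     {frag_of (ract M m r, n) - frag_of (m, lact N r n) | m r n.
        m \<in> carrier M \<and> r \<in> carrier R \<and> n \<in> carrier N}"
    using assms(6,7) by (intro Collect_cong iff_exI) (metis (no_types))
  then show ?thesis unfolding tensor_rels_def assms(1-5) by (simp only:)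
qed

lemma tensor_carrier_cong:
  assumes "tensor_rels R' M' N' = tensor_rels R M N" "carrier M' = carrier M" "carrier N' = carrier N"
  shows "carrier (tensor R' M' N') = carrier (tensor R M N)"
  by (simp add: tensor_def Let_def tensor_group_def tensor_subgroup_def assms)

lemma (in tensor_product) tensor_span: "u \<in> carrier T \<Longrightarrow> u \<in> T.fin_sums {pure m n | m n. m \<in> carrier M \<and> n \<in> carrier N}"
proof (induction u rule: tensor_induct)
  case zero
  show ?case by (rule T.fin_sums_zero)
next
  case (pure m n)
  then show ?case by (intro T.fin_sums_single) (auto simp: pure_closed)
next
  case (add u v)
  then show ?case by (intro T.fin_sums_add) (auto simp: pure_closed)
qed

section \<open>Evaluation of tensors at pairs of ring elements\<close>

context endo_hopf begin

lemma pure_closed: "\<alpha> \<in> carrier L \<Longrightarrow> \<beta> \<in> carrier L \<Longrightarrow> TT.pure \<alpha> \<beta> \<in> carrier TT.T"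
  using TT.pure_closed by simp

lemma pure_add_left: "\<alpha> \<in> carrier L \<Longrightarrow> \<alpha>' \<in> carrier L \<Longrightarrow> \<beta> \<in> carrier L \<Longrightarrow>
  TT.pure (\<alpha> \<oplus>\<^bsub>L\<^esub> \<alpha>') \<beta> = TT.pure \<alpha> \<beta> \<oplus>\<^bsub>TT.T\<^esub> TT.pure \<alpha>' \<beta>"
  using TT.pure_add_left by simp

lemma pure_add_right: "\<alpha> \<in> carrier L \<Longrightarrow> \<beta> \<in> carrier L \<Longrightarrow> \<beta>' \<in> carrier L \<Longrightarrow>
  TT.pure \<alpha> (\<beta> \<oplus>\<^bsub>L\<^esub> \<beta>') = TT.pure \<alpha> \<beta> \<oplus>\<^bsub>TT.T\<^esub> TT.pure \<alpha> \<beta>'"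
  using TT.pure_add_right by simp

lemma pure_balanced: "\<alpha> \<in> carrier L \<Longrightarrow> \<beta> \<in> carrier L \<Longrightarrow> r \<in> V \<Longrightarrow>
  TT.pure (ract M \<alpha> r) \<beta> = TT.pure \<alpha> (lact M r \<beta>)"
  using TT.pure_balanced by simp

lemma M_balancedI:
  assumes "\<And>\<alpha> \<beta>. \<alpha> \<in> carrier L \<Longrightarrow> \<beta> \<in> carrier L \<Longrightarrow> f \<alpha> \<beta> \<in> carrier P"
    "\<And>\<alpha> \<alpha>' \<beta>. \<alpha> \<in> carrier L \<Longrightarrow> \<alpha>' \<in> carrier L \<Longrightarrow> \<beta> \<in> carrier L \<Longrightarrow> f (\<alpha> \<oplus>\<^bsub>L\<^esub> \<alpha>') \<beta> = f \<alpha> \<beta> \<oplus>\<^bsub>P\<^esub> f \<alpha>' \<beta>"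
    "\<And>\<alpha> \<beta> \<beta>'. \<alpha> \<in> carrier L \<Longrightarrow> \<beta> \<in> carrier L \<Longrightarrow> \<beta>' \<in> carrier L \<Longrightarrow> f \<alpha> (\<beta> \<oplus>\<^bsub>L\<^esub> \<beta>') = f \<alpha> \<beta> \<oplus>\<^bsub>P\<^esub> f \<alpha> \<beta>'"
    "\<And>\<alpha> \<beta> r. \<alpha> \<in> carrier L \<Longrightarrow> \<beta> \<in> carrier L \<Longrightarrow> r \<in> V \<Longrightarrow> f (ract M \<alpha> r) \<beta> = f \<alpha> (lact M r \<beta>)"
  shows "balanced VA M M P f"
  by (rule balancedI) (use assms in auto)

lemma lr_ract: "v \<in> V \<Longrightarrow> w \<in> V \<Longrightarrow> lr v w = ract M (lr v \<one>) w"
  by (rule L_eqI) (simp_all add: lr_closed ract_closed V_one V_carrier)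

lemma lr_lact: "v \<in> V \<Longrightarrow> w \<in> V \<Longrightarrow> lr v w = lact M v (lr \<one> w)"
  by (rule L_eqI) (simp_all add: lr_closed lact_closed V_one V_carrier m_assoc)

lemma pure_lr: "v \<in> V \<Longrightarrow> w \<in> V \<Longrightarrow> \<beta> \<in> carrier L \<Longrightarrow> TT.pure (lr v w) \<beta> = TT.pure (lr v \<one>) (lact M w \<beta>)"
  using pure_balanced [of "lr v \<one>" \<beta> w] lr_ract [of v w] lr_closed V_one by simp

text \<open>The value of \<open>endo_tensor_map\<close> at the pure tensor of \<open>a\<close> and
  \<open>a'\<close>, taken without passing through \<open>A \<otimes>_D A\<close>.\<close>

definition ev :: "'a \<Rightarrow> 'a \<Rightarrow> ((('a \<Rightarrow> 'a) \<times> ('a \<Rightarrow> 'a)) \<Rightarrow>\<^sub>0 int) set \<Rightarrow> 'a" where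
  "ev a a' = tensor_lift A (\<lambda>\<alpha> \<beta>. \<alpha> a \<otimes> \<beta> a')"

lemma ev_balanced: "a \<in> carrier A \<Longrightarrow> a' \<in> carrier A \<Longrightarrow> balanced VA M M A (\<lambda>\<alpha> \<beta>. \<alpha> a \<otimes> \<beta> a')"
  by (rule M_balancedI) (auto simp: l_distr r_distr m_assoc V_carrier)

lemma ev_closed: "a \<in> carrier A \<Longrightarrow> a' \<in> carrier A \<Longrightarrow> u \<in> carrier TT.T \<Longrightarrow> ev a a' u \<in> carrier A"
  unfolding ev_def by (rule TT.lift_closed [OF abelian_group_axioms ev_balanced])

lemma ev_add: "a \<in> carrier A \<Longrightarrow> a' \<in> carrier A \<Longrightarrow> u \<in> carrier TT.T \<Longrightarrow> u' \<in> carrier TT.T \<Longrightarrow>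
  ev a a' (u \<oplus>\<^bsub>TT.T\<^esub> u') = ev a a' u \<oplus> ev a a' u'"
  unfolding ev_def by (rule TT.lift_add [OF abelian_group_axioms ev_balanced])

lemma ev_pure: "a \<in> carrier A \<Longrightarrow> a' \<in> carrier A \<Longrightarrow> \<alpha> \<in> carrier L \<Longrightarrow> \<beta> \<in> carrier L \<Longrightarrow>
  ev a a' (TT.pure \<alpha> \<beta>) = \<alpha> a \<otimes> \<beta> a'"
  unfolding ev_def using TT.lift_pure [OF abelian_group_axioms ev_balanced] by simp

text \<open>The right factor of \<open>lr x y\<close> can be pulled across the tensor sign, so
  \<open>L \<otimes>_V L\<close> is spanned by the tensors that come from
  \<open>V \<otimes>_Z L\<close>.\<close>

lemma T_span: "u \<in> carrier TT.T \<Longrightarrow> u \<in> TT.T.fin_sums {TT.pure (lr x \<one>) \<beta> | x \<beta>. x \<in> V \<and> \<beta> \<in> carrier L}"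
proof (induction u rule: TT.tensor_induct)
  case zero
  show ?case by (rule TT.T.fin_sums_zero)
next
  case (pure \<alpha> \<beta>)
  then have ab: "\<alpha> \<in> carrier L" "\<beta> \<in> carrier L" by auto
  obtain I :: "nat set" and x y where I: "finite I" "x \<in> I \<rightarrow> V" "y \<in> I \<rightarrow> V"
    "\<alpha> = (\<Oplus>\<^bsub>L\<^esub>i\<in>I. lr (x i) (y i))" using ab(1) by (rule L_span)
  have xy: "\<And>i. i \<in> I \<Longrightarrow> x i \<in> V" "\<And>i. i \<in> I \<Longrightarrow> y i \<in> V" using I by auto
  have "TT.pure \<alpha> \<beta> = (\<Oplus>\<^bsub>TT.T\<^esub>i\<in>I. TT.pure (lr (x i) (y i)) \<beta>)"
    unfolding I(4)
    by (rule L.additive_finsum [OF L.carrier_additive_subgroup TT.T_abelian, where h = "\<lambda>\<alpha>. TT.pure \<alpha> \<beta>"])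
      (use I(1) xy ab in \<open>auto simp: pure_closed pure_add_left lr_closed\<close>)
  also have "\<dots> \<in> TT.T.fin_sums {TT.pure (lr x \<one>) \<beta> | x \<beta>. x \<in> V \<and> \<beta> \<in> carrier L}"
  proof (rule TT.T.fin_sums_finsum [OF _ I(1)])
    show "(\<lambda>i. TT.pure (lr (x i) (y i)) \<beta>) \<in> I \<rightarrow> {TT.pure (lr x \<one>) \<beta> | x \<beta>. x \<in> V \<and> \<beta> \<in> carrier L}"
    proof
      fix i assume "i \<in> I"
      then show "TT.pure (lr (x i) (y i)) \<beta> \<in> {TT.pure (lr x \<one>) \<beta> | x \<beta>. x \<in> V \<and> \<beta> \<in> carrier L}"
        using pure_lr [OF xy ab(2)] lact_closed [OF xy(2) ab(2)] xy(1) by blast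
    qed
  qed (auto simp: pure_closed lr_closed V_one)
  finally show ?case .
next
  case (add u v)
  then show ?case by (intro TT.T.fin_sums_add) (auto simp: pure_closed lr_closed V_one)
qed

lemma V_central_subspace: "central_subspace V" using D_carrier by (rule centralizer_subspace)

text \<open>On such tensors evaluation is
  \<open>(a, t) \<mapsto> \<Sum> x\<^sub>i a b\<^sub>i(t)\<close>. Injectivity is thus an instance
  of \<open>tensor_zero_of_map_zero\<close> with \<open>N = L\<close>, the elements of
  \<open>L\<close> being separated by their values at all \<open>t\<close>.\<close>

lemma ev_zero_imp:
  assumes u: "u \<in> carrier TT.T" and z: "\<And>a a'. a \<in> carrier A \<Longrightarrow> a' \<in> carrier A \<Longrightarrow> ev a a' u = \<zero>"
  shows "u = \<zero>\<^bsub>TT.T\<^esub>"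
proof -
  obtain I :: "nat set" and h where I: "finite I" "u = (\<Oplus>\<^bsub>TT.T\<^esub>i\<in>I. h i)"
    and h: "h \<in> I \<rightarrow> {TT.pure (lr x \<one>) \<beta> | x \<beta>. x \<in> V \<and> \<beta> \<in> carrier L}"
    using T_span [OF u] unfolding TT.T.fin_sums_def by blast
  have "\<forall>i\<in>I. \<exists>p. fst p \<in> V \<and> snd p \<in> carrier L \<and> h i = TT.pure (lr (fst p) \<one>) (snd p)"
    using h by (fastforce simp: Pi_def)
  then obtain p where p: "\<forall>i\<in>I. fst (p i) \<in> V \<and> snd (p i) \<in> carrier L \<and> h i = TT.pure (lr (fst (p i)) \<one>) (snd (p i))"
    by (rule bchoice [THEN exE])
  define x where "x i = fst (p i)" for i
  define b where "b i = snd (p i)" for i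
  have xb: "\<And>i. i \<in> I \<Longrightarrow> x i \<in> V" "\<And>i. i \<in> I \<Longrightarrow> b i \<in> carrier L"
    "\<And>i. i \<in> I \<Longrightarrow> h i = TT.pure (lr (x i) \<one>) (b i)" using p by (auto simp: x_def b_def)
  have hc: "\<And>i. i \<in> I \<Longrightarrow> h i \<in> carrier TT.T" using xb by (simp add: pure_closed lr_closed V_one)
  interpret G: central_balanced A V L "\<lambda>z n. z \<odot>\<^bsub>L\<^esub> n" TT.T "\<lambda>x \<beta>. TT.pure (lr x \<one>) \<beta>"
  proof unfold_locales
    show "central_subspace V" by (rule V_central_subspace)
    fix x x' \<beta> assume x: "x \<in> V" and x': "x' \<in> V" and b: "\<beta> \<in> carrier L"
    have "lr (x \<oplus> x') \<one> = lr x \<one> \<oplus>\<^bsub>L\<^esub> lr x' \<one>"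
      by (rule L_eqI) (use x x' V_one V_add lr_closed L_add_closed in \<open>simp_all add: V_carrier l_distr\<close>)
    then show "TT.pure (lr (x \<oplus> x') \<one>) \<beta> = TT.pure (lr x \<one>) \<beta> \<oplus>\<^bsub>TT.T\<^esub> TT.pure (lr x' \<one>) \<beta>"
      using x x' b by (simp add: pure_add_left lr_closed V_one)
  next
    fix z x \<beta> assume zZ: "z \<in> Z" and x: "x \<in> V" and b: "\<beta> \<in> carrier L"
    have z: "z \<in> V" "z \<in> carrier A" using zZ Z_V by auto
    have "lr (z \<otimes> x) \<one> = lr x z"
    proof (rule L_eqI)
      fix a assume a: "a \<in> carrier A"
      have "z \<otimes> (x \<otimes> a) = x \<otimes> a \<otimes> z" using center_comm [OF zZ, of "x \<otimes> a"] x a V_carrier by simp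
      then show "lr (z \<otimes> x) \<one> a = lr x z a" using a x z V_carrier by (simp add: m_assoc)
    qed (use x z V_one V_mult lr_closed in auto)
    moreover have "lact M z \<beta> = z \<odot>\<^bsub>L\<^esub> \<beta>"
      by (rule L_eqI) (use z b lact_closed smult_closed in auto)
    ultimately show "TT.pure (lr (z \<otimes> x) \<one>) \<beta> = TT.pure (lr x \<one>) (z \<odot>\<^bsub>L\<^esub> \<beta>)"
      using pure_lr [OF x z(1) b] by simp
  qed (use Z_V smult_closed pure_closed pure_add_right lr_closed V_one in auto)
  have "(\<Oplus>\<^bsub>TT.T\<^esub>i\<in>I. TT.pure (lr (x i) \<one>) (b i)) = \<zero>\<^bsub>TT.T\<^esub>"
  proof (rule G.tensor_zero_of_map_zero [OF I(1), where T = "carrier A" and e = "\<lambda>t \<beta>. \<beta> t"])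
    show "n = \<zero>\<^bsub>L\<^esub>" if "n \<in> carrier L" "\<And>t. t \<in> carrier A \<Longrightarrow> n t = \<zero>" for n
      by (rule L_eqI) (use that L_zero_closed in auto)
    fix a t assume a: "a \<in> carrier A" and t: "t \<in> carrier A"
    have "ev a t u = (\<Oplus>i\<in>I. ev a t (h i))" unfolding I(2)
      by (rule TT.T.additive_finsum [OF TT.T.carrier_additive_subgroup abelian_group_axioms])
        (use a t I(1) hc ev_closed ev_add in auto)
    also have "\<dots> = (\<Oplus>i\<in>I. x i \<otimes> a \<otimes> b i t)"
      by (rule finsum_cong') (use a t xb V_carrier in \<open>auto simp: ev_pure lr_closed V_one\<close>)
    finally show "(\<Oplus>i\<in>I. x i \<otimes> a \<otimes> b i t) = \<zero>" using z [OF a t] by simp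
  qed (use xb in auto)
  moreover have "u = (\<Oplus>\<^bsub>TT.T\<^esub>i\<in>I. TT.pure (lr (x i) \<one>) (b i))"
    unfolding I(2) by (rule TT.T.finsum_cong') (use xb hc in auto)
  ultimately show ?thesis by simp
qed

lemma ev_inj:
  assumes u: "u \<in> carrier TT.T" and v: "v \<in> carrier TT.T"
    and eq: "\<And>a a'. a \<in> carrier A \<Longrightarrow> a' \<in> carrier A \<Longrightarrow> ev a a' u = ev a a' v"
  shows "u = v"
proof -
  define w where "w = u \<oplus>\<^bsub>TT.T\<^esub> \<ominus>\<^bsub>TT.T\<^esub> v"
  have w: "w \<in> carrier TT.T" "u = w \<oplus>\<^bsub>TT.T\<^esub> v" using u v by (auto simp: w_def TT.T.a_assoc TT.T.l_neg)
  have "ev a a' w = \<zero>" if a: "a \<in> carrier A" "a' \<in> carrier A" for a a'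
  proof -
    have c: "ev a a' w \<in> carrier A" "ev a a' v \<in> carrier A" using ev_closed a w v by auto
    have "ev a a' w \<oplus> ev a a' v = ev a a' v" using ev_add [OF a w(1) v] w(2) eq [OF a] by simp
    then show ?thesis using c by (simp add: add.l_cancel_one')
  qed
  then have "w = \<zero>\<^bsub>TT.T\<^esub>" using ev_zero_imp w(1) by blast
  then show ?thesis using w(2) v by simp
qed

section \<open>Comultiplication\<close>

lemma ev_additive_left:
  assumes "a \<in> carrier A" "b \<in> carrier A" "c \<in> carrier A" "u \<in> carrier TT.T"
  shows "ev (a \<oplus> b) c u = ev a c u \<oplus> ev b c u"
  by (rule TT.additive_eq [OF abelian_group_axioms assms(4)])
    (use assms(1-3) in \<open>auto simp: ev_closed ev_add ev_pure L_additive l_distr a_ac\<close>)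

lemma ev_additive_right:
  assumes "a \<in> carrier A" "b \<in> carrier A" "c \<in> carrier A" "u \<in> carrier TT.T"
  shows "ev c (a \<oplus> b) u = ev c a u \<oplus> ev c b u"
  by (rule TT.additive_eq [OF abelian_group_axioms assms(4)])
    (use assms(1-3) in \<open>auto simp: ev_closed ev_add ev_pure L_additive r_distr a_ac\<close>)

lemma ev_middle:
  assumes "a \<in> carrier A" "b \<in> carrier A" "d \<in> D" "u \<in> carrier TT.T"
  shows "ev (a \<otimes> d) b u = ev a (d \<otimes> b) u"
proof -
  have d: "d \<in> carrier A" using assms(3) D_carrier by blast
  show ?thesis
    by (rule TT.additive_eq [OF abelian_group_axioms assms(4)])
      (use assms(1-3) d in \<open>auto simp: ev_closed ev_add ev_pure L_left L_right m_assoc\<close>)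
qed

lemma ev_lact:
  assumes "a \<in> carrier A" "b \<in> carrier A" "r \<in> V" "u \<in> carrier TT.T"
  shows "ev a b (lact TT.T r u) = r \<otimes> ev a b u"
proof -
  interpret T: bimodule VA VA TT.T by (rule TT.tensor_bimodule)
  show ?thesis
    by (rule TT.additive_eq [OF abelian_group_axioms assms(4)])
      (use assms(1-3) T.lact_closed T.lact_add TT.lact_pure V_carrier
       in \<open>auto simp: ev_closed ev_add ev_pure lact_closed r_distr m_assoc\<close>)
qed

lemma ev_ract:
  assumes "a \<in> carrier A" "b \<in> carrier A" "r \<in> V" "u \<in> carrier TT.T"
  shows "ev a b (ract TT.T u r) = ev a b u \<otimes> r"
proof -
  interpret T: bimodule VA VA TT.T by (rule TT.tensor_bimodule)
  show ?thesis
    by (rule TT.additive_eq [OF abelian_group_axioms assms(4)])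
      (use assms(1-3) T.ract_closed T.ract_add TT.ract_pure V_carrier
       in \<open>auto simp: ev_closed ev_add ev_pure ract_closed l_distr m_assoc\<close>)
qed

lemma E_simps [simp]:
  "carrier (regular_bimod A) = carrier A" "ring.add (regular_bimod A) = ring.add A"
  "lact (regular_bimod A) = (\<lambda>a x. a \<otimes> x)" "ract (regular_bimod A) = (\<lambda>x a. x \<otimes> a)"
  by (simp_all add: regular_bimod_def)

abbreviation "E \<equiv> regular_bimod A"
abbreviation "DA \<equiv> A\<lparr>carrier := D\<rparr>"

lemma ev_AA_balanced: "u \<in> carrier TT.T \<Longrightarrow> balanced DA E E A (\<lambda>a a'. ev a a' u)"
  by (rule balancedI) (auto simp: ev_closed ev_additive_left ev_additive_right ev_middle)

lemma mult_AA_balanced: "\<alpha> \<in> carrier L \<Longrightarrow> balanced DA E E A (\<lambda>a a'. \<alpha> (a \<otimes> a'))"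
  using D_carrier by (intro balancedI) (auto simp: L_additive l_distr r_distr m_assoc subset_iff)

text \<open>The property that determines the coproduct, by injectivity of evaluation. Once a
  solution is known, the inverse function in \<open>endo_comult\<close> can be eliminated.\<close>

definition comult_spec :: "('a \<Rightarrow> 'a) \<Rightarrow> _ \<Rightarrow> bool" where
  "comult_spec \<alpha> u \<longleftrightarrow> u \<in> carrier TT.T \<and> (\<forall>a\<in>carrier A. \<forall>a'\<in>carrier A. ev a a' u = \<alpha> (a \<otimes> a'))"

lemma endo_tensor_map_eq:
  "endo_tensor_map A D u = (\<lambda>w\<in>carrier AA.T. tensor_lift A (\<lambda>a a'. ev a a' u) w)"
  by (simp add: endo_tensor_map_def ev_def)

lemma endo_tensor_map_inj: "inj_on (endo_tensor_map A D) (carrier TT.T)"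
proof (rule inj_onI)
  fix u v assume u: "u \<in> carrier TT.T" and v: "v \<in> carrier TT.T"
    and eq: "endo_tensor_map A D u = endo_tensor_map A D v"
  show "u = v"
  proof (rule ev_inj [OF u v])
    fix a a' assume a: "a \<in> carrier A" "a' \<in> carrier A"
    have p: "AA.pure a a' \<in> carrier AA.T" by (rule AA.pure_closed) (use a in auto)
    have val: "endo_tensor_map A D w (AA.pure a a') = ev a a' w" if "w \<in> carrier TT.T" for w
      unfolding endo_tensor_map_eq
      using p a AA.lift_pure [OF abelian_group_axioms ev_AA_balanced [OF that], of a a'] by simp
    show "ev a a' u = ev a a' v" using val u v eq by metis
  qed
qed

lemma endo_tensor_map_spec:
  assumes "\<alpha> \<in> carrier L" "comult_spec \<alpha> u"
  shows "endo_tensor_map A D u = (\<lambda>w\<in>carrier AA.T. tensor_lift A (\<lambda>a a'. \<alpha> (a \<otimes> a')) w)"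
proof -
  have u: "u \<in> carrier TT.T" and uv: "\<And>a a'. a \<in> carrier A \<Longrightarrow> a' \<in> carrier A \<Longrightarrow> ev a a' u = \<alpha> (a \<otimes> a')"
    using assms(2) by (auto simp: comult_spec_def)
  note b1 = ev_AA_balanced [OF u] and b2 = mult_AA_balanced [OF assms(1)]
  note G = abelian_group_axioms
  have "tensor_lift A (\<lambda>a a'. ev a a' u) w = tensor_lift A (\<lambda>a a'. \<alpha> (a \<otimes> a')) w"
    if w: "w \<in> carrier AA.T" for w
    by (rule AA.additive_eq [OF G w AA.lift_closed [OF G b1] AA.lift_add [OF G b1]
          AA.lift_closed [OF G b2] AA.lift_add [OF G b2]])
      (use AA.lift_pure [OF G b1] AA.lift_pure [OF G b2] uv in auto)
  then show ?thesis unfolding endo_tensor_map_eq by (intro restrict_ext) auto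
qed

lemma endo_comult_eqI:
  assumes "\<alpha> \<in> carrier L" "comult_spec \<alpha> u" shows "endo_comult A D \<alpha> = u"
proof -
  let ?E = "endo_bimod A D"
  have "tensor_rels (A\<lparr>carrier := V\<rparr>) ?E ?E = tensor_rels VA M M"
    by (rule tensor_rels_cong) (auto simp: endo_bimod_def lact_M ract_M)
  then have c: "carrier (tensor (A\<lparr>carrier := V\<rparr>) ?E ?E) = carrier TT.T"
    by (rule tensor_carrier_cong) (auto simp: endo_bimod_def)
  have u: "u \<in> carrier TT.T" using assms(2) by (simp add: comult_spec_def)
  have "endo_comult A D \<alpha> = inv_into (carrier TT.T) (endo_tensor_map A D) (endo_tensor_map A D u)"
    using assms(1) by (simp add: endo_comult_def c endo_tensor_map_spec [OF assms])
  also have "\<dots> = u" by (rule inv_into_f_f [OF endo_tensor_map_inj u])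
  finally show ?thesis .
qed

text \<open>The product \<open>v (a a') w\<close> factors as \<open>(v a) (a' w)\<close>.\<close>

lemma comult_spec_lr:
  assumes "v \<in> V" "w \<in> V" shows "comult_spec (lr v w) (TT.pure (lr v \<one>) (lr \<one> w))"
  unfolding comult_spec_def
  using assms V_carrier by (auto simp: pure_closed lr_closed V_one ev_pure m_assoc)

lemma comult_spec_add:
  assumes "comult_spec \<alpha> u" "comult_spec \<beta> v"
  shows "comult_spec (\<alpha> \<oplus>\<^bsub>L\<^esub> \<beta>) (u \<oplus>\<^bsub>TT.T\<^esub> v)"
  using assms by (auto simp: comult_spec_def ev_add)

lemma comult_spec_ex: "\<alpha> \<in> carrier L \<Longrightarrow> \<exists>u. comult_spec \<alpha> u"
proof (induction \<alpha> rule: L_induct)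
  case zero
  have "comult_spec \<zero>\<^bsub>L\<^esub> \<zero>\<^bsub>TT.T\<^esub>" unfolding comult_spec_def
  proof (intro conjI ballI)
    fix a a' assume a: "a \<in> carrier A" "a' \<in> carrier A"
    show "ev a a' \<zero>\<^bsub>TT.T\<^esub> = \<zero>\<^bsub>L\<^esub> (a \<otimes> a')"
      using TT.T.additive_zero [OF TT.T.carrier_additive_subgroup abelian_group_axioms, of "ev a a'"] a
        ev_closed ev_add by auto
  qed simp
  then show ?case by blast
qed (use comult_spec_lr comult_spec_add in blast)+

abbreviation "cm \<equiv> endo_comult A D"

lemma comult_spec: "\<alpha> \<in> carrier L \<Longrightarrow> comult_spec \<alpha> (cm \<alpha>)"
  using comult_spec_ex endo_comult_eqI by metis

lemma comult_closed: "\<alpha> \<in> carrier L \<Longrightarrow> cm \<alpha> \<in> carrier TT.T"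
  using comult_spec by (simp add: comult_spec_def)

lemma ev_comult: "\<alpha> \<in> carrier L \<Longrightarrow> a \<in> carrier A \<Longrightarrow> a' \<in> carrier A \<Longrightarrow> ev a a' (cm \<alpha>) = \<alpha> (a \<otimes> a')"
  using comult_spec by (simp add: comult_spec_def)

lemma comult_lr: "v \<in> V \<Longrightarrow> w \<in> V \<Longrightarrow> cm (lr v w) = TT.pure (lr v \<one>) (lr \<one> w)"
  by (intro endo_comult_eqI lr_closed comult_spec_lr)

lemma comult_add: "\<alpha> \<in> carrier L \<Longrightarrow> \<beta> \<in> carrier L \<Longrightarrow> cm (\<alpha> \<oplus>\<^bsub>L\<^esub> \<beta>) = cm \<alpha> \<oplus>\<^bsub>TT.T\<^esub> cm \<beta>"
  by (intro endo_comult_eqI L_add_closed comult_spec_add comult_spec)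

lemma comult_lact: "r \<in> V \<Longrightarrow> \<alpha> \<in> carrier L \<Longrightarrow> cm (lact M r \<alpha>) = lact TT.T r (cm \<alpha>)"
  using bimodule.lact_closed [OF TT.tensor_bimodule, of r "cm \<alpha>"]
  by (intro endo_comult_eqI) (auto simp: lact_closed comult_spec_def comult_closed ev_lact ev_comult)

lemma comult_ract: "r \<in> V \<Longrightarrow> \<alpha> \<in> carrier L \<Longrightarrow> cm (ract M \<alpha> r) = ract TT.T (cm \<alpha>) r"
  using bimodule.ract_closed [OF TT.tensor_bimodule, of r "cm \<alpha>"]
  by (intro endo_comult_eqI) (auto simp: ract_closed comult_spec_def comult_closed ev_ract ev_comult)

text \<open>Both sides are evaluated at a pair \<open>p\<close>, \<open>q\<close>. After the order
  of summation is exchanged, the sum over \<open>u\<close> gives \<open>\<alpha>\<close> at the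
  product of \<open>x' p\<close> and \<open>y' q\<close>, and then the sum over \<open>v\<close>
  gives \<open>\<alpha>(\<beta>(p q))\<close>. Arbitrary representatives are admissible because
  evaluation depends only on the cosets.\<close>

lemma comult_mult:
  assumes \<alpha>: "\<alpha> \<in> carrier L" and \<beta>: "\<beta> \<in> carrier L" and u: "u \<in> cm \<alpha>" and v: "v \<in> cm \<beta>"
  shows "cm (\<alpha> \<otimes>\<^bsub>L\<^esub> \<beta>) = formal_eval TT.T (\<lambda>(x, y). formal_eval TT.T
          (\<lambda>(x', y'). TT.pure (x \<otimes>\<^bsub>L\<^esub> x') (y \<otimes>\<^bsub>L\<^esub> y')) v) u"
proof (rule endo_comult_eqI [OF L_mult_closed [OF \<alpha> \<beta>]])
  let ?S = "carrier L \<times> carrier L"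
  note G = abelian_group_axioms
  have eb: "balanced VA M M A (\<lambda>\<alpha> \<beta>. \<alpha> \<one> \<otimes> \<beta> \<one>)" by (rule ev_balanced) auto
  have ku: "Poly_Mapping.keys u \<subseteq> ?S" and kv: "Poly_Mapping.keys v \<subseteq> ?S"
    using TT.lift_rep(2)[OF G eb comult_closed [OF \<alpha>] u] TT.lift_rep(2)[OF G eb comult_closed [OF \<beta>] v] by auto
  let ?f = "\<lambda>i j. TT.pure (fst i \<otimes>\<^bsub>L\<^esub> fst j) (snd i \<otimes>\<^bsub>L\<^esub> snd j)"
  let ?F = "\<lambda>i. formal_eval TT.T (?f i) v"
  have fc: "?f i \<in> ?S \<rightarrow> carrier TT.T" if "i \<in> ?S" for i
    using that by (auto simp: pure_closed L_mult_closed)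
  have Fc: "?F \<in> ?S \<rightarrow> carrier TT.T"
    using TT.T.formal_eval_closed [OF kv fc] by blast
  have eq: "formal_eval TT.T (\<lambda>(x, y). formal_eval TT.T
          (\<lambda>(x', y'). TT.pure (x \<otimes>\<^bsub>L\<^esub> x') (y \<otimes>\<^bsub>L\<^esub> y')) v) u = formal_eval TT.T ?F u"
    by (simp add: case_prod_unfold)
  have "ev p q (formal_eval TT.T ?F u) = \<alpha> (\<beta> (p \<otimes> q))" if p: "p \<in> carrier A" and q: "q \<in> carrier A" for p q
  proof -
    have "ev p q (formal_eval TT.T ?F u) = formal_eval A (\<lambda>i. ev p q (?F i)) u"
      by (rule TT.T.formal_eval_hom [OF G _ _ ku Fc]) (use p q ev_closed ev_add in auto)
    also have "\<dots> = formal_eval A (\<lambda>i. formal_eval A (\<lambda>j. fst i (fst j p) \<otimes> snd i (snd j q)) v) u"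
    proof (rule formal_eval_cong [OF ku])
      show "(\<lambda>i. formal_eval A (\<lambda>j. fst i (fst j p) \<otimes> snd i (snd j q)) v) \<in> ?S \<rightarrow> carrier A"
        by (intro Pi_I formal_eval_closed [OF kv]) (use p q in auto)
      fix i assume i: "i \<in> ?S"
      have "ev p q (?F i) = formal_eval A (\<lambda>j. ev p q (?f i j)) v"
        by (rule TT.T.formal_eval_hom [OF G _ _ kv fc [OF i]]) (use p q ev_closed ev_add in auto)
      also have "\<dots> = formal_eval A (\<lambda>j. fst i (fst j p) \<otimes> snd i (snd j q)) v"
        by (rule formal_eval_cong [OF kv]) (use i p q in \<open>auto simp: ev_pure L_mult_closed\<close>)
      finally show "ev p q (?F i) = formal_eval A (\<lambda>j. fst i (fst j p) \<otimes> snd i (snd j q)) v" .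
    qed
    also have "\<dots> = formal_eval A (\<lambda>j. formal_eval A (\<lambda>i. fst i (fst j p) \<otimes> snd i (snd j q)) u) v"
      by (rule formal_eval_swap [OF ku kv]) (use p q in auto)
    also have "\<dots> = formal_eval A (\<lambda>j. \<alpha> (fst j p \<otimes> snd j q)) v"
    proof (rule formal_eval_cong [OF kv])
      fix j assume j: "j \<in> ?S"
      have c: "fst j p \<in> carrier A" "snd j q \<in> carrier A" using j p q by auto
      have "formal_eval A (\<lambda>i. fst i (fst j p) \<otimes> snd i (snd j q)) u = ev (fst j p) (snd j q) (cm \<alpha>)"
        using TT.lift_rep(1)[OF G ev_balanced [OF c] comult_closed [OF \<alpha>] u]
        by (simp add: ev_def case_prod_unfold)
      then show "formal_eval A (\<lambda>i. fst i (fst j p) \<otimes> snd i (snd j q)) u = \<alpha> (fst j p \<otimes> snd j q)"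
        using ev_comult [OF \<alpha> c] by simp
    qed (use p q \<alpha> in auto)
    also have "\<dots> = \<alpha> (formal_eval A (\<lambda>j. fst j p \<otimes> snd j q) v)"
      by (rule formal_eval_hom [OF G _ _ kv, symmetric]) (use p q \<alpha> L_additive in auto)
    also have "formal_eval A (\<lambda>j. fst j p \<otimes> snd j q) v = ev p q (cm \<beta>)"
      using TT.lift_rep(1)[OF G ev_balanced [OF p q] comult_closed [OF \<beta>] v]
      by (simp add: ev_def case_prod_unfold)
    also have "\<dots> = \<beta> (p \<otimes> q)" by (rule ev_comult [OF \<beta> p q])
    finally show ?thesis .
  qed
  moreover have "formal_eval TT.T ?F u \<in> carrier TT.T" by (rule TT.T.formal_eval_closed [OF ku Fc])
  ultimately show "comult_spec (\<alpha> \<otimes>\<^bsub>L\<^esub> \<beta>) (formal_eval TT.T (\<lambda>(x, y). formal_eval TT.T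
          (\<lambda>(x', y'). TT.pure (x \<otimes>\<^bsub>L\<^esub> x') (y \<otimes>\<^bsub>L\<^esub> y')) v) u)"
    unfolding eq comult_spec_def using \<beta> by simp
qed

section \<open>The isomorphism with \<open>V \<otimes>\<^sub>Z V\<close> and the antipode\<close>

abbreviation "MV \<equiv> module_bimod VA"

lemma MV_simps [simp]:
  "carrier MV = V" "ring.add MV = ring.add A" "lact MV z x = z \<otimes> x" "ract MV x z = z \<otimes> x"
  by (simp_all add: module_bimod_def)

lemma V_balancedI:
  assumes "\<And>v w. v \<in> V \<Longrightarrow> w \<in> V \<Longrightarrow> f v w \<in> carrier P"
    "\<And>v v' w. v \<in> V \<Longrightarrow> v' \<in> V \<Longrightarrow> w \<in> V \<Longrightarrow> f (v \<oplus> v') w = f v w \<oplus>\<^bsub>P\<^esub> f v' w"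
    "\<And>v w w'. v \<in> V \<Longrightarrow> w \<in> V \<Longrightarrow> w' \<in> V \<Longrightarrow> f v (w \<oplus> w') = f v w \<oplus>\<^bsub>P\<^esub> f v w'"
    "\<And>v w z. v \<in> V \<Longrightarrow> w \<in> V \<Longrightarrow> z \<in> Z \<Longrightarrow> f (z \<otimes> v) w = f v (z \<otimes> w)"
  shows "balanced K MV MV P f"
  by (rule balancedI) (use assms in auto)

lemma lr_balanced: "balanced K MV MV L (\<lambda>r r'. compose (carrier A) (left_mult A r) (right_mult A r'))"
proof (rule V_balancedI)
  fix v w z assume v: "v \<in> V" and w: "w \<in> V" and z: "z \<in> Z"
  have zV: "z \<in> V" "z \<in> carrier A" using z Z_V by auto
  have "lr (z \<otimes> v) w = lr v (z \<otimes> w)"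
  proof (rule L_eqI)
    fix a assume "a \<in> carrier A"
    then show "lr (z \<otimes> v) w a = lr v (z \<otimes> w) a"
      using center_move [OF z, of v a w] v w V_carrier by simp
  qed (use v w zV V_mult lr_closed in auto)
  then show "compose (carrier A) (left_mult A (z \<otimes> v)) (right_mult A w) =
      compose (carrier A) (left_mult A v) (right_mult A (z \<otimes> w))"
    using v w zV by (simp add: lr_compose V_mult)
next
  fix v v' w assume v: "v \<in> V" "v' \<in> V" and w: "w \<in> V"
  have "lr (v \<oplus> v') w = lr v w \<oplus>\<^bsub>L\<^esub> lr v' w"
    by (rule L_eqI) (use v w V_add lr_closed L_add_closed in \<open>simp_all add: V_carrier l_distr\<close>)
  then show "compose (carrier A) (left_mult A (v \<oplus> v')) (right_mult A w) =
     compose (carrier A) (left_mult A v) (right_mult A w) \<oplus>\<^bsub>L\<^esub> compose (carrier A) (left_mult A v') (right_mult A w)"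
    using v w by (simp add: lr_compose V_add)
next
  fix v w w' assume v: "v \<in> V" and w: "w \<in> V" "w' \<in> V"
  have "lr v (w \<oplus> w') = lr v w \<oplus>\<^bsub>L\<^esub> lr v w'"
    by (rule L_eqI) (use v w V_add lr_closed L_add_closed in \<open>simp_all add: V_carrier r_distr\<close>)
  then show "compose (carrier A) (left_mult A v) (right_mult A (w \<oplus> w')) =
     compose (carrier A) (left_mult A v) (right_mult A w) \<oplus>\<^bsub>L\<^esub> compose (carrier A) (left_mult A v) (right_mult A w')"
    using v w by (simp add: lr_compose V_add)
qed (simp add: lr_compose lr_closed)

lemma mult_map_closed: "u \<in> carrier TV.T \<Longrightarrow> mult_map A D u \<in> carrier L"
  unfolding mult_map_def by (rule TV.lift_closed [OF L_abelian lr_balanced])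

lemma mult_map_add: "u \<in> carrier TV.T \<Longrightarrow> u' \<in> carrier TV.T \<Longrightarrow>
  mult_map A D (u \<oplus>\<^bsub>TV.T\<^esub> u') = mult_map A D u \<oplus>\<^bsub>L\<^esub> mult_map A D u'"
  unfolding mult_map_def by (rule TV.lift_add [OF L_abelian lr_balanced])

lemma mult_map_pure: "v \<in> V \<Longrightarrow> w \<in> V \<Longrightarrow> mult_map A D (TV.pure v w) = lr v w"
  unfolding mult_map_def using TV.lift_pure [OF L_abelian lr_balanced, of v w] by (simp add: lr_compose)

lemma TV_pure_closed: "v \<in> V \<Longrightarrow> w \<in> V \<Longrightarrow> TV.pure v w \<in> carrier TV.T"
  using TV.pure_closed by simp

text \<open>Faithfulness of the sandwich action, this time with both coefficient spaces equal to
  \<open>V\<close>.\<close>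

lemma mult_map_zero_imp:
  assumes u: "u \<in> carrier TV.T" and z: "mult_map A D u = \<zero>\<^bsub>L\<^esub>" shows "u = \<zero>\<^bsub>TV.T\<^esub>"
proof -
  obtain I :: "nat set" and h where I: "finite I" "u = (\<Oplus>\<^bsub>TV.T\<^esub>i\<in>I. h i)"
    and h: "h \<in> I \<rightarrow> {TV.pure x y | x y. x \<in> carrier MV \<and> y \<in> carrier MV}"
    using TV.tensor_span [OF u] unfolding TV.T.fin_sums_def by blast
  have "\<forall>i\<in>I. \<exists>p. fst p \<in> V \<and> snd p \<in> V \<and> h i = TV.pure (fst p) (snd p)"
    using h by (fastforce simp: Pi_def)
  then obtain p where p: "\<forall>i\<in>I. fst (p i) \<in> V \<and> snd (p i) \<in> V \<and> h i = TV.pure (fst (p i)) (snd (p i))"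
    by (rule bchoice [THEN exE])
  define x where "x i = fst (p i)" for i
  define y where "y i = snd (p i)" for i
  have xy: "\<And>i. i \<in> I \<Longrightarrow> x i \<in> V" "\<And>i. i \<in> I \<Longrightarrow> y i \<in> V"
    "\<And>i. i \<in> I \<Longrightarrow> h i = TV.pure (x i) (y i)" using p by (auto simp: x_def y_def)
  have hc: "\<And>i. i \<in> I \<Longrightarrow> h i \<in> carrier TV.T" using xy TV_pure_closed by simp
  have VAab: "abelian_group VA" using VA_module by (simp add: module_def)
  interpret VAg: abelian_group VA by (rule VAab)
  interpret G: central_balanced A V VA "\<lambda>z n. z \<otimes> n" TV.T TV.pure
    by unfold_locales
      (use V_central_subspace Z_V V_mult TV_pure_closed TV.pure_add_left TV.pure_add_right TV.pure_balanced in auto)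
  have "(\<Oplus>\<^bsub>TV.T\<^esub>i\<in>I. TV.pure (x i) (y i)) = \<zero>\<^bsub>TV.T\<^esub>"
  proof (rule G.tensor_zero_of_map_zero [OF I(1), where T = "{()}" and e = "\<lambda>_ n. n"])
    fix a assume a: "a \<in> carrier A"
    have "mult_map A D u = (\<Oplus>\<^bsub>L\<^esub>i\<in>I. mult_map A D (h i))" unfolding I(2)
      by (rule TV.T.additive_finsum [OF TV.T.carrier_additive_subgroup L_abelian])
        (use I(1) hc mult_map_closed mult_map_add in auto)
    then have "(\<Oplus>\<^bsub>L\<^esub>i\<in>I. mult_map A D (h i)) = \<zero>\<^bsub>L\<^esub>" using z by (simp only:)
    then have "(\<Oplus>\<^bsub>L\<^esub>i\<in>I. mult_map A D (h i)) a = \<zero>" using a by simp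
    then have "(\<Oplus>i\<in>I. mult_map A D (h i) a) = \<zero>"
      using finsum_app [OF I(1) _ a, of "\<lambda>i. mult_map A D (h i)"] hc mult_map_closed by simp
    moreover have "(\<Oplus>i\<in>I. mult_map A D (h i) a) = (\<Oplus>i\<in>I. x i \<otimes> a \<otimes> y i)"
      by (rule finsum_cong') (use xy a V_carrier in \<open>auto simp: mult_map_pure\<close>)
    ultimately show "(\<Oplus>i\<in>I. x i \<otimes> a \<otimes> y i) = \<zero>" by simp
  qed (use xy V_carrier in auto)
  moreover have "u = (\<Oplus>\<^bsub>TV.T\<^esub>i\<in>I. TV.pure (x i) (y i))"
    unfolding I(2) by (rule TV.T.finsum_cong') (use xy hc in auto)
  ultimately show ?thesis by simp
qed

lemma mult_map_inj: "inj_on (mult_map A D) (carrier TV.T)"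
proof (rule inj_onI)
  fix u v assume u: "u \<in> carrier TV.T" and v: "v \<in> carrier TV.T" and eq: "mult_map A D u = mult_map A D v"
  define w where "w = u \<oplus>\<^bsub>TV.T\<^esub> \<ominus>\<^bsub>TV.T\<^esub> v"
  have w: "w \<in> carrier TV.T" "u = w \<oplus>\<^bsub>TV.T\<^esub> v" using u v by (auto simp: w_def TV.T.a_assoc TV.T.l_neg)
  have c: "mult_map A D w \<in> carrier L" "mult_map A D v \<in> carrier L" using mult_map_closed w v by auto
  have "mult_map A D w \<oplus>\<^bsub>L\<^esub> mult_map A D v = mult_map A D v"
    using mult_map_add [OF w(1) v] w(2) eq by simp
  then have "mult_map A D w = \<zero>\<^bsub>L\<^esub>" using c by (simp add: L.add.l_cancel_one')
  then have "w = \<zero>\<^bsub>TV.T\<^esub>" using mult_map_zero_imp w(1) by blast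
  then show "u = v" using w(2) v by simp
qed

lemma mult_map_surj: "\<alpha> \<in> carrier L \<Longrightarrow> \<alpha> \<in> mult_map A D ` carrier TV.T"
proof (induction \<alpha> rule: L_induct)
  case zero
  have "mult_map A D \<zero>\<^bsub>TV.T\<^esub> = \<zero>\<^bsub>L\<^esub>"
    by (rule TV.T.additive_zero [OF TV.T.carrier_additive_subgroup L_abelian])
      (use mult_map_closed mult_map_add in auto)
  then show ?case by (intro image_eqI [OF _ TV.T.zero_closed]) simp
next
  case (lr v w)
  then show ?case
    by (intro image_eqI [where x = "TV.pure v w"]) (simp_all add: mult_map_pure TV_pure_closed)
next
  case (add \<alpha> \<beta>)
  then obtain u v where "u \<in> carrier TV.T" "v \<in> carrier TV.T" "\<alpha> = mult_map A D u" "\<beta> = mult_map A D v" by blast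
  then show ?case
    by (intro image_eqI [where x = "u \<oplus>\<^bsub>TV.T\<^esub> v"]) (simp_all add: mult_map_add)
qed

abbreviation "mm_inv \<equiv> inv_into (carrier TV.T) (mult_map A D)"

lemma mm_inv_closed: "\<alpha> \<in> carrier L \<Longrightarrow> mm_inv \<alpha> \<in> carrier TV.T"
  using mult_map_surj by (rule inv_into_into)

lemma mm_inv_lr: "v \<in> V \<Longrightarrow> w \<in> V \<Longrightarrow> mm_inv (lr v w) = TV.pure v w"
  using inv_into_f_f [OF mult_map_inj TV_pure_closed, of v w] by (simp add: mult_map_pure)

lemma mm_inv_add:
  assumes "\<alpha> \<in> carrier L" "\<beta> \<in> carrier L" shows "mm_inv (\<alpha> \<oplus>\<^bsub>L\<^esub> \<beta>) = mm_inv \<alpha> \<oplus>\<^bsub>TV.T\<^esub> mm_inv \<beta>"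
proof (rule inv_into_f_eq [OF mult_map_inj])
  show "mult_map A D (mm_inv \<alpha> \<oplus>\<^bsub>TV.T\<^esub> mm_inv \<beta>) = \<alpha> \<oplus>\<^bsub>L\<^esub> \<beta>"
    using assms by (simp add: mult_map_add mm_inv_closed f_inv_into_f [OF mult_map_surj])
qed (use assms mm_inv_closed in auto)

text \<open>Universal property of \<open>L\<close> as a copy of \<open>V \<otimes>_Z V\<close>: a
  balanced map on \<open>V \<times> V\<close> becomes an additive map on \<open>L\<close>. The
  antipode and the section \<open>eta\<close> arise in this way.\<close>

definition L_lift :: "('t, 'z) ring_scheme \<Rightarrow> ('a \<Rightarrow> 'a \<Rightarrow> 't) \<Rightarrow> ('a \<Rightarrow> 'a) \<Rightarrow> 't" where
  "L_lift P g \<alpha> = tensor_lift P g (mm_inv \<alpha>)"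

lemma L_lift:
  assumes "abelian_group P" "balanced K MV MV P g"
  shows L_lift_closed: "\<alpha> \<in> carrier L \<Longrightarrow> L_lift P g \<alpha> \<in> carrier P"
    and L_lift_add: "\<alpha> \<in> carrier L \<Longrightarrow> \<beta> \<in> carrier L \<Longrightarrow> L_lift P g (\<alpha> \<oplus>\<^bsub>L\<^esub> \<beta>) = L_lift P g \<alpha> \<oplus>\<^bsub>P\<^esub> L_lift P g \<beta>"
    and L_lift_lr: "v \<in> V \<Longrightarrow> w \<in> V \<Longrightarrow> L_lift P g (lr v w) = g v w"
  unfolding L_lift_def using assms
  by (simp_all add: mm_inv_closed mm_inv_add mm_inv_lr TV.lift_closed TV.lift_add TV.lift_pure)

abbreviation "\<tau> \<equiv> endo_antipode A D"

lemma flip_balanced: "balanced K MV MV TV.T (\<lambda>r r'. TV.pure r' r)"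
  using TV.pure_add_left TV.pure_add_right TV.pure_balanced TV_pure_closed
  by (intro V_balancedI) (auto simp: Z_V V_mult)

lemma antipode_eq: "\<alpha> \<in> carrier L \<Longrightarrow> \<tau> \<alpha> = mult_map A D (L_lift TV.T (\<lambda>r r'. TV.pure r' r) \<alpha>)"
  by (simp add: endo_antipode_def Let_def L_lift_def ground_tensor_def)

lemma antipode_closed: "\<alpha> \<in> carrier L \<Longrightarrow> \<tau> \<alpha> \<in> carrier L"
  by (simp add: antipode_eq mult_map_closed L_lift_closed [OF TV.T_abelian flip_balanced])

lemma antipode_add: "\<alpha> \<in> carrier L \<Longrightarrow> \<beta> \<in> carrier L \<Longrightarrow> \<tau> (\<alpha> \<oplus>\<^bsub>L\<^esub> \<beta>) = \<tau> \<alpha> \<oplus>\<^bsub>L\<^esub> \<tau> \<beta>"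
  by (simp add: antipode_eq L_add_closed mult_map_add L_lift_closed [OF TV.T_abelian flip_balanced]
      L_lift_add [OF TV.T_abelian flip_balanced])

lemma antipode_lr: "v \<in> V \<Longrightarrow> w \<in> V \<Longrightarrow> \<tau> (lr v w) = lr w v"
  by (simp add: antipode_eq lr_closed L_lift_lr [OF TV.T_abelian flip_balanced] mult_map_pure)

end

context endo_hopf begin

lemma K_simps [simp]: "carrier K = Z" by simp

lemma source_target:
  "v \<in> V \<Longrightarrow> source H v = lr v \<one>" "v \<in> V \<Longrightarrow> target H v = lr \<one> v"
  by (simp_all add: source_eq target_eq)

section \<open>The axioms of a left bialgebroid\<close>

lemma counit_balanced:
  "balanced VA M M L (\<lambda>x y. lact M (counit H x) y)" "balanced VA M M L (\<lambda>x y. ract M x (counit H y))"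
proof -
  have val: "\<alpha> \<one> \<in> V" if \<alpha>: "\<alpha> \<in> carrier L" for \<alpha>
  proof (rule centralizerI)
    fix d assume d: "d \<in> D"
    then have dc: "d \<in> carrier A" using D_carrier by blast
    have "\<alpha> \<one> \<otimes> d = \<alpha> (\<one> \<otimes> d)" using L_right [OF \<alpha> d] by simp
    also have "\<dots> = \<alpha> (d \<otimes> \<one>)" using dc by simp
    finally show "\<alpha> \<one> \<otimes> d = d \<otimes> \<alpha> \<one>" using L_left [OF \<alpha> d] by simp
  qed (use \<alpha> in simp)
  show "balanced VA M M L (\<lambda>x y. lact M (counit H x) y)"
  proof (rule M_balancedI)
    fix \<alpha> \<alpha>' \<beta> assume c: "\<alpha> \<in> carrier L" "\<alpha>' \<in> carrier L" "\<beta> \<in> carrier L"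
    show "lact M (counit H (\<alpha> \<oplus>\<^bsub>L\<^esub> \<alpha>')) \<beta> = lact M (counit H \<alpha>) \<beta> \<oplus>\<^bsub>L\<^esub> lact M (counit H \<alpha>') \<beta>"
      by (rule L_eqI) (use c val V_add in \<open>simp_all add: L_add_closed lact_closed l_distr\<close>)
    show "lact M (counit H \<beta>) (\<alpha> \<oplus>\<^bsub>L\<^esub> \<alpha>') = lact M (counit H \<beta>) \<alpha> \<oplus>\<^bsub>L\<^esub> lact M (counit H \<beta>) \<alpha>'"
      by (rule L_eqI) (use c val in \<open>simp_all add: L_add_closed lact_closed r_distr\<close>)
  next
    fix \<alpha> \<beta> r assume c: "\<alpha> \<in> carrier L" "\<beta> \<in> carrier L" "r \<in> V"
    then show "lact M (counit H (ract M \<alpha> r)) \<beta> = lact M (counit H \<alpha>) (lact M r \<beta>)"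
      by (intro L_eqI) (use c val V_mult V_carrier in \<open>simp_all add: lact_closed ract_closed m_assoc\<close>)
  qed (use val in \<open>simp add: lact_closed\<close>)
  show "balanced VA M M L (\<lambda>x y. ract M x (counit H y))"
  proof (rule M_balancedI)
    fix \<alpha> \<alpha>' \<beta> assume c: "\<alpha> \<in> carrier L" "\<alpha>' \<in> carrier L" "\<beta> \<in> carrier L"
    show "ract M \<beta> (counit H (\<alpha> \<oplus>\<^bsub>L\<^esub> \<alpha>')) = ract M \<beta> (counit H \<alpha>) \<oplus>\<^bsub>L\<^esub> ract M \<beta> (counit H \<alpha>')"
      by (rule L_eqI) (use c val V_add in \<open>simp_all add: L_add_closed ract_closed r_distr\<close>)
    show "ract M (\<alpha> \<oplus>\<^bsub>L\<^esub> \<alpha>') (counit H \<beta>) = ract M \<alpha> (counit H \<beta>) \<oplus>\<^bsub>L\<^esub> ract M \<alpha>' (counit H \<beta>)"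
      by (rule L_eqI) (use c val in \<open>simp_all add: L_add_closed ract_closed l_distr\<close>)
  next
    fix \<alpha> \<beta> r assume c: "\<alpha> \<in> carrier L" "\<beta> \<in> carrier L" "r \<in> V"
    then show "ract M (ract M \<alpha> r) (counit H \<beta>) = ract M \<alpha> (counit H (lact M r \<beta>))"
      by (intro L_eqI) (use c val V_mult V_carrier in \<open>simp_all add: lact_closed ract_closed m_assoc\<close>)
  qed (use val in \<open>simp add: ract_closed\<close>)
qed

lemma counit_value: "\<alpha> \<in> carrier L \<Longrightarrow> \<alpha> \<one> \<in> V"
proof (rule centralizerI)
  fix d assume \<alpha>: "\<alpha> \<in> carrier L" and d: "d \<in> D"
  then have dc: "d \<in> carrier A" using D_carrier by blast
  have "\<alpha> \<one> \<otimes> d = \<alpha> (\<one> \<otimes> d)" using L_right [OF \<alpha> d] by simp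
  also have "\<dots> = \<alpha> (d \<otimes> \<one>)" using dc by simp
  finally show "\<alpha> \<one> \<otimes> d = d \<otimes> \<alpha> \<one>" using L_left [OF \<alpha> d] by simp
qed simp

text \<open>The form in which an axiom containing the coproduct is checked: on generators the
  coproduct is the single pure tensor of \<open>lr v \<one>\<close> and
  \<open>lr \<one> w\<close>.\<close>

lemma lift_comult_eq:
  assumes G: "abelian_group G" and f: "balanced VA M M G f"
    and h: "\<And>\<alpha>. \<alpha> \<in> carrier L \<Longrightarrow> h \<alpha> \<in> carrier G"
      "\<And>\<alpha> \<beta>. \<alpha> \<in> carrier L \<Longrightarrow> \<beta> \<in> carrier L \<Longrightarrow> h (\<alpha> \<oplus>\<^bsub>L\<^esub> \<beta>) = h \<alpha> \<oplus>\<^bsub>G\<^esub> h \<beta>"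
    and eq: "\<And>v w. v \<in> V \<Longrightarrow> w \<in> V \<Longrightarrow> f (lr v \<one>) (lr \<one> w) = h (lr v w)"
    and \<alpha>: "\<alpha> \<in> carrier L"
  shows "tensor_lift G f (cm \<alpha>) = h \<alpha>"
proof (rule L_additive_eq [OF G \<alpha>, where h = "\<lambda>\<alpha>. tensor_lift G f (cm \<alpha>)"])
  show "tensor_lift G f (cm u) \<in> carrier G" if "u \<in> carrier L" for u
    by (rule TT.lift_closed [OF G f comult_closed [OF that]])
  show "tensor_lift G f (cm (u \<oplus>\<^bsub>L\<^esub> v)) = tensor_lift G f (cm u) \<oplus>\<^bsub>G\<^esub> tensor_lift G f (cm v)"
    if "u \<in> carrier L" "v \<in> carrier L" for u v
    using that by (simp add: comult_add TT.lift_add [OF G f comult_closed comult_closed])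
  show "tensor_lift G f (cm (lr v w)) = h (lr v w)" if "v \<in> V" "w \<in> V" for v w
    using that TT.lift_pure [OF G f, of "lr v \<one>" "lr \<one> w"] eq by (simp add: comult_lr lr_closed V_one)
qed (use h in auto)

lemma lift_counit_left:
  assumes "a \<in> carrier L"
  shows "tensor_lift L (\<lambda>x y. lact M (counit H x) y) (cm a) = a"
  by (rule lift_comult_eq [OF L_abelian counit_balanced(1) _ _ _ assms])
    (auto simp: lr_closed V_one V_carrier lr_lact [symmetric])

lemma lift_counit_right:
  assumes "a \<in> carrier L"
  shows "tensor_lift L (\<lambda>x y. ract M x (counit H y)) (cm a) = a"
  by (rule lift_comult_eq [OF L_abelian counit_balanced(2) _ _ _ assms])
    (auto simp: lr_closed V_one V_carrier lr_ract [symmetric])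

lemma takeuchi_balanced:
  assumes r: "r \<in> V"
  shows "balanced VA M M TT.T (\<lambda>x y. TT.pure (x \<otimes>\<^bsub>L\<^esub> lr \<one> r) y)"
    "balanced VA M M TT.T (\<lambda>x y. TT.pure x (y \<otimes>\<^bsub>L\<^esub> lr r \<one>))"
proof -
  have c: "lr \<one> r \<in> carrier L" "lr r \<one> \<in> carrier L" using r by (auto simp: lr_closed V_one)
  have a: "ract M \<alpha> s \<otimes>\<^bsub>L\<^esub> lr \<one> r = ract M (\<alpha> \<otimes>\<^bsub>L\<^esub> lr \<one> r) s" if "\<alpha> \<in> carrier L" "s \<in> V" for \<alpha> s
    using that c by (simp add: ract_M_mult L.m_assoc lr_closed V_one)
  have b: "lact M s \<alpha> \<otimes>\<^bsub>L\<^esub> lr r \<one> = lact M s (\<alpha> \<otimes>\<^bsub>L\<^esub> lr r \<one>)" if "\<alpha> \<in> carrier L" "s \<in> V" for \<alpha> s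
    using that c by (simp add: lact_M_mult L.m_assoc lr_closed V_one)
  show "balanced VA M M TT.T (\<lambda>x y. TT.pure (x \<otimes>\<^bsub>L\<^esub> lr \<one> r) y)"
    by (rule M_balancedI) (use c in \<open>simp_all add: pure_closed pure_add_left pure_add_right L.l_distr a pure_balanced\<close>)
  show "balanced VA M M TT.T (\<lambda>x y. TT.pure x (y \<otimes>\<^bsub>L\<^esub> lr r \<one>))"
    by (rule M_balancedI) (use c in \<open>simp_all add: pure_closed pure_add_left pure_add_right L.l_distr b pure_balanced\<close>)
qed

lemma takeuchi_eq:
  assumes "a \<in> carrier L" "r \<in> V"
  shows "tensor_lift TT.T (\<lambda>x y. TT.pure (x \<otimes>\<^bsub>L\<^esub> lr \<one> r) y) (cm a) =
    tensor_lift TT.T (\<lambda>x y. TT.pure x (y \<otimes>\<^bsub>L\<^esub> lr r \<one>)) (cm a)"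
proof (rule lift_comult_eq [OF TT.T_abelian takeuchi_balanced(1)[OF assms(2)] _ _ _ assms(1)])
  note b = takeuchi_balanced(2)[OF assms(2)]
  show "tensor_lift TT.T (\<lambda>x y. TT.pure x (y \<otimes>\<^bsub>L\<^esub> lr r \<one>)) (cm \<alpha>) \<in> carrier TT.T" if "\<alpha> \<in> carrier L" for \<alpha>
    by (rule TT.lift_closed [OF TT.T_abelian b comult_closed [OF that]])
  show "tensor_lift TT.T (\<lambda>x y. TT.pure x (y \<otimes>\<^bsub>L\<^esub> lr r \<one>)) (cm (\<alpha> \<oplus>\<^bsub>L\<^esub> \<beta>)) =
      tensor_lift TT.T (\<lambda>x y. TT.pure x (y \<otimes>\<^bsub>L\<^esub> lr r \<one>)) (cm \<alpha>) \<oplus>\<^bsub>TT.T\<^esub>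
      tensor_lift TT.T (\<lambda>x y. TT.pure x (y \<otimes>\<^bsub>L\<^esub> lr r \<one>)) (cm \<beta>)" if "\<alpha> \<in> carrier L" "\<beta> \<in> carrier L" for \<alpha> \<beta>
    unfolding comult_add [OF that] by (rule TT.lift_add [OF TT.T_abelian b comult_closed comult_closed]) fact+
  show "TT.pure (lr v \<one> \<otimes>\<^bsub>L\<^esub> lr \<one> r) (lr \<one> w) =
      tensor_lift TT.T (\<lambda>x y. TT.pure x (y \<otimes>\<^bsub>L\<^esub> lr r \<one>)) (cm (lr v w))" if v: "v \<in> V" and w: "w \<in> V" for v w
  proof -
    have "tensor_lift TT.T (\<lambda>x y. TT.pure x (y \<otimes>\<^bsub>L\<^esub> lr r \<one>)) (cm (lr v w)) = TT.pure (lr v \<one>) (lr \<one> w \<otimes>\<^bsub>L\<^esub> lr r \<one>)"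
      using v w TT.lift_pure [OF TT.T_abelian b, of "lr v \<one>" "lr \<one> w"] by (simp add: comult_lr lr_closed V_one)
    \<comment> \<open>Source and target values commute, so the factor on the right becomes a left
      action of \<open>r\<close> and can be pulled across the tensor sign.\<close>
    also have "lr \<one> w \<otimes>\<^bsub>L\<^esub> lr r \<one> = lact M r (lr \<one> w)"
      using v w assms(2) V_carrier by (simp add: lr_mult_lr V_one lr_lact [symmetric])
    also have "TT.pure (lr v \<one>) (lact M r (lr \<one> w)) = TT.pure (lr v r) (lr \<one> w)"
      using v w assms(2) by (simp add: pure_lr lr_closed V_one)
    also have "lr v r = lr v \<one> \<otimes>\<^bsub>L\<^esub> lr \<one> r"
      using v assms(2) V_carrier by (simp add: lr_mult_lr V_one)
    finally show ?thesis by simp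
  qed
qed

text \<open>\<open>T2\<close> and \<open>T3\<close> are the triple tensor products bracketed to the
  left and to the right.\<close>

sublocale T2: tensor_product VA VA VA TT.T M
  by (intro tensor_product.intro TT.tensor_bimodule M_bimodule)

sublocale T3: tensor_product VA VA VA M TT.T
  by (intro tensor_product.intro TT.tensor_bimodule M_bimodule)

lemma T2_pure:
  "u \<in> carrier TT.T \<Longrightarrow> \<beta> \<in> carrier L \<Longrightarrow> T2.pure u \<beta> \<in> carrier T2.T"
  "u \<in> carrier TT.T \<Longrightarrow> u' \<in> carrier TT.T \<Longrightarrow> \<beta> \<in> carrier L \<Longrightarrow> T2.pure (u \<oplus>\<^bsub>TT.T\<^esub> u') \<beta> = T2.pure u \<beta> \<oplus>\<^bsub>T2.T\<^esub> T2.pure u' \<beta>"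
  "u \<in> carrier TT.T \<Longrightarrow> \<beta> \<in> carrier L \<Longrightarrow> \<beta>' \<in> carrier L \<Longrightarrow> T2.pure u (\<beta> \<oplus>\<^bsub>L\<^esub> \<beta>') = T2.pure u \<beta> \<oplus>\<^bsub>T2.T\<^esub> T2.pure u \<beta>'"
  "u \<in> carrier TT.T \<Longrightarrow> \<beta> \<in> carrier L \<Longrightarrow> r \<in> V \<Longrightarrow> T2.pure (ract TT.T u r) \<beta> = T2.pure u (lact M r \<beta>)"
  using T2.pure_closed T2.pure_add_left T2.pure_add_right T2.pure_balanced by simp_all

lemma T3_pure:
  "u \<in> carrier TT.T \<Longrightarrow> \<beta> \<in> carrier L \<Longrightarrow> T3.pure \<beta> u \<in> carrier T3.T"
  "u \<in> carrier TT.T \<Longrightarrow> u' \<in> carrier TT.T \<Longrightarrow> \<beta> \<in> carrier L \<Longrightarrow> T3.pure \<beta> (u \<oplus>\<^bsub>TT.T\<^esub> u') = T3.pure \<beta> u \<oplus>\<^bsub>T3.T\<^esub> T3.pure \<beta> u'"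
  "u \<in> carrier TT.T \<Longrightarrow> \<beta> \<in> carrier L \<Longrightarrow> \<beta>' \<in> carrier L \<Longrightarrow> T3.pure (\<beta> \<oplus>\<^bsub>L\<^esub> \<beta>') u = T3.pure \<beta> u \<oplus>\<^bsub>T3.T\<^esub> T3.pure \<beta>' u"
  "u \<in> carrier TT.T \<Longrightarrow> \<beta> \<in> carrier L \<Longrightarrow> r \<in> V \<Longrightarrow> T3.pure (ract M \<beta> r) u = T3.pure \<beta> (lact TT.T r u)"
  using T3.pure_closed T3.pure_add_left T3.pure_add_right T3.pure_balanced by simp_all

lemma comult_id_balanced: "balanced VA M M T2.T (\<lambda>x y. T2.pure (cm x) y)"
  by (rule M_balancedI) (simp_all add: T2_pure comult_closed comult_add comult_ract)

lemma id_comult_balanced: "balanced VA M M T3.T (\<lambda>x y. T3.pure x (cm y))"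
  by (rule M_balancedI) (simp_all add: T3_pure comult_closed comult_add comult_lact)

lemma assoc_inner_balanced: "z \<in> carrier L \<Longrightarrow> balanced VA M M T3.T (\<lambda>x y. T3.pure x (TT.pure y z))"
  using TT.lact_pure
  by (intro M_balancedI) (simp_all add: T3_pure pure_closed pure_add_left)

abbreviation "assoc_inner z \<equiv> tensor_lift T3.T (\<lambda>x y. T3.pure x (TT.pure y z))"

text \<open>The associator is built by two nested lifts. This lemma is the well-definedness of the
  outer one.\<close>

lemma assoc_balanced: "balanced VA TT.T M T3.T (\<lambda>u z. assoc_inner z u)"
proof (rule balancedI)
  note cl = TT.lift_closed [OF T3.T_abelian assoc_inner_balanced]
    and ad = TT.lift_add [OF T3.T_abelian assoc_inner_balanced]
    and pu = TT.lift_pure [OF T3.T_abelian assoc_inner_balanced]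
  have p3: "T3.pure x (TT.pure y z) \<in> carrier T3.T" if "x \<in> carrier L" "y \<in> carrier L" "z \<in> carrier L" for x y z
    using that by (simp add: T3_pure pure_closed)
  show "assoc_inner z u \<in> carrier T3.T" if "u \<in> carrier TT.T" "z \<in> carrier M" for u z
    using cl that by simp
  show "assoc_inner z (u \<oplus>\<^bsub>TT.T\<^esub> u') = assoc_inner z u \<oplus>\<^bsub>T3.T\<^esub> assoc_inner z u'"
    if "u \<in> carrier TT.T" "u' \<in> carrier TT.T" "z \<in> carrier M" for u u' z
    using ad that by simp
  show "assoc_inner (z \<oplus>\<^bsub>M\<^esub> z') u = assoc_inner z u \<oplus>\<^bsub>T3.T\<^esub> assoc_inner z' u"
    if u: "u \<in> carrier TT.T" and z: "z \<in> carrier M" "z' \<in> carrier M" for u z z'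
  proof -
    have zz: "z \<in> carrier L" "z' \<in> carrier L" "z \<oplus>\<^bsub>L\<^esub> z' \<in> carrier L" using z L_add_closed by auto
    show ?thesis unfolding M_simps
    proof (rule TT.additive_eq [OF T3.T_abelian u, where h = "assoc_inner (z \<oplus>\<^bsub>L\<^esub> z')" and
          h' = "\<lambda>u. assoc_inner z u \<oplus>\<^bsub>T3.T\<^esub> assoc_inner z' u"])
      show "assoc_inner (z \<oplus>\<^bsub>L\<^esub> z') (TT.pure m n) = assoc_inner z (TT.pure m n) \<oplus>\<^bsub>T3.T\<^esub> assoc_inner z' (TT.pure m n)"
        if "m \<in> carrier M" "n \<in> carrier M" for m n
        using that zz pu by (simp add: pure_add_right T3_pure pure_closed)
      show "assoc_inner z (a \<oplus>\<^bsub>TT.T\<^esub> b) \<oplus>\<^bsub>T3.T\<^esub> assoc_inner z' (a \<oplus>\<^bsub>TT.T\<^esub> b) =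
          assoc_inner z a \<oplus>\<^bsub>T3.T\<^esub> assoc_inner z' a \<oplus>\<^bsub>T3.T\<^esub> (assoc_inner z b \<oplus>\<^bsub>T3.T\<^esub> assoc_inner z' b)"
        if "a \<in> carrier TT.T" "b \<in> carrier TT.T" for a b
        using that zz cl ad by (simp add: T3.T.a_ac)
    qed (use zz cl ad in simp_all)
  qed
  show "assoc_inner z (ract TT.T u r) = assoc_inner (lact M r z) u"
    if u: "u \<in> carrier TT.T" and z: "z \<in> carrier M" and r: "r \<in> carrier VA" for u z r
  proof -
    have zz: "z \<in> carrier L" "r \<in> V" "lact M r z \<in> carrier L" using z r lact_closed by auto
    have rc: "ract TT.T a r \<in> carrier TT.T" if "a \<in> carrier TT.T" for a
      using bimodule.ract_closed [OF TT.tensor_bimodule] zz that by simp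
    have ra: "ract TT.T (a \<oplus>\<^bsub>TT.T\<^esub> b) r = ract TT.T a r \<oplus>\<^bsub>TT.T\<^esub> ract TT.T b r"
      if "a \<in> carrier TT.T" "b \<in> carrier TT.T" for a b
      using bimodule.ract_add [OF TT.tensor_bimodule] zz that by simp
    show ?thesis
    proof (rule TT.additive_eq [OF T3.T_abelian u, where h = "\<lambda>u. assoc_inner z (ract TT.T u r)"])
      show "assoc_inner z (ract TT.T (TT.pure m n) r) = assoc_inner (lact M r z) (TT.pure m n)"
        if "m \<in> carrier M" "n \<in> carrier M" for m n
        using that zz pu TT.ract_pure ract_closed by (simp add: pure_balanced)
    qed (use zz cl ad rc ra in simp_all)
  qed
qed

text \<open>Both iterated coproducts of \<open>lr v w\<close> are the triple tensor of
  \<open>lr v \<one>\<close>, \<open>lr \<one> \<one>\<close> and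
  \<open>lr \<one> w\<close>.\<close>

lemma coassoc_eq:
  assumes a: "a \<in> carrier L"
  shows "tensor_assoc H (comult_id H (cm a)) = id_comult H (cm a)"
proof -
  have ci: "comult_id H = tensor_lift T2.T (\<lambda>x y. T2.pure (cm x) y)" by (simp add: comult_id_def)
  have ic: "id_comult H = tensor_lift T3.T (\<lambda>x y. T3.pure x (cm y))" by (simp add: id_comult_def)
  have ta: "tensor_assoc H = tensor_lift T3.T (\<lambda>u z. assoc_inner z u)"
    by (simp add: tensor_assoc_def Let_def)
  note c1 = TT.lift_closed [OF T2.T_abelian comult_id_balanced comult_closed]
    and a1 = TT.lift_add [OF T2.T_abelian comult_id_balanced comult_closed comult_closed]
    and c2 = T2.lift_closed [OF T3.T_abelian assoc_balanced]
    and a2 = T2.lift_add [OF T3.T_abelian assoc_balanced]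
    and p2 = T2.lift_pure [OF T3.T_abelian assoc_balanced]
  show ?thesis unfolding ic
  proof (rule lift_comult_eq [OF T3.T_abelian id_comult_balanced _ _ _ a, symmetric])
    show "tensor_assoc H (comult_id H (cm \<alpha>)) \<in> carrier T3.T" if "\<alpha> \<in> carrier L" for \<alpha>
      unfolding ta ci by (rule c2 [OF c1 [OF that]])
    show "tensor_assoc H (comult_id H (cm (\<alpha> \<oplus>\<^bsub>L\<^esub> \<beta>))) =
        tensor_assoc H (comult_id H (cm \<alpha>)) \<oplus>\<^bsub>T3.T\<^esub> tensor_assoc H (comult_id H (cm \<beta>))"
      if "\<alpha> \<in> carrier L" "\<beta> \<in> carrier L" for \<alpha> \<beta>
      unfolding ta ci comult_add [OF that] a1 [OF that] by (rule a2 [OF c1 [OF that(1)] c1 [OF that(2)]])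
    show "T3.pure (lr v \<one>) (cm (lr \<one> w)) = tensor_assoc H (comult_id H (cm (lr v w)))"
      if v: "v \<in> V" and w: "w \<in> V" for v w
    proof -
      have l: "lr v \<one> \<in> carrier L" "lr \<one> w \<in> carrier L" "lr \<one> \<one> \<in> carrier L" using v w by (auto simp: lr_closed V_one)
      have "comult_id H (cm (lr v w)) = T2.pure (cm (lr v \<one>)) (lr \<one> w)"
        unfolding ci using TT.lift_pure [OF T2.T_abelian comult_id_balanced, of "lr v \<one>" "lr \<one> w"] l v w
        by (simp add: comult_lr)
      also have "cm (lr v \<one>) = TT.pure (lr v \<one>) (lr \<one> \<one>)" using v by (simp add: comult_lr V_one)
      finally have "tensor_assoc H (comult_id H (cm (lr v w))) = assoc_inner (lr \<one> w) (TT.pure (lr v \<one>) (lr \<one> \<one>))"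
        unfolding ta using p2 [of "TT.pure (lr v \<one>) (lr \<one> \<one>)" "lr \<one> w"] l by (simp add: pure_closed)
      also have "\<dots> = T3.pure (lr v \<one>) (TT.pure (lr \<one> \<one>) (lr \<one> w))"
        using TT.lift_pure [OF T3.T_abelian assoc_inner_balanced, of "lr \<one> w" "lr v \<one>" "lr \<one> \<one>"] l by simp
      also have "TT.pure (lr \<one> \<one>) (lr \<one> w) = cm (lr \<one> w)" using w by (simp add: comult_lr V_one)
      finally show ?thesis by simp
    qed
  qed
qed

lemma endo_comult_ext: "cm \<in> carrier L \<rightarrow>\<^sub>E carrier TT.T"
  by (intro PiE_I comult_closed) (auto simp: endo_comult_def)

lemma left_bialgebroid: "left_bialgebroid K H"
proof (rule left_bialgebroid.intro)
  show "assoc_algebra K (total H)" by (simp add: L_assoc_algebra)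
  show "assoc_algebra K (base H)" by (simp add: centralizer_algebra_assoc D_carrier)
  show "source H \<in> carrier (base H) \<rightarrow>\<^sub>E carrier (total H)" "target H \<in> carrier (base H) \<rightarrow>\<^sub>E carrier (total H)"
    by (auto simp: source_eq target_eq lr_closed V_one)
  show "comult H \<in> carrier (total H) \<rightarrow>\<^sub>E carrier (total_tensor H)"
    using endo_comult_ext by simp
  show "counit H \<in> carrier (total H) \<rightarrow>\<^sub>E carrier (base H)"
    by (auto simp: counit_value)
  have add: "lr (v \<oplus> w) \<one> = lr v \<one> \<oplus>\<^bsub>L\<^esub> lr w \<one>" "lr \<one> (v \<oplus> w) = lr \<one> v \<oplus>\<^bsub>L\<^esub> lr \<one> w" if "v \<in> V" "w \<in> V" for v w
    by (rule L_eqI; use that V_add V_one V_carrier in \<open>simp add: lr_closed L_add_closed l_distr r_distr\<close>)+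
  have sm: "lr (k \<otimes> v) \<one> = k \<odot>\<^bsub>L\<^esub> lr v \<one>" "lr \<one> (k \<otimes> v) = k \<odot>\<^bsub>L\<^esub> lr \<one> v" if "v \<in> V" "k \<in> Z" for v k
  proof -
    have kV: "k \<in> V" "k \<in> carrier A" using that Z_V by auto
    show "lr (k \<otimes> v) \<one> = k \<odot>\<^bsub>L\<^esub> lr v \<one>"
      by (rule L_eqI) (use that kV V_mult V_one V_carrier in \<open>simp_all add: lr_closed smult_closed m_assoc\<close>)
    have "a \<otimes> (k \<otimes> v) = k \<otimes> (a \<otimes> v)" if a: "a \<in> carrier A" for a
      using a kV V_carrier [OF \<open>v \<in> V\<close>] center_comm [OF \<open>k \<in> Z\<close> a] by (simp add: m_assoc [symmetric])
    then show "lr \<one> (k \<otimes> v) = k \<odot>\<^bsub>L\<^esub> lr \<one> v"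
      by (intro L_eqI) (use that kV V_mult V_one V_carrier in \<open>simp_all add: lr_closed smult_closed\<close>)
  qed
  show "source H \<in> algebra_hom K (base H) (total H)"
    unfolding algebra_hom_def ring_hom_def
    by (auto simp: source_eq V_mult V_add V_one lr_closed lr_mult_lr add sm Z_V one_eq_lr)
  show "target H \<in> algebra_hom K (base H) (opp_ring (total H))"
    unfolding algebra_hom_def ring_hom_def
    by (auto simp: target_eq V_mult V_add V_one lr_closed lr_mult_lr add sm Z_V one_eq_lr opp_ring_def)
  show "source H r \<otimes>\<^bsub>total H\<^esub> target H r' = target H r' \<otimes>\<^bsub>total H\<^esub> source H r"
    if "r \<in> carrier (base H)" "r' \<in> carrier (base H)" for r r'
    using that V_carrier by (simp add: source_eq target_eq lr_mult_lr V_one)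
  show "comult H \<in> bimod_hom (base H) (base H) (total_bimod H) (total_tensor H)"
    by (rule bimod_homI) (simp_all add: comult_closed comult_add comult_lact comult_ract)
  show "counit H \<in> bimod_hom (base H) (base H) (total_bimod H) (base_bimod H)"
    by (rule bimod_homI)
      (simp_all add: base_bimod_def regular_bimod_def counit_value lact_closed ract_closed L_add_closed)
  show "tensor_assoc H (comult_id H (comult H a)) = id_comult H (comult H a)" if "a \<in> carrier (total H)" for a
    using that coassoc_eq by simp
  show "tensor_lift (total H) (\<lambda>x y. lact (total_bimod H) (counit H x) y) (comult H a) = a"
    "tensor_lift (total H) (\<lambda>x y. ract (total_bimod H) x (counit H y)) (comult H a) = a"
    if "a \<in> carrier (total H)" for a
    using lift_counit_left [of a] lift_counit_right [of a] that
    by (simp_all only: endo_hopf_simps(1,5))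
  show "tensor_lift (total_tensor H) (\<lambda>x y. total_pure H (x \<otimes>\<^bsub>total H\<^esub> target H r) y) (comult H a) =
      tensor_lift (total_tensor H) (\<lambda>x y. total_pure H x (y \<otimes>\<^bsub>total H\<^esub> source H r)) (comult H a)"
    if "a \<in> carrier (total H)" "r \<in> carrier (base H)" for a r
    using takeuchi_eq [of a r] that by (simp add: source_eq target_eq)
  show "comult H (a \<otimes>\<^bsub>total H\<^esub> b) =
        formal_eval (total_tensor H) (\<lambda>(x, y). formal_eval (total_tensor H)
          (\<lambda>(x', y'). total_pure H (x \<otimes>\<^bsub>total H\<^esub> x') (y \<otimes>\<^bsub>total H\<^esub> y')) v) u"
    if "a \<in> carrier (total H)" "b \<in> carrier (total H)" "u \<in> comult H a" "v \<in> comult H b" for a b u v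
    using comult_mult that by simp
  show "comult H \<one>\<^bsub>total H\<^esub> = total_pure H \<one>\<^bsub>total H\<^esub> \<one>\<^bsub>total H\<^esub>"
    by (simp add: one_eq_lr comult_lr V_one)
  show "counit H (a \<otimes>\<^bsub>total H\<^esub> b) = counit H (a \<otimes>\<^bsub>total H\<^esub> source H (counit H b))"
    "counit H (a \<otimes>\<^bsub>total H\<^esub> b) = counit H (a \<otimes>\<^bsub>total H\<^esub> target H (counit H b))"
    if "a \<in> carrier (total H)" "b \<in> carrier (total H)" for a b
    using that by (simp_all add: counit_value source_eq target_eq lr_closed V_one L_mult_closed)
  show "counit H \<one>\<^bsub>total H\<^esub> = \<one>\<^bsub>base H\<^esub>" by (simp add: L_one_closed)
qed

end

context endo_hopf begin

section \<open>The axioms of a Hopf algebroid\<close>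

lemma antipode_mult:
  assumes \<alpha>: "\<alpha> \<in> carrier L" and \<beta>: "\<beta> \<in> carrier L"
  shows "\<tau> (\<alpha> \<otimes>\<^bsub>L\<^esub> \<beta>) = \<tau> \<beta> \<otimes>\<^bsub>L\<^esub> \<tau> \<alpha>"
proof (rule L_additive_eq [OF L_abelian \<alpha>, where h = "\<lambda>\<alpha>. \<tau> (\<alpha> \<otimes>\<^bsub>L\<^esub> \<beta>)" and h' = "\<lambda>\<alpha>. \<tau> \<beta> \<otimes>\<^bsub>L\<^esub> \<tau> \<alpha>"])
  fix v w assume v: "v \<in> V" and w: "w \<in> V"
  show "\<tau> (lr v w \<otimes>\<^bsub>L\<^esub> \<beta>) = \<tau> \<beta> \<otimes>\<^bsub>L\<^esub> \<tau> (lr v w)"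
    by (rule L_additive_eq [OF L_abelian \<beta>, where h = "\<lambda>\<beta>. \<tau> (lr v w \<otimes>\<^bsub>L\<^esub> \<beta>)" and h' = "\<lambda>\<beta>. \<tau> \<beta> \<otimes>\<^bsub>L\<^esub> \<tau> (lr v w)"])
      (use v w in \<open>simp_all add: antipode_closed antipode_add antipode_lr lr_closed lr_mult_lr V_mult L.r_distr L.l_distr\<close>)
qed (use \<beta> in \<open>simp_all add: antipode_closed antipode_add L.r_distr L.l_distr\<close>)

lemma antipode_antipode: "\<alpha> \<in> carrier L \<Longrightarrow> \<tau> (\<tau> \<alpha>) = \<alpha>"
  by (rule L_additive_eq [OF L_abelian, where h = "\<lambda>\<alpha>. \<tau> (\<tau> \<alpha>)" and h' = "\<lambda>\<alpha>. \<alpha>"])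
    (simp_all add: antipode_closed antipode_add antipode_lr)

lemma smult_eq:
  assumes k: "k \<in> Z" and x: "x \<in> carrier L"
  shows smult_lact: "k \<odot>\<^bsub>L\<^esub> x = lact M k x" and smult_ract: "k \<odot>\<^bsub>L\<^esub> x = ract M x k"
  by (rule L_eqI; use Z_V [OF k] x center_comm [OF k] in \<open>simp add: smult_closed lact_closed ract_closed\<close>)+

lemma smult_lr:
  assumes k: "k \<in> Z" and v: "v \<in> V" and w: "w \<in> V"
  shows "k \<odot>\<^bsub>L\<^esub> lr v w = lr (k \<otimes> v) w" "k \<odot>\<^bsub>L\<^esub> lr v w = lr v (k \<otimes> w)"
proof -
  have kV: "k \<in> V" "k \<in> carrier A" using k Z_V by auto
  show "k \<odot>\<^bsub>L\<^esub> lr v w = lr (k \<otimes> v) w"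
    by (rule L_eqI) (use v w kV V_mult V_carrier in \<open>simp_all add: lr_closed smult_closed m_assoc\<close>)
  moreover have "lr (k \<otimes> v) w = lr v (k \<otimes> w)"
    by (rule L_eqI) (use v w kV V_mult V_carrier center_move [OF k] in \<open>simp_all add: lr_closed\<close>)
  ultimately show "k \<odot>\<^bsub>L\<^esub> lr v w = lr v (k \<otimes> w)" by simp
qed

lemma smult_add:
  "k \<in> Z \<Longrightarrow> x \<in> carrier L \<Longrightarrow> y \<in> carrier L \<Longrightarrow> k \<odot>\<^bsub>L\<^esub> (x \<oplus>\<^bsub>L\<^esub> y) = k \<odot>\<^bsub>L\<^esub> x \<oplus>\<^bsub>L\<^esub> k \<odot>\<^bsub>L\<^esub> y"
  using module.smult_r_distr [OF L_module] by simp

lemma smult_mult: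
  assumes "k \<in> Z" "x \<in> carrier L" "y \<in> carrier L"
  shows "k \<odot>\<^bsub>L\<^esub> x \<otimes>\<^bsub>L\<^esub> y = k \<odot>\<^bsub>L\<^esub> (x \<otimes>\<^bsub>L\<^esub> y)" "x \<otimes>\<^bsub>L\<^esub> (k \<odot>\<^bsub>L\<^esub> y) = k \<odot>\<^bsub>L\<^esub> (x \<otimes>\<^bsub>L\<^esub> y)"
  using assoc_algebra.smult_mult_left [OF L_assoc_algebra] assoc_algebra.smult_mult_right [OF L_assoc_algebra] assms
  by simp_all

lemma antipode_smult: "k \<in> Z \<Longrightarrow> \<alpha> \<in> carrier L \<Longrightarrow> \<tau> (k \<odot>\<^bsub>L\<^esub> \<alpha>) = k \<odot>\<^bsub>L\<^esub> \<tau> \<alpha>"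
  by (rule L_additive_eq [OF L_abelian, where h = "\<lambda>\<alpha>. \<tau> (k \<odot>\<^bsub>L\<^esub> \<alpha>)" and h' = "\<lambda>\<alpha>. k \<odot>\<^bsub>L\<^esub> \<tau> \<alpha>"])
    (simp_all add: antipode_closed antipode_add smult_add smult_closed Z_V antipode_lr smult_lr(1) V_mult smult_lr(2)[symmetric])

text \<open>The antipode turns multiplication by a target value on the left into multiplication by
  the corresponding source value on the right, which is the balance condition.\<close>

lemma antipode_left_balanced: "balanced VA M M L (\<lambda>x y. \<tau> x \<otimes>\<^bsub>L\<^esub> y)"
  by (rule M_balancedI)
    (simp_all add: antipode_closed antipode_add antipode_mult antipode_lr L.l_distr L.r_distr L.m_assoc
      ract_M_mult lact_M_mult lr_closed V_one)

text \<open>On the generator \<open>lr v w\<close> the left side is \<open>lr \<one> v\<close> times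
  \<open>lr \<one> w\<close>, that is right multiplication by \<open>w \<otimes> v\<close>, and this
  is the value of \<open>\<tau> (lr v w)\<close> at \<open>\<one>\<close>.\<close>

lemma antipode_left_eq:
  assumes "a \<in> carrier L"
  shows "tensor_lift L (\<lambda>x y. \<tau> x \<otimes>\<^bsub>L\<^esub> y) (cm a) = lr \<one> (\<tau> a \<one>)"
proof (rule lift_comult_eq [OF L_abelian antipode_left_balanced _ _ _ assms])
  fix \<alpha> \<beta> assume c: "\<alpha> \<in> carrier L" "\<beta> \<in> carrier L"
  then have v: "\<tau> \<alpha> \<one> \<in> V" "\<tau> \<beta> \<one> \<in> V" "\<tau> (\<alpha> \<oplus>\<^bsub>L\<^esub> \<beta>) \<one> \<in> V" by (auto simp: counit_value antipode_closed L_add_closed)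
  show "lr \<one> (\<tau> (\<alpha> \<oplus>\<^bsub>L\<^esub> \<beta>) \<one>) = lr \<one> (\<tau> \<alpha> \<one>) \<oplus>\<^bsub>L\<^esub> lr \<one> (\<tau> \<beta> \<one>)"
    by (rule L_eqI) (use c v in \<open>simp_all add: lr_closed V_one V_carrier antipode_add r_distr\<close>)
qed (simp_all add: lr_closed V_one counit_value antipode_closed antipode_lr lr_mult_lr V_carrier)

abbreviation "LZ \<equiv> module_bimod L"

lemma ground_simps [simp]:
  "carrier LZ = carrier L" "ring.add LZ = ring.add L" "lact LZ k x = k \<odot>\<^bsub>L\<^esub> x" "ract LZ x k = k \<odot>\<^bsub>L\<^esub> x"
  by (simp_all add: module_bimod_def)

lemma ground_pure:
  "x \<in> carrier L \<Longrightarrow> y \<in> carrier L \<Longrightarrow> GT.pure x y \<in> carrier GT.T"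
  "x \<in> carrier L \<Longrightarrow> x' \<in> carrier L \<Longrightarrow> y \<in> carrier L \<Longrightarrow> GT.pure (x \<oplus>\<^bsub>L\<^esub> x') y = GT.pure x y \<oplus>\<^bsub>GT.T\<^esub> GT.pure x' y"
  "x \<in> carrier L \<Longrightarrow> y \<in> carrier L \<Longrightarrow> y' \<in> carrier L \<Longrightarrow> GT.pure x (y \<oplus>\<^bsub>L\<^esub> y') = GT.pure x y \<oplus>\<^bsub>GT.T\<^esub> GT.pure x y'"
  "x \<in> carrier L \<Longrightarrow> y \<in> carrier L \<Longrightarrow> k \<in> Z \<Longrightarrow> GT.pure (k \<odot>\<^bsub>L\<^esub> x) y = GT.pure x (k \<odot>\<^bsub>L\<^esub> y)"
  using GT.pure_closed GT.pure_add_left GT.pure_add_right GT.pure_balanced by simp_all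

text \<open>The section of the canonical projection pulls the right factor of the generator
  \<open>\<lambda>\<^sub>v\<rho>\<^sub>w\<close> across the tensor sign.\<close>

definition eta :: "('a \<Rightarrow> 'a) \<Rightarrow> ('a \<Rightarrow> 'a) \<Rightarrow> ((('a \<Rightarrow> 'a) \<times> ('a \<Rightarrow> 'a)) \<Rightarrow>\<^sub>0 int) set" where
  "eta x y = L_lift GT.T (\<lambda>v w. GT.pure (lr v \<one>) (lact M w y)) x"

lemma lact_add_right: "r \<in> V \<Longrightarrow> y \<in> carrier L \<Longrightarrow> y' \<in> carrier L \<Longrightarrow>
  lact M r (y \<oplus>\<^bsub>L\<^esub> y') = lact M r y \<oplus>\<^bsub>L\<^esub> lact M r y'"
  using bimodule.lact_add [OF M_bimodule] by simp

lemma lact_add_left: "r \<in> V \<Longrightarrow> r' \<in> V \<Longrightarrow> y \<in> carrier L \<Longrightarrow>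
  lact M (r \<oplus> r') y = lact M r y \<oplus>\<^bsub>L\<^esub> lact M r' y"
  by (rule L_eqI) (simp_all add: lact_closed V_add V_carrier l_distr)

lemma lact_lact: "r \<in> V \<Longrightarrow> r' \<in> V \<Longrightarrow> y \<in> carrier L \<Longrightarrow> lact M (r \<otimes> r') y = lact M r (lact M r' y)"
  by (rule L_eqI) (simp_all add: lact_closed V_mult V_carrier m_assoc)

lemma lact_one: "y \<in> carrier L \<Longrightarrow> lact M \<one> y = y"
  by (rule L_eqI) (simp_all add: lact_closed V_one)

lemma lr_add_left: "v \<in> V \<Longrightarrow> v' \<in> V \<Longrightarrow> w \<in> V \<Longrightarrow> lr (v \<oplus> v') w = lr v w \<oplus>\<^bsub>L\<^esub> lr v' w"
  by (rule L_eqI) (simp_all add: lr_closed V_add V_carrier l_distr)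

lemma eta_inner_balanced: "y \<in> carrier L \<Longrightarrow> balanced K MV MV GT.T (\<lambda>v w. GT.pure (lr v \<one>) (lact M w y))"
  by (rule V_balancedI)
    (simp_all add: ground_pure lr_closed V_one lact_closed lact_add_left lr_add_left lact_lact Z_V
      smult_lr(1)[symmetric] smult_lact [symmetric])

lemmas eta_facts = L_lift_closed [OF GT.T_abelian eta_inner_balanced, folded eta_def]
  L_lift_add [OF GT.T_abelian eta_inner_balanced, folded eta_def]
  L_lift_lr [OF GT.T_abelian eta_inner_balanced, folded eta_def]

lemma eta_balanced: "balanced VA M M GT.T eta"
proof (rule M_balancedI)
  fix x y y' assume x: "x \<in> carrier L" and y: "y \<in> carrier L" "y' \<in> carrier L"
  show "eta x (y \<oplus>\<^bsub>L\<^esub> y') = eta x y \<oplus>\<^bsub>GT.T\<^esub> eta x y'"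
    by (rule L_additive_eq [OF GT.T_abelian x, where h = "\<lambda>x. eta x (y \<oplus>\<^bsub>L\<^esub> y')" and h' = "\<lambda>x. eta x y \<oplus>\<^bsub>GT.T\<^esub> eta x y'"])
      (use y in \<open>simp_all add: eta_facts lact_add_right ground_pure lact_closed lr_closed V_one GT.T.a_ac\<close>)
next
  fix x y r assume x: "x \<in> carrier L" and y: "y \<in> carrier L" and r: "r \<in> V"
  have rlr: "ract M (lr v w) r = lr v (w \<otimes> r)" if "v \<in> V" "w \<in> V" for v w
    by (rule L_eqI) (use that r V_carrier in \<open>simp_all add: lr_closed ract_closed V_mult m_assoc\<close>)
  have radd: "ract M (u \<oplus>\<^bsub>L\<^esub> v) r = ract M u r \<oplus>\<^bsub>L\<^esub> ract M v r" if "u \<in> carrier L" "v \<in> carrier L" for u v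
    using bimodule.ract_add [OF M_bimodule] that r by simp
  show "eta (ract M x r) y = eta x (lact M r y)"
    by (rule L_additive_eq [OF GT.T_abelian x, where h = "\<lambda>x. eta (ract M x r) y" and h' = "\<lambda>x. eta x (lact M r y)"])
      (use y r in \<open>simp_all add: eta_facts lact_closed ract_closed lr_closed V_one V_mult rlr radd lact_lact\<close>)
qed (simp_all add: eta_facts)

abbreviation "\<eta> \<equiv> tensor_lift GT.T eta"

lemma eta_lift:
  "u \<in> carrier TT.T \<Longrightarrow> \<eta> u \<in> carrier GT.T"
  "u \<in> carrier TT.T \<Longrightarrow> v \<in> carrier TT.T \<Longrightarrow> \<eta> (u \<oplus>\<^bsub>TT.T\<^esub> v) = \<eta> u \<oplus>\<^bsub>GT.T\<^esub> \<eta> v"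
  "x \<in> carrier L \<Longrightarrow> y \<in> carrier L \<Longrightarrow> \<eta> (TT.pure x y) = eta x y"
  using TT.lift_closed [OF GT.T_abelian eta_balanced] TT.lift_add [OF GT.T_abelian eta_balanced]
    TT.lift_pure [OF GT.T_abelian eta_balanced] by simp_all

lemma eta_linear:
  assumes k: "k \<in> Z" and u: "u \<in> carrier TT.T"
  shows "\<eta> (tensor_lift TT.T (\<lambda>x y. TT.pure (k \<odot>\<^bsub>L\<^esub> x) y) u) = lact GT.T k (\<eta> u)"
proof -
  have kV: "k \<in> V" using k by (rule Z_V)
  have rs: "k \<odot>\<^bsub>L\<^esub> ract M x r = ract M (k \<odot>\<^bsub>L\<^esub> x) r" if "x \<in> carrier L" "r \<in> V" for x r
    using that k smult_mult(2)[OF k, of "lr \<one> r" x] by (simp add: ract_M_mult lr_closed V_one)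
  have b: "balanced VA M M TT.T (\<lambda>x y. TT.pure (k \<odot>\<^bsub>L\<^esub> x) y)"
    by (rule M_balancedI)
      (use k kV in \<open>simp_all add: pure_closed pure_add_left pure_add_right smult_add smult_closed rs pure_balanced\<close>)
  note cl = TT.lift_closed [OF TT.T_abelian b] and ad = TT.lift_add [OF TT.T_abelian b]
    and pu = TT.lift_pure [OF TT.T_abelian b]
  have G: "lact GT.T k w \<in> carrier GT.T" "w' \<in> carrier GT.T \<Longrightarrow> lact GT.T k (w \<oplus>\<^bsub>GT.T\<^esub> w') = lact GT.T k w \<oplus>\<^bsub>GT.T\<^esub> lact GT.T k w'"
    if "w \<in> carrier GT.T" for w w'
    using bimodule.lact_closed [OF GT.tensor_bimodule] bimodule.lact_add [OF GT.tensor_bimodule] that k by simp_all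
  have e: "eta (k \<odot>\<^bsub>L\<^esub> x) y = lact GT.T k (eta x y)" if x: "x \<in> carrier L" and y: "y \<in> carrier L" for x y
  proof (rule L_additive_eq [OF GT.T_abelian x, where h = "\<lambda>x. eta (k \<odot>\<^bsub>L\<^esub> x) y" and h' = "\<lambda>x. lact GT.T k (eta x y)"])
    fix v w assume v: "v \<in> V" and w: "w \<in> V"
    show "eta (k \<odot>\<^bsub>L\<^esub> lr v w) y = lact GT.T k (eta (lr v w) y)"
      using y v w k kV GT.lact_pure [of k "lr v \<one>" "lact M w y"]
      by (simp add: eta_facts smult_lr(1) V_mult lr_closed V_one lact_closed)
  qed (use y k kV in \<open>simp_all add: eta_facts smult_closed smult_add G\<close>)
  show ?thesis
    by (rule TT.additive_eq [OF GT.T_abelian u, where h = "\<lambda>u. \<eta> (tensor_lift TT.T (\<lambda>x y. TT.pure (k \<odot>\<^bsub>L\<^esub> x) y) u)"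
          and h' = "\<lambda>u. lact GT.T k (\<eta> u)"])
      (use k kV in \<open>simp_all add: cl ad pu eta_lift G smult_closed e\<close>)
qed

text \<open>In \<open>L \<otimes>_V L\<close> the factor \<open>w\<close> that \<open>eta\<close>
  has moved to the right can be moved back.\<close>

lemma eta_section:
  assumes u: "u \<in> carrier TT.T"
  shows "tensor_lift TT.T TT.pure (\<eta> u) = u"
proof -
  have "TT.pure (k \<odot>\<^bsub>L\<^esub> x) y = TT.pure x (k \<odot>\<^bsub>L\<^esub> y)" if "x \<in> carrier L" "y \<in> carrier L" "k \<in> Z" for x y k
    using that pure_balanced [of x y k] by (simp add: smult_lact [of k y] smult_ract [of k x] Z_V)
  then have b: "balanced K LZ LZ TT.T TT.pure"
    by (intro balancedI) (simp_all add: pure_closed pure_add_left pure_add_right)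
  note cl = GT.lift_closed [OF TT.T_abelian b] and ad = GT.lift_add [OF TT.T_abelian b]
    and pu = GT.lift_pure [OF TT.T_abelian b]
  have e: "tensor_lift TT.T TT.pure (eta x y) = TT.pure x y" if x: "x \<in> carrier L" and y: "y \<in> carrier L" for x y
    by (rule L_additive_eq [OF TT.T_abelian x, where h = "\<lambda>x. tensor_lift TT.T TT.pure (eta x y)" and h' = "\<lambda>x. TT.pure x y"])
      (use y in \<open>simp_all add: cl ad pu eta_facts pure_closed pure_add_left lr_closed V_one lact_closed pure_lr\<close>)
  show ?thesis
    by (rule TT.additive_eq [OF TT.T_abelian u, where h = "\<lambda>u. tensor_lift TT.T TT.pure (\<eta> u)" and h' = "\<lambda>u. u"])
      (simp_all add: cl ad eta_lift e)
qed

text \<open>On a generator \<open>\<eta>\<close> lifts the coproduct to the tensor of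
  \<open>lr v \<one>\<close> and \<open>lr \<one> w\<close> over \<open>Z\<close>. Multiplying the
  first factor by the antipode of the second gives \<open>lr (v \<otimes> w) \<one>\<close>, the
  source of the counit.\<close>

lemma antipode_right_eq:
  assumes a: "a \<in> carrier L"
  shows "tensor_lift L (\<lambda>x y. x \<otimes>\<^bsub>L\<^esub> \<tau> y) (\<eta> (cm a)) = lr (a \<one>) \<one>"
proof -
  have b: "balanced K LZ LZ L (\<lambda>x y. x \<otimes>\<^bsub>L\<^esub> \<tau> y)"
    by (intro balancedI)
      (simp_all add: antipode_closed antipode_add L.l_distr L.r_distr antipode_smult smult_mult)
  note cl = GT.lift_closed [OF L_abelian b] and ad = GT.lift_add [OF L_abelian b]
    and pu = GT.lift_pure [OF L_abelian b]
  show ?thesis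
  proof (rule L_additive_eq [OF L_abelian a, where h = "\<lambda>a. tensor_lift L (\<lambda>x y. x \<otimes>\<^bsub>L\<^esub> \<tau> y) (\<eta> (cm a))" and h' = "\<lambda>a. lr (a \<one>) \<one>"])
    fix v w assume "v \<in> V" "w \<in> V"
    then show "tensor_lift L (\<lambda>x y. x \<otimes>\<^bsub>L\<^esub> \<tau> y) (\<eta> (cm (lr v w))) = lr (lr v w \<one>) \<one>"
      by (simp add: comult_lr eta_lift eta_facts lr_closed V_one lact_one pu antipode_lr lr_mult_lr V_carrier)
  qed (simp_all add: cl ad eta_lift comult_closed comult_add lr_closed V_one counit_value lr_add_left)
qed

lemma is_hopf: "is_hopf_algebroid K H"
proof (intro is_hopf_algebroid.intro left_bialgebroid is_hopf_algebroid_axioms.intro)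
  show "antipode H \<in> carrier (total H) \<rightarrow>\<^sub>E carrier (total H)"
    unfolding endo_hopf_simps by (intro PiE_I antipode_closed) (auto simp: endo_antipode_def)
  show "antipode H \<in> algebra_hom K (total H) (opp_ring (total H))"
    unfolding algebra_hom_def ring_hom_def
    by (auto simp: antipode_closed antipode_add antipode_mult antipode_smult one_eq_lr antipode_lr V_one opp_ring_def)
  show "bij_betw (antipode H) (carrier (total H)) (carrier (total H))"
    by (rule bij_betw_byWitness [where f' = "\<tau>"]) (auto simp: antipode_antipode antipode_closed)
  show "antipode H (target H r) = source H r" if "r \<in> carrier (base H)" for r
    using that by (simp add: source_eq target_eq antipode_lr V_one)
  show "tensor_lift (total H) (\<lambda>x y. antipode H x \<otimes>\<^bsub>total H\<^esub> y) (comult H a) = target H (counit H (antipode H a))"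
    if "a \<in> carrier (total H)" for a
    using that by (simp add: antipode_left_eq antipode_closed counit_value target_eq)
  show "\<exists>\<eta> \<in> ground_sections K H. \<forall>a \<in> carrier (total H).
      tensor_lift (total H) (\<lambda>x y. x \<otimes>\<^bsub>total H\<^esub> antipode H y) (\<eta> (comult H a)) = source H (counit H a)"
  proof (intro bexI ballI)
    show "\<eta> \<in> ground_sections K H"
      unfolding ground_sections_def ground_tensor_def
      by (auto simp: eta_lift eta_linear eta_section)
    show "tensor_lift (total H) (\<lambda>x y. x \<otimes>\<^bsub>total H\<^esub> antipode H y) (\<eta> (comult H a)) = source H (counit H a)"
      if "a \<in> carrier (total H)" for a
      using that by (simp add: antipode_right_eq counit_value source_eq)
  qed
qed

end

context endo_hopf begin

section \<open>Hopf subalgebroids and minimality\<close>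

context
  fixes B assumes S: "endo_hopf A B" and BD: "B \<subseteq> D"
begin

interpretation S: endo_hopf A B by (rule S)

lemma V_mono: "V \<subseteq> S.V"
  using BD unfolding centralizer_def by blast

lemma L_mono: "carrier L \<subseteq> carrier S.L"
proof
  fix \<alpha> assume "\<alpha> \<in> carrier L"
  then show "\<alpha> \<in> carrier S.L"
    unfolding L_carrier_iff S.L_carrier_iff using subsetD [OF BD] by blast
qed

lemmas V_monoD = subsetD [OF V_mono] and L_monoD = subsetD [OF L_mono]

lemma restrict_total: "L = S.L\<lparr>carrier := carrier L\<rparr>"
  by (simp add: endo_algebra_def)

lemma restrict_base: "VA = S.VA\<lparr>carrier := carrier VA\<rparr>"
  by (simp add: centralizer_algebra_def)

lemma sub_antipode: "a \<in> carrier L \<Longrightarrow> \<tau> a = S.\<tau> a"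
proof (rule L_additive_eq [OF S.L_abelian, where h = \<tau> and h' = S.\<tau>])
  have add: "u \<oplus>\<^bsub>L\<^esub> v = u \<oplus>\<^bsub>S.L\<^esub> v" for u v by (simp add: endo_algebra_simps)
  show "\<tau> (u \<oplus>\<^bsub>L\<^esub> v) = \<tau> u \<oplus>\<^bsub>S.L\<^esub> \<tau> v" "S.\<tau> (u \<oplus>\<^bsub>L\<^esub> v) = S.\<tau> u \<oplus>\<^bsub>S.L\<^esub> S.\<tau> v"
    if "u \<in> carrier L" "v \<in> carrier L" for u v
    using that by (simp_all add: antipode_add [unfolded add] S.antipode_add add L_monoD)
  show "\<tau> (lr v w) = S.\<tau> (lr v w)" if "v \<in> V" "w \<in> V" for v w
    using that by (simp add: antipode_lr S.antipode_lr V_monoD)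
qed (simp_all add: L_monoD antipode_closed S.antipode_closed)

text \<open>Both coproducts send \<open>lr v w\<close> to the pure tensor of
  \<open>lr v \<one>\<close> and \<open>lr \<one> w\<close>; they differ only in the base ring over
  which that tensor is formed.\<close>

lemma sub_comult: "a \<in> carrier L \<Longrightarrow> tensor_lift S.TT.T S.TT.pure (cm a) = S.cm a"
proof (rule lift_comult_eq [OF S.TT.T_abelian])
  have add: "u \<oplus>\<^bsub>L\<^esub> v = u \<oplus>\<^bsub>S.L\<^esub> v" for u v by (simp add: endo_algebra_simps)
  have mult: "monoid.mult L = monoid.mult S.L" by (simp add: endo_algebra_simps)
  show "balanced VA M M S.TT.T S.TT.pure"
  proof (rule M_balancedI)
    show "S.TT.pure (ract M \<alpha> r) \<beta> = S.TT.pure \<alpha> (lact M r \<beta>)"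
      if "\<alpha> \<in> carrier L" "\<beta> \<in> carrier L" "r \<in> V" for \<alpha> \<beta> r
    proof -
      have r: "r \<in> S.V" using that V_mono by blast
      have "ract M \<alpha> r = ract S.M \<alpha> r" "lact M r \<beta> = lact S.M r \<beta>"
        using that r by (simp_all only: ract_M_mult lact_M_mult S.ract_M_mult S.lact_M_mult mult)
      then show ?thesis using S.pure_balanced [OF _ _ r] that L_mono by auto
    qed
  qed (simp_all add: add subsetD [OF L_mono] S.pure_closed S.pure_add_left S.pure_add_right)
  show "S.cm (\<alpha> \<oplus>\<^bsub>L\<^esub> \<beta>) = S.cm \<alpha> \<oplus>\<^bsub>S.TT.T\<^esub> S.cm \<beta>" if "\<alpha> \<in> carrier L" "\<beta> \<in> carrier L" for \<alpha> \<beta>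
    using that by (simp add: S.comult_add add L_monoD)
qed (simp_all add: L_monoD V_monoD S.comult_closed S.comult_lr)

lemma sub_bialgebroid: "sub_bialgebroid K H S.H"
proof -
  have "bialgebroid_hom K H S.H (\<lambda>x. x) (\<lambda>r. r)"
    unfolding bialgebroid_hom_def
  proof (intro conjI ballI)
    show "(\<lambda>x. x) \<in> algebra_hom K (total H) (total S.H)" "(\<lambda>r. r) \<in> algebra_hom K (base H) (base S.H)"
      using L_mono V_mono by (auto simp: algebra_hom_def ring_hom_def endo_algebra_simps)
    show "comult S.H a = tensor_lift (total_tensor S.H) (total_pure S.H) (comult H a)" if "a \<in> carrier (total H)" for a
      using that sub_comult by simp
  qed (use V_mono L_mono in auto)
  then show ?thesis
    unfolding sub_bialgebroid_def
    using left_bialgebroid S.left_bialgebroid L_mono V_mono restrict_total restrict_base by simp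
qed

lemma hopf_subalgebroid: "hopf_subalgebroid K H S.H"
  unfolding hopf_subalgebroid_def using is_hopf S.is_hopf sub_bialgebroid sub_antipode by simp

text \<open>\<open>L\<close> is spanned by products of values of source and target on its base, so it lies in every
  sub-bialgebroid whose base contains that of \<open>L\<close>.\<close>

lemma span_subset:
  assumes sub: "sub_bialgebroid K H' S.H" and V: "V \<subseteq> carrier (base H')"
  shows "carrier L \<subseteq> carrier (total H')"
proof
  have "left_bialgebroid K H'" using sub by (simp add: sub_bialgebroid_def)
  then interpret H': left_bialgebroid K H' .
  interpret T: ring "total H'" using H'.total_algebra by (simp add: assoc_algebra_def)
  have "total H' = S.L\<lparr>carrier := carrier (total H')\<rparr>" using sub by (simp add: sub_bialgebroid_def)
  then have T: "monoid.mult (total H') = monoid.mult S.L" "ring.add (total H') = ring.add S.L" "\<zero>\<^bsub>total H'\<^esub> = \<zero>\<^bsub>S.L\<^esub>"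
    by (metis partial_object.update_convs monoid.select_convs ring.select_convs monoid.surjective ring.surjective)+
  have st: "source H' v = left_mult A v" "target H' v = right_mult A v" if "v \<in> V" for v
    using sub subsetD [OF V that] subsetD [OF V_mono that]
    by (simp_all add: sub_bialgebroid_def bialgebroid_hom_def)
  fix \<alpha> assume "\<alpha> \<in> carrier L"
  then show "\<alpha> \<in> carrier (total H')"
  proof (induction \<alpha> rule: L_induct)
    case zero
    then show ?case using T.zero_closed by (simp only: T endo_algebra_simps)
  next
    case (lr v w)
    then have vS: "v \<in> S.V" "w \<in> S.V" "v \<in> carrier (base H')" "w \<in> carrier (base H')" using V V_mono by auto
    have "source H' v \<otimes>\<^bsub>total H'\<^esub> target H' w \<in> carrier (total H')"
      using PiE_mem [OF H'.source_ext vS(3)] PiE_mem [OF H'.target_ext vS(4)] by (rule T.m_closed)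
    also have "source H' v \<otimes>\<^bsub>total H'\<^esub> target H' w = lr v w"
      using lr vS by (simp add: T st S.source_eq S.target_eq S.lr_mult_lr S.V_one S.V_carrier)
    finally show ?case .
  next
    case (add \<alpha> \<beta>)
    then show ?case using T.a_closed [of \<alpha> \<beta>] by (simp only: T endo_algebra_simps)
  qed
qed

end

lemma minimal: "minimal_over_base K H"
  unfolding minimal_over_base_def
proof (intro allI impI)
  fix H' :: "('a, 'a \<Rightarrow> 'a, 'a) bialgebroid"
  assume H': "sub_bialgebroid K H' H \<and> carrier (base H') = carrier (base H)"
  have "carrier L \<subseteq> carrier (total H')"
    \<comment> \<open>The ambient Hopf algebroid is here that of \<open>D\<close> itself.\<close>
    by (rule span_subset [OF endo_hopf_axioms order_refl]) (use H' in auto)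
  then show "carrier (total H') = carrier (total H)" using H' by (auto simp: sub_bialgebroid_def)
qed

text \<open>Being fixed by the right multiplications \<open>lr \<one> v\<close> means commuting with
  \<open>V\<close>; conversely \<open>v a w = v w a\<close> on generators.\<close>

lemma fixed_points: "fixed_points A H = centralizer A V"
proof (intro subset_antisym subsetI)
  fix a assume a: "a \<in> fixed_points A H"
  show "a \<in> centralizer A V"
  proof (rule centralizerI)
    fix v assume v: "v \<in> V"
    have ac: "a \<in> carrier A" using a by (simp add: fixed_points_def)
    have "lr \<one> v a = lr \<one> v \<one> \<otimes> a"
      using a lr_closed [OF V_one v] unfolding fixed_points_def endo_hopf_simps by blast
    then show "a \<otimes> v = v \<otimes> a" using V_carrier [OF v] ac by simp
  qed (use a in \<open>simp add: fixed_points_def\<close>)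
next
  fix a assume a: "a \<in> centralizer A V"
  then have ac: "a \<in> carrier A" by (rule centralizer_carrier)
  have "\<alpha> a = \<alpha> \<one> \<otimes> a" if "\<alpha> \<in> carrier L" for \<alpha>
  proof (rule L_additive_eq [OF abelian_group_axioms that, where h = "\<lambda>\<alpha>. \<alpha> a" and h' = "\<lambda>\<alpha>. \<alpha> \<one> \<otimes> a"])
    fix v w assume v: "v \<in> V" and w: "w \<in> V"
    have "lr v w a = v \<otimes> (a \<otimes> w)" using ac v w V_carrier by (simp add: m_assoc)
    also have "a \<otimes> w = w \<otimes> a" using a w by (rule centralizer_comm)
    finally show "lr v w a = lr v w \<one> \<otimes> a" using ac v w V_carrier by (simp add: m_assoc)
  qed (use ac in \<open>simp_all add: l_distr\<close>)
  then show "a \<in> fixed_points A H" using ac by (simp add: fixed_points_def)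
qed

end

lemma ring_cong:
  assumes "ring R" "carrier R' = carrier R" "monoid.mult R' = monoid.mult R" "\<one>\<^bsub>R'\<^esub> = \<one>\<^bsub>R\<^esub>"
    "ring.add R' = ring.add R" "\<zero>\<^bsub>R'\<^esub> = \<zero>\<^bsub>R\<^esub>"
  shows "ring R'"
proof -
  interpret ring R by fact
  have "abelian_group R'" by (rule abelian_group_cong [OF abelian_group_axioms]) (use assms in auto)
  then show ?thesis
    by (rule ringI) (auto simp: assms(2-) l_distr r_distr m_assoc intro!: monoidI)
qed

text \<open>Moves simplicity between the base algebra, which is a \<open>module\<close> record, and
  the corresponding subring of \<open>A\<close>.\<close>

lemma simple_ring_cong:
  assumes "simple_ring R" "carrier R' = carrier R" "monoid.mult R' = monoid.mult R" "\<one>\<^bsub>R'\<^esub> = \<one>\<^bsub>R\<^esub>"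
    "ring.add R' = ring.add R" "\<zero>\<^bsub>R'\<^esub> = \<zero>\<^bsub>R\<^esub>"
  shows "simple_ring R'"
proof -
  have R: "ring R" using assms(1) by (simp add: simple_ring_def)
  have "ideal I R" if "ideal I R'" for I
  proof -
    interpret I: ideal I R' by (rule that)
    show ?thesis
    proof (rule idealI [OF R])
      have "inv\<^bsub>add_monoid R\<^esub> x = inv\<^bsub>add_monoid R'\<^esub> x" for x by (simp add: m_inv_def assms(2-))
      then show "subgroup I (add_monoid R)"
        using I.a_subgroup by (simp add: subgroup_def assms(2-))
    qed (use I.I_l_closed I.I_r_closed in \<open>simp_all add: assms(2-)\<close>)
  qed
  then show ?thesis
    using assms(1) ring_cong [OF R assms(2-)] by (simp add: simple_ring_def assms(2-))
qed

text \<open>Minimality quantifies over plain bialgebroid records, so the Hopf algebroid of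
  \<open>D\<close> has to be stripped of its antipode before it can compete.\<close>

lemma left_bialgebroid_truncate:
  assumes "left_bialgebroid K H" shows "left_bialgebroid K (bialgebroid.truncate H)"
proof -
  have sel: "total (bialgebroid.truncate H) = total H" "base (bialgebroid.truncate H) = base H"
    "source (bialgebroid.truncate H) = source H" "target (bialgebroid.truncate H) = target H"
    "comult (bialgebroid.truncate H) = comult H" "counit (bialgebroid.truncate H) = counit H"
    by (simp_all add: bialgebroid.truncate_def)
  then have bim: "total_bimod (bialgebroid.truncate H) = total_bimod H" "base_bimod (bialgebroid.truncate H) = base_bimod H"
    by (simp_all add: total_bimod_def base_bimod_def)
  with sel have ids: "tensor_assoc (bialgebroid.truncate H) = tensor_assoc H"
    "comult_id (bialgebroid.truncate H) = comult_id H" "id_comult (bialgebroid.truncate H) = id_comult H"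
    by (simp_all add: tensor_assoc_def comult_id_def id_comult_def)
  show ?thesis unfolding left_bialgebroid_def sel bim ids by (rule assms [unfolded left_bialgebroid_def])
qed

section \<open>Coproducts of source and target values in any left bialgebroid\<close>

context left_bialgebroid begin

sublocale total: ring "total H" using total_algebra by (simp add: assoc_algebra_def)

sublocale base: ring "base H" using base_algebra by (simp add: assoc_algebra_def)

lemma source_closed: "r \<in> carrier (base H) \<Longrightarrow> source H r \<in> carrier (total H)"
  using source_ext by (rule PiE_mem)

lemma target_closed: "r \<in> carrier (base H) \<Longrightarrow> target H r \<in> carrier (total H)"
  using target_ext by (rule PiE_mem)

lemma total_bimod_simps [simp]:
  "carrier (total_bimod H) = carrier (total H)" "ring.add (total_bimod H) = ring.add (total H)"
  "ring.zero (total_bimod H) = ring.zero (total H)"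
  "lact (total_bimod H) r x = source H r \<otimes>\<^bsub>total H\<^esub> x" "ract (total_bimod H) x r = target H r \<otimes>\<^bsub>total H\<^esub> x"
  by (simp_all add: total_bimod_def)

lemma total_bimodule: "bimodule (base H) (base H) (total_bimod H)"
proof -
  have "abelian_group (total_bimod H)"
    unfolding total_bimod_def by (rule abelian_group_bimod_of) (rule total.abelian_group_axioms)
  then interpret M: abelian_group "total_bimod H" .
  show ?thesis
    by unfold_locales
      (simp_all add: source_closed target_closed total.r_distr total.m_assoc [symmetric] source_target_comm)
qed

sublocale TT: tensor_product "base H" "base H" "base H" "total_bimod H" "total_bimod H"
  by (intro tensor_product.intro total_bimodule)

text \<open>The coproduct is a bimodule map and sends the unit to the tensor of units, so its values
  on products of source and target are forced.\<close>

lemma comult_source_target: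
  assumes v: "v \<in> carrier (base H)" and w: "w \<in> carrier (base H)"
  shows "comult H (source H v \<otimes>\<^bsub>total H\<^esub> target H w) = total_pure H (source H v) (target H w)"
proof -
  note s = source_closed [OF v] and t = target_closed [OF w]
  have "comult H (target H w) = ract (total_tensor H) (comult H \<one>\<^bsub>total H\<^esub>) w"
    using bimod_homD(4)[OF comult_hom w, of "\<one>\<^bsub>total H\<^esub>"] t by simp
  also have "\<dots> = total_pure H \<one>\<^bsub>total H\<^esub> (target H w)"
    using TT.ract_pure [OF w, of "\<one>\<^bsub>total H\<^esub>" "\<one>\<^bsub>total H\<^esub>"] t by (simp add: comult_one)
  finally have "comult H (target H w) = total_pure H \<one>\<^bsub>total H\<^esub> (target H w)" .
  then have "comult H (source H v \<otimes>\<^bsub>total H\<^esub> target H w) = lact (total_tensor H) v (total_pure H \<one>\<^bsub>total H\<^esub> (target H w))"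
    using bimod_homD(3)[OF comult_hom v, of "target H w"] t by simp
  also have "\<dots> = total_pure H (source H v) (target H w)"
    using TT.lact_pure [OF v, of "\<one>\<^bsub>total H\<^esub>" "target H w"] s t by simp
  finally show ?thesis .
qed

end

section \<open>Hopf subalgebroids with base \<open>V\<close>\<close>

context endo_hopf begin

context
  fixes B and H' :: "('a, 'a \<Rightarrow> 'a, 'a) hopf_algebroid"
  assumes S: "endo_hopf A B" and BD: "B \<subseteq> D"
    and H': "hopf_subalgebroid K H' (endo_hopf_algebroid A B)" and base: "carrier (base H') = V"
begin

interpretation S: endo_hopf A B by (rule S)

lemma H'_bialgebroid: "left_bialgebroid K H'"
  using H' by (simp add: hopf_subalgebroid_def sub_bialgebroid_def)

interpretation H': left_bialgebroid K H' by (rule H'_bialgebroid)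

lemma H'_sub: "sub_bialgebroid K H' S.H" using H' by (simp add: hopf_subalgebroid_def)

lemma H'_total: "total H' = S.L\<lparr>carrier := carrier (total H')\<rparr>"
  using H'_sub by (simp add: sub_bialgebroid_def)

lemma H'_base: "base H' = VA"
  using H'_sub base restrict_base [OF S BD] by (simp add: sub_bialgebroid_def)

lemma H'_ops: "monoid.mult (total H') = monoid.mult L" "ring.add (total H') = ring.add L"
  by (subst H'_total, simp add: endo_algebra_simps)+

lemma L_sub: "carrier L \<subseteq> carrier (total H')"
  by (rule span_subset [OF S BD H'_sub]) (simp add: base)

lemmas L_subD = subsetD [OF L_sub]

lemma H'_hom: "bialgebroid_hom K H' S.H (\<lambda>x. x) (\<lambda>r. r)"
  using H'_sub by (simp add: sub_bialgebroid_def)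

lemma H'_source: "v \<in> V \<Longrightarrow> source H' v = lr v \<one>" and H'_target: "v \<in> V \<Longrightarrow> target H' v = lr \<one> v"
  using H'_hom V_monoD [OF S BD] base
  by (simp_all add: bialgebroid_hom_def source_eq target_eq)

lemma H'_counit: "a \<in> carrier (total H') \<Longrightarrow> counit H' a = a \<one>"
proof -
  assume a: "a \<in> carrier (total H')"
  then have "a \<in> carrier S.L" using H'_sub by (auto simp: sub_bialgebroid_def)
  moreover have "counit S.H a = counit H' a" using a H'_hom unfolding bialgebroid_hom_def by blast
  ultimately show ?thesis by simp
qed

text \<open>The coproduct of \<open>H'\<close> lives in its own tensor square and cannot be read off
  from the larger algebroid, since the canonical map between the tensor squares is not known to be
  injective. On \<open>L\<close> it is determined instead by
  \<open>comult_source_target\<close>.\<close>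

lemma H'_comult: "a \<in> carrier L \<Longrightarrow> tensor_lift (total_tensor H') (total_pure H') (cm a) = comult H' a"
proof (rule lift_comult_eq [OF H'.TT.T_abelian])
  show "balanced VA M M (total_tensor H') (total_pure H')"
    using H'.TT.balanced_pure L_sub
    by (intro M_balancedI)
      (simp_all add: balanced_def H'_ops base L_subD H'_source H'_target ract_M_mult lact_M_mult)
  show "total_pure H' (lr v \<one>) (lr \<one> w) = comult H' (lr v w)" if "v \<in> V" "w \<in> V" for v w
    using that V_carrier H'.comult_source_target [of v w]
    by (simp add: base H'_source H'_target H'_ops lr_mult_lr V_one)
qed (use bimod_homD(1,2)[OF H'.comult_hom] in \<open>simp_all add: L_subD H'_ops\<close>)

text \<open>This makes the bialgebroid of \<open>D\<close> a candidate in the definition of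
  minimality of \<open>H'\<close>.\<close>

lemma truncate_sub: "sub_bialgebroid K (bialgebroid.truncate H) H'"
proof -
  let ?T = "bialgebroid.truncate H"
  have T: "total ?T = L" "base ?T = VA" "source ?T = source H" "target ?T = target H" "comult ?T = cm" "counit ?T = counit H"
    by (simp_all add: bialgebroid.truncate_def del: endo_hopf_simps(3,4,6))
  have "total H'\<lparr>carrier := carrier L\<rparr> = S.L\<lparr>carrier := carrier L\<rparr>"
    by (subst H'_total) simp
  then have t: "L = total H'\<lparr>carrier := carrier L\<rparr>" using restrict_total [OF S BD] by simp
  have one: "\<one>\<^bsub>total H'\<^esub> = \<one>\<^bsub>L\<^esub>" "module.smult (total H') = module.smult L"
    by (subst H'_total, simp add: endo_algebra_simps)+
  have "bialgebroid_hom K ?T H' (\<lambda>x. x) (\<lambda>r. r)"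
    unfolding bialgebroid_hom_def T
  proof (intro conjI ballI)
    show "(\<lambda>x. x) \<in> algebra_hom K L (total H')"
      by (simp add: algebra_hom_def ring_hom_def H'_ops one L_subD)
    show "(\<lambda>r. r) \<in> algebra_hom K VA (base H')"
      by (simp add: algebra_hom_def ring_hom_def H'_base)
    show "comult H' a = tensor_lift (total_tensor H') (total_pure H') (cm a)" if "a \<in> carrier L" for a
      using that by (simp add: H'_comult)
  qed (simp_all add: source_target H'_source H'_target H'_counit L_subD del: endo_hopf_simps(3,4))
  then show ?thesis
    unfolding sub_bialgebroid_def T
    using left_bialgebroid_truncate [OF left_bialgebroid] H'_bialgebroid L_sub t by (simp add: H'_base)
qed

lemma lift_pure_id: "u \<in> carrier TT.T \<Longrightarrow> tensor_lift TT.T TT.pure u = u"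
  by (rule TT.additive_eq [OF TT.T_abelian, where h = "tensor_lift TT.T TT.pure" and h' = "\<lambda>u. u"])
    (simp_all add: TT.lift_closed [OF TT.T_abelian TT.balanced_pure] TT.lift_add [OF TT.T_abelian TT.balanced_pure]
      TT.lift_pure [OF TT.T_abelian TT.balanced_pure])

lemma minimal_eq:
  assumes "minimal_over_base K H'" shows "H' = H"
proof -
  have "carrier (base (bialgebroid.truncate H)) = carrier (base H')"
    using base by (simp add: bialgebroid.truncate_def)
  then have "carrier (total (bialgebroid.truncate H)) = carrier (total H')"
    using assms truncate_sub unfolding minimal_over_base_def by blast
  then have c: "carrier (total H') = carrier L" by (simp add: bialgebroid.truncate_def)
  have t: "total H' = L" using H'_total restrict_total [OF S BD] c by simp
  \<comment> \<open>Functions extensional on the same domain are equal when they agree there. Each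
    structure map of \<open>H'\<close> is identified in this way, as equality of records
    requires.\<close>
  have ext: "f = g" if "f \<in> A' \<rightarrow>\<^sub>E B'" "g \<in> A' \<rightarrow>\<^sub>E C'" "\<And>x. x \<in> A' \<Longrightarrow> f x = g x" for f g and A' :: "'x set" and B' C' :: "'y set"
    using that by (intro extensionalityI [of f A' g]) (auto simp: PiE_def)
  interpret E: is_hopf_algebroid K H by (rule is_hopf)
  interpret H'': is_hopf_algebroid K H' using H' by (simp add: hopf_subalgebroid_def)
  have src: "source H' = source H"
    by (rule ext [OF H'.source_ext [unfolded H'_base t] E.source_ext [unfolded endo_hopf_simps(1,2)]])
      (simp add: H'_source source_target del: endo_hopf_simps(3))
  have tgt: "target H' = target H"
    by (rule ext [OF H'.target_ext [unfolded H'_base t] E.target_ext [unfolded endo_hopf_simps(1,2)]])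
      (simp add: H'_target source_target del: endo_hopf_simps(4))
  have tb: "total_bimod H' = M" by (simp add: total_bimod_def t src tgt H'_base)
  have "comult H' a = cm a" if "a \<in> carrier L" for a
    using H'_comult [OF that] lift_pure_id [OF comult_closed [OF that]] by (simp add: tb H'_base)
  then have cm: "comult H' = cm"
    by (intro ext [OF H'.comult_ext [unfolded t] endo_comult_ext])
  have cu: "counit H' = counit H"
    by (rule ext [OF H'.counit_ext [unfolded t] E.counit_ext [unfolded endo_hopf_simps(1,2)]])
      (simp add: H'_counit t)
  \<comment> \<open>Both antipodes are restrictions of the antipode of the ambient Hopf
    algebroid.\<close>
  have "antipode H' a = \<tau> a" if "a \<in> carrier L" for a
    using H' that sub_antipode [OF S BD that] c by (simp add: hopf_subalgebroid_def)
  then have "antipode H' = \<tau>"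
    by (intro ext [OF H''.antipode_ext [unfolded t] E.antipode_ext [unfolded endo_hopf_simps(1,7)]])
  then show ?thesis using t H'_base src tgt cm cu
    by (intro hopf_algebroid.equality) simp_all
qed

end

end

section \<open>The correspondence\<close>

context h_separable begin

lemma endo_hopf_intermediate:
  assumes D: "subring D A" "B \<subseteq> D" shows "endo_hopf A D"
proof (intro endo_hopf.intro endo_hopf_axioms.intro simple_axioms)
  have Dc: "D \<subseteq> carrier A" using D(1) by (rule subringE)
  fix \<alpha> assume "\<alpha> \<in> carrier (endo_algebra A D)"
  then have \<alpha>: "\<alpha> \<in> bimod_hom (A\<lparr>carrier := D\<rparr>) (A\<lparr>carrier := D\<rparr>) (regular_bimod A) (regular_bimod A)"
    by (simp add: endo_algebra_def)
  show "sandwich (centralizer A D) (centralizer A D) \<alpha>"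
    by (rule bilinear_sandwich_intermediate [OF D(2) Dc])
      (use bimod_homD [OF \<alpha>] in \<open>auto simp: right_linear_def regular_bimod_def\<close>)
qed (rule D(1))

end

context hs_separable begin

abbreviation "S \<equiv> endo_hopf_algebroid A B"

lemma intermediate_hopf:
  assumes D: "subring D A" "B \<subseteq> D" "simple_ring (A\<lparr>carrier := D\<rparr>)" "fg_projective (A\<lparr>carrier := D\<rparr>) (right_regular A)"
  shows "fixed_points A (endo_hopf_algebroid A D) = D"
    and "hopf_subalgebroid (center_ring A) (endo_hopf_algebroid A D) S"
    and "simple_ring (base (endo_hopf_algebroid A D))"
    and "minimal_over_base (center_ring A) (endo_hopf_algebroid A D)"
proof -
  obtain I y f where db: "dual_basis D I y f"
    by (rule fg_projective_imp_dual_basis [OF D(1,4)]) (rule that)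
  interpret E: endo_hopf A D using D(1,2) by (rule endo_hopf_intermediate)
  show "fixed_points A (endo_hopf_algebroid A D) = D"
    unfolding E.fixed_points by (rule double_centralizer [OF D(1-3) db])
  show "hopf_subalgebroid (center_ring A) (endo_hopf_algebroid A D) S"
    by (rule E.hopf_subalgebroid [OF endo_hopf_intermediate [OF B order_refl] D(2)])
  show "simple_ring (base (endo_hopf_algebroid A D))"
    by (rule simple_ring_cong [OF centralizer_simple [OF D(1-3) db]]) simp_all
  show "minimal_over_base (center_ring A) (endo_hopf_algebroid A D)"
    by (rule E.minimal)
qed

lemma minimal_hopf_subalgebroid:
  fixes H :: "('a, 'a \<Rightarrow> 'a, 'a) hopf_algebroid"
  assumes H: "hopf_subalgebroid (center_ring A) H S" "simple_ring (base H)" "minimal_over_base (center_ring A) H"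
  defines "D \<equiv> centralizer A (carrier (base H))"
  shows "subring D A" "B \<subseteq> D" "simple_ring (A\<lparr>carrier := D\<rparr>)" "fg_projective (A\<lparr>carrier := D\<rparr>) (right_regular A)"
    and "endo_hopf_algebroid A D = H"
proof -
  let ?V = "carrier (base H)"
  have sub: "sub_bialgebroid (center_ring A) H S" using H(1) by (simp add: hopf_subalgebroid_def)
  then interpret H: left_bialgebroid "center_ring A" H by (simp add: sub_bialgebroid_def)
  have base: "base H = (centralizer_algebra A B)\<lparr>carrier := ?V\<rparr>"
    using sub by (simp add: sub_bialgebroid_def)
  have ops: "monoid.mult (base H) = monoid.mult A" "\<one>\<^bsub>base H\<^esub> = \<one>" "ring.add (base H) = ring.add A"
    "\<zero>\<^bsub>base H\<^esub> = \<zero>" "module.smult (base H) = monoid.mult A"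
    by (subst base, simp)+
  have VR: "?V \<subseteq> Rc" using sub by (simp add: sub_bialgebroid_def Rc_def)
  then have Vc: "?V \<subseteq> carrier A" using Rc_sub by blast
  have Vs: "simple_ring (A\<lparr>carrier := ?V\<rparr>)"
    by (rule simple_ring_cong [OF H(2)]) (simp_all add: ops)
  then have V: "subring ?V A"
    by (intro ring_incl_imp_subring [OF Vc]) (simp add: simple_ring_def)
  \<comment> \<open>The base is closed under scalars from \<open>Z\<close>, and each
    \<open>z\<close> is the multiple \<open>z \<odot> \<one>\<close> of its unit.\<close>
  have ZV: "Z \<subseteq> ?V"
  proof
    fix z assume z: "z \<in> Z"
    have "z \<odot>\<^bsub>base H\<^esub> \<one>\<^bsub>base H\<^esub> \<in> ?V"
      using module.smult_closed [of "center_ring A" "base H" z] H.base_algebra z H.base.one_closed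
      by (simp add: assoc_algebra_def)
    then show "z \<in> ?V" using z center_carrier by (simp add: ops)
  qed
  note V' = V ZV VR Vs
  show D: "subring D A" "B \<subseteq> D" "simple_ring (A\<lparr>carrier := D\<rparr>)"
    unfolding D_def using centralizer_subring [OF Vc] B_le [OF V'] centralizer_simple_ring [OF V'] by auto
  obtain I y f where "dual_basis D I y f" using centralizer_dual_basis [OF V'] unfolding D_def by blast
  then show "fg_projective (A\<lparr>carrier := D\<rparr>) (right_regular A)"
    by (rule dual_basis_imp_fg_projective [OF D(1)])
  interpret E: endo_hopf A D using D(1,2) by (rule endo_hopf_intermediate)
  have "?V = centralizer A D" unfolding D_def using centralizer_centralizer [OF V'] by simp
  then show "endo_hopf_algebroid A D = H"
    using E.minimal_eq [OF endo_hopf_intermediate [OF B order_refl] D(2) H(1) _ H(3)] by simp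
qed

end

theorem theorem6p6:
  fixes A :: "('a, 'm) ring_scheme" and B :: "'a set"
    and intermediate_rings :: "'a set set"
    and minimal_hopf_subalgebroids :: "('a, 'a \<Rightarrow> 'a, 'a) hopf_algebroid set"
  assumes "simple_ring A"
    and "subring B A"
    and "simple_ring (A\<lparr>carrier := B\<rparr>)"
    and "HS_separable A B"
  defines "intermediate_rings \<equiv>
      {D. subring D A \<and> B \<subseteq> D \<and> simple_ring (A\<lparr>carrier := D\<rparr>)
          \<and> fg_projective (A\<lparr>carrier := D\<rparr>) (right_regular A)}"
    and "minimal_hopf_subalgebroids \<equiv>
      {H. hopf_subalgebroid (center_ring A) H (endo_hopf_algebroid A B)
          \<and> simple_ring (base H) \<and> minimal_over_base (center_ring A) H}"
  shows "bij_betw (endo_hopf_algebroid A) intermediate_rings minimal_hopf_subalgebroids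
    \<and> bij_betw (fixed_points A) minimal_hopf_subalgebroids intermediate_rings
    \<and> (\<forall>D\<in>intermediate_rings. fixed_points A (endo_hopf_algebroid A D) = D)
    \<and> (\<forall>H\<in>minimal_hopf_subalgebroids. endo_hopf_algebroid A (fixed_points A H) = H)"
proof -
  interpret simple A
    using assms(1) by (intro simple.intro simple_axioms.intro) (auto simp: simple_ring_def)
  interpret hs_separable A B "centralizer A B"
    using assms(2-4) by (rule HS_separable_imp)
  let ?I = intermediate_rings and ?M = minimal_hopf_subalgebroids
  have IM: "endo_hopf_algebroid A D \<in> ?M" and IF: "fixed_points A (endo_hopf_algebroid A D) = D" if "D \<in> ?I" for D
    using that intermediate_hopf [of D] by (simp_all add: intermediate_rings_def minimal_hopf_subalgebroids_def)
  \<comment> \<open>The witness \<open>D\<close> is the centralizer of the base of \<open>H\<close>.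
    Once every \<open>H\<close> is known to be of this form, the second composite follows from the
    first.\<close>
  have M: "\<exists>D\<in>?I. endo_hopf_algebroid A D = H" if "H \<in> ?M" for H
    using that minimal_hopf_subalgebroid [of H]
    unfolding intermediate_rings_def minimal_hopf_subalgebroids_def by blast
  have MF: "fixed_points A H \<in> ?I" "endo_hopf_algebroid A (fixed_points A H) = H" if H: "H \<in> ?M" for H
  proof -
    obtain D where "D \<in> ?I" "endo_hopf_algebroid A D = H" using M [OF H] by blast
    then show "fixed_points A H \<in> ?I" "endo_hopf_algebroid A (fixed_points A H) = H" using IF by auto
  qed
  have "bij_betw (endo_hopf_algebroid A) ?I ?M" "bij_betw (fixed_points A) ?M ?I"
    using IM IF MF
    by (auto intro!: bij_betw_byWitness [where f' = "fixed_points A"] bij_betw_byWitness [where f' = "endo_hopf_algebroid A"])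
  then show ?thesis using IF MF by blast
qed

end
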